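(* Let $\mathcal C$ be a premodular category over $k$. The elliptic Drinfeld center $\mathcal Z^{\mathrm{el}}(\mathcal C)$ admits the following monoidal structure. The tensor product of objects is $$(X,\lambda^1,\lambda^2)\otimes(Y,\mu^1,\mu^2)=\bigl(X\,{}_{\lambda^1}\overline{\otimes}_{\mu^1}\,Y,\ \lambda^1\overline\otimes\mu^1,\ \lambda^2\otimes\mu^2\bigr),$$ where $X\,{}_{\lambda^1}\overline{\otimes}_{\mu^1}Y$ is the reduced tensor product (the image of the projection $Q_{\lambda^1,\mu^1}$ on $X\otimes Y$), and $\lambda^1\overline\otimes\mu^1$ and $\lambda^2\otimes\mu^2$ are the half-braidings on it described in the context. The associativity constraint is given by that of $\mathcal C$, understood on the images of the projections. The unit object is $$\mathbf 1^{\mathrm{el}}=\mathcal I_1(\mathbf 1,\mathrm{id}_-)=\Bigl(\bigoplus_{i\in J}X_i\otimes X_i^*,\ \Gamma,\ \Omega\Bigr),\qquad \Omega=\widetilde{\mathrm{id}_-},$$ with left and right unit constraints $l:\mathbf 1^{\mathrm{el}}\otimes(X,\lambda^1,\lambda^2)\to(X,\lambda^1,\lambda^2)$ and $r:(X,\lambda^1,\lambda^2)\otimes\mathbf 1^{\mathrm{el}}\to(X,\lambda^1,\lambda^2)$ given (with implicit precomposition by the projections $Q_{\Gamma,\lambda^1}$, resp. $Q_{\lambda^1,\Gamma}$) by $$l=\kappa\sum_{i\in J}\sqrt{d_i}\,(\mathrm{id}_X\otimes\widetilde{\mathrm{ev}}_{X_i})(\lambda^1_{X_i}\otimes\mathrm{id}_{X_i^*})(\mathrm{id}_{X_i}\otimes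 c_{X_i^*,X}),$$ $$r=\kappa\sum_{i\in J}\sqrt{d_i}\,(\mathrm{id}_X\otimes\widetilde{\mathrm{ev}}_{X_i})(\lambda^1_{X_i}\otimes\mathrm{id}_{X_i^*})(c_{X,X_i}\otimes\mathrm{id}_{X_i^*}),$$ where $\kappa\in k^\times$ is a fixed normalization constant, the same for $l$ and $r$ and for all objects.
   Context: $k$ is an algebraically closed field of characteristic $0$. A premodular category is a $k$-linear ribbon fusion category; its braiding is $c_{A,B}:A\otimes B\to B\otimes A$. Associativity constraints are suppressed and $V^{**}$ is identified with $V$. $J$ is the set of isomorphism classes of simple objects, with representatives $X_j$ ($X_0=\mathbf 1$), $d_j=\dim X_j$, fixed square roots $\sqrt{d_j}$, and $\mathcal D=\sum_j d_j^2$, assumed nonzero. $\mathrm{coev}_X:\mathbf 1\to X\otimes X^*$, $\widetilde{\mathrm{coev}}_X:\mathbf 1\to X^*\otimes X$, $\widetilde{\mathrm{ev}}_X:X\otimes X^*\to\mathbf 1$ are the (co)evaluations. A half-braiding on $X$ is a natural isomorphism $\lambda_A:A\otimes X\to X\otimes A$ with $\lambda_{A\otimes B}=(\lambda_A\otimes \mathrm{id}_B)(\mathrm{id}_A\otimes\lambda_B)$. The Drinfeld center $\mathcal Z(\mathcal C)$ has objects $(X,\lambda)$ with $\lambda$ a half-braiding on $X$. $\mathcal Z^{\mathrm{el}}(\mathcal C)$ has objects $(X,\lambda^1,\lambda^2)$ with $\lambda^1,\lambda^2$ half-braidings on $X$ satisfying for all $A,B$ $$(\mathrm{id}_X\otimes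 c_{A,B})(\lambda^1_A\otimes \mathrm{id}_B)(\mathrm{id}_A\otimes\lambda^2_B)=(\lambda^2_B\otimes \mathrm{id}_A)(\mathrm{id}_B\otimes\lambda^1_A)(c_{B,A}^{-1}\otimes \mathrm{id}_X);$$ morphisms are the morphisms of $\mathcal C$ intertwining both half-braidings. For half-braidings $\lambda$ on $X$ and $\mu$ on $Y$, put $\rho_A=(\mathrm{id}_X\otimes c_{A,Y})(\lambda_A\otimes\mathrm{id}_Y)$ and $\rho'_A=(\mathrm{id}_X\otimes\mu_A)(c_{X,A}^{-1}\otimes\mathrm{id}_Y)$, both $A\otimes X\otimes Y\to X\otimes Y\otimes A$. The projection $Q_{\lambda,\mu}:X\otimes Y\to X\otimes Y$ is $$Q_{\lambda,\mu}=\frac1{\mathcal D}\sum_{j\in J}d_j\,(\mathrm{id}_{X\otimes Y}\otimes\widetilde{\mathrm{ev}}_{X_j})(\rho'_{X_j}\otimes\mathrm{id}_{X_j^*})(\mathrm{id}_{X_j}\otimes\rho_{X_j^*})(\mathrm{coev}_{X_j}\otimes\mathrm{id}_{X\otimes Y}).$$ $X\,{}_\lambda\overline\otimes_\mu Y$ is a chosen image of $Q_{\lambda,\mu}$; morphisms out of (into) it are identified with morphisms out of (into) $X\otimes Y$ invariant under pre- (post-) composition with $Q_{\lambda,\mu}$. The half-braiding $\lambda\overline\otimes\mu$ on it is the one induced by $\rho$ (equivalently by $\rho'$). The half-braiding $\lambda^2\otimes\mu^2$ is the one induced by $(\mathrm{id}_X\otimes\mu^2_A)(\lambda^2_A\otimes\mathrm{id}_Y)$.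 The tensor product of morphisms is induced by that of $\mathcal C$. The functor $\mathcal I_1:\mathcal Z(\mathcal C)\to\mathcal Z^{\mathrm{el}}(\mathcal C)$ sends $(X,\lambda)$ to $(\bigoplus_i X_i\otimes X\otimes X_i^*,\Gamma,\widetilde\lambda)$ and $f$ to $\bigoplus_i\mathrm{id}_{X_i}\otimes f\otimes\mathrm{id}_{X_i^*}$. Here $\widetilde\lambda_A$ is, on the $i$-th summand, $(\mathrm{id}\otimes c_{X_i^*,A}^{-1})(\mathrm{id}_{X_i}\otimes\lambda_A\otimes\mathrm{id}_{X_i^*})(c_{A,X_i}\otimes\mathrm{id})$; in particular $\Omega_A=(\mathrm{id}_{X_i}\otimes c_{X_i^*,A}^{-1})(c_{A,X_i}\otimes\mathrm{id}_{X_i^*})$ on $X_i\otimes X_i^*$. The half-braiding $\Gamma$ is defined as follows: for $A\in\mathcal C$, let $\{\varphi_\alpha\}$ be a basis of $\mathrm{Hom}(A\otimes X_i,X_j)$ and $\{\varphi^\alpha\}$ the dual basis of $\mathrm{Hom}(X_i^*,X_j^*\otimes A)$ for the pairing $(\varphi,\psi)=\mathrm{tr}(\varphi\circ\hat\psi)$, $\hat\psi=(\widetilde{\mathrm{ev}}_{X_j}\otimes\mathrm{id}_{A\otimes X_i})(\mathrm{id}_{X_j}\otimes\psi\otimes\mathrm{id}_{X_i})(\mathrm{id}_{X_j}\otimes\widetilde{\mathrm{coev}}_{X_i}):X_j\to A\otimes X_i$; then $\Gamma_A=\sum_{i,j,\alpha}\sqrt{d_i}\sqrt{d_j}\,\varphi_\alpha\otimes\mathrm{id}_X\otimes\varphi^\alpha$.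 *)

theory Defs
  imports "HOL-Algebra.FiniteProduct" "HOL-Computational_Algebra.Polynomial"
begin

section \<open>Categories and monoidal categories\<close>

record ('o, 'a) category_data =
  Obj :: "'o set"
  Arr :: "'a set"
  Dom :: "'a \<Rightarrow> 'o"
  Cod :: "'a \<Rightarrow> 'o"
  Id :: "'o \<Rightarrow> 'a"
  Comp :: "'a \<Rightarrow> 'a \<Rightarrow> 'a" (infixr "\<cdot>\<index>" 55)

definition Hom :: "('o, 'a, 'm) category_data_scheme \<Rightarrow> 'o \<Rightarrow> 'o \<Rightarrow> 'a set" where
  "Hom C X Y = {f \<in> Arr C. Dom C f = X \<and> Cod C f = Y}"

definition inverse_arrows :: "('o, 'a, 'm) category_data_scheme \<Rightarrow> 'a \<Rightarrow> 'a \<Rightarrow> bool" where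
  "inverse_arrows C f g \<longleftrightarrow> f \<in> Arr C \<and> g \<in> Hom C (Cod C f) (Dom C f) \<and>
     g \<cdot>\<^bsub>C\<^esub> f = Id C (Dom C f) \<and> f \<cdot>\<^bsub>C\<^esub> g = Id C (Cod C f)"

definition is_iso :: "('o, 'a, 'm) category_data_scheme \<Rightarrow> 'a \<Rightarrow> bool" where
  "is_iso C f \<longleftrightarrow> (\<exists>g. inverse_arrows C f g)"

definition inv_arr :: "('o, 'a, 'm) category_data_scheme \<Rightarrow> 'a \<Rightarrow> 'a" where
  "inv_arr C f = (THE g. inverse_arrows C f g)"

definition isomorphic :: "('o, 'a, 'm) category_data_scheme \<Rightarrow> 'o \<Rightarrow> 'o \<Rightarrow> bool" where
  "isomorphic C X Y \<longleftrightarrow> (\<exists>f \<in> Hom C X Y. is_iso C f)"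

definition is_mono :: "('o, 'a, 'm) category_data_scheme \<Rightarrow> 'a \<Rightarrow> bool" where
  "is_mono C f \<longleftrightarrow> f \<in> Arr C \<and>
     (\<forall>W. \<forall>g \<in> Hom C W (Dom C f). \<forall>h \<in> Hom C W (Dom C f). f \<cdot>\<^bsub>C\<^esub> g = f \<cdot>\<^bsub>C\<^esub> h \<longrightarrow> g = h)"

definition is_epi :: "('o, 'a, 'm) category_data_scheme \<Rightarrow> 'a \<Rightarrow> bool" where
  "is_epi C f \<longleftrightarrow> f \<in> Arr C \<and>
     (\<forall>W. \<forall>g \<in> Hom C (Cod C f) W. \<forall>h \<in> Hom C (Cod C f) W. g \<cdot>\<^bsub>C\<^esub> f = h \<cdot>\<^bsub>C\<^esub> f \<longrightarrow> g = h)"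

locale category =
  fixes C :: "('o, 'a, 'm) category_data_scheme" (structure)
  assumes Dom_closed: "f \<in> Arr C \<Longrightarrow> Dom C f \<in> Obj C"
    and Cod_closed: "f \<in> Arr C \<Longrightarrow> Cod C f \<in> Obj C"
    and Id_Hom: "X \<in> Obj C \<Longrightarrow> Id C X \<in> Hom C X X"
    and Comp_Hom: "\<lbrakk>f \<in> Hom C X Y; g \<in> Hom C Y Z\<rbrakk> \<Longrightarrow> g \<cdot> f \<in> Hom C X Z"
    and Id_right: "f \<in> Hom C X Y \<Longrightarrow> f \<cdot> Id C X = f"
    and Id_left: "f \<in> Hom C X Y \<Longrightarrow> Id C Y \<cdot> f = f"
    and Comp_assoc: "\<lbrakk>f \<in> Hom C W X; g \<in> Hom C X Y; h \<in> Hom C Y Z\<rbrakk>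
      \<Longrightarrow> (h \<cdot> g) \<cdot> f = h \<cdot> (g \<cdot> f)"

record ('o, 'a) monoidal_data = "('o, 'a) category_data" +
  TensO :: "'o \<Rightarrow> 'o \<Rightarrow> 'o" (infixr "\<odot>\<index>" 70)
  TensA :: "'a \<Rightarrow> 'a \<Rightarrow> 'a" (infixr "\<boxtimes>\<index>" 70)
  Unit :: "'o"
  Assoc :: "'o \<Rightarrow> 'o \<Rightarrow> 'o \<Rightarrow> 'a"
  LUnit :: "'o \<Rightarrow> 'a"
  RUnit :: "'o \<Rightarrow> 'a"

locale monoidal_category = category C
  for C :: "('o, 'a, 'm) monoidal_data_scheme" (structure) +
  assumes TensO_closed: "\<lbrakk>X \<in> Obj C; Y \<in> Obj C\<rbrakk> \<Longrightarrow> X \<odot> Y \<in> Obj C"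
    and Unit_closed: "Unit C \<in> Obj C"
    and TensA_Hom: "\<lbrakk>f \<in> Hom C X Y; f' \<in> Hom C X' Y'\<rbrakk> \<Longrightarrow> f \<boxtimes> f' \<in> Hom C (X \<odot> X') (Y \<odot> Y')"
    and TensA_Id: "\<lbrakk>X \<in> Obj C; Y \<in> Obj C\<rbrakk> \<Longrightarrow> Id C X \<boxtimes> Id C Y = Id C (X \<odot> Y)"
    and TensA_Comp: "\<lbrakk>f \<in> Hom C X Y; g \<in> Hom C Y Z; f' \<in> Hom C X' Y'; g' \<in> Hom C Y' Z'\<rbrakk>
      \<Longrightarrow> (g \<cdot> f) \<boxtimes> (g' \<cdot> f') = (g \<boxtimes> g') \<cdot> (f \<boxtimes> f')"
    and Assoc_Hom: "\<lbrakk>X \<in> Obj C; Y \<in> Obj C; Z \<in> Obj C\<rbrakk>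
      \<Longrightarrow> Assoc C X Y Z \<in> Hom C ((X \<odot> Y) \<odot> Z) (X \<odot> (Y \<odot> Z))"
    and Assoc_iso: "\<lbrakk>X \<in> Obj C; Y \<in> Obj C; Z \<in> Obj C\<rbrakk> \<Longrightarrow> is_iso C (Assoc C X Y Z)"
    and Assoc_natural: "\<lbrakk>f \<in> Hom C X X'; g \<in> Hom C Y Y'; h \<in> Hom C Z Z'\<rbrakk>
      \<Longrightarrow> Assoc C X' Y' Z' \<cdot> ((f \<boxtimes> g) \<boxtimes> h) = (f \<boxtimes> (g \<boxtimes> h)) \<cdot> Assoc C X Y Z"
    and LUnit_Hom: "X \<in> Obj C \<Longrightarrow> LUnit C X \<in> Hom C (Unit C \<odot> X) X"
    and LUnit_iso: "X \<in> Obj C \<Longrightarrow> is_iso C (LUnit C X)"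
    and LUnit_natural: "f \<in> Hom C X Y \<Longrightarrow> LUnit C Y \<cdot> (Id C (Unit C) \<boxtimes> f) = f \<cdot> LUnit C X"
    and RUnit_Hom: "X \<in> Obj C \<Longrightarrow> RUnit C X \<in> Hom C (X \<odot> Unit C) X"
    and RUnit_iso: "X \<in> Obj C \<Longrightarrow> is_iso C (RUnit C X)"
    and RUnit_natural: "f \<in> Hom C X Y \<Longrightarrow> RUnit C Y \<cdot> (f \<boxtimes> Id C (Unit C)) = f \<cdot> RUnit C X"
    and pentagon: "\<lbrakk>W \<in> Obj C; X \<in> Obj C; Y \<in> Obj C; Z \<in> Obj C\<rbrakk>
      \<Longrightarrow> (Id C W \<boxtimes> Assoc C X Y Z) \<cdot> Assoc C W (X \<odot> Y) Z \<cdot> (Assoc C W X Y \<boxtimes> Id C Z)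
        = Assoc C W X (Y \<odot> Z) \<cdot> Assoc C (W \<odot> X) Y Z"
    and triangle: "\<lbrakk>X \<in> Obj C; Y \<in> Obj C\<rbrakk>
      \<Longrightarrow> (Id C X \<boxtimes> LUnit C Y) \<cdot> Assoc C X (Unit C) Y = RUnit C X \<boxtimes> Id C Y"


section \<open>Premodular categories\<close>

record ('o, 'a, 'k) premodular_data = "('o, 'a) monoidal_data" +
  Add :: "'a \<Rightarrow> 'a \<Rightarrow> 'a"
  Zero :: "'o \<Rightarrow> 'o \<Rightarrow> 'a"
  Scale :: "'k \<Rightarrow> 'a \<Rightarrow> 'a"
  Braid :: "'o \<Rightarrow> 'o \<Rightarrow> 'a"
  Dual :: "'o \<Rightarrow> 'o"
  Ev :: "'o \<Rightarrow> 'a"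
  Coev :: "'o \<Rightarrow> 'a"
  Twist :: "'o \<Rightarrow> 'a"

definition hom_group :: "('o, 'a, 'k, 'm) premodular_data_scheme \<Rightarrow> 'o \<Rightarrow> 'o \<Rightarrow> 'a monoid" where
  "hom_group C X Y = \<lparr>carrier = Hom C X Y, monoid.mult = Add C, one = Zero C X Y\<rparr>"

definition hom_sum ::
    "('o, 'a, 'k, 'm) premodular_data_scheme \<Rightarrow> 'o \<Rightarrow> 'o \<Rightarrow> ('i \<Rightarrow> 'a) \<Rightarrow> 'i set \<Rightarrow> 'a" where
  "hom_sum C X Y f I = finprod (hom_group C X Y) f I"

definition is_basis ::
    "('o, 'a, 'k, 'm) premodular_data_scheme \<Rightarrow> 'o \<Rightarrow> 'o \<Rightarrow> nat \<Rightarrow> (nat \<Rightarrow> 'a) \<Rightarrow> bool" where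
  "is_basis C X Y n b \<longleftrightarrow> (\<forall>i<n. b i \<in> Hom C X Y) \<and>
     (\<forall>f \<in> Hom C X Y. \<exists>!c. c \<in> extensional {..<n} \<and>
        f = hom_sum C X Y (\<lambda>i. Scale C (c i) (b i)) {..<n})"

definition is_biproduct ::
    "('o, 'a, 'k, 'm) premodular_data_scheme \<Rightarrow> 'i set \<Rightarrow> ('i \<Rightarrow> 'o) \<Rightarrow>
     'o \<Rightarrow> ('i \<Rightarrow> 'a) \<Rightarrow> ('i \<Rightarrow> 'a) \<Rightarrow> bool" where
  "is_biproduct C I F S inc prj \<longleftrightarrow> finite I \<and> S \<in> Obj C \<and>
     (\<forall>i\<in>I. F i \<in> Obj C \<and> inc i \<in> Hom C (F i) S \<and> prj i \<in> Hom C S (F i)) \<and>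
     (\<forall>i\<in>I. \<forall>j\<in>I. prj j \<cdot>\<^bsub>C\<^esub> inc i = (if i = j then Id C (F i) else Zero C (F i) (F j))) \<and>
     hom_sum C S S (\<lambda>i. inc i \<cdot>\<^bsub>C\<^esub> prj i) I = Id C S"

definition is_kernel :: "('o, 'a, 'k, 'm) premodular_data_scheme \<Rightarrow> 'a \<Rightarrow> 'a \<Rightarrow> bool" where
  "is_kernel C f k \<longleftrightarrow> f \<in> Arr C \<and> k \<in> Hom C (Dom C k) (Dom C f) \<and>
     f \<cdot>\<^bsub>C\<^esub> k = Zero C (Dom C k) (Cod C f) \<and>
     (\<forall>W. \<forall>g \<in> Hom C W (Dom C f). f \<cdot>\<^bsub>C\<^esub> g = Zero C W (Cod C f) \<longrightarrow>
        (\<exists>!u. u \<in> Hom C W (Dom C k) \<and> k \<cdot>\<^bsub>C\<^esub> u = g))"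

definition is_cokernel :: "('o, 'a, 'k, 'm) premodular_data_scheme \<Rightarrow> 'a \<Rightarrow> 'a \<Rightarrow> bool" where
  "is_cokernel C f q \<longleftrightarrow> f \<in> Arr C \<and> q \<in> Hom C (Cod C f) (Cod C q) \<and>
     q \<cdot>\<^bsub>C\<^esub> f = Zero C (Dom C f) (Cod C q) \<and>
     (\<forall>W. \<forall>g \<in> Hom C (Cod C f) W. g \<cdot>\<^bsub>C\<^esub> f = Zero C (Dom C f) W \<longrightarrow>
        (\<exists>!u. u \<in> Hom C (Cod C q) W \<and> u \<cdot>\<^bsub>C\<^esub> q = g))"

definition is_simple :: "('o, 'a, 'k, 'm) premodular_data_scheme \<Rightarrow> 'o \<Rightarrow> bool" where
  "is_simple C X \<longleftrightarrow> X \<in> Obj C \<and> Id C X \<noteq> Zero C X X \<and>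
     (\<forall>m. is_mono C m \<and> Cod C m = X \<longrightarrow> m = Zero C (Dom C m) X \<or> is_iso C m)"

locale linear_monoidal_category = monoidal_category C
  for C :: "('o, 'a, 'k::field, 'm) premodular_data_scheme" (structure) +
  assumes hom_comm_group: "\<lbrakk>X \<in> Obj C; Y \<in> Obj C\<rbrakk> \<Longrightarrow> comm_group (hom_group C X Y)"
    and Scale_Hom: "f \<in> Hom C X Y \<Longrightarrow> Scale C a f \<in> Hom C X Y"
    and Scale_Add: "\<lbrakk>f \<in> Hom C X Y; g \<in> Hom C X Y\<rbrakk>
      \<Longrightarrow> Scale C a (Add C f g) = Add C (Scale C a f) (Scale C a g)"
    and Scale_plus: "f \<in> Hom C X Y \<Longrightarrow> Scale C (a + b) f = Add C (Scale C a f) (Scale C b f)"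
    and Scale_times: "f \<in> Hom C X Y \<Longrightarrow> Scale C (a * b) f = Scale C a (Scale C b f)"
    and Scale_one: "f \<in> Hom C X Y \<Longrightarrow> Scale C 1 f = f"
    and Comp_Add_left: "\<lbrakk>f \<in> Hom C X Y; g \<in> Hom C Y Z; g' \<in> Hom C Y Z\<rbrakk>
      \<Longrightarrow> Add C g g' \<cdot> f = Add C (g \<cdot> f) (g' \<cdot> f)"
    and Comp_Add_right: "\<lbrakk>f \<in> Hom C X Y; f' \<in> Hom C X Y; g \<in> Hom C Y Z\<rbrakk>
      \<Longrightarrow> g \<cdot> Add C f f' = Add C (g \<cdot> f) (g \<cdot> f')"
    and Comp_Scale_left: "\<lbrakk>f \<in> Hom C X Y; g \<in> Hom C Y Z\<rbrakk> \<Longrightarrow> Scale C a g \<cdot> f = Scale C a (g \<cdot> f)"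
    and Comp_Scale_right: "\<lbrakk>f \<in> Hom C X Y; g \<in> Hom C Y Z\<rbrakk> \<Longrightarrow> g \<cdot> Scale C a f = Scale C a (g \<cdot> f)"
    and TensA_Add_left: "\<lbrakk>f \<in> Hom C X Y; f' \<in> Hom C X Y; g \<in> Hom C X' Y'\<rbrakk>
      \<Longrightarrow> Add C f f' \<boxtimes> g = Add C (f \<boxtimes> g) (f' \<boxtimes> g)"
    and TensA_Add_right: "\<lbrakk>f \<in> Hom C X Y; g \<in> Hom C X' Y'; g' \<in> Hom C X' Y'\<rbrakk>
      \<Longrightarrow> f \<boxtimes> Add C g g' = Add C (f \<boxtimes> g) (f \<boxtimes> g')"
    and TensA_Scale_left: "\<lbrakk>f \<in> Hom C X Y; g \<in> Hom C X' Y'\<rbrakk>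
      \<Longrightarrow> Scale C a f \<boxtimes> g = Scale C a (f \<boxtimes> g)"
    and TensA_Scale_right: "\<lbrakk>f \<in> Hom C X Y; g \<in> Hom C X' Y'\<rbrakk>
      \<Longrightarrow> f \<boxtimes> Scale C a g = Scale C a (f \<boxtimes> g)"

locale abelian_monoidal_category = linear_monoidal_category C
  for C :: "('o, 'a, 'k::field, 'm) premodular_data_scheme" (structure) +
  assumes zero_object: "\<exists>Z \<in> Obj C. Id C Z = Zero C Z Z"
    and biproducts: "\<lbrakk>X \<in> Obj C; Y \<in> Obj C\<rbrakk>
      \<Longrightarrow> \<exists>S inc prj. is_biproduct C (UNIV :: bool set) (\<lambda>b. if b then X else Y) S inc prj"
    and kernels: "f \<in> Arr C \<Longrightarrow> \<exists>k. is_kernel C f k"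
    and cokernels: "f \<in> Arr C \<Longrightarrow> \<exists>q. is_cokernel C f q"
    and mono_normal: "is_mono C m \<Longrightarrow> \<exists>f. is_kernel C f m"
    and epi_normal: "is_epi C e \<Longrightarrow> \<exists>f. is_cokernel C f e"

text \<open>
  Duals \<open>Ev X : X* \<otimes> X \<rightarrow> 1\<close>, \<open>Coev X : 1 \<rightarrow> X \<otimes> X*\<close> are left duals; together with the
  braiding and twist they also determine right duals, see \<open>EvR\<close>, \<open>CoevR\<close> below.
\<close>

locale ribbon_category = linear_monoidal_category C
  for C :: "('o, 'a, 'k::field, 'm) premodular_data_scheme" (structure) +
  assumes Braid_Hom: "\<lbrakk>X \<in> Obj C; Y \<in> Obj C\<rbrakk> \<Longrightarrow> Braid C X Y \<in> Hom C (X \<odot> Y) (Y \<odot> X)"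
    and Braid_iso: "\<lbrakk>X \<in> Obj C; Y \<in> Obj C\<rbrakk> \<Longrightarrow> is_iso C (Braid C X Y)"
    and Braid_natural: "\<lbrakk>f \<in> Hom C X X'; g \<in> Hom C Y Y'\<rbrakk>
      \<Longrightarrow> Braid C X' Y' \<cdot> (f \<boxtimes> g) = (g \<boxtimes> f) \<cdot> Braid C X Y"
    and hexagon_right: "\<lbrakk>X \<in> Obj C; Y \<in> Obj C; Z \<in> Obj C\<rbrakk>
      \<Longrightarrow> Assoc C Y Z X \<cdot> Braid C X (Y \<odot> Z) \<cdot> Assoc C X Y Z
        = (Id C Y \<boxtimes> Braid C X Z) \<cdot> Assoc C Y X Z \<cdot> (Braid C X Y \<boxtimes> Id C Z)"
    and hexagon_left: "\<lbrakk>X \<in> Obj C; Y \<in> Obj C; Z \<in> Obj C\<rbrakk>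
      \<Longrightarrow> Braid C (X \<odot> Y) Z
        = Assoc C Z X Y \<cdot> (Braid C X Z \<boxtimes> Id C Y) \<cdot> inv_arr C (Assoc C X Z Y)
            \<cdot> (Id C X \<boxtimes> Braid C Y Z) \<cdot> Assoc C X Y Z"
    and Dual_closed: "X \<in> Obj C \<Longrightarrow> Dual C X \<in> Obj C"
    and Ev_Hom: "X \<in> Obj C \<Longrightarrow> Ev C X \<in> Hom C (Dual C X \<odot> X) (Unit C)"
    and Coev_Hom: "X \<in> Obj C \<Longrightarrow> Coev C X \<in> Hom C (Unit C) (X \<odot> Dual C X)"
    and zigzag: "X \<in> Obj C
      \<Longrightarrow> RUnit C X \<cdot> (Id C X \<boxtimes> Ev C X) \<cdot> Assoc C X (Dual C X) X \<cdot> (Coev C X \<boxtimes> Id C X)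
            \<cdot> inv_arr C (LUnit C X) = Id C X"
    and zigzag_dual: "X \<in> Obj C
      \<Longrightarrow> LUnit C (Dual C X) \<cdot> (Ev C X \<boxtimes> Id C (Dual C X))
            \<cdot> inv_arr C (Assoc C (Dual C X) X (Dual C X)) \<cdot> (Id C (Dual C X) \<boxtimes> Coev C X)
            \<cdot> inv_arr C (RUnit C (Dual C X)) = Id C (Dual C X)"
    and Twist_Hom: "X \<in> Obj C \<Longrightarrow> Twist C X \<in> Hom C X X"
    and Twist_iso: "X \<in> Obj C \<Longrightarrow> is_iso C (Twist C X)"
    and Twist_natural: "f \<in> Hom C X Y \<Longrightarrow> Twist C Y \<cdot> f = f \<cdot> Twist C X"
    and Twist_balanced: "\<lbrakk>X \<in> Obj C; Y \<in> Obj C\<rbrakk>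
      \<Longrightarrow> Twist C (X \<odot> Y) = Braid C Y X \<cdot> Braid C X Y \<cdot> (Twist C X \<boxtimes> Twist C Y)"
    and Twist_Dual: "X \<in> Obj C
      \<Longrightarrow> (Twist C X \<boxtimes> Id C (Dual C X)) \<cdot> Coev C X = (Id C X \<boxtimes> Twist C (Dual C X)) \<cdot> Coev C X"

locale premodular_category = abelian_monoidal_category C + ribbon_category C
  for C :: "('o, 'a, 'k::{alg_closed_field, field_char_0}, 'm) premodular_data_scheme" (structure) +
  assumes hom_finite_dim: "\<lbrakk>X \<in> Obj C; Y \<in> Obj C\<rbrakk> \<Longrightarrow> \<exists>n b. is_basis C X Y n b"
    and semisimple: "X \<in> Obj C
      \<Longrightarrow> \<exists>n F inc prj. (\<forall>i<(n::nat). is_simple C (F i)) \<and> is_biproduct C {..<n} F X inc prj"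
    and finitely_many_simples:
      "\<exists>R. finite R \<and> (\<forall>X. is_simple C X \<longrightarrow> (\<exists>Y \<in> R. isomorphic C X Y))"
    and Unit_simple: "is_simple C (Unit C)"

definition EvR :: "('o, 'a, 'k, 'm) premodular_data_scheme \<Rightarrow> 'o \<Rightarrow> 'a" where
  "EvR C X = Ev C X \<cdot>\<^bsub>C\<^esub> Braid C X (Dual C X) \<cdot>\<^bsub>C\<^esub> (Twist C X \<boxtimes>\<^bsub>C\<^esub> Id C (Dual C X))"

definition CoevR :: "('o, 'a, 'k, 'm) premodular_data_scheme \<Rightarrow> 'o \<Rightarrow> 'a" where
  "CoevR C X = (Id C (Dual C X) \<boxtimes>\<^bsub>C\<^esub> Twist C X) \<cdot>\<^bsub>C\<^esub> Braid C X (Dual C X) \<cdot>\<^bsub>C\<^esub> Coev C X"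

definition qtrace :: "('o, 'a, 'k, 'm) premodular_data_scheme \<Rightarrow> 'a \<Rightarrow> 'k" where
  "qtrace C f = (THE a. EvR C (Dom C f) \<cdot>\<^bsub>C\<^esub> (f \<boxtimes>\<^bsub>C\<^esub> Id C (Dual C (Dom C f))) \<cdot>\<^bsub>C\<^esub> Coev C (Dom C f)
      = Scale C a (Id C (Unit C)))"

definition qdim :: "('o, 'a, 'k, 'm) premodular_data_scheme \<Rightarrow> 'o \<Rightarrow> 'k" where
  "qdim C X = qtrace C (Id C X)"


section \<open>Suppressed associativity constraints\<close>

text \<open>
  Formulas with suppressed constraints are read in the strictification: an arrow between words
  \<open>xs\<close>, \<open>ys\<close> of objects is an arrow between the right-bracketed tensor products of the words, and
  the tensor product of arrows between words inserts the canonical isomorphisms \<open>word_join\<close>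
  (built from the associativity and unit constraints).
\<close>

fun word_obj :: "('o, 'a, 'm) monoidal_data_scheme \<Rightarrow> 'o list \<Rightarrow> 'o" where
  "word_obj C [] = Unit C"
| "word_obj C [x] = x"
| "word_obj C (x # y # ys) = x \<odot>\<^bsub>C\<^esub> word_obj C (y # ys)"

fun word_join :: "('o, 'a, 'm) monoidal_data_scheme \<Rightarrow> 'o list \<Rightarrow> 'o list \<Rightarrow> 'a" where
  "word_join C [] ys = LUnit C (word_obj C ys)"
| "word_join C (x # xs) [] = RUnit C (word_obj C (x # xs))"
| "word_join C [x] (y # ys) = Id C (word_obj C (x # y # ys))"
| "word_join C (x # x' # xs) (y # ys) =
     (Id C x \<boxtimes>\<^bsub>C\<^esub> word_join C (x' # xs) (y # ys))
       \<cdot>\<^bsub>C\<^esub> Assoc C x (word_obj C (x' # xs)) (word_obj C (y # ys))"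

type_synonym ('o, 'a) word_arr = "'o list \<times> 'a \<times> 'o list"

definition word_id :: "('o, 'a, 'm) monoidal_data_scheme \<Rightarrow> 'o list \<Rightarrow> ('o, 'a) word_arr"
    ("id\<^sub>w\<index>") where
  "id\<^sub>w\<^bsub>C\<^esub> xs = (xs, Id C (word_obj C xs), xs)"

definition word_comp ::
    "('o, 'a, 'm) monoidal_data_scheme \<Rightarrow> ('o, 'a) word_arr \<Rightarrow> ('o, 'a) word_arr \<Rightarrow> ('o, 'a) word_arr"
    (infixr "\<circ>\<^sub>w\<index>" 60) where
  "g \<circ>\<^sub>w\<^bsub>C\<^esub> f = (fst f, fst (snd g) \<cdot>\<^bsub>C\<^esub> fst (snd f), snd (snd g))"

definition word_tensor ::
    "('o, 'a, 'm) monoidal_data_scheme \<Rightarrow> ('o, 'a) word_arr \<Rightarrow> ('o, 'a) word_arr \<Rightarrow> ('o, 'a) word_arr"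
    (infixr "\<otimes>\<^sub>w\<index>" 70) where
  "f \<otimes>\<^sub>w\<^bsub>C\<^esub> g = (fst f @ fst g,
     word_join C (snd (snd f)) (snd (snd g)) \<cdot>\<^bsub>C\<^esub> (fst (snd f) \<boxtimes>\<^bsub>C\<^esub> fst (snd g))
       \<cdot>\<^bsub>C\<^esub> inv_arr C (word_join C (fst f) (fst g)),
     snd (snd f) @ snd (snd g))"

definition underlying :: "('o, 'a) word_arr \<Rightarrow> 'a" where
  "underlying f = fst (snd f)"

definition wBraid :: "('o, 'a, 'k, 'm) premodular_data_scheme \<Rightarrow> 'o \<Rightarrow> 'o \<Rightarrow> ('o, 'a) word_arr" where
  "wBraid C X Y = ([X, Y], Braid C X Y, [Y, X])"

definition wBraidInv :: "('o, 'a, 'k, 'm) premodular_data_scheme \<Rightarrow> 'o \<Rightarrow> 'o \<Rightarrow> ('o, 'a) word_arr" where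
  "wBraidInv C X Y = ([Y, X], inv_arr C (Braid C X Y), [X, Y])"

definition wCoev :: "('o, 'a, 'k, 'm) premodular_data_scheme \<Rightarrow> 'o \<Rightarrow> ('o, 'a) word_arr" where
  "wCoev C X = ([], Coev C X, [X, Dual C X])"

definition wEvR :: "('o, 'a, 'k, 'm) premodular_data_scheme \<Rightarrow> 'o \<Rightarrow> ('o, 'a) word_arr" where
  "wEvR C X = ([X, Dual C X], EvR C X, [])"

definition wCoevR :: "('o, 'a, 'k, 'm) premodular_data_scheme \<Rightarrow> 'o \<Rightarrow> ('o, 'a) word_arr" where
  "wCoevR C X = ([], CoevR C X, [Dual C X, X])"

definition wHalf :: "('o \<Rightarrow> 'a) \<Rightarrow> 'o \<Rightarrow> 'o \<Rightarrow> ('o, 'a) word_arr" where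
  "wHalf l A X = ([A, X], l A, [X, A])"


section \<open>Half-braidings and the elliptic Drinfeld center\<close>

definition half_braiding :: "('o, 'a, 'm) monoidal_data_scheme \<Rightarrow> 'o \<Rightarrow> ('o \<Rightarrow> 'a) \<Rightarrow> bool" where
  "half_braiding C X l \<longleftrightarrow> X \<in> Obj C \<and> l \<in> extensional (Obj C) \<and>
     (\<forall>A \<in> Obj C. l A \<in> Hom C (A \<odot>\<^bsub>C\<^esub> X) (X \<odot>\<^bsub>C\<^esub> A) \<and> is_iso C (l A)) \<and>
     (\<forall>A B. \<forall>f \<in> Hom C A B. (Id C X \<boxtimes>\<^bsub>C\<^esub> f) \<cdot>\<^bsub>C\<^esub> l A = l B \<cdot>\<^bsub>C\<^esub> (f \<boxtimes>\<^bsub>C\<^esub> Id C X)) \<and>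
     (\<forall>A \<in> Obj C. \<forall>B \<in> Obj C.
        l (A \<odot>\<^bsub>C\<^esub> B) = Assoc C X A B \<cdot>\<^bsub>C\<^esub> (l A \<boxtimes>\<^bsub>C\<^esub> Id C B) \<cdot>\<^bsub>C\<^esub> inv_arr C (Assoc C A X B)
          \<cdot>\<^bsub>C\<^esub> (Id C A \<boxtimes>\<^bsub>C\<^esub> l B) \<cdot>\<^bsub>C\<^esub> Assoc C A B X)"

type_synonym ('o, 'a) half_braided = "'o \<times> ('o \<Rightarrow> 'a)"
type_synonym ('o, 'a) elliptic_obj = "'o \<times> ('o \<Rightarrow> 'a) \<times> ('o \<Rightarrow> 'a)"
type_synonym ('o, 'a) elliptic_arr = "('o, 'a) elliptic_obj \<times> 'a \<times> ('o, 'a) elliptic_obj"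

definition drinfeld_center_objects ::
    "('o, 'a, 'm) monoidal_data_scheme \<Rightarrow> ('o, 'a) half_braided set" where
  "drinfeld_center_objects C = {(X, l). half_braiding C X l}"

definition elliptic_objects ::
    "('o, 'a, 'k, 'm) premodular_data_scheme \<Rightarrow> ('o, 'a) elliptic_obj set" where
  "elliptic_objects C = {(X, l1, l2). half_braiding C X l1 \<and> half_braiding C X l2 \<and>
     (\<forall>A \<in> Obj C. \<forall>B \<in> Obj C.
        (id\<^sub>w\<^bsub>C\<^esub> [X] \<otimes>\<^sub>w\<^bsub>C\<^esub> wBraid C A B) \<circ>\<^sub>w\<^bsub>C\<^esub> (wHalf l1 A X \<otimes>\<^sub>w\<^bsub>C\<^esub> id\<^sub>w\<^bsub>C\<^esub> [B])
          \<circ>\<^sub>w\<^bsub>C\<^esub> (id\<^sub>w\<^bsub>C\<^esub> [A] \<otimes>\<^sub>w\<^bsub>C\<^esub> wHalf l2 B X)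
        = (wHalf l2 B X \<otimes>\<^sub>w\<^bsub>C\<^esub> id\<^sub>w\<^bsub>C\<^esub> [A]) \<circ>\<^sub>w\<^bsub>C\<^esub> (id\<^sub>w\<^bsub>C\<^esub> [B] \<otimes>\<^sub>w\<^bsub>C\<^esub> wHalf l1 A X)
          \<circ>\<^sub>w\<^bsub>C\<^esub> (wBraidInv C B A \<otimes>\<^sub>w\<^bsub>C\<^esub> id\<^sub>w\<^bsub>C\<^esub> [X]))}"

definition intertwines ::
    "('o, 'a, 'm) monoidal_data_scheme \<Rightarrow> 'a \<Rightarrow> ('o \<Rightarrow> 'a) \<Rightarrow> ('o \<Rightarrow> 'a) \<Rightarrow> bool" where
  "intertwines C f l m \<longleftrightarrow>
     (\<forall>A \<in> Obj C. m A \<cdot>\<^bsub>C\<^esub> (Id C A \<boxtimes>\<^bsub>C\<^esub> f) = (f \<boxtimes>\<^bsub>C\<^esub> Id C A) \<cdot>\<^bsub>C\<^esub> l A)"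

definition elliptic_center ::
    "('o, 'a, 'k, 'm) premodular_data_scheme \<Rightarrow>
     (('o, 'a) elliptic_obj, ('o, 'a) elliptic_arr) category_data" where
  "elliptic_center C = \<lparr>
     Obj = elliptic_objects C,
     Arr = {((X, l1, l2), f, (Y, m1, m2)) | X l1 l2 f Y m1 m2.
              (X, l1, l2) \<in> elliptic_objects C \<and> (Y, m1, m2) \<in> elliptic_objects C \<and>
              f \<in> Hom C X Y \<and> intertwines C f l1 m1 \<and> intertwines C f l2 m2},
     Dom = (\<lambda>(P, f, P'). P),
     Cod = (\<lambda>(P, f, P'). P'),
     Id = (\<lambda>P. (P, Id C (fst P), P)),
     Comp = (\<lambda>(Q, g, Q') (P, f, P'). (P, g \<cdot>\<^bsub>C\<^esub> f, Q'))\<rparr>"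


section \<open>Choices: simple objects, square roots, images, direct sums\<close>

record ('o, 'a, 'k, 'j) chosen_data = "('o, 'a, 'k) premodular_data" +
  J :: "'j set"
  Simp :: "'j \<Rightarrow> 'o"
  SqrtDim :: "'j \<Rightarrow> 'k"
  ImObj :: "('o, 'a) half_braided \<Rightarrow> ('o, 'a) half_braided \<Rightarrow> 'o"
  ImInc :: "('o, 'a) half_braided \<Rightarrow> ('o, 'a) half_braided \<Rightarrow> 'a"
  ImProj :: "('o, 'a) half_braided \<Rightarrow> ('o, 'a) half_braided \<Rightarrow> 'a"
  SumObj :: "'o"
  SumInj :: "'j \<Rightarrow> 'a"
  SumProj :: "'j \<Rightarrow> 'a"

context
  fixes C :: "('o, 'a, 'k::field, 'j, 'm) chosen_data_scheme" (structure)
begin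

definition global_dim :: 'k where
  "global_dim = (\<Sum>j \<in> J C. (qdim C (Simp C j))^2)"

definition rho :: "('o, 'a) half_braided \<Rightarrow> ('o, 'a) half_braided \<Rightarrow> 'o \<Rightarrow> ('o, 'a) word_arr" where
  "rho = (\<lambda>(X, l) (Y, m) A. (id\<^sub>w [X] \<otimes>\<^sub>w wBraid C A Y) \<circ>\<^sub>w (wHalf l A X \<otimes>\<^sub>w id\<^sub>w [Y]))"

definition rho' :: "('o, 'a) half_braided \<Rightarrow> ('o, 'a) half_braided \<Rightarrow> 'o \<Rightarrow> ('o, 'a) word_arr" where
  "rho' = (\<lambda>(X, l) (Y, m) A. (id\<^sub>w [X] \<otimes>\<^sub>w wHalf m A Y) \<circ>\<^sub>w (wBraidInv C X A \<otimes>\<^sub>w id\<^sub>w [Y]))"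

definition Qproj :: "('o, 'a) half_braided \<Rightarrow> ('o, 'a) half_braided \<Rightarrow> 'a" where
  "Qproj P P' = (let X = fst P; Y = fst P' in
     Scale C (1 / global_dim) (hom_sum C (X \<odot> Y) (X \<odot> Y)
       (\<lambda>j. let S = Simp C j in Scale C (qdim C S) (underlying
          ((id\<^sub>w [X, Y] \<otimes>\<^sub>w wEvR C S) \<circ>\<^sub>w (rho' P P' S \<otimes>\<^sub>w id\<^sub>w [Dual C S])
             \<circ>\<^sub>w (id\<^sub>w [S] \<otimes>\<^sub>w rho P P' (Dual C S)) \<circ>\<^sub>w (wCoev C S \<otimes>\<^sub>w id\<^sub>w [X, Y]))))
       (J C)))"

definition red_half ::
    "('o, 'a) half_braided \<Rightarrow> ('o, 'a) half_braided \<Rightarrow> 'o \<Rightarrow> 'a" where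
  "red_half P P' = (\<lambda>A \<in> Obj C. let X = fst P; Y = fst P'; I = ImObj C P P' in
     underlying ((([X, Y], ImProj C P P', [I]) \<otimes>\<^sub>w id\<^sub>w [A]) \<circ>\<^sub>w rho P P' A
       \<circ>\<^sub>w (id\<^sub>w [A] \<otimes>\<^sub>w ([I], ImInc C P P', [X, Y]))))"

definition tens_half ::
    "('o, 'a) elliptic_obj \<Rightarrow> ('o, 'a) elliptic_obj \<Rightarrow> 'o \<Rightarrow> 'a" where
  "tens_half = (\<lambda>(X, l1, l2) (Y, m1, m2). \<lambda>A \<in> Obj C. let I = ImObj C (X, l1) (Y, m1) in
     underlying ((([X, Y], ImProj C (X, l1) (Y, m1), [I]) \<otimes>\<^sub>w id\<^sub>w [A])
       \<circ>\<^sub>w (id\<^sub>w [X] \<otimes>\<^sub>w wHalf m2 A Y) \<circ>\<^sub>w (wHalf l2 A X \<otimes>\<^sub>w id\<^sub>w [Y])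
       \<circ>\<^sub>w (id\<^sub>w [A] \<otimes>\<^sub>w ([I], ImInc C (X, l1) (Y, m1), [X, Y]))))"

definition hb1 :: "('o, 'a) elliptic_obj \<Rightarrow> ('o, 'a) half_braided" where
  "hb1 = (\<lambda>(X, l1, l2). (X, l1))"

definition el_tensor :: "('o, 'a) elliptic_obj \<Rightarrow> ('o, 'a) elliptic_obj \<Rightarrow> ('o, 'a) elliptic_obj" where
  "el_tensor P P' = (ImObj C (hb1 P) (hb1 P'), red_half (hb1 P) (hb1 P'), tens_half P P')"

definition el_tensor_arr ::
    "('o, 'a) elliptic_arr \<Rightarrow> ('o, 'a) elliptic_arr \<Rightarrow> ('o, 'a) elliptic_arr" where
  "el_tensor_arr = (\<lambda>(P, f, R) (P', g, R').
     (el_tensor P P',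
      ImProj C (hb1 R) (hb1 R') \<cdot> (f \<boxtimes> g) \<cdot> ImInc C (hb1 P) (hb1 P'),
      el_tensor R R'))"

definition el_assoc ::
    "('o, 'a) elliptic_obj \<Rightarrow> ('o, 'a) elliptic_obj \<Rightarrow> ('o, 'a) elliptic_obj \<Rightarrow> ('o, 'a) elliptic_arr" where
  "el_assoc P P' P'' =
     (el_tensor (el_tensor P P') P'',
      ImProj C (hb1 P) (hb1 (el_tensor P' P'')) \<cdot> (Id C (fst P) \<boxtimes> ImProj C (hb1 P') (hb1 P''))
        \<cdot> Assoc C (fst P) (fst P') (fst P'')
        \<cdot> (ImInc C (hb1 P) (hb1 P') \<boxtimes> Id C (fst P'')) \<cdot> ImInc C (hb1 (el_tensor P P')) (hb1 P''),
      el_tensor P (el_tensor P' P''))"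

definition hat :: "'o \<Rightarrow> 'j \<Rightarrow> 'j \<Rightarrow> 'a \<Rightarrow> 'a" where
  "hat A i j \<psi> = (let S = Simp C i; T = Simp C j in underlying
     ((wEvR C T \<otimes>\<^sub>w id\<^sub>w [A, S])
       \<circ>\<^sub>w (id\<^sub>w [T] \<otimes>\<^sub>w ([Dual C S], \<psi>, [Dual C T, A]) \<otimes>\<^sub>w id\<^sub>w [S])
       \<circ>\<^sub>w (id\<^sub>w [T] \<otimes>\<^sub>w wCoevR C S)))"

definition is_dual_basis_pair :: "'o \<Rightarrow> 'j \<Rightarrow> 'j \<Rightarrow> nat \<times> (nat \<Rightarrow> 'a) \<times> (nat \<Rightarrow> 'a) \<Rightarrow> bool" where
  "is_dual_basis_pair A i j = (\<lambda>(n, \<phi>, \<psi>).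
     is_basis C (A \<odot> Simp C i) (Simp C j) n \<phi> \<and>
     is_basis C (Dual C (Simp C i)) (Dual C (Simp C j) \<odot> A) n \<psi> \<and>
     (\<forall>a<n. \<forall>b<n. qtrace C (\<phi> a \<cdot> hat A i j (\<psi> b)) = (if a = b then 1 else 0)))"

definition dual_bases :: "'o \<Rightarrow> 'j \<Rightarrow> 'j \<Rightarrow> nat \<times> (nat \<Rightarrow> 'a) \<times> (nat \<Rightarrow> 'a)" where
  "dual_bases A i j = (SOME t. is_dual_basis_pair A i j t)"

text \<open>
  The middle factor of the summands \<open>X\<^sub>i \<otimes> X \<otimes> X\<^sub>i*\<close> is a word \<open>vs\<close>: it is \<open>[X]\<close> for the functor
  \<open>I\<^sub>1\<close> and \<open>[]\<close> for the unit object \<open>\<Oplus>X\<^sub>i \<otimes> X\<^sub>i*\<close>.  The triple \<open>(S, inc, prj)\<close> is a direct sum of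
  these summands.
\<close>

definition summand :: "'o list \<Rightarrow> 'j \<Rightarrow> 'o list" where
  "summand vs i = [Simp C i] @ vs @ [Dual C (Simp C i)]"

definition Gamma :: "'o list \<Rightarrow> 'o \<times> ('j \<Rightarrow> 'a) \<times> ('j \<Rightarrow> 'a) \<Rightarrow> 'o \<Rightarrow> 'a" where
  "Gamma vs = (\<lambda>(S, inc, prj). \<lambda>A \<in> Obj C.
     hom_sum C (A \<odot> S) (S \<odot> A) (\<lambda>(i, j). let (n, \<phi>, \<psi>) = dual_bases A i j in
       hom_sum C (A \<odot> S) (S \<odot> A) (\<lambda>a. Scale C (SqrtDim C i * SqrtDim C j) (underlying
         ((((summand vs j, inc j, [S]) \<otimes>\<^sub>w id\<^sub>w [A])
           \<circ>\<^sub>w (([A, Simp C i], \<phi> a, [Simp C j]) \<otimes>\<^sub>w id\<^sub>w vs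
                 \<otimes>\<^sub>w ([Dual C (Simp C i)], \<psi> a, [Dual C (Simp C j), A]))
           \<circ>\<^sub>w (id\<^sub>w [A] \<otimes>\<^sub>w ([S], prj i, summand vs i)))))) {..<n})
     (J C \<times> J C))"

definition lambda_tilde :: "('o, 'a) half_braided \<Rightarrow> 'o \<times> ('j \<Rightarrow> 'a) \<times> ('j \<Rightarrow> 'a) \<Rightarrow> 'o \<Rightarrow> 'a" where
  "lambda_tilde = (\<lambda>(X, l) (S, inc, prj). \<lambda>A \<in> Obj C.
     hom_sum C (A \<odot> S) (S \<odot> A) (\<lambda>i. let T = Simp C i in underlying
       (((summand [X] i, inc i, [S]) \<otimes>\<^sub>w id\<^sub>w [A])
         \<circ>\<^sub>w (id\<^sub>w [T, X] \<otimes>\<^sub>w wBraidInv C (Dual C T) A)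
         \<circ>\<^sub>w (id\<^sub>w [T] \<otimes>\<^sub>w wHalf l A X \<otimes>\<^sub>w id\<^sub>w [Dual C T])
         \<circ>\<^sub>w (wBraid C A T \<otimes>\<^sub>w id\<^sub>w [X, Dual C T])
         \<circ>\<^sub>w (id\<^sub>w [A] \<otimes>\<^sub>w ([S], prj i, summand [X] i)))) (J C))"

definition Omega :: "'o \<times> ('j \<Rightarrow> 'a) \<times> ('j \<Rightarrow> 'a) \<Rightarrow> 'o \<Rightarrow> 'a" where
  "Omega = (\<lambda>(S, inc, prj). \<lambda>A \<in> Obj C.
     hom_sum C (A \<odot> S) (S \<odot> A) (\<lambda>i. let T = Simp C i in underlying
       (((summand [] i, inc i, [S]) \<otimes>\<^sub>w id\<^sub>w [A])
         \<circ>\<^sub>w (id\<^sub>w [T] \<otimes>\<^sub>w wBraidInv C (Dual C T) A)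
         \<circ>\<^sub>w (wBraid C A T \<otimes>\<^sub>w id\<^sub>w [Dual C T])
         \<circ>\<^sub>w (id\<^sub>w [A] \<otimes>\<^sub>w ([S], prj i, summand [] i)))) (J C))"

definition I1_obj ::
    "'o \<times> ('j \<Rightarrow> 'a) \<times> ('j \<Rightarrow> 'a) \<Rightarrow> ('o, 'a) half_braided \<Rightarrow> ('o, 'a) elliptic_obj" where
  "I1_obj D P = (fst D, Gamma [fst P] D, lambda_tilde P D)"

definition unit_center :: "('o, 'a) half_braided" where
  "unit_center = (Unit C, \<lambda>A \<in> Obj C. inv_arr C (LUnit C A) \<cdot> RUnit C A)"

definition unit_sum :: "'o \<times> ('j \<Rightarrow> 'a) \<times> ('j \<Rightarrow> 'a)" where
  "unit_sum = (SumObj C, SumInj C, SumProj C)"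

text \<open>
  \<open>unit_sum\<close>, a direct sum of the \<open>X\<^sub>i \<otimes> X\<^sub>i*\<close>, regarded as a direct sum of the \<open>X\<^sub>i \<otimes> (1 \<otimes> X\<^sub>i*)\<close>
  by means of the unit constraints.
\<close>

definition unit_sum' :: "'o \<times> ('j \<Rightarrow> 'a) \<times> ('j \<Rightarrow> 'a)" where
  "unit_sum' = (SumObj C,
     \<lambda>i. SumInj C i \<cdot> (Id C (Simp C i) \<boxtimes> LUnit C (Dual C (Simp C i))),
     \<lambda>i. (Id C (Simp C i) \<boxtimes> inv_arr C (LUnit C (Dual C (Simp C i)))) \<cdot> SumProj C i)"

definition el_unit :: "('o, 'a) elliptic_obj" where
  "el_unit = (SumObj C, Gamma [] unit_sum, Omega unit_sum)"

definition el_lunit :: "'k \<Rightarrow> ('o, 'a) elliptic_obj \<Rightarrow> ('o, 'a) elliptic_arr" where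
  "el_lunit \<kappa> = (\<lambda>(X, l1, l2).
     (el_tensor el_unit (X, l1, l2),
      Scale C \<kappa> (hom_sum C (SumObj C \<odot> X) X
        (\<lambda>i. let T = Simp C i in Scale C (SqrtDim C i) (underlying
          ((id\<^sub>w [X] \<otimes>\<^sub>w wEvR C T) \<circ>\<^sub>w (wHalf l1 T X \<otimes>\<^sub>w id\<^sub>w [Dual C T])
             \<circ>\<^sub>w (id\<^sub>w [T] \<otimes>\<^sub>w wBraid C (Dual C T) X)
             \<circ>\<^sub>w (([SumObj C], SumProj C i, summand [] i) \<otimes>\<^sub>w id\<^sub>w [X])))) (J C))
        \<cdot> ImInc C (hb1 el_unit) (X, l1),
      (X, l1, l2)))"

definition el_runit :: "'k \<Rightarrow> ('o, 'a) elliptic_obj \<Rightarrow> ('o, 'a) elliptic_arr" where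
  "el_runit \<kappa> = (\<lambda>(X, l1, l2).
     (el_tensor (X, l1, l2) el_unit,
      Scale C \<kappa> (hom_sum C (X \<odot> SumObj C) X
        (\<lambda>i. let T = Simp C i in Scale C (SqrtDim C i) (underlying
          ((id\<^sub>w [X] \<otimes>\<^sub>w wEvR C T) \<circ>\<^sub>w (wHalf l1 T X \<otimes>\<^sub>w id\<^sub>w [Dual C T])
             \<circ>\<^sub>w (wBraid C X T \<otimes>\<^sub>w id\<^sub>w [Dual C T])
             \<circ>\<^sub>w (id\<^sub>w [X] \<otimes>\<^sub>w ([SumObj C], SumProj C i, summand [] i))))) (J C))
        \<cdot> ImInc C (X, l1) (hb1 el_unit),
      (X, l1, l2)))"

definition elliptic_monoidal ::
    "'k \<Rightarrow> (('o, 'a) elliptic_obj, ('o, 'a) elliptic_arr) monoidal_data" where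
  "elliptic_monoidal \<kappa> = category_data.extend (elliptic_center C)
     (monoidal_data.fields el_tensor el_tensor_arr el_unit el_assoc (el_lunit \<kappa>) (el_runit \<kappa>))"

end

text \<open>
  The images are epi-mono factorizations \<open>Q = ImInc \<cdot> ImProj\<close>, which exist in any abelian category;
  that \<open>Q\<close> is a projection is not presupposed.  The square roots are arbitrary, in particular
  \<open>SqrtDim\<close> at the unit object may be \<open>-1\<close>.
\<close>

locale premodular_category_with_choices = premodular_category C
  for C :: "('o, 'a, 'k::{alg_closed_field, field_char_0}, 'j, 'm) chosen_data_scheme" (structure) +
  assumes Simp_simple: "j \<in> J C \<Longrightarrow> is_simple C (Simp C j)"
    and Simp_complete: "is_simple C X \<Longrightarrow> \<exists>!j. j \<in> J C \<and> isomorphic C X (Simp C j)"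
    and Simp_Unit: "\<exists>j \<in> J C. Simp C j = Unit C"
    and SqrtDim: "j \<in> J C \<Longrightarrow> (SqrtDim C j)^2 = qdim C (Simp C j)"
    and Sum_biproduct: "is_biproduct C (J C) (\<lambda>j. Simp C j \<odot> Dual C (Simp C j))
                          (SumObj C) (SumInj C) (SumProj C)"
    and image: "\<lbrakk>(X, l) \<in> drinfeld_center_objects C; (Y, m) \<in> drinfeld_center_objects C\<rbrakk>
      \<Longrightarrow> ImProj C (X, l) (Y, m) \<in> Hom C (X \<odot> Y) (ImObj C (X, l) (Y, m)) \<and>
          ImInc C (X, l) (Y, m) \<in> Hom C (ImObj C (X, l) (Y, m)) (X \<odot> Y) \<and>
          is_epi C (ImProj C (X, l) (Y, m)) \<and> is_mono C (ImInc C (X, l) (Y, m)) \<and>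
          ImInc C (X, l) (Y, m) \<cdot> ImProj C (X, l) (Y, m) = Qproj C (X, l) (Y, m)"

end

theory Submission
  imports Defs
begin

text \<open>
 The computations are string diagrams. Words of objects form a strict monoidal category, and a
 half-braiding of \<open>X\<close> extends uniquely to words, so an identity of arrows is proved by moving boxes.

 For half-braidings \<open>ro\<close>, \<open>ro'\<close> on a word \<open>M\<close>, the average \<open>avg M ro ro'\<close> over loops labelled by the
 simple objects projects onto the largest part of \<open>M\<close> on which \<open>ro\<close> and \<open>ro'\<close> agree: fusing a strand
 \<open>A\<close> with the loop turns \<open>ro\<close> into \<open>ro'\<close> (\<open>avg_slide\<close>, by completeness of dual bases), and a loop
 contracts to its dimension on an arrow that does not distinguish them (\<open>avg_fix\<close>). The reduced
 tensor product is the part of \<open>X \<otimes> Y\<close> on which it makes no difference whether a strand half-braids with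
 \<open>X\<close> and braids past \<open>Y\<close> or the other way round, and both half-braidings of the product are restrictions
 along its inclusion (\<open>inc2_intw\<close>, \<open>ot_elliptic\<close>).

 Both triple products are therefore the same part of \<open>X \<otimes> Y \<otimes> Z\<close>, where three half-braidings agree, and
 the associativity constraint is the arrow compatible with the two inclusions (\<open>incR_assL\<close>). Since the
 inclusions are split, naturality, pentagon and triangle may be tested after them, where the
 constraint has disappeared.

 For the unit, let \<open>u\<close> be the projection of \<open>\<Oplus>X\<^sub>i \<otimes> X\<^sub>i*\<close> to its component at the unit object. Followed
 by the average, \<open>u\<close> becomes, up to a constant, the sum in the unit constraints (\<open>avg_unit_left\<close>,
 \<open>avg_unit_right\<close>). It is invertible on the reduced product since \<open>\<Gamma>\<close> mixes the components: \<open>u\<close>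
 composed with \<open>\<Gamma>\<close> at \<open>X\<^sub>i*\<close> returns the component at \<open>i\<close> (\<open>g_coev\<close>). The triangle then only says that
 \<open>u\<close> applied in the middle of \<open>X \<otimes> 1 \<otimes> Y\<close> may be read with either neighbour.
\<close>

section \<open>Arrows, inverses and unit coherence\<close>

context category
begin

abbreviation Ob where "Ob == Obj C"
abbreviation comp_arr (infixr "**" 55) where "g ** f == Comp C g f"

lemma arr_Id [simp]: "X : Ob ==> Id C X : Arr C"
 and Dom_Id [simp]: "X : Ob ==> Dom C (Id C X) = X"
 and Cod_Id [simp]: "X : Ob ==> Cod C (Id C X) = X"
 using Id_Hom[of X] by (auto simp: Hom_def)

lemma arr_Comp [simp]: "[|f : Arr C; g : Arr C; Dom C g = Cod C f|] ==> g ** f : Arr C"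
 and Dom_Comp [simp]: "[|f : Arr C; g : Arr C; Dom C g = Cod C f|] ==> Dom C (g ** f) = Dom C f"
 and Cod_Comp [simp]: "[|f : Arr C; g : Arr C; Dom C g = Cod C f|] ==> Cod C (g ** f) = Cod C g"
 using Comp_Hom[of f "Dom C f" "Cod C f" g "Cod C g"] by (auto simp: Hom_def)

lemma Comp_Id [simp]: "[|f : Arr C; X = Dom C f|] ==> f ** Id C X = f"
 and Id_Comp [simp]: "[|f : Arr C; X = Cod C f|] ==> Id C X ** f = f"
 using Id_right[of f "Dom C f" "Cod C f"] Id_left[of f "Dom C f" "Cod C f"] by (auto simp: Hom_def)

lemma Comp_Comp: "[|f : Arr C; g : Arr C; h : Arr C; Dom C g = Cod C f; Dom C h = Cod C g|]
  ==> (h ** g) ** f = h ** g ** f"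
 using Comp_assoc[of f "Dom C f" "Cod C f" g "Cod C g" h "Cod C h"] by (auto simp: Hom_def)

lemma Dom_Obj [simp]: "f : Arr C ==> Dom C f : Ob"
 and Cod_Obj [simp]: "f : Arr C ==> Cod C f : Ob"
 by (simp_all add: Dom_closed Cod_closed)

lemma inverse_unique:
 assumes "inverse_arrows C f g" "inverse_arrows C f h"
 shows "g = h"
proof -
 have "g = g ** f ** h" "h = (g ** f) ** h"
  using assms by (simp_all add: inverse_arrows_def Hom_def)
 then show ?thesis
  using assms Comp_Comp[of h f g] by (simp add: inverse_arrows_def Hom_def)
qed

lemma inv_arr_inverse: "is_iso C f ==> inverse_arrows C f (inv_arr C f)"
 unfolding is_iso_def inv_arr_def using inverse_unique by (metis theI)

lemma inv_arr_eq: "inverse_arrows C f g ==> inv_arr C f = g"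
 using inv_arr_inverse inverse_unique is_iso_def by metis

lemma iso_arr: "is_iso C f ==> f : Arr C"
 and arr_inv [simp]: "is_iso C f ==> inv_arr C f : Arr C"
 and Dom_inv [simp]: "is_iso C f ==> Dom C (inv_arr C f) = Cod C f"
 and Cod_inv [simp]: "is_iso C f ==> Cod C (inv_arr C f) = Dom C f"
 and inv_Comp [simp]: "is_iso C f ==> inv_arr C f ** f = Id C (Dom C f)"
 and Comp_inv [simp]: "is_iso C f ==> f ** inv_arr C f = Id C (Cod C f)"
 using inv_arr_inverse[of f] by (auto simp: inverse_arrows_def Hom_def)

lemma inv_Comp_Comp [simp]:
 assumes "is_iso C f" "h : Arr C" "Dom C f = Cod C h"
 shows "inv_arr C f ** f ** h = h"
proof -
 have "inv_arr C f ** f ** h = (inv_arr C f ** f) ** h"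
  using assms iso_arr[of f] by (subst Comp_Comp) simp_all
 then show ?thesis using assms iso_arr[of f] by simp
qed

lemma Comp_inv_Comp [simp]:
 assumes "is_iso C f" "h : Arr C" "Cod C f = Cod C h"
 shows "f ** inv_arr C f ** h = h"
proof -
 have "f ** inv_arr C f ** h = (f ** inv_arr C f) ** h"
  using assms iso_arr[of f] by (subst Comp_Comp) simp_all
 then show ?thesis using assms iso_arr[of f] by simp
qed

lemma isoI: "[|f : Arr C; g : Arr C; Dom C g = Cod C f; Cod C g = Dom C f;
  g ** f = Id C (Dom C f); f ** g = Id C (Cod C f)|] ==> is_iso C f"
 by (auto simp: is_iso_def inverse_arrows_def Hom_def)

lemma iso_Id [simp]: "X : Ob ==> is_iso C (Id C X)"
 by (rule isoI[where g = "Id C X"]) simp_all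

lemma inv_Id [simp]: "X : Ob ==> inv_arr C (Id C X) = Id C X"
 by (rule inv_arr_eq) (simp add: inverse_arrows_def Hom_def)

lemma inverse_Comp:
 assumes "is_iso C f" "is_iso C g" "Dom C g = Cod C f"
 shows "inverse_arrows C (g ** f) (inv_arr C f ** inv_arr C g)"
 using assms iso_arr[of f] iso_arr[of g] by (simp add: inverse_arrows_def Hom_def Comp_Comp)

lemma iso_Comp [simp]: "[|is_iso C f; is_iso C g; Dom C g = Cod C f|] ==> is_iso C (g ** f)"
 and inv_of_Comp: "[|is_iso C f; is_iso C g; Dom C g = Cod C f|]
  ==> inv_arr C (g ** f) = inv_arr C f ** inv_arr C g"
 using inverse_Comp inv_arr_eq is_iso_def by metis+

lemma iso_inv [simp]: "is_iso C f ==> is_iso C (inv_arr C f)"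
 by (rule isoI[where g = f]) (simp_all add: iso_arr)

lemma iso_cancel_left:
 assumes "is_iso C h" "f : Arr C" "g : Arr C" "Cod C f = Dom C h" "Cod C g = Dom C h"
  "h ** f = h ** g"
 shows "f = g"
 using assms inv_Comp_Comp by metis

lemma iso_cancel_right:
 assumes "is_iso C h" "f : Arr C" "g : Arr C" "Dom C f = Cod C h" "Dom C g = Cod C h"
  "f ** h = g ** h"
 shows "f = g"
proof -
 have "(f ** h) ** inv_arr C h = (g ** h) ** inv_arr C h" using assms(6) by simp
 then show ?thesis using assms(1-5) iso_arr[of h] by (simp add: Comp_Comp)
qed

end

context monoidal_category
begin

abbreviation tensor_arr (infixr "@@" 70) where "f @@ g == TensA C f g"
abbreviation wobj where "wobj == word_obj C"
abbreviation idw where "idw == word_id C"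
abbreviation wcomp (infixr "$" 60) where "g$f == word_comp C g f"
abbreviation wtensor (infixr "##" 70) where "f ## g == word_tensor C f g"

lemma TensO_Obj [simp]: "[|X : Ob; Y : Ob|] ==> X \<odot> Y : Ob"
 and Unit_Obj [simp]: "Unit C : Ob"
 by (simp_all add: TensO_closed Unit_closed)

lemma arr_TensA [simp]: "[|f : Arr C; g : Arr C|] ==> f @@ g : Arr C"
 and Dom_TensA [simp]: "[|f : Arr C; g : Arr C|] ==> Dom C (f @@ g) = Dom C f \<odot> Dom C g"
 and Cod_TensA [simp]: "[|f : Arr C; g : Arr C|] ==> Cod C (f @@ g) = Cod C f \<odot> Cod C g"
 using TensA_Hom[of f "Dom C f" "Cod C f" g "Dom C g" "Cod C g"] by (auto simp: Hom_def)

lemma interchange: "[|f : Arr C; g : Arr C; f' : Arr C; g' : Arr C; Dom C g = Cod C f;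
  Dom C g' = Cod C f'|] ==> (g @@ g') ** (f @@ f') = (g ** f) @@ (g' ** f')"
 using TensA_Comp[of f "Dom C f" "Cod C f" g "Cod C g" f' "Dom C f'" "Cod C f'" g' "Cod C g'"]
 by (auto simp: Hom_def)

lemma interchange_Comp:
 assumes "f : Arr C" "g : Arr C" "f' : Arr C" "g' : Arr C" "Dom C g = Cod C f"
  "Dom C g' = Cod C f'" "h : Arr C" "Cod C h = Dom C f \<odot> Dom C f'"
 shows "(g @@ g') ** (f @@ f') ** h = ((g ** f) @@ (g' ** f')) ** h"
 using assms Comp_Comp[of h "f @@ f'" "g @@ g'"] by (simp add: interchange)

lemma Id_TensA [simp]: "[|X : Ob; Y : Ob|] ==> Id C X @@ Id C Y = Id C (X \<odot> Y)"
 by (rule TensA_Id)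

lemma inverse_TensA:
 assumes "is_iso C f" "is_iso C g"
 shows "inverse_arrows C (f @@ g) (inv_arr C f @@ inv_arr C g)"
 using assms iso_arr[of f] iso_arr[of g] by (simp add: inverse_arrows_def Hom_def interchange)

lemma iso_TensA [simp]: "[|is_iso C f; is_iso C g|] ==> is_iso C (f @@ g)"
 and inv_TensA: "[|is_iso C f; is_iso C g|] ==> inv_arr C (f @@ g) = inv_arr C f @@ inv_arr C g"
 using inverse_TensA inv_arr_eq is_iso_def by metis+

lemma Assoc_simps [simp]:
 assumes "X : Ob" "Y : Ob" "Z : Ob"
 shows "Assoc C X Y Z : Arr C" "Dom C (Assoc C X Y Z) = (X \<odot> Y) \<odot> Z"
  "Cod C (Assoc C X Y Z) = X \<odot> (Y \<odot> Z)" "is_iso C (Assoc C X Y Z)"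
 using Assoc_Hom[OF assms] Assoc_iso[OF assms] by (auto simp: Hom_def)

lemma LUnit_simps [simp]:
 assumes "X : Ob"
 shows "LUnit C X : Arr C" "Dom C (LUnit C X) = Unit C \<odot> X" "Cod C (LUnit C X) = X"
  "is_iso C (LUnit C X)"
 using LUnit_Hom[OF assms] LUnit_iso[OF assms] by (auto simp: Hom_def)

lemma RUnit_simps [simp]:
 assumes "X : Ob"
 shows "RUnit C X : Arr C" "Dom C (RUnit C X) = X \<odot> Unit C" "Cod C (RUnit C X) = X"
  "is_iso C (RUnit C X)"
 using RUnit_Hom[OF assms] RUnit_iso[OF assms] by (auto simp: Hom_def)

lemma Assoc_nat: "[|f : Arr C; g : Arr C; h : Arr C|] ==>
  Assoc C (Cod C f) (Cod C g) (Cod C h) ** ((f @@ g) @@ h)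
  = (f @@ (g @@ h)) ** Assoc C (Dom C f) (Dom C g) (Dom C h)"
 using Assoc_natural[of f "Dom C f" "Cod C f" g "Dom C g" "Cod C g" h "Dom C h" "Cod C h"]
 by (auto simp: Hom_def)

lemma LUnit_nat: "f : Arr C ==> LUnit C (Cod C f) ** (Id C (Unit C) @@ f) = f ** LUnit C (Dom C f)"
 using LUnit_natural[of f "Dom C f" "Cod C f"] by (auto simp: Hom_def)

lemma RUnit_nat: "f : Arr C ==> RUnit C (Cod C f) ** (f @@ Id C (Unit C)) = f ** RUnit C (Dom C f)"
 using RUnit_natural[of f "Dom C f" "Cod C f"] by (auto simp: Hom_def)

lemma Unit_tensor_cancel:
 assumes "f : Arr C" "g : Arr C" "Dom C f = Dom C g" "Cod C f = Cod C g"
  "Id C (Unit C) @@ f = Id C (Unit C) @@ g"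
 shows "f = g"
proof (rule iso_cancel_right)
 show "f ** LUnit C (Dom C f) = g ** LUnit C (Dom C f)"
  using LUnit_nat[of f] LUnit_nat[of g] assms by metis
qed (use assms in simp_all)

lemma tensor_Unit_cancel:
 assumes "f : Arr C" "g : Arr C" "Dom C f = Dom C g" "Cod C f = Cod C g"
  "f @@ Id C (Unit C) = g @@ Id C (Unit C)"
 shows "f = g"
proof (rule iso_cancel_right)
 show "f ** RUnit C (Dom C f) = g ** RUnit C (Dom C f)"
  using RUnit_nat[of f] RUnit_nat[of g] assms by metis
qed (use assms in simp_all)

text \<open>
 Kelly's observation: the triangle for the middle unit and the pentagon imply the unit
 triangles on the left and on the right, since tensoring with the unit is faithful.
\<close>

lemma LUnit_tensor:
 assumes [simp]: "X : Ob" "Y : Ob"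
 shows "LUnit C (X \<odot> Y) ** Assoc C (Unit C) X Y = LUnit C X @@ Id C Y"
proof -
 let ?I = "Unit C"
 let ?B = "Assoc C ?I (?I \<odot> X) Y ** (Assoc C ?I ?I X @@ Id C Y)"
 have "(Id C ?I @@ (LUnit C (X \<odot> Y) ** Assoc C ?I X Y)) ** ?B
   = (Id C ?I @@ LUnit C (X \<odot> Y)) ** ((Id C ?I @@ Assoc C ?I X Y) ** ?B)"
  by (simp add: interchange Comp_Comp[symmetric])
 also have "... = ((Id C ?I @@ LUnit C (X \<odot> Y)) ** Assoc C ?I ?I (X \<odot> Y)) ** Assoc C (?I \<odot> ?I) X Y"
  by (simp add: pentagon Comp_Comp)
 also have "... = (RUnit C ?I @@ (Id C X @@ Id C Y)) ** Assoc C (?I \<odot> ?I) X Y"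
  by (simp add: triangle)
 also have "... = Assoc C ?I X Y ** ((RUnit C ?I @@ Id C X) @@ Id C Y)"
  using Assoc_nat[of "RUnit C ?I" "Id C X" "Id C Y"] by simp
 also have "... = Assoc C ?I X Y ** ((Id C ?I @@ LUnit C X) @@ Id C Y) ** (Assoc C ?I ?I X @@ Id C Y)"
  by (simp add: triangle[symmetric] interchange)
 also have "... = (Assoc C ?I X Y ** ((Id C ?I @@ LUnit C X) @@ Id C Y)) ** (Assoc C ?I ?I X @@ Id C Y)"
  by (simp add: Comp_Comp)
 also have "... = (Id C ?I @@ (LUnit C X @@ Id C Y)) ** ?B"
  using Assoc_nat[of "Id C ?I" "LUnit C X" "Id C Y"] by (simp add: Comp_Comp)
 finally have "Id C ?I @@ (LUnit C (X \<odot> Y) ** Assoc C ?I X Y) = Id C ?I @@ (LUnit C X @@ Id C Y)"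
  by (rule iso_cancel_right[rotated 5]) simp_all
 then show ?thesis by (rule Unit_tensor_cancel[rotated 4]) simp_all
qed

lemma RUnit_tensor:
 assumes [simp]: "X : Ob" "Y : Ob"
 shows "(Id C X @@ RUnit C Y) ** Assoc C X Y (Unit C) = RUnit C (X \<odot> Y)"
proof -
 let ?I = "Unit C"
 have "Assoc C X Y ?I ** (((Id C X @@ RUnit C Y) ** Assoc C X Y ?I) @@ Id C ?I)
   = Assoc C X Y ?I ** ((Id C X @@ RUnit C Y) @@ Id C ?I) ** (Assoc C X Y ?I @@ Id C ?I)"
  by (simp add: interchange)
 also have "... = (Assoc C X Y ?I ** ((Id C X @@ RUnit C Y) @@ Id C ?I)) ** (Assoc C X Y ?I @@ Id C ?I)"
  by (simp add: Comp_Comp)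
 also have "... = (Id C X @@ (RUnit C Y @@ Id C ?I)) ** Assoc C X (Y \<odot> ?I) ?I ** (Assoc C X Y ?I @@ Id C ?I)"
  using Assoc_nat[of "Id C X" "RUnit C Y" "Id C ?I"] by (simp add: Comp_Comp)
 also have "... = (Id C X @@ (Id C Y @@ LUnit C ?I)) **
   ((Id C X @@ Assoc C Y ?I ?I) ** Assoc C X (Y \<odot> ?I) ?I ** (Assoc C X Y ?I @@ Id C ?I))"
  by (simp add: triangle[symmetric] interchange Comp_Comp[symmetric])
 also have "... = ((Id C X @@ (Id C Y @@ LUnit C ?I)) ** Assoc C X Y (?I \<odot> ?I)) ** Assoc C (X \<odot> Y) ?I ?I"
  by (simp add: pentagon Comp_Comp)
 also have "... = Assoc C X Y ?I ** (Id C (X \<odot> Y) @@ LUnit C ?I) ** Assoc C (X \<odot> Y) ?I ?I"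
  using Assoc_nat[of "Id C X" "Id C Y" "LUnit C ?I", symmetric] by (simp add: Comp_Comp)
 also have "... = Assoc C X Y ?I ** (RUnit C (X \<odot> Y) @@ Id C ?I)"
  by (simp add: triangle)
 finally have "((Id C X @@ RUnit C Y) ** Assoc C X Y ?I) @@ Id C ?I = RUnit C (X \<odot> Y) @@ Id C ?I"
  by (rule iso_cancel_left[rotated 5]) simp_all
 then show ?thesis by (rule tensor_Unit_cancel[rotated 4]) simp_all
qed

lemma LUnit_Unit: "LUnit C (Unit C) = RUnit C (Unit C)"
proof -
 let ?I = "Unit C"
 have "LUnit C ?I ** (Id C ?I @@ LUnit C ?I) = LUnit C ?I ** LUnit C (?I \<odot> ?I)"
  using LUnit_nat[of "LUnit C ?I"] by simp
 then have l: "Id C ?I @@ LUnit C ?I = LUnit C (?I \<odot> ?I)"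
  by (rule iso_cancel_left[rotated 5]) simp_all
 have "LUnit C ?I @@ Id C ?I = RUnit C ?I @@ Id C ?I"
  using LUnit_tensor[of ?I ?I] triangle[of ?I ?I] l by simp
 then show ?thesis by (rule tensor_Unit_cancel[rotated 4]) simp_all
qed

end

section \<open>The strict monoidal category of words\<close>

definition dom where
 "dom f = fst f"

definition cod where
 "cod f = snd (snd f)"

lemma dom_simps [simp]:
 "dom (x, f, y) = x" "dom (id\<^sub>w\<^bsub>C\<^esub> x) = x" "dom (g' \<circ>\<^sub>w\<^bsub>C\<^esub> f') = dom f'"
 "dom (f' \<otimes>\<^sub>w\<^bsub>C\<^esub> g') = dom f' @ dom g'"
 by (simp_all add: dom_def word_id_def word_comp_def word_tensor_def)

lemma cod_simps [simp]:
 "cod (x, f, y) = y" "cod (id\<^sub>w\<^bsub>C\<^esub> x) = x" "cod (g' \<circ>\<^sub>w\<^bsub>C\<^esub> f') = cod g'"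
 "cod (f' \<otimes>\<^sub>w\<^bsub>C\<^esub> g') = cod f' @ cod g'"
 by (simp_all add: cod_def word_id_def word_comp_def word_tensor_def)

lemma underlying_simps [simp]:
 "underlying (x, f, y) = f" "underlying (id\<^sub>w\<^bsub>C\<^esub> x) = Id C (word_obj C x)"
 "underlying (g' \<circ>\<^sub>w\<^bsub>C\<^esub> f') = underlying g' \<cdot>\<^bsub>C\<^esub> underlying f'"
 by (simp_all add: underlying_def word_id_def word_comp_def)

lemma word_arr_eqI:
 "[|dom f = dom g; cod f = cod g; underlying f = underlying g|] ==> f = g"
 by (cases f; cases g) (auto simp: dom_def cod_def underlying_def)

context monoidal_category
begin

definition word where
 "word x \<longleftrightarrow> set x \<subseteq> Ob"

definition warr where
 "warr f \<longleftrightarrow> word (dom f) & word (cod f) &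
   underlying f : Hom C (wobj (dom f)) (wobj (cod f))"

lemma word_simps [simp]:
 "word []" "word (a # x) \<longleftrightarrow> a : Ob & word x" "word (x @ y) \<longleftrightarrow> word x & word y"
 by (auto simp: word_def)

lemma word_obj_Obj [simp]: "word x ==> wobj x : Ob"
 by (induction x rule: induct_list012) auto

lemma warr_word [simp]: "warr f ==> word (dom f)" "warr f ==> word (cod f)"
 by (simp_all add: warr_def)

lemma warr_arr [simp]:
 assumes "warr f"
 shows "underlying f : Arr C" "Dom C (underlying f) = wobj (dom f)"
  "Cod C (underlying f) = wobj (cod f)"
 using assms unfolding warr_def Hom_def by auto

lemma warrI: "[|word x; word y; f : Hom C (wobj x) (wobj y)|] ==> warr (x, f, y)"
 unfolding warr_def by simp

lemma warr_intro: "[|word (dom f); word (cod f); underlying f : Arr C;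
  Dom C (underlying f) = wobj (dom f); Cod C (underlying f) = wobj (cod f)|] ==> warr f"
 unfolding warr_def Hom_def by simp

lemma word_obj_Cons: "x ~= [] ==> wobj (a # x) = a \<odot> wobj x"
 by (cases x) simp_all

lemma word_join_Cons: "[|x ~= []; y ~= []|] ==> word_join C (a # x) y =
  (Id C a @@ word_join C x y) ** Assoc C a (wobj x) (wobj y)"
 by (cases x; cases y) simp_all

lemma word_join_single: "y ~= [] ==> word_join C [a] y = Id C (wobj (a # y))"
 by (cases y) simp_all

lemma word_join_simps [simp]:
 assumes "word x" "word y"
 shows "word_join C x y : Arr C" "Dom C (word_join C x y) = wobj x \<odot> wobj y"
  "Cod C (word_join C x y) = wobj (x @ y)" "is_iso C (word_join C x y)"
proof -
 have "is_iso C (word_join C x y) & Dom C (word_join C x y) = wobj x \<odot> wobj y &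
  Cod C (word_join C x y) = wobj (x @ y)"
  using assms
 proof (induction x)
  case (Cons a x)
  show ?case
  proof (cases "x = [] \<or> y = []")
   case True
   then show ?thesis using Cons.prems by (cases y) auto
  next
   case False
   then show ?thesis using Cons by (simp add: word_join_Cons word_obj_Cons iso_arr)
  qed
 qed simp
 then show "word_join C x y : Arr C" "Dom C (word_join C x y) = wobj x \<odot> wobj y"
  "Cod C (word_join C x y) = wobj (x @ y)" "is_iso C (word_join C x y)"
  using iso_arr by simp_all
qed

lemma word_join_Nil_right: "word x ==> word_join C x [] = RUnit C (wobj x)"
 by (cases x) (simp_all add: LUnit_Unit)

text \<open>
 Joining three words in the two possible orders differs by the associativity constraint; this is
 the only coherence needed to make the tensor product of arrows between words strictly associative.
\<close>

lemma word_join_assoc: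
 assumes "word x" "word y" "word z"
 shows "word_join C (x @ y) z ** (word_join C x y @@ Id C (wobj z)) =
  word_join C x (y @ z) ** (Id C (wobj x) @@ word_join C y z)
   ** Assoc C (wobj x) (wobj y) (wobj z)"
proof -
 note [simp] = assms
 let ?o = "wobj"
 consider "x = []" | "x ~= []" "y = []" | "x ~= []" "y ~= []" "z = []" | "x ~= []" "y ~= []" "z ~= []"
  by blast
 then show ?thesis
 proof cases
  case 1
  have "word_join C y z ** (LUnit C (?o y) @@ Id C (?o z))
    = (word_join C y z ** LUnit C (?o y \<odot> ?o z)) ** Assoc C (Unit C) (?o y) (?o z)"
   by (simp add: LUnit_tensor[symmetric] Comp_Comp)
  also have "word_join C y z ** LUnit C (?o y \<odot> ?o z)
    = LUnit C (?o (y @ z)) ** (Id C (Unit C) @@ word_join C y z)"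
   using LUnit_nat[of "word_join C y z"] by simp
  finally show ?thesis using 1 by (simp add: Comp_Comp)
 next
  case 2
  then show ?thesis by (simp add: word_join_Nil_right triangle)
 next
  case 3
  have "RUnit C (?o (x @ y)) ** (word_join C x y @@ Id C (Unit C)) = word_join C x y ** RUnit C (?o x \<odot> ?o y)"
   using RUnit_nat[of "word_join C x y"] by simp
  then show ?thesis using 3 by (simp add: word_join_Nil_right RUnit_tensor)
 next
  case 4
  from 4(1) assms(1) show ?thesis
  proof (induction x)
   case (Cons a x)
   show ?case
   proof (cases "x = []")
    case True
    then show ?thesis using 4 Cons.prems by (simp add: word_join_single word_join_Cons word_obj_Cons)
   next
    case False
    have IH: "word_join C (x @ y) z ** (word_join C x y @@ Id C (?o z)) =
      word_join C x (y @ z) ** (Id C (?o x) @@ word_join C y z) ** Assoc C (?o x) (?o y) (?o z)"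
     using Cons False by simp
    have [simp]: "a : Ob" "word x" using Cons.prems by simp_all
    have "word_join C (a # x @ y) z ** (word_join C (a # x) y @@ Id C (?o z))
     = (Id C a @@ word_join C (x @ y) z) ** Assoc C a (?o (x @ y)) (?o z)
      ** ((Id C a @@ word_join C x y) @@ Id C (?o z)) ** (Assoc C a (?o x) (?o y) @@ Id C (?o z))"
     using False 4 by (simp add: word_join_Cons Comp_Comp interchange)
    also have "... = (Id C a @@ word_join C (x @ y) z) ** (Assoc C a (?o (x @ y)) (?o z)
      ** ((Id C a @@ word_join C x y) @@ Id C (?o z))) ** (Assoc C a (?o x) (?o y) @@ Id C (?o z))"
     by (simp add: Comp_Comp)
    also have "Assoc C a (?o (x @ y)) (?o z) ** ((Id C a @@ word_join C x y) @@ Id C (?o z))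
     = (Id C a @@ (word_join C x y @@ Id C (?o z))) ** Assoc C a (?o x \<odot> ?o y) (?o z)"
     using Assoc_nat[of "Id C a" "word_join C x y" "Id C (?o z)"] by simp
    also have "(Id C a @@ word_join C (x @ y) z)
      ** ((Id C a @@ (word_join C x y @@ Id C (?o z))) ** Assoc C a (?o x \<odot> ?o y) (?o z))
      ** (Assoc C a (?o x) (?o y) @@ Id C (?o z))
     = (Id C a @@ (word_join C (x @ y) z ** (word_join C x y @@ Id C (?o z))))
      ** Assoc C a (?o x \<odot> ?o y) (?o z) ** (Assoc C a (?o x) (?o y) @@ Id C (?o z))"
     by (simp add: Comp_Comp interchange_Comp)
    also have "... = (Id C a @@ (word_join C x (y @ z) ** (Id C (?o x) @@ word_join C y z)))
      ** (Id C a @@ Assoc C (?o x) (?o y) (?o z)) ** Assoc C a (?o x \<odot> ?o y) (?o z)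
      ** (Assoc C a (?o x) (?o y) @@ Id C (?o z))"
     unfolding IH by (simp add: interchange_Comp Comp_Comp)
    also have "... = (Id C a @@ (word_join C x (y @ z) ** (Id C (?o x) @@ word_join C y z)))
      ** Assoc C a (?o x) (?o y \<odot> ?o z) ** Assoc C (a \<odot> ?o x) (?o y) (?o z)"
     by (simp add: pentagon)
    also have "... = (Id C a @@ word_join C x (y @ z))
      ** ((Id C a @@ (Id C (?o x) @@ word_join C y z)) ** Assoc C a (?o x) (?o y \<odot> ?o z))
      ** Assoc C (a \<odot> ?o x) (?o y) (?o z)"
     by (simp add: Comp_Comp interchange_Comp)
    also have "(Id C a @@ (Id C (?o x) @@ word_join C y z)) ** Assoc C a (?o x) (?o y \<odot> ?o z)
     = Assoc C a (?o x) (?o (y @ z)) ** (Id C (a \<odot> ?o x) @@ word_join C y z)"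
     using Assoc_nat[of "Id C a" "Id C (?o x)" "word_join C y z"] by simp
    finally show ?thesis
     using False 4 by (simp add: word_join_Cons Comp_Comp word_obj_Cons)
   qed
  qed simp
 qed
qed

lemma warr_id [simp]: "word x ==> warr (idw x)"
 and warr_comp [simp]: "[|warr f; warr g; dom g = cod f|] ==> warr (g$f)"
 by (rule warr_intro; simp)+

lemma underlying_tensor: "underlying (f ## g) =
  word_join C (cod f) (cod g) ** (underlying f @@ underlying g)
   ** inv_arr C (word_join C (dom f) (dom g))"
 by (simp add: underlying_def word_tensor_def dom_def cod_def)

lemma warr_tensor [simp]: "[|warr f; warr g|] ==> warr (f ## g)"
 by (rule warr_intro) (simp_all add: underlying_tensor)

lemma underlying_tensor_join: "[|warr f; warr g|] ==>
  underlying (f ## g) ** word_join C (dom f) (dom g) =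
  word_join C (cod f) (cod g) ** (underlying f @@ underlying g)"
 by (simp add: underlying_tensor Comp_Comp)

lemma cassoc: "[|warr f; warr g; warr h; dom g = cod f; dom h = cod g|]
  ==> (h$g)$f = h$g$f"
 by (rule word_arr_eqI) (simp_all add: Comp_Comp)

lemma comp_id [simp]: "[|warr f; x = dom f|] ==> f$idw x = f"
 and id_comp [simp]: "[|warr f; x = cod f|] ==> idw x$f = f"
 by (rule word_arr_eqI; simp)+

lemma tensor_comp:
 assumes "warr f" "warr g" "warr f'" "warr g'" "dom g = cod f" "dom g' = cod f'"
 shows "(g$f) ## (g'$f') = (g ## g')$(f ## f')"
 by (rule word_arr_eqI) (use assms in "simp_all add: underlying_tensor Comp_Comp interchange_Comp")

lemma tensor_id: "[|word x; word y|] ==> idw x ## idw y = idw (x @ y)"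
 by (rule word_arr_eqI) (simp_all add: underlying_tensor)

lemma tensor_nil_left [simp]:
 assumes "warr f"
 shows "idw [] ## f = f"
proof (rule word_arr_eqI)
 have "underlying (idw [] ## f) = (LUnit C (wobj (cod f)) ** (Id C (Unit C) @@ underlying f))
   ** inv_arr C (LUnit C (wobj (dom f)))"
  using assms by (simp add: underlying_tensor Comp_Comp)
 also have "LUnit C (wobj (cod f)) ** (Id C (Unit C) @@ underlying f) = underlying f ** LUnit C (wobj (dom f))"
  using LUnit_nat[of "underlying f"] assms by simp
 finally show "underlying (idw [] ## f) = underlying f"
  using assms by (simp add: Comp_Comp)
qed simp_all

lemma tensor_nil_right [simp]:
 assumes "warr f"
 shows "f ## idw [] = f"
proof (rule word_arr_eqI)
 have "underlying (f ## idw []) = (RUnit C (wobj (cod f)) ** (underlying f @@ Id C (Unit C)))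
   ** inv_arr C (RUnit C (wobj (dom f)))"
  using assms by (simp add: underlying_tensor Comp_Comp word_join_Nil_right)
 also have "RUnit C (wobj (cod f)) ** (underlying f @@ Id C (Unit C)) = underlying f ** RUnit C (wobj (dom f))"
  using RUnit_nat[of "underlying f"] assms by simp
 finally show "underlying (f ## idw []) = underlying f"
  using assms by (simp add: Comp_Comp)
qed simp_all

lemma tensor_assoc:
 assumes [simp]: "warr f" "warr g" "warr h"
 shows "(f ## g) ## h = f ## g ## h"
proof (rule word_arr_eqI)
 let ?d = dom and ?c = cod and ?u = underlying and ?o = "wobj"
 let ?J = "word_join C (?d f @ ?d g) (?d h) ** (word_join C (?d f) (?d g) @@ Id C (?o (?d h)))"
 have "?u ((f ## g) ## h) ** ?J
   = (?u ((f ## g) ## h) ** word_join C (?d f @ ?d g) (?d h)) ** (word_join C (?d f) (?d g) @@ Id C (?o (?d h)))"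
  by (simp add: Comp_Comp)
 also have "... = word_join C (?c f @ ?c g) (?c h)
   ** ((?u (f ## g) ** word_join C (?d f) (?d g)) @@ ?u h)"
  using underlying_tensor_join[of "f ## g" h] by (simp add: Comp_Comp interchange)
 also have "... = (word_join C (?c f @ ?c g) (?c h) ** (word_join C (?c f) (?c g) @@ Id C (?o (?c h))))
   ** ((?u f @@ ?u g) @@ ?u h)"
  by (simp add: underlying_tensor_join Comp_Comp interchange)
 also have "... = word_join C (?c f) (?c g @ ?c h) ** (Id C (?o (?c f)) @@ word_join C (?c g) (?c h))
   ** (Assoc C (?o (?c f)) (?o (?c g)) (?o (?c h)) ** ((?u f @@ ?u g) @@ ?u h))"
  by (simp add: word_join_assoc Comp_Comp)
 also have "... = word_join C (?c f) (?c g @ ?c h) ** (?u f @@ (word_join C (?c g) (?c h) ** (?u g @@ ?u h)))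
   ** Assoc C (?o (?d f)) (?o (?d g)) (?o (?d h))"
  using Assoc_nat[of "?u f" "?u g" "?u h"] by (simp add: interchange_Comp)
 also have "... = (word_join C (?c f) (?c g @ ?c h) ** (?u f @@ ?u (g ## h)))
   ** (Id C (?o (?d f)) @@ word_join C (?d g) (?d h)) ** Assoc C (?o (?d f)) (?o (?d g)) (?o (?d h))"
  by (simp add: underlying_tensor_join Comp_Comp interchange_Comp)
 also have "... = ?u (f ## g ## h) ** ?J"
  using underlying_tensor_join[of f "g ## h", symmetric] by (simp add: Comp_Comp word_join_assoc)
 finally show "?u ((f ## g) ## h) = ?u (f ## g ## h)"
  by (rule iso_cancel_right[rotated 5]) simp_all
qed simp_all

end

section \<open>String diagrams in layers\<close>

text \<open>Matching on prefixes lets the rewriter see whether two boxes in adjacent layers are disjoint.\<close>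

definition strip where
 "strip x y = (if \<exists>z. y = x @ z then Some (drop (length x) y) else None)"

lemma strip_append [simp]: "strip x (x @ z) = Some z" "strip (x @ y) (x @ z) = strip y z"
 and strip_self [simp]: "strip x x = Some []"
 and strip_Nil [simp]: "strip [] y = Some y"
 and strip_Cons [simp]: "strip (a # x) (a # y) = strip x y" "strip (a # x) [] = None"
 by (auto simp: strip_def)

lemma strip_Some: "strip x y = Some z \<longleftrightarrow> y = x @ z"
 by (auto simp: strip_def)

context monoidal_category
begin

text \<open>Diagrams are composites of layers with one box each; a word omitted in the notation is empty.\<close>

definition layer
  ("{_;_;_}") where
 "{p;f;q} = idw p ## f ## idw q"

abbreviation layer_left ("{;_;_}") where "{;f;q} == {[];f;q}"
abbreviation layer_right ("{_;_;}") where "{p;f;} == {p;f;[]}"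
abbreviation layer_both ("{;_;}") where "{;f;} == {[];f;[]}"

lemma layer_simps [simp]:
 "dom {p;f;q} = p @ dom f @ q" "cod {p;f;q} = p @ cod f @ q"
 "[|word p; warr f; word q|] ==> warr {p;f;q}"
 by (simp_all add: layer_def)

lemma layer_layer [simp]:
 "[|word p; word p'; warr f; word q'; word q|] ==> {p;{p';f;q'};q} = {p @ p';f;q' @ q}"
 by (simp add: layer_def tensor_assoc tensor_id[symmetric])

lemma layer_id [simp]: "[|word p; word x; word q|] ==> {p;idw x;q} = idw (p @ x @ q)"
 by (simp add: layer_def tensor_id)

lemma layer_nil: "warr f ==> {;f;} = f"
 by (simp add: layer_def)

lemma layer_comp [simp]:
 assumes "word p" "warr f" "warr g" "word q" "dom g = cod f"
 shows "{p;g$f;q} = {p;g;q}${p;f;q}"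
 unfolding layer_def using assms
 by (subst tensor_comp[symmetric]; simp)+

lemma tensor_layers:
 assumes [simp]: "warr f" "warr g"
 shows "f ## g = {cod f;g;}${;f;dom g}"
 unfolding layer_def by (simp add: tensor_comp[symmetric])

lemma exchange:
 assumes [simp]: "word p" "warr f" "warr g" "word m" "word q"
 shows "{p @ cod g @ m;f;q}${p;g;m @ dom f @ q}
  = {p;g;m @ cod f @ q}${p @ dom g @ m;f;q}"
proof -
 have "{cod g @ m;f;q}${;g;m @ dom f @ q}
  = g ## {m;f;q}"
  by (simp add: tensor_layers[of g "{m;f;q}"])
 also have "... = {;g;m @ cod f @ q}${dom g @ m;f;q}"
  by (simp add: layer_def tensor_comp[symmetric] tensor_id[symmetric] tensor_assoc)
 finally have "{p;{cod g @ m;f;q}${;g;m @ dom f @ q};}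
  = {p;{;g;m @ cod f @ q}${dom g @ m;f;q};}"
  by simp
 then show ?thesis by simp
qed

text \<open>
 Used as rewrite rules, the next two facts bring a diagram into a normal form: of two boxes that
 do not interact, the right one is executed first.
\<close>

lemma exchange_right_first:
 assumes "strip (p @ cod g) p' = Some m" "p' @ dom f @ q' = p @ cod g @ q"
  "word p" "warr f" "warr g" "word q"
 shows "{p';f;q'}${p;g;q} = {p;g;m @ cod f @ q'}${p @ dom g @ m;f;q'}"
proof -
 have "p' = p @ cod g @ m" "q = m @ dom f @ q'"
  using assms(1,2) by (simp_all add: strip_Some)
 then show ?thesis using assms exchange[of p f g m q'] by simp
qed

lemma exchange_right_first_comp:
 assumes "strip (p @ cod g) p' = Some m" "p' @ dom f @ q' = p @ cod g @ q"
  "word p" "warr f" "warr g" "word q" "warr r" "cod r = p @ dom g @ q"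
 shows "{p';f;q'}${p;g;q}$r
  = {p;g;m @ cod f @ q'}${p @ dom g @ m;f;q'}$r"
proof -
 have e: "p' = p @ cod g @ m" "q = m @ dom f @ q'"
  using assms(1,2) by (simp_all add: strip_Some)
 have "{p';f;q'}${p;g;q}$r = ({p';f;q'}${p;g;q})$r"
  using assms e by (simp add: cassoc)
 then show ?thesis
  using assms e exchange_right_first[OF assms(1-6)] by (simp add: cassoc)
qed

lemmas diagram = cassoc exchange_right_first exchange_right_first_comp

lemma rewrite:
 assumes "s = t" "f = u${p;s;q}$v" "g = u${p;t;q}$v"
 shows "f = g"
 using assms by simp

section \<open>Half-braidings on words\<close>

definition hbraid where
 "hbraid M ro \<longleftrightarrow> word M &
   (\<forall>A. word A \<longrightarrow> warr (ro A) & dom (ro A) = A @ M & cod (ro A) = M @ A) &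
   (\<forall>f. warr f \<longrightarrow> {M;f;}$ro (dom f) = ro (cod f)${;f;M}) &
   (\<forall>A B. word A & word B \<longrightarrow> ro (A @ B) = {;ro A;B}${A;ro B;}) &
   ro [] = idw M"

lemma hb_simps [simp]:
 assumes "hbraid M ro"
 shows "word M" "ro [] = idw M" "word A ==> warr (ro A)"
  "word A ==> dom (ro A) = A @ M" "word A ==> cod (ro A) = M @ A"
 using assms unfolding hbraid_def by auto

lemma half_braid_nat:
 assumes "hbraid M ro" "warr f" "dom f = A" "cod f = B"
 shows "{M;f;}$ro A = ro B${;f;M}"
 using assms unfolding hbraid_def by blast

lemma half_braid_append:
 assumes "hbraid M ro" "word A" "word B"
 shows "ro (A @ B) = {;ro A;B}${A;ro B;}"
 using assms unfolding hbraid_def by blast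

definition hprod where
 "hprod sg X ta Y A = {X;ta A;}${;sg A;Y}"

lemma half_braid_prod:
 assumes l: "hbraid X sg" and m: "hbraid Y ta"
 shows "hbraid (X @ Y) (hprod sg X ta Y)"
proof -
 note [simp] = l[THEN hb_simps(1)] m[THEN hb_simps(1)]
  hb_simps(2-5)[OF l] hb_simps(2-5)[OF m]
 show ?thesis unfolding hbraid_def hprod_def
 proof (intro conjI allI impI)
  fix f assume f[simp]: "warr f"
  let ?a = "dom f" and ?b = "cod f"
  have "{X @ Y;f;}${X;ta ?a;}${;sg ?a;Y}
    = {X;ta ?b;}${X;f;Y}${;sg ?a;Y}"
   by (rule rewrite[OF half_braid_nat[OF m f refl refl], of _ "idw (X @ Y @ ?b)" X "[]" "{;sg ?a;Y}"])
    (simp_all add: diagram)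
  also have "... = {X;ta ?b;}${;sg ?b;Y}${;f;X @ Y}"
   by (rule rewrite[OF half_braid_nat[OF l f refl refl], of _ "{X;ta ?b;}" "[]" Y "idw (?a @ X @ Y)"])
    (simp_all add: diagram)
  finally show "{X @ Y;f;}${X;ta ?a;}${;sg ?a;Y}
    = ({X;ta ?b;}${;sg ?b;Y})${;f;X @ Y}"
   by (simp add: diagram)
 next
  fix A B assume "word A & word B"
  then show "{X;ta (A @ B);}${;sg (A @ B);Y} =
    {;{X;ta A;}${;sg A;Y};B}${A;{X;ta B;}${;sg B;Y};}"
   by (simp add: diagram half_braid_append[OF l] half_braid_append[OF m])
 qed simp_all
qed

end

context monoidal_category
begin

definition fuse where
 "fuse A = (A, Id C (wobj A), [wobj A])"

definition unfuse where
 "unfuse A = ([wobj A], Id C (wobj A), A)"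

lemma fuse_simps [simp]:
 "dom (fuse A) = A" "cod (fuse A) = [wobj A]"
 "underlying (fuse A) = Id C (wobj A)" "word A ==> warr (fuse A)" "fuse [a] = idw [a]"
 by (simp_all add: fuse_def warr_intro word_id_def)

lemma unfuse_simps [simp]:
 "dom (unfuse A) = [wobj A]" "cod (unfuse A) = A"
 "underlying (unfuse A) = Id C (wobj A)" "word A ==> warr (unfuse A)" "unfuse [a] = idw [a]"
 by (simp_all add: unfuse_def warr_intro word_id_def)

lemma fuse_unfuse: "word A ==> fuse A$unfuse A = idw [wobj A]"
 and unfuse_fuse: "word A ==> unfuse A$fuse A = idw A"
 by (rule word_arr_eqI; simp)+

lemma layer_cancel:
 assumes "g$f = idw x" "word p" "word q" "warr f" "warr g" "dom g = cod f"
 shows "{p;g;q}${p;f;q} = idw (p @ dom f @ q)"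
  "[|warr r; cod r = p @ dom f @ q|] ==> {p;g;q}${p;f;q}$r = r"
proof -
 have x: "x = dom f" using assms(1) dom_simps(2,3) by metis
 have "{p;g;q}${p;f;q} = {p;g$f;q}" using assms(2-) by simp
 then show e: "{p;g;q}${p;f;q} = idw (p @ dom f @ q)"
  using assms x by simp
 assume "warr r" "cod r = p @ dom f @ q"
 then show "{p;g;q}${p;f;q}$r = r"
  using assms(2-) cassoc[of r "{p;f;q}" "{p;g;q}", symmetric] e by simp
qed

definition joiner where
 "joiner A B = ([wobj A \<odot> wobj B], word_join C A B, [wobj (A @ B)])"

lemma joiner_simps [simp]:
 "dom (joiner A B) = [wobj A \<odot> wobj B]" "cod (joiner A B) = [wobj (A @ B)]"
 "underlying (joiner A B) = word_join C A B" "[|word A; word B|] ==> warr (joiner A B)"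
 by (simp_all add: joiner_def warr_intro)

lemma fuse_append:
 assumes [simp]: "word A" "word B"
 shows "fuse (A @ B) =
  joiner A B$fuse [wobj A, wobj B]$(fuse A ## fuse B)"
 by (rule word_arr_eqI) (simp_all add: underlying_tensor)

lemma unfuse_append:
 assumes [simp]: "word A" "word B"
 shows "unfuse (A @ B)$joiner A B =
  (unfuse A ## unfuse B)$unfuse [wobj A, wobj B]"
 by (rule word_arr_eqI) (simp_all add: underlying_tensor)

text \<open>
 A half-braiding is determined by its values on objects: a word is isomorphic to the one-letter
 word formed by its tensor product.
\<close>

definition extend where
 "extend M t A = {M;unfuse A;}$t (wobj A)${;fuse A;M}"

lemma extend_single:
 "[|word M; a : Ob; warr (t a); dom (t a) = a # M; cod (t a) = M @ [a]|] ==> extend M t [a] = t a"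
 by (simp add: extend_def)

lemma half_braid_extend:
 assumes M [simp]: "word M"
  and t: "!!a. a : Ob ==> warr (t a) & dom (t a) = a # M & cod (t a) = M @ [a]"
  and nat: "!!a b f. [|warr f; dom f = [a]; cod f = [b]|]
   ==> {M;f;}$t a = t b${;f;M}"
  and mult: "!!a b. [|a : Ob; b : Ob|] ==>
   t (a \<odot> b)${;fuse [a, b];M} = {M;fuse [a, b];}${;t a;[b]}${[a];t b;}"
  and inv: "warr g" "dom g = M @ [Unit C]" "cod g = Unit C # M"
   "g$t (Unit C) = idw (Unit C # M)"
 shows "hbraid M (extend M t)"
proof -
 let ?o = "wobj"
 have [simp]: "warr (t (?o A))" "dom (t (?o A)) = ?o A # M" "cod (t (?o A)) = M @ [?o A]" if "word A" for A
  using t[of "?o A"] that by auto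
 have [simp]: "warr (extend M t A)" "dom (extend M t A) = A @ M" "cod (extend M t A) = M @ A" if "word A" for A
  using that by (simp_all add: extend_def)
 have natural: "{M;f;}$extend M t (dom f) = extend M t (cod f)${;f;M}" if [simp]: "warr f" for f
 proof -
  let ?a = "dom f" and ?b = "cod f"
  let ?f = "fuse ?b$f$unfuse ?a"
  have n: "{M;?f;}$t (?o ?a) = t (?o ?b)${;?f;M}"
   by (rule nat) simp_all
  have f: "f$unfuse ?a = unfuse ?b$?f" "?f$fuse ?a = fuse ?b$f"
   using layer_cancel[OF unfuse_fuse, of ?b "[]" "[]"] layer_cancel[OF unfuse_fuse, of ?a "[]" "[]"]
   by (simp_all add: cassoc layer_nil unfuse_fuse)
  have "{M;f;}$extend M t ?a = {M;f$unfuse ?a;}$t (?o ?a)${;fuse ?a;M}"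
   by (simp add: extend_def cassoc)
  also have "... = {M;unfuse ?b;}$({M;?f;}$t (?o ?a))${;fuse ?a;M}"
   by (subst f(1)) (simp add: cassoc)
  also have "... = {M;unfuse ?b;}$t (?o ?b)${;?f$fuse ?a;M}"
   unfolding n by (simp add: cassoc)
  also have "... = extend M t ?b${;f;M}"
   unfolding f(2) by (simp add: extend_def cassoc)
  finally show ?thesis .
 qed
 have append: "extend M t (A @ B) = {;extend M t A;B}${A;extend M t B;}"
  if [simp]: "word A" "word B" for A B
 proof -
  let ?a = "?o A" and ?b = "?o B"
  have n: "{M;joiner A B;}$t (?a \<odot> ?b) = t (?o (A @ B))${;joiner A B;M}"
   by (rule nat) simp_all
  have [simp]: "warr (t (?a \<odot> ?b))" "dom (t (?a \<odot> ?b)) = (?a \<odot> ?b) # M" "cod (t (?a \<odot> ?b)) = M @ [?a \<odot> ?b]"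
   using t[of "?a \<odot> ?b"] by simp_all
  have "extend M t (A @ B) = {M;unfuse (A @ B);}$(t (?o (A @ B))${;joiner A B;M})
   ${;fuse [?a, ?b];M}${;fuse A ## fuse B;M}"
   by (simp add: extend_def fuse_append cassoc)
  also have "... = {M;unfuse (A @ B)$joiner A B;}$(t (?a \<odot> ?b)${;fuse [?a, ?b];M})
   ${;fuse A ## fuse B;M}"
   unfolding n[symmetric] by (simp add: cassoc)
  also have "... = {M;unfuse A ## unfuse B;}$({M;unfuse [?a, ?b];}${M;fuse [?a, ?b];}
   ${;t ?a;[?b]})${[?a];t ?b;}${;fuse A ## fuse B;M}"
   unfolding unfuse_append[OF that] mult[OF word_obj_Obj[OF that(1)] word_obj_Obj[OF that(2)]]
   by (simp add: cassoc)
  also have "... = {M;unfuse A ## unfuse B;}${;t ?a;[?b]}${[?a];t ?b;}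
   ${;fuse A ## fuse B;M}"
   by (subst layer_cancel(2)[OF unfuse_fuse]) (simp_all)
  also have "... = {;extend M t A;B}${A;extend M t B;}"
   by (simp add: extend_def tensor_layers diagram)
  finally show ?thesis .
 qed
 have "extend M t [] = idw M"
 proof -
  let ?T = "extend M t []"
  define h where "h = {;unfuse [];M}$g${M;fuse [];}"
  have [simp]: "warr h" "dom h = M" "cod h = M" using inv by (simp_all add: h_def)
  have "h$?T = {;unfuse [];M}$g$({M;fuse [];}${M;unfuse [];}$t (Unit C))${;fuse [];M}"
   using inv t[of "Unit C"] by (simp add: h_def extend_def cassoc)
  also have "... = {;unfuse [];M}$g$t (Unit C)${;fuse [];M}"
   using inv t[of "Unit C"] by (subst layer_cancel(2)[OF fuse_unfuse]) (simp_all add: cassoc)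
  also have "g$t (Unit C)${;fuse [];M} = {;fuse [];M}"
   using inv t[of "Unit C"] by (subst cassoc[symmetric]) simp_all
  also have "{;unfuse [];M}${;fuse [];M} = idw M"
   using layer_cancel(1)[OF unfuse_fuse, of "[]" "[]" M] by simp
  finally have h: "h$?T = idw M" .
  have "?T = ?T$?T" using append[of "[]" "[]"] by (simp add: layer_def tensor_id)
  then have "h$?T = (h$?T)$?T" by (simp add: cassoc)
  then show ?thesis by (simp add: h)
 qed
 then show ?thesis unfolding hbraid_def using natural append by simp
qed

lemma underlying_layer_left: "[|a : Ob; warr f; dom f ~= []; cod f ~= []|] ==>
  underlying {[a];f;} = Id C a @@ underlying f"
 by (simp add: layer_def underlying_tensor word_join_single word_obj_Cons)

lemma word_join_pair [simp]: "[|a : Ob; b : Ob; c : Ob|] ==> word_join C [a, b] [c] = Assoc C a b c"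
 by simp

lemma underlying_layer_right: "[|c : Ob; warr f; dom f = [a, b]; cod f = [a', b']|] ==>
  underlying {;f;[c]} = Assoc C a' b' c ** (underlying f @@ Id C c) ** inv_arr C (Assoc C a b c)"
 using warr_word[of f] by (simp add: layer_def underlying_tensor)

lemma underlying_layer_single: "[|c : Ob; warr f; dom f = [a]; cod f = [a']|] ==>
  underlying {;f;[c]} = underlying f @@ Id C c"
 using warr_word[of f] by (simp add: layer_def underlying_tensor)

lemma underlying_layer_fuse: "[|a : Ob; b : Ob; c : Ob|] ==>
  underlying {;fuse [a, b];[c]} = inv_arr C (Assoc C a b c)"
 by (simp add: layer_def underlying_tensor)

definition word_half where
 "word_half X l = extend [X] (%A. wHalf l A X)"

lemma wHalf_simps [simp]: "dom (wHalf l A X) = [A, X]" "cod (wHalf l A X) = [X, A]"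
 "underlying (wHalf l A X) = l A" "[|A : Ob; X : Ob; l A : Hom C (A \<odot> X) (X \<odot> A)|] ==> warr (wHalf l A X)"
 by (simp_all add: wHalf_def warrI)

lemma hexagon_word:
 assumes [simp]: "X : Ob" "a : Ob" "b : Ob"
  and l: "!!a. a : Ob ==> l a : Hom C (a \<odot> X) (X \<odot> a)"
 shows "wHalf l (a \<odot> b) X${;fuse [a, b];[X]}
   = {[X];fuse [a, b];}${;wHalf l a X;[b]}${[a];wHalf l b X;}
  \<longleftrightarrow> l (a \<odot> b) = Assoc C X a b ** (l a @@ Id C b) ** inv_arr C (Assoc C a X b)
     ** (Id C a @@ l b) ** Assoc C a b X" (is "?L = ?R \<longleftrightarrow> _ = ?r ** _ ** _ ** _ ** _")
proof -
 have [simp]: "l c : Arr C" "Dom C (l c) = c \<odot> X" "Cod C (l c) = X \<odot> c" if "c : Ob" for c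
  using l[OF that] by (simp_all add: Hom_def)
 let ?s = "Assoc C X a b ** (l a @@ Id C b) ** inv_arr C (Assoc C a X b) ** (Id C a @@ l b)"
 have "?L = ?R \<longleftrightarrow> underlying ?L = underlying ?R"
  by (rule iffI, rule arg_cong[where f = underlying], assumption, rule word_arr_eqI) simp_all
 also have "underlying ?L = l (a \<odot> b) ** inv_arr C (Assoc C a b X)"
  by (simp add: underlying_layer_fuse)
 also have "underlying ?R = ?s"
  using l by (simp add: underlying_layer_left underlying_layer_right Comp_Comp)
 also have "l (a \<odot> b) ** inv_arr C (Assoc C a b X) = ?s \<longleftrightarrow> l (a \<odot> b) = ?s ** Assoc C a b X"
 proof
  assume "l (a \<odot> b) ** inv_arr C (Assoc C a b X) = ?s"
  then have "(l (a \<odot> b) ** inv_arr C (Assoc C a b X)) ** Assoc C a b X = ?s ** Assoc C a b X" by simp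
  then show "l (a \<odot> b) = ?s ** Assoc C a b X" by (simp add: Comp_Comp)
 next
  assume "l (a \<odot> b) = ?s ** Assoc C a b X"
  then show "l (a \<odot> b) ** inv_arr C (Assoc C a b X) = ?s" by (simp add: Comp_Comp)
 qed
 finally show ?thesis by (simp add: Comp_Comp)
qed

lemma half_braid_word_half:
 assumes "half_braiding C X l"
 shows "hbraid [X] (word_half X l)" "A : Ob ==> word_half X l [A] = wHalf l A X"
proof -
 have X [simp]: "X : Ob" and l: "!!A. A : Ob ==> l A : Hom C (A \<odot> X) (X \<odot> A)"
  and iso: "!!A. A : Ob ==> is_iso C (l A)"
  and nat: "!!A B f. f : Hom C A B ==> (Id C X @@ f) ** l A = l B ** (f @@ Id C X)"
  and mult: "!!A B. [|A : Ob; B : Ob|] ==> l (A \<odot> B) = Assoc C X A B ** (l A @@ Id C B)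
    ** inv_arr C (Assoc C A X B) ** (Id C A @@ l B) ** Assoc C A B X"
  using assms unfolding half_braiding_def by auto
 have [simp]: "warr (wHalf l A X)" if "A : Ob" for A using l that by simp
 show "hbraid [X] (word_half X l)"
  unfolding word_half_def
 proof (rule half_braid_extend)
  show "{[X];f;}$wHalf l a X = wHalf l b X${;f;[X]}"
   if f: "warr f" "dom f = [a]" "cod f = [b]" for f a b
  proof -
   have "underlying f : Hom C a b" using f by (simp add: Hom_def)
   from nat[OF this] show ?thesis
    using f by (intro word_arr_eqI) (simp_all add: underlying_layer_left underlying_layer_single)
  qed
  show "wHalf l (a \<odot> b) X${;fuse [a, b];[X]}
   = {[X];fuse [a, b];}${;wHalf l a X;[b]}${[a];wHalf l b X;}"
   if "a : Ob" "b : Ob" for a b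
   using hexagon_word[of X a b l] mult l that by simp
  let ?g = "([X, Unit C], inv_arr C (l (Unit C)), [Unit C, X])"
  have i: "is_iso C (l (Unit C))" "Dom C (l (Unit C)) = Unit C \<odot> X" "Cod C (l (Unit C)) = X \<odot> Unit C"
   using iso[of "Unit C"] l[of "Unit C"] by (simp_all add: Hom_def)
  show "warr ?g" by (rule warr_intro) (use i in simp_all)
  show "?g$wHalf l (Unit C) X = idw (Unit C # [X])"
   by (rule word_arr_eqI) (use i in simp_all)
 qed simp_all
 show "word_half X l [A] = wHalf l A X" if "A : Ob"
  unfolding word_half_def using that by (intro extend_single) simp_all
qed

lemma half_braiding_of_half_braid:
 assumes r: "hbraid [X] ro" and iso: "!!A. A : Ob ==> is_iso C (underlying (ro [A]))"
  and l: "l = (\<lambda>A\<in>Ob. underlying (ro [A]))"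
 shows "half_braiding C X l"
proof -
 have X [simp]: "X : Ob" using hb_simps(1)[OF r] by simp
 note [simp] = hb_simps(2-5)[OF r]
 have lr: "wHalf l A X = ro [A]" if "A : Ob" for A
  using that by (intro word_arr_eqI) (simp_all add: l)
 have lA: "l A = underlying (ro [A])" if "A : Ob" for A using that by (simp add: l)
 have hom: "l A : Hom C (A \<odot> X) (X \<odot> A)" if "A : Ob" for A
  using that by (simp add: lA Hom_def)
 have nat: "(Id C X @@ f) ** l A = l B ** (f @@ Id C X)" if f: "f : Hom C A B" for A B f
 proof -
  have [simp]: "A : Ob" "B : Ob" "warr ([A], f, [B])" using f by (auto simp: Hom_def intro: warr_intro)
  have "{[X];([A], f, [B]);}$ro [A] = ro [B]${;([A], f, [B]);[X]}"
   by (rule half_braid_nat[OF r]) simp_all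
  then have "underlying ({[X];([A], f, [B]);}$ro [A]) = underlying (ro [B]${;([A], f, [B]);[X]})"
   by simp
  then show ?thesis by (simp add: underlying_layer_left underlying_layer_single lA)
 qed
 have mult: "l (a \<odot> b) = Assoc C X a b ** (l a @@ Id C b) ** inv_arr C (Assoc C a X b)
     ** (Id C a @@ l b) ** Assoc C a b X" if [simp]: "a : Ob" "b : Ob" for a b
 proof -
  have "ro [a \<odot> b]${;fuse [a, b];[X]} = {[X];fuse [a, b];}$ro ([a] @ [b])"
   using half_braid_nat[OF r, of "fuse [a, b]" "[a, b]" "[a \<odot> b]"] by simp
  also have "ro ([a] @ [b]) = {;ro [a];[b]}${[a];ro [b];}"
   by (rule half_braid_append[OF r]) simp_all
  finally show ?thesis using hexagon_word[of X a b l] hom by (simp add: lr)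
 qed
 show ?thesis
  unfolding half_braiding_def using hom nat mult iso lA by (auto simp: l)
qed

end

context monoidal_category
begin

definition intw where
 "intw f sg ta \<longleftrightarrow> warr f & (\<forall>a\<in>Ob. {;f;[a]}$sg [a] = ta [a]${[a];f;})"

lemma intertwiner_word:
 assumes f: "intw f sg ta" and s: "hbraid (dom f) sg" and t: "hbraid (cod f) ta"
  and [simp]: "word A"
 shows "{;f;A}$sg A = ta A${A;f;}"
proof -
 let ?M = "dom f" and ?N = "cod f" and ?a = "wobj A"
 note [simp] = hb_simps(1,3-5)[OF s] hb_simps(1,3-5)[OF t]
 have [simp]: "warr f" using f by (simp add: intw_def)
 have E: "{;f;[?a]}$sg [?a] = ta [?a]${[?a];f;}"
  using f by (simp add: intw_def)
 have "{;f;A}$sg A = {;f;A}${?M;unfuse A;}${?M;fuse A;}$sg A"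
  by (simp add: layer_cancel[OF unfuse_fuse])
 also have "... = {?N;unfuse A;}${;f;[?a]}$sg [?a]${;fuse A;?M}"
  using half_braid_nat[OF s, of "fuse A" A "[?a]"] by (simp add: diagram)
 also have "... = {?N;unfuse A;}$({;f;[?a]}$sg [?a])${;fuse A;?M}"
  by (simp add: cassoc)
 also have "... = ({?N;unfuse A;}$ta [?a])${[?a];f;}${;fuse A;?M}"
  unfolding E by (simp add: cassoc)
 also have "... = ta A$({;unfuse A;?N}${[?a];f;})${;fuse A;?M}"
  using half_braid_nat[OF t, of "unfuse A" "[?a]" A] by (simp add: cassoc)
 also have "{;unfuse A;?N}${[?a];f;} = {A;f;}${;unfuse A;?M}"
  by (simp add: diagram)
 also have "ta A$({A;f;}${;unfuse A;?M})${;fuse A;?M} = ta A${A;f;}"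
  by (simp add: cassoc layer_cancel[OF unfuse_fuse])
 finally show ?thesis .
qed

lemma intertwiner_comp:
 assumes "intw f sg ta" "intw g ta \<upsilon>" "dom g = cod f"
  "hbraid (dom f) sg" "hbraid (cod f) ta" "hbraid (cod g) \<upsilon>"
 shows "intw (g$f) sg \<upsilon>"
 unfolding intw_def
proof (intro conjI ballI)
 have [simp]: "warr f" "warr g" using assms by (simp_all add: intw_def)
 note [simp] = hb_simps(3-5)[OF assms(4)] hb_simps(3-5)[OF assms(5)] hb_simps(3-5)[OF assms(6)]
 show "warr (g$f)" using assms(3) by simp
 fix a assume [simp]: "a : Ob"
 have "{;g$f;[a]}$sg [a] = {;g;[a]}$({;f;[a]}$sg [a])"
  using assms(3) by (simp add: cassoc)
 also have "... = ({;g;[a]}$ta [a])${[a];f;}"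
  using assms(1,3) by (simp add: intw_def cassoc)
 also have "... = \<upsilon> [a]${[a];g$f;}"
  using assms(2,3) by (simp add: intw_def cassoc)
 finally show "{;g$f;[a]}$sg [a] = \<upsilon> [a]${[a];g$f;}" .
qed

lemma intertwiner_tensor:
 assumes f: "intw f sg sg'" and g: "intw g ta ta'"
  and hb: "hbraid (dom f) sg" "hbraid (cod f) sg'" "hbraid (dom g) ta" "hbraid (cod g) ta'"
 shows "intw (f ## g) (hprod sg (dom f) ta (dom g)) (hprod sg' (cod f) ta' (cod g))"
 unfolding intw_def
proof (intro conjI ballI)
 have [simp]: "warr f" "warr g" using f g by (simp_all add: intw_def)
 note [simp] = hb_simps(3-5)[OF hb(1)] hb_simps(3-5)[OF hb(2)] hb_simps(3-5)[OF hb(3)] hb_simps(3-5)[OF hb(4)]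
 let ?X = "dom f" and ?X' = "cod f" and ?Y = "dom g" and ?Y' = "cod g"
 show "warr (f ## g)" by simp
 fix a assume a [simp]: "a : Ob"
 have F: "{;f;[a]}$sg [a] = sg' [a]${[a];f;}" and G: "{;g;[a]}$ta [a] = ta' [a]${[a];g;}"
  using f g by (simp_all add: intw_def)
 have "{;f ## g;[a]}$hprod sg ?X ta ?Y [a]
   = {?X';ta' [a];}${?X' @ [a];g;}${;f;[a] @ ?Y}${;sg [a];?Y}"
  by (rule rewrite[OF G, of _ "idw (?X' @ ?Y' @ [a])" ?X' "[]" "{;f;[a] @ ?Y}${;sg [a];?Y}"])
   (simp_all add: hprod_def tensor_layers diagram)
 also have "... = {?X';ta' [a];}${?X' @ [a];g;}${;sg' [a];?Y}${[a];f;?Y}"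
  by (rule rewrite[OF F, of _ "{?X';ta' [a];}${?X' @ [a];g;}" "[]" ?Y "idw (a # ?X @ ?Y)"]) (simp_all add: cassoc)
 also have "... = hprod sg' ?X' ta' ?Y' [a]${[a];f ## g;}"
  by (simp add: hprod_def tensor_layers diagram)
 finally show "{;f ## g;[a]}$hprod sg ?X ta ?Y [a] = hprod sg' ?X' ta' ?Y' [a]${[a];f ## g;}" .
qed

lemma intertwiner_id: "hbraid M sg ==> intw (idw M) sg sg"
 by (simp add: intw_def)

text \<open>The idempotent commutes with \<open>ro\<close>, so in a product of two compressions the inner one may be moved away.\<close>

lemma half_braid_retract:
 assumes r: "hbraid M ro" and ip [simp]: "warr i" "warr p" "cod i = M" "dom p = M" "dom i = N" "cod p = N"
  and pi: "p$i = idw N" and Q: "intw (i$p) ro ro"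
 shows "hbraid N (%A. {;p;A}$ro A${A;i;})"
  "intw i (%A. {;p;A}$ro A${A;i;}) ro"
  "intw p ro (%A. {;p;A}$ro A${A;i;})"
proof -
 let ?r = "%A. {;p;A}$ro A${A;i;}"
 note [simp] = hb_simps[OF r]
 have [simp]: "word N" using warr_word(1)[OF ip(1)] by simp
 have q: "{;i;A}${;p;A}$ro A = ro A${A;i;}${A;p;}" if "word A" for A
  using intertwiner_word[OF Q, of A] r that by (simp add: cassoc)
 have pin: "[|warr f; cod f = x @ N @ y|] ==> {x;p;y}${x;i;y}$f = f"
  "{x;p;y}${x;i;y} = idw (x @ N @ y)" if "word x" "word y" for x y f
  using layer_cancel[OF pi, of x y] that by simp_all
 have i: "{;i;A}$?r A = ro A${A;i;}" if [simp]: "word A" for A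
 proof -
  have "{;i;A}$?r A = ({;i;A}${;p;A}$ro A)${A;i;}"
   by (simp add: cassoc)
  also have "... = ro A${A;i;}" unfolding q[OF that] by (simp add: cassoc pin)
  finally show ?thesis .
 qed
 have p: "{;p;A}$ro A = ?r A${A;p;}" if [simp]: "word A" for A
 proof -
  have "?r A${A;p;} = {;p;A}$(ro A${A;i;}${A;p;})"
   by (simp add: cassoc)
  also have "... = {;p;A}$ro A" unfolding q[OF that, symmetric] by (simp add: cassoc pin)
  finally show ?thesis by simp
 qed
 show "intw i ?r ro" "intw p ro ?r"
  unfolding intw_def using i p by simp_all
 show "hbraid N ?r"
  unfolding hbraid_def
 proof (intro conjI allI impI)
  fix f assume f [simp]: "warr f"
  let ?a = "dom f" and ?b = "cod f"
  have "{N;f;}${;p;?a}$ro ?a${?a;i;}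
   = {;p;?b}$ro ?b${;f;M}${?a;i;}"
   by (rule rewrite[OF half_braid_nat[OF r f refl refl], of _ "{;p;?b}" "[]" "[]" "{?a;i;}"])
    (simp_all add: diagram layer_nil)
  then show "{N;f;}${;p;?a}$ro ?a${?a;i;}
   = ({;p;?b}$ro ?b${?b;i;})${;f;N}"
   by (simp add: diagram)
 next
  fix A B assume "word A & word B"
  then have [simp]: "word A" "word B" by simp_all
  have "{;?r A;B}${A;?r B;}
    = {;p;A @ B}${;ro A;B}${A;{;i;B}$?r B;}"
   by (simp add: cassoc)
  also have "... = {;p;A @ B}$ro (A @ B)${A @ B;i;}"
   by (subst i) (simp_all add: cassoc half_braid_append[OF r])
  finally show "{;p;A @ B}$ro (A @ B)${A @ B;i;}
   = {;{;p;A}$ro A${A;i;};B}${A;{;p;B}$ro B${B;i;};}"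
   by simp
 qed (use pi in "simp_all add: layer_nil")
qed

lemma half_braid_conjugate:
 assumes r: "hbraid M ro" and ip [simp]: "warr i" "warr p" "cod i = M" "dom p = M" "dom i = N" "cod p = N"
  and pi: "p$i = idw N" "i$p = idw M"
 shows "hbraid N (%A. {;p;A}$ro A${A;i;})"
 using half_braid_retract(1)[OF r, of i p N] assms intertwiner_id[OF r] by simp

text \<open>The properties shared by the braiding and the inverse braiding, so that each argument is made once for both.\<close>

definition crossing where
 "crossing e \<longleftrightarrow> (\<forall>B. word B \<longrightarrow> hbraid B (%A. e A B)) &
   (\<forall>A g. word A & warr g \<longrightarrow> {;g;A}$e A (dom g) = e A (cod g)${A;g;}) &
   (\<forall>A B B'. word A & word B & word B' \<longrightarrow> e A (B @ B') = {B;e A B';}${;e A B;B'}) &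
   (\<forall>A. word A \<longrightarrow> e A [] = idw A)"

lemma crossing_half_braid: "[|crossing e; word B|] ==> hbraid B (%A. e A B)"
 by (simp add: crossing_def)

lemma crossing_simps [simp]:
 assumes "crossing e" "word A" "word B"
 shows "warr (e A B)" "dom (e A B) = A @ B" "cod (e A B) = B @ A"
 using hb_simps[OF crossing_half_braid[OF assms(1,3)]] assms(2) by auto

lemma crossing_Nil [simp]: "[|crossing e; word A|] ==> e A [] = idw A" "[|crossing e; word A|] ==> e [] A = idw A"
 using hb_simps(2)[OF crossing_half_braid] by (auto simp: crossing_def)

lemma crossing_nat1: "[|crossing e; word B; warr f; dom f = A; cod f = A'|]
  ==> {B;f;}$e A B = e A' B${;f;B}"
 using half_braid_nat[OF crossing_half_braid] by blast

lemma crossing_nat2: "[|crossing e; word A; warr g; dom g = B; cod g = B'|]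
  ==> {;g;A}$e A B = e A B'${A;g;}"
 unfolding crossing_def by blast

lemma crossing_append1: "[|crossing e; word A; word A'; word B|] ==> e (A @ A') B = {;e A B;A'}${A;e A' B;}"
 using half_braid_append[OF crossing_half_braid] by blast

lemma crossing_append2: "[|crossing e; word A; word B; word B'|] ==> e A (B @ B') = {B;e A B';}${;e A B;B'}"
 unfolding crossing_def by blast

text \<open>Of the two variables of a crossing, one is inherited from the inverse crossing.\<close>

lemma crossing_pairI:
 assumes e: "!!B. word B ==> hbraid B (%A. e A B)" and d: "!!B. word B ==> hbraid B (%A. d A B)"
  and ed: "!!A B. [|word A; word B|] ==> e A B$d B A = idw (B @ A)"
  and de: "!!A B. [|word A; word B|] ==> d A B$e B A = idw (B @ A)"
 shows "crossing e"
proof -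
 have [simp]: "warr (e A B)" "dom (e A B) = A @ B" "cod (e A B) = B @ A"
  "warr (d A B)" "dom (d A B) = A @ B" "cod (d A B) = B @ A" if "word A" "word B" for A B
  using hb_simps[OF e[OF that(2)]] hb_simps[OF d[OF that(2)]] that(1) by auto
 have ed': "{p;e A B;q}${p;d B A;q}$f = f"
  if "word A" "word B" "word p" "word q" "warr f" "cod f = p @ B @ A @ q" for A B p q f
  using layer_cancel(2)[OF ed] that by simp
 have ed'': "e A B$d B A$f = f"
  if "word A" "word B" "warr f" "cod f = B @ A" for A B f
  using ed'[of A B "[]" "[]" f] that by (simp add: layer_nil)
 have nat: "{;g;A}$e A (dom g) = e A (cod g)${A;g;}" if [simp]: "word A" "warr g" for A g
 proof -
  let ?b = "dom g" and ?b' = "cod g"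
  have "{;g;A}$e A ?b = e A ?b'$(d ?b' A${;g;A})$e A ?b"
   by (simp add: cassoc ed'')
  also have "d ?b' A${;g;A} = {A;g;}$d ?b A"
   using half_braid_nat[OF d[OF that(1)] that(2) refl refl] by simp
  finally show ?thesis by (simp add: cassoc de)
 qed
 have app: "e A (B @ B') = {B;e A B';}${;e A B;B'}" if [simp]: "word A" "word B" "word B'" for A B B'
 proof -
  have "e A (B @ B') = ({B;e A B';}${;e A B;B'})$({;d B A;B'}${B;d B' A;})$e A (B @ B')"
   by (simp add: cassoc ed')
  also have "{;d B A;B'}${B;d B' A;} = d (B @ B') A"
   by (rule half_braid_append[OF d, symmetric]) simp_all
  finally show ?thesis by (simp add: cassoc de)
 qed
 have "e A [] = idw A" if [simp]: "word A" for A
  using ed[of A "[]"] hb_simps(2)[OF d[of A]] by simp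
 then show ?thesis unfolding crossing_def using e nat app by blast
qed

text \<open>
 \<open>sg\<close> and \<open>ta\<close> satisfy a Yang-Baxter relation in which the two moving strands cross by \<open>e'\<close> before
 and by \<open>e\<close> after having passed \<open>M\<close>.  For \<open>e\<close> the braiding and \<open>e'\<close> the inverse braiding this is the
 compatibility condition of an object of the elliptic center.
\<close>

definition crosses where
 "crosses e e' M sg ta \<longleftrightarrow> (\<forall>a\<in>Ob. \<forall>b\<in>Ob.
   {M;e [a] [b];}${;sg [a];[b]}${[a];ta [b];}
   = {;ta [b];[a]}${[b];sg [a];}${;e' [a] [b];M})"

lemma crosses_prod:
 assumes X: "crosses m e' X sg ta" "hbraid X sg" "hbraid X ta"
  and Y: "crosses e m Y sg' ta'" "hbraid Y sg'" "hbraid Y ta'"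
  and e: "crossing e" "crossing e'" "crossing m"
 shows "crosses e e' (X @ Y) (hprod sg X sg' Y) (hprod ta X ta' Y)"
 unfolding crosses_def
proof (intro ballI)
 fix a b assume ab [simp]: "a : Ob" "b : Ob"
 note [simp] = hb_simps(1,3-5)[OF X(2)] hb_simps(3-5)[OF X(3)] hb_simps(1,3-5)[OF Y(2)] hb_simps(3-5)[OF Y(3)] e
 have R: "{X;m [a] [b];}${;sg [a];[b]}${[a];ta [b];}
   = {;ta [b];[a]}${[b];sg [a];}${;e' [a] [b];X}"
  "{Y;e [a] [b];}${;sg' [a];[b]}${[a];ta' [b];}
   = {;ta' [b];[a]}${[b];sg' [a];}${;m [a] [b];Y}"
  using X(1) Y(1) ab by (auto simp: crosses_def)
 have "{X @ Y;e [a] [b];}${;hprod sg X sg' Y [a];[b]}${[a];hprod ta X ta' Y [b];}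
  = {X;ta' [b];[a]}${X @ [b];sg' [a];}${X;m [a] [b];Y}${;sg [a];b # Y}${[a];ta [b];Y}"
  by (rule rewrite[OF R(2), of _ "idw (X @ Y @ [b, a])" X "[]" "{;sg [a];b # Y}${[a];ta [b];Y}"])
   (simp_all add: hprod_def diagram)
 also have "... = {X;ta' [b];[a]}${X @ [b];sg' [a];}${;ta [b];a # Y}${[b];sg [a];Y}${;e' [a] [b];X @ Y}"
  by (rule rewrite[OF R(1), of _ "{X;ta' [b];[a]}${X @ [b];sg' [a];}" "[]" Y "idw (a # b # X @ Y)"])
   (simp_all add: cassoc)
 also have "... = {;hprod ta X ta' Y [b];[a]}${[b];hprod sg X sg' Y [a];}${;e' [a] [b];X @ Y}"
  by (simp add: hprod_def diagram)
 finally show "{X @ Y;e [a] [b];}${;hprod sg X sg' Y [a];[b]}${[a];hprod ta X ta' Y [b];}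
  = {;hprod ta X ta' Y [b];[a]}${[b];hprod sg X sg' Y [a];}${;e' [a] [b];X @ Y}" .
qed

lemma crosses_swap:
 assumes r: "crosses e e' M sg ta" "hbraid M sg" "hbraid M ta" and e: "crossing e" "crossing e'" "crossing d" "crossing d'"
  and inv: "!!A B. [|word A; word B|] ==> d A B$e B A = idw (B @ A)"
   "!!A B. [|word A; word B|] ==> e' A B$d' B A = idw (B @ A)"
 shows "crosses d d' M ta sg"
 unfolding crosses_def
proof (intro ballI)
 fix a b assume ab [simp]: "a : Ob" "b : Ob"
 note [simp] = hb_simps(1,3-5)[OF r(2)] hb_simps(3-5)[OF r(3)] e
 have inv': "{p;d [a] [b];q}${p;e [b] [a];q}$f = f"
  if "word p" "word q" "warr f" "cod f = p @ b # a # q" for p q f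
  using layer_cancel(2)[OF inv(1)[of "[a]" "[b]"], of p q f] that by simp
 have inv'': "{;e' [b] [a];M}${;d' [a] [b];M} = idw ([a, b] @ M)"
  using layer_cancel(1)[OF inv(2)[of "[b]" "[a]"], of "[]" M] by simp
 have R: "{M;e [b] [a];}${;sg [b];[a]}${[b];ta [a];}
   = {;ta [a];[b]}${[a];sg [b];}${;e' [b] [a];M}"
  using r(1) by (auto simp: crosses_def)
 have "{M;d [a] [b];}${;ta [a];[b]}${[a];sg [b];}
  = {M;d [a] [b];}$({;ta [a];[b]}${[a];sg [b];}${;e' [b] [a];M})${;d' [a] [b];M}"
  by (simp add: cassoc inv'')
 also have "... = {;sg [b];[a]}${[b];ta [a];}${;d' [a] [b];M}"
  unfolding R[symmetric] by (simp add: cassoc inv')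
 finally show "{M;d [a] [b];}${;ta [a];[b]}${[a];sg [b];}
  = {;sg [b];[a]}${[b];ta [a];}${;d' [a] [b];M}" .
qed

lemma crosses_self:
 assumes r: "hbraid M ro" and e [simp]: "crossing e"
 shows "crosses e e M ro ro"
 unfolding crosses_def
proof (intro ballI)
 fix a b assume ab [simp]: "a : Ob" "b : Ob"
 note [simp] = hb_simps(1,3-5)[OF r]
 show "{M;e [a] [b];}${;ro [a];[b]}${[a];ro [b];}
  = {;ro [b];[a]}${[b];ro [a];}${;e [a] [b];M}"
  using half_braid_nat[OF r, of "e [a] [b]" "[a] @ [b]" "[b] @ [a]"] half_braid_append[OF r, of "[a]" "[b]"] half_braid_append[OF r, of "[b]" "[a]"]
  by (simp add: cassoc)
qed

lemma crosses_crossing: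
 assumes r: "hbraid M ta" and e [simp]: "crossing e"
 shows "crosses e e M (%A. e A M) ta"
 unfolding crosses_def
proof (intro ballI)
 fix a b assume ab [simp]: "a : Ob" "b : Ob"
 note [simp] = hb_simps(1,3-5)[OF r]
 show "{M;e [a] [b];}${;e [a] M;[b]}${[a];ta [b];}
  = {;ta [b];[a]}${[b];e [a] M;}${;e [a] [b];M}"
  using crossing_nat2[OF e, of "[a]" "ta [b]" "[b] @ M" "M @ [b]"] crossing_append2[OF e, of "[a]" M "[b]"] crossing_append2[OF e, of "[a]" "[b]" M]
  by (simp add: cassoc)
qed

end

section \<open>Braiding and duals on words\<close>

context ribbon_category
begin

abbreviation Du where "Du == Dual C"
abbreviation evR where "evR == wEvR C"
abbreviation coev where "coev == wCoev C"
abbreviation coevR where "coevR == wCoevR C"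

lemma Braid_simps [simp]:
 assumes "X : Ob" "Y : Ob"
 shows "Braid C X Y : Arr C" "Dom C (Braid C X Y) = X \<odot> Y" "Cod C (Braid C X Y) = Y \<odot> X" "is_iso C (Braid C X Y)"
 using Braid_Hom[OF assms] Braid_iso[OF assms] by (auto simp: Hom_def)

lemma Dual_Obj [simp]: "X : Ob ==> Du X : Ob"
 by (rule Dual_closed)

lemma half_braiding_Braid:
 assumes [simp]: "X : Ob"
 shows "half_braiding C X (\<lambda>A\<in>Ob. Braid C A X)"
 unfolding half_braiding_def
proof (intro conjI allI ballI)
 fix A B f assume f: "f : Hom C A B"
 then have "A : Ob" "B : Ob" by (auto simp: Hom_def)
 then show "(Id C X @@ f) ** restrict (%A. Braid C A X) (Ob) A = restrict (%A. Braid C A X) (Ob) B ** (f @@ Id C X)"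
  using Braid_natural[OF f, of "Id C X" X X] by (simp add: Hom_def)
qed (simp_all add: hexagon_left Braid_Hom)

lemma half_braiding_Braid_inv:
 assumes [simp]: "X : Ob"
 shows "half_braiding C X (\<lambda>A\<in>Ob. inv_arr C (Braid C X A))"
 unfolding half_braiding_def
proof (intro conjI allI ballI)
 fix A B f assume f: "f : Hom C A B"
 then have [simp]: "A : Ob" "B : Ob" "f : Arr C" "Dom C f = A" "Cod C f = B" by (auto simp: Hom_def)
 have n: "Braid C X B ** (Id C X @@ f) = (f @@ Id C X) ** Braid C X A"
  using Braid_natural[OF _ f, of "Id C X" X X] by (simp add: Hom_def)
 have "Braid C X B ** ((Id C X @@ f) ** inv_arr C (Braid C X A)) = Braid C X B ** (inv_arr C (Braid C X B) ** (f @@ Id C X))"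
  using n by (simp add: Comp_Comp[symmetric]) (simp add: Comp_Comp)
 then have "(Id C X @@ f) ** inv_arr C (Braid C X A) = inv_arr C (Braid C X B) ** (f @@ Id C X)"
  by (rule iso_cancel_left[rotated 5]) simp_all
 then show "(Id C X @@ f) ** restrict (%A. inv_arr C (Braid C X A)) (Ob) A = restrict (%A. inv_arr C (Braid C X A)) (Ob) B ** (f @@ Id C X)"
  by simp
next
 fix A B assume [simp]: "A : Ob" "B : Ob"
 have "inv_arr C (Assoc C A B X ** Braid C X (A \<odot> B) ** Assoc C X A B)
   = inv_arr C ((Id C A @@ Braid C X B) ** Assoc C A X B ** (Braid C X A @@ Id C B))"
  by (simp only: hexagon_right[of X A B] assms \<open>A : Ob\<close> \<open>B : Ob\<close>)
 then have "inv_arr C (Assoc C X A B) ** inv_arr C (Braid C X (A \<odot> B)) ** inv_arr C (Assoc C A B X)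
   = (inv_arr C (Braid C X A) @@ Id C B) ** inv_arr C (Assoc C A X B) ** (Id C A @@ inv_arr C (Braid C X B))"
  by (simp add: inv_of_Comp inv_TensA Comp_Comp)
 then have "Assoc C X A B ** (inv_arr C (Assoc C X A B) ** inv_arr C (Braid C X (A \<odot> B)) ** inv_arr C (Assoc C A B X)) ** Assoc C A B X
   = Assoc C X A B ** ((inv_arr C (Braid C X A) @@ Id C B) ** inv_arr C (Assoc C A X B) ** (Id C A @@ inv_arr C (Braid C X B))) ** Assoc C A B X"
  by simp
 then show "restrict (%A. inv_arr C (Braid C X A)) (Ob) (A \<odot> B) = Assoc C X A B
   ** (restrict (%A. inv_arr C (Braid C X A)) (Ob) A @@ Id C B) ** inv_arr C (Assoc C A X B)
   ** (Id C A @@ restrict (%A. inv_arr C (Braid C X A)) (Ob) B) ** Assoc C A B X"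
  by (simp add: Comp_Comp)
qed (simp_all add: Hom_def)

definition braid where
 "braid A B = {;unfuse B;A}
  $word_half (wobj B) (\<lambda>A\<in>Ob. Braid C A (wobj B)) A${A;fuse B;}"

definition braid' where
 "braid' A B = {;unfuse B;A}
  $word_half (wobj B) (\<lambda>A\<in>Ob. inv_arr C (Braid C (wobj B) A)) A${A;fuse B;}"

lemma wBraid_simps [simp]: "dom (wBraid C X Y) = [X, Y]" "cod (wBraid C X Y) = [Y, X]"
  "underlying (wBraid C X Y) = Braid C X Y" "[|X : Ob; Y : Ob|] ==> warr (wBraid C X Y)"
 and wBraidInv_simps [simp]: "dom (wBraidInv C X Y) = [Y, X]" "cod (wBraidInv C X Y) = [X, Y]"
  "underlying (wBraidInv C X Y) = inv_arr C (Braid C X Y)" "[|X : Ob; Y : Ob|] ==> warr (wBraidInv C X Y)"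
 by (simp_all add: wBraid_def wBraidInv_def warr_intro)

lemma wBraid_inverse:
 assumes "X : Ob" "Y : Ob"
 shows "wBraid C X Y$wBraidInv C X Y = idw [Y, X]" "wBraidInv C X Y$wBraid C X Y = idw [X, Y]"
 using assms by (auto intro!: word_arr_eqI)

lemma half_braid_braid: "word B ==> hbraid B (%A. braid A B)"
 unfolding braid_def
 by (rule half_braid_conjugate[OF half_braid_word_half(1)[OF half_braiding_Braid]])
  (simp_all add: fuse_unfuse unfuse_fuse)

lemma half_braid_braid_inv: "word B ==> hbraid B (%A. braid' A B)"
 unfolding braid'_def
 by (rule half_braid_conjugate[OF half_braid_word_half(1)[OF half_braiding_Braid_inv]])
  (simp_all add: fuse_unfuse unfuse_fuse)

lemma braid_eq:
 assumes [simp]: "word A" "word B"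
 shows "braid A B = {;unfuse B;A}${[wobj B];unfuse A;}
 $wBraid C (wobj A) (wobj B)${;fuse A;[wobj B]}${A;fuse B;}"
proof -
 have "wHalf (\<lambda>A\<in>Ob. Braid C A (wobj B)) (wobj A) (wobj B) = wBraid C (wobj A) (wobj B)"
  by (simp add: wHalf_def wBraid_def)
 then show ?thesis by (simp add: braid_def word_half_def extend_def cassoc)
qed

lemma braid_inv_eq:
 assumes [simp]: "word A" "word B"
 shows "braid' A B = {;unfuse B;A}${[wobj B];unfuse A;}
 $wBraidInv C (wobj B) (wobj A)${;fuse A;[wobj B]}${A;fuse B;}"
proof -
 have "wHalf (\<lambda>A\<in>Ob. inv_arr C (Braid C (wobj B) A)) (wobj A) (wobj B) = wBraidInv C (wobj B) (wobj A)"
  by (simp add: wHalf_def wBraidInv_def)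
 then show ?thesis by (simp add: braid'_def word_half_def extend_def cassoc)
qed

lemma braid_single: "[|a : Ob; b : Ob|] ==> braid [a] [b] = wBraid C a b"
 and braid_inv_single: "[|a : Ob; b : Ob|] ==> braid' [a] [b] = wBraidInv C b a"
 by (simp_all add: braid_eq braid_inv_eq)

lemma fuse_pair_cancel:
 assumes [simp]: "word A" "word B"
 shows "{;unfuse A;B}${[wobj A];unfuse B;}${;fuse A;[wobj B]}${A;fuse B;} = idw (A @ B)"
  "[|warr f; cod f = [wobj A, wobj B]|] ==>
   {;fuse A;[wobj B]}${A;fuse B;}${;unfuse A;B}${[wobj A];unfuse B;}$f = f"
 by (simp_all add: diagram layer_cancel[OF fuse_unfuse] layer_cancel[OF unfuse_fuse])

lemma braid_inverse:
 assumes [simp]: "word A" "word B"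
 shows "braid A B$braid' B A = idw (B @ A)" "braid' A B$braid B A = idw (B @ A)"
proof -
 let ?a = "wobj A" and ?b = "wobj B"
 have c: "wBraid C X Y$wBraidInv C X Y$f = f"
   "wBraidInv C Y X$wBraid C Y X$f = f"
  if "X : Ob" "Y : Ob" "warr f" "cod f = [Y, X]" for X Y f
  using that cassoc[of f "wBraidInv C X Y" "wBraid C X Y", symmetric]
   cassoc[of f "wBraid C Y X" "wBraidInv C Y X", symmetric] by (simp_all add: wBraid_inverse)
 show "braid A B$braid' B A = idw (B @ A)" "braid' A B$braid B A = idw (B @ A)"
  by (simp_all add: braid_eq braid_inv_eq cassoc fuse_pair_cancel c)
qed

lemma crossing_braid [simp]: "crossing braid" and crossing_braid_inv [simp]: "crossing braid'"
 by (rule crossing_pairI[OF half_braid_braid half_braid_braid_inv braid_inverse]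
   crossing_pairI[OF half_braid_braid_inv half_braid_braid braid_inverse(2) braid_inverse(1)]; simp)+

lemma braid_cancel [simp]:
 assumes "word A" "word B" "word p" "word q"
 shows "{p;braid A B;q}${p;braid' B A;q} = idw (p @ B @ A @ q)"
  "{p;braid' A B;q}${p;braid B A;q} = idw (p @ B @ A @ q)"
 using assms layer_cancel(1)[OF braid_inverse(1)] layer_cancel(1)[OF braid_inverse(2)] by simp_all

lemma braid_cancel_comp [simp]:
 assumes "word A" "word B" "word p" "word q" "warr f" "cod f = p @ B @ A @ q"
 shows "{p;braid A B;q}${p;braid' B A;q}$f = f"
  "{p;braid' A B;q}${p;braid B A;q}$f = f"
 using assms layer_cancel(2)[OF braid_inverse(1)] layer_cancel(2)[OF braid_inverse(2)] by simp_all

definition wEv where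
 "wEv X = ([Du X, X], Ev C X, [])"

definition wTwist where
 "wTwist X = ([X], Twist C X, [X])"

lemma Ev_simps [simp]: "X : Ob ==> Ev C X : Arr C" "X : Ob ==> Dom C (Ev C X) = Du X \<odot> X"
  "X : Ob ==> Cod C (Ev C X) = Unit C"
 and Coev_simps [simp]: "X : Ob ==> Coev C X : Arr C" "X : Ob ==> Cod C (Coev C X) = X \<odot> Du X"
  "X : Ob ==> Dom C (Coev C X) = Unit C"
 and Twist_simps [simp]: "X : Ob ==> Twist C X : Arr C" "X : Ob ==> Dom C (Twist C X) = X"
  "X : Ob ==> Cod C (Twist C X) = X" "X : Ob ==> is_iso C (Twist C X)"
 using Ev_Hom[of X] Coev_Hom[of X] Twist_Hom[of X] Twist_iso[of X] by (auto simp: Hom_def)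

lemma EvR_simps [simp]: "X : Ob ==> EvR C X : Arr C" "X : Ob ==> Dom C (EvR C X) = X \<odot> Du X"
  "X : Ob ==> Cod C (EvR C X) = Unit C"
 and CoevR_simps [simp]: "X : Ob ==> CoevR C X : Arr C" "X : Ob ==> Cod C (CoevR C X) = Du X \<odot> X"
  "X : Ob ==> Dom C (CoevR C X) = Unit C"
 by (simp_all add: EvR_def CoevR_def)

lemma dual_simps [simp]:
 "dom (wEv X) = [Du X, X]" "cod (wEv X) = []" "underlying (wEv X) = Ev C X" "X : Ob ==> warr (wEv X)"
 "dom (coev X) = []" "cod (coev X) = [X, Du X]" "underlying (coev X) = Coev C X" "X : Ob ==> warr (coev X)"
 "dom (evR X) = [X, Du X]" "cod (evR X) = []" "underlying (evR X) = EvR C X" "X : Ob ==> warr (evR X)"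
 "dom (coevR X) = []" "cod (coevR X) = [Du X, X]" "underlying (coevR X) = CoevR C X" "X : Ob ==> warr (coevR X)"
 "dom (wTwist X) = [X]" "cod (wTwist X) = [X]" "underlying (wTwist X) = Twist C X" "X : Ob ==> warr (wTwist X)"
 by (simp_all add: wEv_def wCoev_def wEvR_def wCoevR_def wTwist_def warr_intro)

lemma ev_coev:
 assumes [simp]: "X : Ob"
 shows "{[X];wEv X;}${;coev X;[X]} = idw [X]"
  "{;wEv X;[Du X]}${[Du X];coev X;} = idw [Du X]"
 by (rule word_arr_eqI; simp add: layer_def underlying_tensor Comp_Comp zigzag zigzag_dual)+

text \<open>Rigidity makes every half-braiding invertible.\<close>

lemma half_braid_inverse:
 assumes r: "hbraid M ro" and [simp]: "X : Ob"
 defines "g == {X # M;wEv X;}${[X];ro [Du X];[X]}${;coev X;M @ [X]}"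
 shows "ro [X]$g = idw (M @ [X])" "g$ro [X] = idw (X # M)"
proof -
 let ?Y = "Du X"
 note [simp] = hb_simps[OF r]
 have app: "ro [X, ?Y] = {;ro [X];[?Y]}${[X];ro [?Y];}" "ro [?Y, X] = {;ro [?Y];[X]}${[?Y];ro [X];}"
  using half_braid_append[OF r, of "[X]" "[?Y]"] half_braid_append[OF r, of "[?Y]" "[X]"] by simp_all
 have n: "{;ro [X];[?Y]}${[X];ro [?Y];}${;coev X;M} = {M;coev X;}"
  "{M;wEv X;}${;ro [?Y];[X]}${[?Y];ro [X];} = {;wEv X;M}"
  using half_braid_nat[OF r, of "coev X" "[]" "[X, ?Y]"] half_braid_nat[OF r, of "wEv X" "[?Y, X]" "[]"]
  by (simp_all add: app cassoc)
 have z: "{M @ [X];wEv X;}${M;coev X;[X]} = idw (M @ [X])"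
  "{[X];wEv X;M}${;coev X;X # M} = idw (X # M)"
  using arg_cong[OF ev_coev(1), of X "%f. {M;f;}"] arg_cong[OF ev_coev(1), of X "%f. {;f;M}"] by simp_all
 have "{;ro [X];}$g = {M @ [X];wEv X;}${M;coev X;[X]}"
  by (rule rewrite[OF n(1), of _ "{M @ [X];wEv X;}" "[]" "[X]" "idw (M @ [X])"]) (simp_all add: g_def diagram)
 then show "ro [X]$g = idw (M @ [X])" by (simp add: z layer_nil)
 have "g${;ro [X];} = {[X];wEv X;M}${;coev X;X # M}"
  by (rule rewrite[OF n(2), of _ "idw (X # M)" "[X]" "[]" "{;coev X;X # M}"]) (simp_all add: g_def diagram)
 then show "g$ro [X] = idw (X # M)" by (simp add: z layer_nil)
qed

lemma half_braiding_of_word: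
 assumes r: "hbraid [X] ro"
 shows "half_braiding C X (\<lambda>A\<in>Ob. underlying (ro [A]))"
proof (rule half_braiding_of_half_braid[OF r _ refl])
 fix A assume [simp]: "A : Ob"
 note [simp] = hb_simps[OF r]
 let ?g = "{[A, X];wEv A;}${[A];ro [Du A];[A]}${;coev A;[X, A]}"
 have [simp]: "X : Ob" using hb_simps(1)[OF r] by simp
 have g: "warr ?g" "dom ?g = [X, A]" "cod ?g = [A, X]" by simp_all
 have "underlying (ro [A]$?g) = Id C (X \<odot> A)" "underlying (?g$ro [A]) = Id C (A \<odot> X)"
  using half_braid_inverse[OF r, of A] by simp_all
 then show "is_iso C (underlying (ro [A]))"
  using warr_arr[OF g(1)] g(2,3) unfolding underlying_simps(3)
  by (intro isoI[where g = "underlying ?g"]) simp_all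
qed

lemma Braid_Unit: "Braid C (Unit C) (Unit C) = Id C (Unit C \<odot> Unit C)"
proof -
 let ?k = "fuse []" and ?I = "Unit C"
 have "braid [?I] [?I]${[?I];?k;} = {;?k;[?I]}"
  using crossing_nat2[of braid "[?I]" ?k "[]" "[?I]"] by simp
 moreover have "{;?k;[?I]}$?k = {[?I];?k;}$?k"
  using exchange[of "[]" ?k ?k "[]" "[]"] by (simp add: layer_nil)
 ultimately have k: "braid [?I] [?I]${[?I];?k;}$?k = {[?I];?k;}$?k"
  by (simp add: cassoc[symmetric])
 have u: "{[?I];?k;}$?k$unfuse []${[?I];unfuse [];} = idw [?I, ?I]"
  using layer_cancel(2)[OF fuse_unfuse, of "[]" "[]" "[]" "{[?I];unfuse [];}"] layer_cancel(1)[OF fuse_unfuse, of "[]" "[?I]" "[]"]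
  by (simp add: layer_nil)
 have "braid [?I] [?I] = (braid [?I] [?I]${[?I];?k;}$?k)$unfuse []${[?I];unfuse [];}"
  by (simp add: cassoc u)
 also have "... = idw [?I, ?I]" unfolding k by (simp add: cassoc u)
 finally have "underlying (braid [?I] [?I]) = Id C (?I \<odot> ?I)" by simp
 then show ?thesis by (simp add: braid_single)
qed

lemma Twist_Unit: "Twist C (Unit C) = Id C (Unit C)"
proof -
 let ?I = "Unit C" and ?t = "Twist C (Unit C)" and ?l = "LUnit C (Unit C)"
 have "?t ** ?l = ?l ** Twist C (?I \<odot> ?I)" using Twist_natural[of ?l "?I \<odot> ?I" ?I] by (simp add: Hom_def)
 also have "... = ?l ** (?t @@ ?t)" using Twist_balanced[of ?I ?I] by (simp add: Braid_Unit)
 also have "... = (?l ** (Id C ?I @@ ?t)) ** (?t @@ Id C ?I)" by (simp add: Comp_Comp interchange)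
 also have "... = ?t ** ?l ** (?t @@ Id C ?I)" using LUnit_nat[of ?t] by (simp add: Comp_Comp)
 also have "... = (?t ** ?t) ** ?l" using RUnit_nat[of ?t] by (simp add: Comp_Comp LUnit_Unit)
 finally have "?t ** Id C ?I = ?t ** ?t"
  using iso_cancel_right[of ?l ?t "?t ** ?t"] by simp
 then show ?thesis using iso_cancel_left[of ?t ?t "Id C ?I"] by simp
qed

lemma Twist_nat: "[|warr f; dom f = [a]; cod f = [b]|] ==> wTwist b$f = f$wTwist a"
 using Twist_natural[of "underlying f" a b] warr_word[of f] by (intro word_arr_eqI) (auto simp: Hom_def)

text \<open>
 The right duals obtained from the braiding and the twist.  \<open>braid'\<close> and \<open>braid\<close> both turn the
 left duals into right duals, up to powers of the twist; the two forms together make the Reidemeister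
 moves in the snake identities for \<open>wEvR\<close> and \<open>wCoevR\<close> cancel.
\<close>

context
 fixes X Y
 assumes X [simp]: "X : Ob" and Y: "Y = Du X"
begin

lemma Y_Obj [simp]: "Y : Ob" by (simp add: Y)

lemma wEvR_eq: "evR X = wEv X$braid [X] [Y]${;wTwist X;[Y]}"
 by (rule word_arr_eqI) (simp_all add: EvR_def Y braid_single underlying_layer_single)

lemma wCoevR_eq: "coevR X = {[Y];wTwist X;}$braid [X] [Y]$coev X"
 by (rule word_arr_eqI) (simp_all add: CoevR_def Y braid_single underlying_layer_left)

lemma Twist_coev: "{;wTwist X;[Y]}$coev X = {[X];wTwist Y;}$coev X"
 by (rule word_arr_eqI) (simp_all add: Y underlying_layer_left underlying_layer_single Twist_Dual)

lemma Twist_ev: "wEv X${;wTwist Y;[X]} = wEv X${[Y];wTwist X;}"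
proof -
 have z: "{[Y];{[X];wEv X;}${;coev X;[X]};} = idw [Y, X]"
  "{;wEv X;[Y]}${[Y];coev X;} = idw [Y]"
  by (simp_all only: ev_coev X Y, simp_all add: Y[symmetric])
 have dom: "dom (wEv X) = [Y, X]" "cod (coev X) = [X, Y]" by (simp_all add: Y)
 note dual_simps(1,6) [simp del]
 note dom [simp]
 have "{;wEv X;}${;wTwist Y;[X]}
  = {;wEv X;}${;wTwist Y;[X]}${;{;wEv X;[Y]}${[Y];coev X;};[X]}"
  unfolding z by simp
 also have "... = {;wEv X;}${;wEv X;[Y, X]}${[Y];{;wTwist X;[Y]}$coev X;[X]}"
  unfolding Twist_coev by (simp add: diagram)
 also have "... = {;wEv X;}${[Y];wTwist X;}${[Y];{[X];wEv X;}${;coev X;[X]};}"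
  by (simp add: diagram)
 also have "... = {;wEv X;}${[Y];wTwist X;}" unfolding z by simp
 finally show ?thesis by (simp add: layer_nil)
qed

end

declare Y_Obj [simp del]

end

context ribbon_category
begin

context
 fixes X Y
 assumes X [simp]: "X : Ob" and Y: "Y = Du X"
begin

lemma Y_Obj' [simp]: "Y : Ob" by (simp add: Y)

lemmas Y_simp [simp] = Y[symmetric]

lemma balanced_coev:
 "braid [Y] [X]$braid [X] [Y]${;wTwist X;[Y]}${[X];wTwist Y;}$coev X = coev X"
proof (rule word_arr_eqI)
 have "Twist C (X \<odot> Y) ** Coev C X = Coev C X"
  using Twist_natural[of "Coev C X" "Unit C" "X \<odot> Y"] by (simp add: Hom_def Twist_Unit)
 then show "underlying (braid [Y] [X]$braid [X] [Y]${;wTwist X;[Y]}${[X];wTwist Y;}$coev X)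
   = underlying (coev X)"
  by (simp add: braid_single underlying_layer_left underlying_layer_single Twist_balanced Comp_Comp interchange_Comp)
qed simp_all

lemma balanced_ev:
 "wEv X$braid [X] [Y]$braid [Y] [X]${;wTwist Y;[X]}${[Y];wTwist X;} = wEv X"
proof (rule word_arr_eqI)
 have "Ev C X ** Twist C (Y \<odot> X) = Ev C X"
  using Twist_natural[of "Ev C X" "Y \<odot> X" "Unit C"] by (simp add: Hom_def Twist_Unit)
 then show "underlying (wEv X$braid [X] [Y]$braid [Y] [X]${;wTwist Y;[X]}${[Y];wTwist X;}) = underlying (wEv X)"
  by (simp add: braid_single underlying_layer_left underlying_layer_single Twist_balanced Comp_Comp interchange)
qed simp_all

lemma braid_twist: "{[Y];wTwist X;}$braid [X] [Y] = braid [X] [Y]${;wTwist X;[Y]}"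
 "{[X];wTwist Y;}$braid [Y] [X] = braid [Y] [X]${;wTwist Y;[X]}"
 "{;wTwist X;[Y]}$braid [Y] [X] = braid [Y] [X]${[Y];wTwist X;}"
 "{;wTwist Y;[X]}$braid [X] [Y] = braid [X] [Y]${[X];wTwist Y;}"
 by (auto intro!: crossing_nat1 crossing_nat2)

lemma braid_twist_comp:
 "[|warr r; cod r = [X, Y]|] ==> {[Y];wTwist X;}$braid [X] [Y]$r = braid [X] [Y]${;wTwist X;[Y]}$r"
 "[|warr r; cod r = [Y, X]|] ==> {[X];wTwist Y;}$braid [Y] [X]$r = braid [Y] [X]${;wTwist Y;[X]}$r"
 "[|warr r; cod r = [Y, X]|] ==> {;wTwist X;[Y]}$braid [Y] [X]$r = braid [Y] [X]${[Y];wTwist X;}$r"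
 "[|warr r; cod r = [X, Y]|] ==> {;wTwist Y;[X]}$braid [X] [Y]$r = braid [X] [Y]${[X];wTwist Y;}$r"
 using braid_twist[THEN arg_cong[where f = "%f. f$r"]] by (simp_all add: cassoc)

lemma coevR_twist: "{[Y];wTwist X;}$coevR X = braid' [X] [Y]$coev X"
proof -
 let ?t = "{[Y];wTwist X;}" and ?s = "{;wTwist X;[Y]}"
 have e: "?t$coevR X = braid [X] [Y]$?s${[X];wTwist Y;}$coev X"
  by (simp add: wCoevR_eq[OF X Y] braid_twist_comp Twist_coev[OF X Y, symmetric])
 have "braid' [X] [Y]$(braid [Y] [X]$?t$coevR X) = ?t$coevR X"
  using braid_cancel_comp(2)[of "[X]" "[Y]" "[]" "[]" "?t$coevR X"] by (simp add: layer_nil)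
 then show ?thesis using e balanced_coev by simp
qed

lemma evR_twist: "evR X$braid [Y] [X]${[Y];wTwist X;} = wEv X"
proof -
 let ?t = "{[Y];wTwist X;}" and ?c = "braid [X] [Y]$braid [Y] [X]"
 have "evR X$braid [Y] [X]$?t = wEv X$braid [X] [Y]${;wTwist X;[Y]}$braid [Y] [X]$?t"
  by (simp add: wEvR_eq[OF X Y] cassoc)
 also have "... = (wEv X$?t)$?c$?t"
  by (simp add: cassoc braid_twist_comp)
 also have "... = wEv X$braid [X] [Y]$braid [Y] [X]${;wTwist Y;[X]}$?t"
  unfolding Twist_ev[OF X Y, symmetric] by (simp add: cassoc braid_twist_comp)
 finally show ?thesis using balanced_ev by simp
qed

lemma braid_loop_left:
 "{;wEv X;[X]}${;braid [X] [Y];[X]}${[X];braid' [X] [Y];}${[X];coev X;} = idw [X]"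
proof -
 have 1: "braid [X] [X, Y] = {[X];braid [X] [Y];}${;braid [X] [X];[Y]}"
  "braid [X] [Y, X] = {[Y];braid [X] [X];}${;braid [X] [Y];[X]}"
  "braid' [X] [Y, X] = {[Y];braid' [X] [X];}${;braid' [X] [Y];[X]}"
  using crossing_append2[of braid "[X]" "[X]" "[Y]"] crossing_append2[of braid "[X]" "[Y]" "[X]"]
   crossing_append2[of braid' "[X]" "[Y]" "[X]"] by simp_all
 have n: "braid [X] [X, Y]${[X];coev X;} = {;coev X;[X]}"
  "{;braid' [X] [Y];[X]}$braid [X] [X, Y] = braid [X] [Y, X]${[X];braid' [X] [Y];}"
  "{;wEv X;[X]}$braid' [X] [Y, X] = {[X];wEv X;}"
  using crossing_nat2[of braid "[X]" "coev X" "[]" "[X, Y]"]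
   crossing_nat2[of braid "[X]" "braid' [X] [Y]" "[X, Y]" "[Y, X]"]
   crossing_nat2[of braid' "[X]" "wEv X" "[Y, X]" "[]"] by simp_all
 have c: "{[Y];braid' [X] [X];}$braid [X] [Y, X] = {;braid [X] [Y];[X]}"
  unfolding 1(2) by simp
 have "{;braid [X] [Y];[X]}${[X];braid' [X] [Y];}${[X];coev X;}
  = {[Y];braid' [X] [X];}$(braid [X] [Y, X]${[X];braid' [X] [Y];})${[X];coev X;}"
  unfolding c[symmetric] by (simp add: cassoc)
 also have "... = ({[Y];braid' [X] [X];}${;braid' [X] [Y];[X]})${;coev X;[X]}"
  unfolding n(2)[symmetric] n(1)[symmetric] by (simp add: cassoc)
 finally have "{;wEv X;[X]}${;braid [X] [Y];[X]}${[X];braid' [X] [Y];}${[X];coev X;}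
  = ({;wEv X;[X]}$braid' [X] [Y, X])${;coev X;[X]}"
  unfolding 1(3) by (simp add: cassoc)
 then show ?thesis unfolding n(3) using ev_coev(1)[of X] by simp
qed

lemma braid_loop_right:
 "{[Y];wEv X;}${[Y];braid [X] [Y];}${;braid' [X] [Y];[Y]}${;coev X;[Y]} = idw [Y]"
proof -
 have 1: "braid [X, Y] [Y] = {;braid [X] [Y];[Y]}${[X];braid [Y] [Y];}"
  "braid [Y, X] [Y] = {;braid [Y] [Y];[X]}${[Y];braid [X] [Y];}"
  "braid' [Y, X] [Y] = {;braid' [Y] [Y];[X]}${[Y];braid' [X] [Y];}"
  using crossing_append1[of braid "[X]" "[Y]" "[Y]"] crossing_append1[of braid "[Y]" "[X]" "[Y]"]
   crossing_append1[of braid' "[Y]" "[X]" "[Y]"] by simp_all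
 have n: "braid [X, Y] [Y]${;coev X;[Y]} = {[Y];coev X;}"
  "{[Y];braid' [X] [Y];}$braid [X, Y] [Y] = braid [Y, X] [Y]${;braid' [X] [Y];[Y]}"
  "{[Y];wEv X;}$braid' [Y, X] [Y] = {;wEv X;[Y]}"
  using crossing_nat1[of braid "[Y]" "coev X" "[]" "[X, Y]"]
   crossing_nat1[of braid "[Y]" "braid' [X] [Y]" "[X, Y]" "[Y, X]"]
   crossing_nat1[of braid' "[Y]" "wEv X" "[Y, X]" "[]"] by simp_all
 have c: "{;braid' [Y] [Y];[X]}$braid [Y, X] [Y] = {[Y];braid [X] [Y];}"
  unfolding 1(2) by simp
 have "{[Y];braid [X] [Y];}${;braid' [X] [Y];[Y]}${;coev X;[Y]}
  = {;braid' [Y] [Y];[X]}$(braid [Y, X] [Y]${;braid' [X] [Y];[Y]})${;coev X;[Y]}"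
  unfolding c[symmetric] by (simp add: cassoc)
 also have "... = ({;braid' [Y] [Y];[X]}${[Y];braid' [X] [Y];})${[Y];coev X;}"
  unfolding n(2)[symmetric] n(1)[symmetric] by (simp add: cassoc)
 finally have "{[Y];wEv X;}${[Y];braid [X] [Y];}${;braid' [X] [Y];[Y]}${;coev X;[Y]}
  = ({[Y];wEv X;}$braid' [Y, X] [Y])${[Y];coev X;}"
  unfolding 1(3) by (simp add: cassoc)
 then show ?thesis unfolding n(3) using ev_coev(2)[of X] by simp
qed

lemma layer_Comp_eq:
 assumes "f = g"
 shows "{p;f;q} = {p;g;q}"
 using assms by simp

lemma snake_right_left: "{;evR X;[X]}${[X];coevR X;} = idw [X]" (is "?Z = _")
proof -
 let ?t = "wTwist X" and ?b = "braid [X] [Y]" and ?d = "braid' [X] [Y]"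
 have E1: "{[X, Y];?t;}${[X];coevR X;} = {[X];?d;}${[X];coev X;}"
  using layer_Comp_eq[OF coevR_twist, of "[X]" "[]"] by simp
 have "{;?t;}$?Z = {;evR X;[X]}${[X, Y];?t;}${[X];coevR X;}"
  using exchange[of "[]" "wTwist X" "evR X" "[]" "[]"] by (simp add: cassoc[symmetric])
 also have "... = {;wEv X;[X]}${;?b;[X]}${;?t;[Y, X]}${[X];?d;}${[X];coev X;}"
  unfolding E1 wEvR_eq[OF X Y] by (simp add: cassoc)
 also have "{;?t;[Y, X]}${[X];?d;}${[X];coev X;} = {[X];?d;}${[X];coev X;}${;?t;}"
  by (simp add: diagram)
 also have "{;wEv X;[X]}${;?b;[X]}${[X];?d;}${[X];coev X;}${;?t;}
  = ({;wEv X;[X]}${;?b;[X]}${[X];?d;}${[X];coev X;})${;?t;}"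
  by (simp add: cassoc)
 finally have "{;?t;}$?Z = {;?t;}$idw [X]"
  unfolding braid_loop_left by simp
 then have "underlying ({;?t;}$?Z) = underlying ({;?t;}$idw [X])" by simp
 then have "Twist C X ** underlying ?Z = Twist C X ** Id C X" by (simp add: layer_nil)
 then have "underlying ?Z = Id C X"
  using warr_arr[of ?Z] by (intro iso_cancel_left[of "Twist C X" "underlying ?Z" "Id C X"]) simp_all
 then show ?thesis by (intro word_arr_eqI) simp_all
qed

lemma snake_right_right: "{[Y];evR X;}${;coevR X;[Y]} = idw [Y]"
proof -
 let ?t = "wTwist X" and ?b = "braid [X] [Y]" and ?d = "braid' [X] [Y]"
 have E1: "{[Y];?t;[Y]}${;coevR X;[Y]} = {;?d;[Y]}${;coev X;[Y]}"
  using layer_Comp_eq[OF coevR_twist, of "[]" "[Y]"] by simp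
 have "{[Y];evR X;}${;coevR X;[Y]} = {[Y];wEv X;}${[Y];?b;}${[Y];?t;[Y]}${;coevR X;[Y]}"
  unfolding wEvR_eq[OF X Y] by (simp add: cassoc)
 then show ?thesis unfolding E1 braid_loop_right .
qed

lemma trace_left_right:
 assumes [simp]: "warr f" "dom f = [X]" "cod f = [X]"
 shows "evR X${;f;[Y]}$coev X = wEv X${[Y];f;}$coevR X"
proof -
 let ?b = "braid [X] [Y]"
 have t: "{;wTwist X;[Y]}${;f;[Y]} = {;f;[Y]}${;wTwist X;[Y]}"
  using layer_Comp_eq[OF Twist_nat[of f X X], of "[]" "[Y]"] by simp
 have n: "{[Y];f;}${[Y];wTwist X;}$?b = ?b${;f;[Y]}${;wTwist X;[Y]}"
  using crossing_nat1[of braid "[Y]" "f$wTwist X" "[X]" "[X]"] by (simp add: cassoc)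
 have "evR X${;f;[Y]}$coev X = wEv X$?b$({;wTwist X;[Y]}${;f;[Y]})$coev X"
  by (simp add: wEvR_eq[OF X Y] cassoc)
 also have "... = wEv X$({[Y];f;}${[Y];wTwist X;}$?b)$coev X"
  unfolding t n by (simp add: cassoc)
 finally show ?thesis by (simp add: wCoevR_eq[OF X Y] cassoc)
qed

end

declare Y_Obj' [simp del] Y_simp [simp del]

end

section \<open>Linear combinations of arrows\<close>

context linear_monoidal_category
begin

lemma hom_group_simps [simp]:
 "carrier (hom_group C X Y) = Hom C X Y" "monoid.mult (hom_group C X Y) = Add C" "one (hom_group C X Y) = Zero C X Y"
 by (simp_all add: hom_group_def)

lemma Hom_Obj: "f : Hom C X Y ==> X : Ob & Y : Ob"
 by (auto simp: Hom_def)

lemma Zero_Hom [simp]: "[|X : Ob; Y : Ob|] ==> Zero C X Y : Hom C X Y"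
 using hom_comm_group[of X Y] comm_groupE(2)[of "hom_group C X Y"] by simp

lemma Add_Hom [simp]: "[|f : Hom C X Y; g : Hom C X Y|] ==> Add C f g : Hom C X Y"
 using hom_comm_group[of X Y] comm_groupE(1)[of "hom_group C X Y" f g] Hom_Obj[of f X Y] by simp

lemma Add_Zero [simp]: "f : Hom C X Y ==> Add C (Zero C X Y) f = f" "f : Hom C X Y ==> Add C f (Zero C X Y) = f"
 using hom_comm_group[of X Y] comm_groupE(2,4,5)[of "hom_group C X Y"] Hom_Obj[of f X Y] by simp_all

lemma Add_idem:
 assumes "f : Hom C X Y" "Add C f f = f"
 shows "f = Zero C X Y"
proof -
 interpret G: comm_group "hom_group C X Y" using hom_comm_group Hom_Obj[OF assms(1)] by blast
 show ?thesis using G.l_cancel_one[of f f] assms by simp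
qed

lemma Scale_0: "f : Hom C X Y ==> Scale C 0 f = Zero C X Y"
 using Scale_plus[of f X Y 0 0] Scale_Hom[of f X Y 0] by (intro Add_idem) simp_all

lemma Scale_Zero: "[|X : Ob; Y : Ob|] ==> Scale C a (Zero C X Y) = Zero C X Y"
 using Scale_Add[of "Zero C X Y" X Y "Zero C X Y" a] Scale_Hom[of "Zero C X Y" X Y a] by (intro Add_idem) simp_all

lemma Comp_Zero: "[|g : Hom C Y Z; X : Ob|] ==> g ** Zero C X Y = Zero C X Z"
 using Comp_Add_right[of "Zero C X Y" X Y "Zero C X Y" g Z] Comp_Hom[of "Zero C X Y" X Y g Z] Hom_Obj[of g Y Z]
 by (intro Add_idem) simp_all

lemma Zero_Comp: "[|f : Hom C X Y; Z : Ob|] ==> Zero C Y Z ** f = Zero C X Z"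
 using Comp_Add_left[of f X Y "Zero C Y Z" Z "Zero C Y Z"] Comp_Hom[of f X Y "Zero C Y Z" Z] Hom_Obj[of f X Y]
 by (intro Add_idem) simp_all

lemma hom_sum_Hom: "[|X : Ob; Y : Ob; !!i. i : I ==> f i : Hom C X Y|] ==> hom_sum C X Y f I : Hom C X Y"
 using hom_comm_group[of X Y] comm_monoid.finprod_closed[of "hom_group C X Y" f I]
 by (auto simp: hom_sum_def comm_group_def)

lemma hom_sum_empty: "[|X : Ob; Y : Ob|] ==> hom_sum C X Y f {} = Zero C X Y"
 using hom_comm_group[of X Y] comm_monoid.finprod_empty[of "hom_group C X Y" f]
 by (auto simp: hom_sum_def comm_group_def)

lemma hom_sum_infinite: "[|X : Ob; Y : Ob; infinite I|] ==> hom_sum C X Y f I = Zero C X Y"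
 using hom_comm_group[of X Y] comm_monoid.finprod_infinite[of "hom_group C X Y" I f]
 by (auto simp: hom_sum_def comm_group_def)

lemma hom_sum_insert: "[|X : Ob; Y : Ob; finite I; i \<notin> I; f i : Hom C X Y; !!j. j : I ==> f j : Hom C X Y|]
  ==> hom_sum C X Y f (insert i I) = Add C (f i) (hom_sum C X Y f I)"
 using hom_comm_group[of X Y] comm_monoid.finprod_insert[of "hom_group C X Y" I i f]
 by (auto simp: hom_sum_def comm_group_def)

lemma hom_sum_cong: "[|X : Ob; Y : Ob; !!i. i : I ==> g i : Hom C X Y; !!i. i : I ==> f i = g i|]
  ==> hom_sum C X Y f I = hom_sum C X Y g I"
 using hom_comm_group[of X Y] comm_monoid.finprod_cong'[of "hom_group C X Y" I I g f]
 by (auto simp: hom_sum_def comm_group_def)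

lemma hom_sum_Add: "[|X : Ob; Y : Ob; !!i. i : I ==> f i : Hom C X Y; !!i. i : I ==> g i : Hom C X Y|]
  ==> hom_sum C X Y (%i. Add C (f i) (g i)) I = Add C (hom_sum C X Y f I) (hom_sum C X Y g I)"
 using hom_comm_group[of X Y] comm_monoid.finprod_multf[of "hom_group C X Y" f I g]
 by (auto simp: hom_sum_def comm_group_def)

lemma additive_hom_sum:
 assumes obj: "X : Ob" "Y : Ob" "X' : Ob" "Y' : Ob"
  and hom: "!!f. f : Hom C X Y ==> T f : Hom C X' Y'"
  and add: "!!f g. [|f : Hom C X Y; g : Hom C X Y|] ==> T (Add C f g) = Add C (T f) (T g)"
  and F: "!!i. i : I ==> F i : Hom C X Y"
 shows "T (hom_sum C X Y F I) = hom_sum C X' Y' (%i. T (F i)) I"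
proof -
 have T0: "T (Zero C X Y) = Zero C X' Y'"
  using add[of "Zero C X Y" "Zero C X Y"] hom[of "Zero C X Y"] obj by (intro Add_idem) simp_all
 show ?thesis using F
 proof (induction I rule: infinite_finite_induct)
  case (insert i I)
  then show ?case using obj hom by (simp add: hom_sum_insert hom_sum_Hom add)
 qed (simp_all add: obj T0 hom_sum_empty hom_sum_infinite)
qed

definition wsum where
 "wsum x y F I = (x, hom_sum C (wobj x) (wobj y) (%i. underlying (F i)) I, y)"

definition sc where
 "sc a f = (dom f, Scale C a (underlying f), cod f)"

definition wzero where
 "wzero x y = (x, Zero C (wobj x) (wobj y), y)"

definition whom where
 "whom x y = {f. warr f & dom f = x & cod f = y}"

lemma homs: "f : whom x y \<longleftrightarrow> warr f & dom f = x & cod f = y"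
 by (simp add: whom_def)

lemma underlying_Hom: "warr f ==> underlying f : Hom C (wobj (dom f)) (wobj (cod f))"
 by (simp add: Hom_def)

lemma whom_underlying: "f : whom x y ==> underlying f : Hom C (wobj x) (wobj y)"
 by (auto simp: homs underlying_Hom)

lemma wscale_simps [simp]: "dom (sc a f) = dom f" "cod (sc a f) = cod f"
  "underlying (sc a f) = Scale C a (underlying f)" "warr f ==> warr (sc a f)"
 by (auto simp: sc_def intro!: warrI Scale_Hom underlying_Hom)

lemma wzero_simps [simp]: "dom (wzero x y) = x" "cod (wzero x y) = y"
  "underlying (wzero x y) = Zero C (wobj x) (wobj y)" "[|word x; word y|] ==> warr (wzero x y)"
 by (auto simp: wzero_def intro!: warrI)

lemma wsum_simps [simp]: "dom (wsum x y F I) = x" "cod (wsum x y F I) = y"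
  "underlying (wsum x y F I) = hom_sum C (wobj x) (wobj y) (%i. underlying (F i)) I"
 by (simp_all add: wsum_def)

lemma wsum_warr [simp]: "[|word x; word y; !!i. i : I ==> warr (F i) & dom (F i) = x & cod (F i) = y|] ==> warr (wsum x y F I)"
 unfolding wsum_def by (auto intro!: warrI hom_sum_Hom whom_underlying simp: homs)

lemma wsum_empty: "[|word x; word y|] ==> wsum x y F {} = wzero x y"
 by (rule word_arr_eqI) (simp_all add: hom_sum_empty)

lemma wsum_cong: "[|word x; word y; !!i. i : I ==> F i = G i;
  !!i. i : I ==> warr (G i) & dom (G i) = x & cod (G i) = y|] ==> wsum x y F I = wsum x y G I"
 by (rule word_arr_eqI) (auto intro!: hom_sum_cong whom_underlying simp: homs)

text \<open>Reduces the behaviour of sums under composition and tensoring to that of sums of two arrows.\<close>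

lemma additive_wsum:
 assumes w: "word x" "word y" "word x'" "word y'"
  and hom: "!!f. f : whom x y ==> T f : whom x' y'"
  and add: "!!f g. [|f : Hom C (wobj x) (wobj y); g : Hom C (wobj x) (wobj y)|] ==>
   underlying (T (x, Add C f g, y)) = Add C (underlying (T (x, f, y))) (underlying (T (x, g, y)))"
  and F: "!!i. i : I ==> F i : whom x y"
 shows "T (wsum x y F I) = wsum x' y' (%i. T (F i)) I"
proof -
 let ?T = "%f. underlying (T (x, f, y))"
 have F': "F i = (x, underlying (F i), y)" if "i : I" for i
  using F[OF that] by (intro word_arr_eqI) (auto simp: homs)
 have hom': "?T f : Hom C (wobj x') (wobj y')" if "f : Hom C (wobj x) (wobj y)" for f
  using hom[of "(x, f, y)"] warrI[of x y f] that w by (auto simp: homs intro!: whom_underlying)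
 have "?T (hom_sum C (wobj x) (wobj y) (%i. underlying (F i)) I)
   = hom_sum C (wobj x') (wobj y') (%i. ?T (underlying (F i))) I"
  by (rule additive_hom_sum) (use w hom' add F whom_underlying in "auto")
 also have "... = hom_sum C (wobj x') (wobj y') (%i. underlying (T (F i))) I"
  by (rule hom_sum_cong) (use w hom F F' whom_underlying in "auto")
 finally have e: "underlying (T (wsum x y F I)) = underlying (wsum x' y' (%i. T (F i)) I)"
  by (simp add: wsum_def)
 have "wsum x y F I : whom x y" using w F by (auto simp: homs)
 from hom[OF this] e show ?thesis by (intro word_arr_eqI) (auto simp: homs)
qed

lemma comp_wsum:
 assumes "warr g" "dom g = y" "word x" "!!i. i : I ==> warr (F i) & dom (F i) = x & cod (F i) = y"
 shows "g$wsum x y F I = wsum x (cod g) (%i. g$F i) I"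
proof (rule additive_wsum)
 fix f f' assume "f : Hom C (wobj x) (wobj y)" "f' : Hom C (wobj x) (wobj y)"
 then show "underlying (g$(x, Add C f f', y)) = Add C (underlying (g$(x, f, y))) (underlying (g$(x, f', y)))"
  using underlying_Hom[OF assms(1)] assms(2) by (simp add: Comp_Add_right)
qed (use assms warr_word[OF assms(1)] in \<open>auto simp: homs\<close>)

lemma wsum_comp:
 assumes "warr g" "cod g = x" "word y" "!!i. i : I ==> warr (F i) & dom (F i) = x & cod (F i) = y"
 shows "wsum x y F I$g = wsum (dom g) y (%i. F i$g) I"
proof (rule additive_wsum)
 fix f f' assume "f : Hom C (wobj x) (wobj y)" "f' : Hom C (wobj x) (wobj y)"
 then show "underlying ((x, Add C f f', y)$g) = Add C (underlying ((x, f, y)$g)) (underlying ((x, f', y)$g))"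
  using underlying_Hom[OF assms(1)] assms(2) by (simp add: Comp_Add_left)
qed (use assms warr_word[OF assms(1)] in \<open>auto simp: homs\<close>)

lemma underlying_layer:
 assumes "warr f" "word p" "word q"
 shows "underlying {p;f;q} = word_join C p (cod f @ q) ** (Id C (wobj p) @@
  (word_join C (cod f) q ** (underlying f @@ Id C (wobj q)) ** inv_arr C (word_join C (dom f) q)))
  ** inv_arr C (word_join C p (dom f @ q))"
 using assms by (simp add: layer_def underlying_tensor)

lemma word_join_Hom:
 assumes "word x" "word y"
 shows "word_join C x y : Hom C (wobj x \<odot> wobj y) (wobj (x @ y))"
  "inv_arr C (word_join C x y) : Hom C (wobj (x @ y)) (wobj x \<odot> wobj y)"
 using assms by (auto simp: Hom_def)

lemma layer_wsum:
 assumes w: "word p" "word q" "word x" "word y" and F: "!!i. i : I ==> warr (F i) & dom (F i) = x & cod (F i) = y"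
 shows "{p;wsum x y F I;q} = wsum (p @ x @ q) (p @ y @ q) (%i. {p;F i;q}) I"
proof (rule additive_wsum)
 fix f g assume fg: "f : Hom C (wobj x) (wobj y)" "g : Hom C (wobj x) (wobj y)"
 note J = word_join_Hom[of y q] word_join_Hom[of x q] word_join_Hom[of p "y @ q"] word_join_Hom[of p "x @ q"]
 have I: "Id C (wobj p) : Hom C (wobj p) (wobj p)" "Id C (wobj q) : Hom C (wobj q) (wobj q)"
  using w by (simp_all add: Id_Hom)
 let ?a = "%f. f @@ Id C (wobj q)"
 let ?b = "%f. word_join C y q ** f ** inv_arr C (word_join C x q)"
 let ?c = "%f. Id C (wobj p) @@ f"
 let ?d = "%f. word_join C p (y @ q) ** f ** inv_arr C (word_join C p (x @ q))"
 have u: "underlying {p;(x, f, y);q} = ?d (?c (?b (?a f)))" if "f : Hom C (wobj x) (wobj y)" for f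
  using that w by (simp add: underlying_layer warrI)
 have h: "?a f : Hom C (wobj x \<odot> wobj q) (wobj y \<odot> wobj q)" if "f : Hom C (wobj x) (wobj y)" for f
  using that I by (rule_tac TensA_Hom)
 have h2: "?b f : Hom C (wobj (x @ q)) (wobj (y @ q))" if "f : Hom C (wobj x \<odot> wobj q) (wobj y \<odot> wobj q)" for f
  using that J(1-4) w by (auto intro!: Comp_Hom)
 have h3: "?c f : Hom C (wobj p \<odot> wobj (x @ q)) (wobj p \<odot> wobj (y @ q))" if "f : Hom C (wobj (x @ q)) (wobj (y @ q))" for f
  using that I by (auto intro!: TensA_Hom)
 have a: "?a (Add C f g) = Add C (?a f) (?a g)" using fg I by (simp add: TensA_Add_left)
 have b: "?b (Add C f g) = Add C (?b f) (?b g)"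
  if "f : Hom C (wobj x \<odot> wobj q) (wobj y \<odot> wobj q)" "g : Hom C (wobj x \<odot> wobj q) (wobj y \<odot> wobj q)" for f g
  using that J(1-4) w by (simp add: Comp_Add_left[OF _ that] Comp_Add_right[OF Comp_Hom Comp_Hom])
 have c: "?c (Add C f g) = Add C (?c f) (?c g)"
  if "f : Hom C (wobj (x @ q)) (wobj (y @ q))" "g : Hom C (wobj (x @ q)) (wobj (y @ q))" for f g
  using that I by (simp add: TensA_Add_right)
 have d: "?d (Add C f g) = Add C (?d f) (?d g)"
  if "f : Hom C (wobj p \<odot> wobj (x @ q)) (wobj p \<odot> wobj (y @ q))"
   "g : Hom C (wobj p \<odot> wobj (x @ q)) (wobj p \<odot> wobj (y @ q))" for f g
  using that J(5-8) w by (simp add: Comp_Add_left[OF _ that] Comp_Add_right[OF Comp_Hom Comp_Hom])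
 have "Add C f g : Hom C (wobj x) (wobj y)" using fg by simp
 from u[OF this] show "underlying {p;(x, Add C f g, y);q} = Add C (underlying {p;(x, f, y);q}) (underlying {p;(x, g, y);q})"
  using fg by (simp only: u a b[OF h h] c[OF h2 h2, OF h h] d[OF h3 h3, OF h2 h2, OF h h])
qed (use w F in "auto simp: homs")

lemma comp_wscale: "[|warr f; warr g; dom g = cod f|] ==> g$sc a f = sc a (g$f)"
 and wscale_comp: "[|warr f; warr g; dom g = cod f|] ==> sc a g$f = sc a (g$f)"
 using Comp_Scale_right[OF underlying_Hom[of f], of "underlying g" _ a] Comp_Scale_left[OF underlying_Hom[of f], of "underlying g" _ a]
 by (auto intro!: word_arr_eqI simp: Hom_def)

lemma layer_wscale:
 assumes w: "word p" "word q" "warr f"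
 shows "{p;sc a f;q} = sc a {p;f;q}"
proof (rule word_arr_eqI)
 let ?x = "dom f" and ?y = "cod f" and ?u = "underlying f"
 have f: "?u : Hom C (wobj ?x) (wobj ?y)" using w by (simp add: underlying_Hom)
 note J = word_join_Hom[of ?y q] word_join_Hom[of ?x q] word_join_Hom[of p "?y @ q"] word_join_Hom[of p "?x @ q"]
 have I: "Id C (wobj p) : Hom C (wobj p) (wobj p)" "Id C (wobj q) : Hom C (wobj q) (wobj q)"
  using w by (simp_all add: Id_Hom)
 let ?a = "?u @@ Id C (wobj q)"
 let ?b = "word_join C ?y q ** ?a ** inv_arr C (word_join C ?x q)"
 have h: "?a : Hom C (wobj ?x \<odot> wobj q) (wobj ?y \<odot> wobj q)"
  using f I by (rule_tac TensA_Hom)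
 have h2: "?b : Hom C (wobj (?x @ q)) (wobj (?y @ q))"
  using h J(1-4) w by (auto intro!: Comp_Hom)
 have h3: "Id C (wobj p) @@ ?b : Hom C (wobj p \<odot> wobj (?x @ q)) (wobj p \<odot> wobj (?y @ q))"
  using h2 I by (auto intro!: TensA_Hom)
 show "underlying {p;sc a f;q} = underlying (sc a {p;f;q})"
  using w J by (simp add: underlying_layer TensA_Scale_left[OF f I(2)] Comp_Scale_left[OF _ h]
   Comp_Scale_right[OF Comp_Hom[OF _ h]] TensA_Scale_right[OF I(1) h2] Comp_Scale_left[OF _ h3] Comp_Scale_right[OF Comp_Hom[OF _ h3]])
qed (use w in simp_all)

lemma wscale_wscale [simp]: "warr f ==> sc a (sc b f) = sc (a * b) f"
 and wscale_1 [simp]: "warr f ==> sc 1 f = f"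
 using Scale_times[OF underlying_Hom[of f]] Scale_one[OF underlying_Hom[of f]] by (auto intro!: word_arr_eqI)

lemma wscale_wsum:
 assumes "word x" "word y" "!!i. i : I ==> warr (F i) & dom (F i) = x & cod (F i) = y"
 shows "sc a (wsum x y F I) = wsum x y (%i. sc a (F i)) I"
 by (rule additive_wsum) (use assms in "auto simp: homs Scale_Add")

lemma wscale_0: "warr f ==> sc 0 f = wzero (dom f) (cod f)"
 using Scale_0[OF underlying_Hom[of f]] by (auto intro!: word_arr_eqI)

lemma wscale_wzero [simp]: "[|word x; word y|] ==> sc a (wzero x y) = wzero x y"
 by (rule word_arr_eqI) (simp_all add: Scale_Zero)

lemma wsum_wscale_const:
 assumes f: "warr f" and I: "finite I"
 shows "wsum (dom f) (cod f) (%i. sc (c i) f) I = sc (\<Sum>i\<in>I. c i) f"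
proof (rule word_arr_eqI)
 have h: "Scale C b (underlying f) : Hom C (wobj (dom f)) (wobj (cod f))" for b
  by (rule Scale_Hom[OF underlying_Hom[OF f]])
 show "underlying (wsum (dom f) (cod f) (%i. sc (c i) f) I) = underlying (sc (\<Sum>i\<in>I. c i) f)"
  using I by (induction I) (use f h Scale_0[OF underlying_Hom[OF f]] Scale_plus[OF underlying_Hom[OF f]] in
   \<open>auto simp: hom_sum_empty hom_sum_insert\<close>)
qed simp_all

lemma comp_wzero [simp]: "[|warr g; dom g = y; word x|] ==> g$wzero x y = wzero x (cod g)"
 and wzero_comp [simp]: "[|warr g; cod g = x; word y|] ==> wzero x y$g = wzero (dom g) y"
 using Comp_Zero[OF underlying_Hom[of g], of "wobj x"] Zero_Comp[OF underlying_Hom[of g], of "wobj y"]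
 by (auto intro!: word_arr_eqI)

lemma layer_wzero [simp]:
 assumes "word p" "word q" "word x" "word y"
 shows "{p;wzero x y;q} = wzero (p @ x @ q) (p @ y @ q)"
 using layer_wsum[of p q x y "{}" "%_. wzero x y"] assms by (simp add: wsum_empty)

lemma wsum_zero:
 assumes "word x" "word y" "!!i. i : I ==> F i = wzero x y"
 shows "wsum x y F I = wzero x y"
proof -
 have "wsum x y F I = wsum x y (%i. sc 0 (wzero x y)) I"
  by (rule wsum_cong) (use assms in auto)
 also have "... = sc 0 (wsum x y (%i. wzero x y) I)"
  using assms by (simp add: wscale_wsum)
 also have "... = wzero x y" using assms by (simp add: wscale_0)
 finally show ?thesis .
qed

lemma wsum_single:
 assumes w: "word x" "word y" and I: "finite I" "i : I" and F: "!!j. [|j : I; j ~= i|] ==> F j = wzero x y" "F i : whom x y"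
 shows "wsum x y F I = F i"
proof -
 have h: "F j : whom x y" if "j : I" for j using F w that by (cases "j = i") (auto simp: homs)
 have z: "wsum x y F (I - {i}) = wzero x y" by (rule wsum_zero) (use w F in auto)
 show ?thesis
 proof (rule word_arr_eqI)
  have "hom_sum C (wobj x) (wobj y) (%j. underlying (F j)) (insert i (I - {i}))
   = Add C (underlying (F i)) (hom_sum C (wobj x) (wobj y) (%j. underlying (F j)) (I - {i}))"
   by (rule hom_sum_insert) (use w I in "auto intro!: whom_underlying[OF h]")
  also have "hom_sum C (wobj x) (wobj y) (%j. underlying (F j)) (I - {i}) = Zero C (wobj x) (wobj y)"
   using arg_cong[OF z, of underlying] by simp
  finally show "underlying (wsum x y F I) = underlying (F i)"
   using I whom_underlying[OF F(2)] by (simp add: insert_absorb)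
 qed (use F(2) in \<open>auto simp: homs\<close>)
qed

lemma wsum_swap:
 assumes w: "word x" "word y" and fin: "finite I" "finite K"
  and F: "!!i k. [|i : I; k : K|] ==> F i k : whom x y"
 shows "wsum x y (%i. wsum x y (F i) K) I = wsum x y (%k. wsum x y (%i. F i k) I) K"
proof (rule word_arr_eqI)
 let ?s = "hom_sum C (wobj x) (wobj y)"
 have o: "wobj x : Ob" "wobj y : Ob" using w by simp_all
 have "?s (%i. ?s (%k. underlying (F i k)) K) I = ?s (%k. ?s (%i. underlying (F i k)) I) K"
  using fin(1) F
 proof (induction I)
  case empty
  show ?case using arg_cong[OF wsum_zero[OF w, of K "%_. wzero x y"], of underlying] o by (simp add: hom_sum_empty)
 next
  case (insert i I)
  then have h: "underlying (F j k) : Hom C (wobj x) (wobj y)" if "j : insert i I" "k : K" for j k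
   using that whom_underlying by blast
  have "?s (%i. ?s (%k. underlying (F i k)) K) (insert i I) = Add C (?s (%k. underlying (F i k)) K) (?s (%k. ?s (%i. underlying (F i k)) I) K)"
   using insert h o by (subst hom_sum_insert) (auto intro!: hom_sum_Hom)
  also have "... = ?s (%k. Add C (underlying (F i k)) (?s (%i. underlying (F i k)) I)) K"
   using h o by (subst hom_sum_Add) (auto intro!: hom_sum_Hom)
  also have "... = ?s (%k. ?s (%i. underlying (F i k)) (insert i I)) K"
   by (rule hom_sum_cong) (use insert h o in "auto intro!: hom_sum_Hom Add_Hom simp: hom_sum_insert")
  finally show ?case .
 qed
 then show "underlying (wsum x y (%i. wsum x y (F i) K) I) = underlying (wsum x y (%k. wsum x y (%i. F i k) I) K)" by simp
qed simp_all

end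

section \<open>Simple objects\<close>

text \<open>
 Yields a polynomial annihilating an endomorphism whose powers lie in a space of finite dimension. The
 substitution \<open>T\<close> makes the induction possible: composed with it, the last condition becomes void.
\<close>

lemma linear_conditions_poly:
 fixes \<phi> :: "nat => 'k::field poly => 'k"
 assumes \<phi>: "!!i p q. i < n ==> \<phi> i (p + q) = \<phi> i p + \<phi> i q" "!!i c p. i < n ==> \<phi> i (smult c p) = c * \<phi> i p"
  and T: "!!p q. T (p + q) = T p + T q" "!!c p. T (smult c p) = smult c (T p)" "!!p. p ~= 0 ==> T p ~= (0 :: 'k poly)"
 shows "\<exists>p. p ~= 0 & (\<forall>i<n. \<phi> i (T p) = 0)"
 using assms
proof (induction n arbitrary: T)
 case 0
 show ?case by (rule exI[of _ 1]) simp
next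
 case (Suc n)
 show ?case
 proof (cases "\<forall>p. \<phi> n (T p) = 0")
  case True
  have "\<exists>p. p ~= 0 & (\<forall>i<n. \<phi> i (T p) = 0)"
   by (rule Suc.IH) (use Suc.prems in auto)
  then show ?thesis using True less_Suc_eq by auto
 next
  case False
  then obtain A where A: "\<phi> n (T A) ~= 0" by blast
  let ?m = "monom 1 (Suc (degree A)) :: 'k poly"
  define c where "c p = \<phi> n (T (?m * p)) / \<phi> n (T A)" for p
  define g where "g p = ?m * p + smult (- c p) A" for p
  have c: "c (p + q) = c p + c q" "c (smult b p) = b * c p" for p q b
   using Suc.prems(1,2)[of n] Suc.prems(3,4) by (simp_all add: c_def distrib_left add_divide_distrib)
  have g: "g (p + q) = g p + g q" "g (smult b p) = smult b (g p)" for p q b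
   by (simp_all add: g_def c algebra_simps smult_add_left smult_add_right smult_diff_right smult_diff_left)
  have g0: "g p ~= 0" if "p ~= 0" for p
  proof
   assume "g p = 0"
   then have "?m * p = smult (c p) A" by (simp add: g_def)
   then have "degree (?m * p) \<le> degree A" using degree_smult_le by metis
   then show False using that by (simp add: degree_mult_eq degree_monom_eq)
  qed
  have "\<exists>p. p ~= 0 & (\<forall>i<n. \<phi> i (T (g p)) = 0)"
   by (rule Suc.IH[of "%p. T (g p)"]) (simp_all add: Suc.prems g g0)
  then obtain p where p: "p ~= 0" "\<forall>i<n. \<phi> i (T (g p)) = 0" by blast
  have "\<phi> n (T (g p)) = \<phi> n (T (?m * p)) + - c p * \<phi> n (T A)"
   using Suc.prems(1,2)[of n] Suc.prems(3,4) unfolding g_def by (simp del: smult_minus_left)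
  also have "... = 0" using A by (simp add: c_def)
  finally show ?thesis using p g0[of p] less_Suc_eq by (intro exI[of _ "g p"]) auto
 qed
qed

context abelian_monoidal_category
begin

lemma Add_minus_eq:
 assumes "g : Hom C X Y" "h : Hom C X Y" "Add C g (Scale C (- 1) h) = Zero C X Y"
 shows "g = h"
proof -
 interpret G: comm_group "hom_group C X Y" using hom_comm_group Hom_Obj[OF assms(1)] by blast
 have "Add C (Scale C (- 1) h) h = Zero C X Y"
  using Scale_plus[OF assms(2), of "- 1" 1] Scale_one[OF assms(2)] Scale_0[OF assms(2)] by simp
 then show ?thesis
  using G.m_assoc[of g "Scale C (- 1) h" h] assms Scale_Hom[OF assms(2), of "- 1"] by simp
qed

lemma schur:
 assumes X: "is_simple C X" and Y: "is_simple C Y" and f: "f : Hom C X Y"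
 shows "f = Zero C X Y \<or> is_iso C f"
proof -
 have o: "X : Ob" "Y : Ob" using X Y by (simp_all add: is_simple_def)
 have df: "f : Arr C" "Dom C f = X" "Cod C f = Y" using f by (auto simp: Hom_def)
 obtain k where k: "is_kernel C f k" using kernels df by blast
 have kh: "k : Hom C (Dom C k) X" and fk: "f ** k = Zero C (Dom C k) Y"
  and ku: "!!W g. [|g : Hom C W X; f ** g = Zero C W Y|] ==> \<exists>!u. u : Hom C W (Dom C k) & k ** u = g"
  using k df by (auto simp: is_kernel_def)
 have ka: "k : Arr C" "Cod C k = X" "Dom C k : Ob" using kh by (auto simp: Hom_def)
 have "is_mono C k"
  unfolding is_mono_def
 proof (intro conjI allI ballI impI)
  fix W g h assume gh: "g : Hom C W (Dom C k)" "h : Hom C W (Dom C k)" "k ** g = k ** h"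
  have "f ** k ** g = Zero C W Y"
   using Comp_assoc[OF gh(1) kh f] fk Zero_Comp[OF gh(1), of Y] o by simp
  then show "g = h" using ku[OF Comp_Hom[OF gh(1) kh]] gh by metis
 qed (rule ka)
 then consider "is_iso C k" | "k = Zero C (Dom C k) X"
  using X ka by (auto simp: is_simple_def)
 then show ?thesis
 proof cases
  case 1
  then have "f ** k = Zero C X Y ** k" using fk Zero_Comp[OF kh o(2)] by simp
  then have "f = Zero C X Y"
   using iso_cancel_right[OF 1, of f "Zero C X Y"] df ka Zero_Hom[OF o] by (simp add: Hom_def)
  then show ?thesis ..
 next
  case 2
  have "is_mono C f"
   unfolding is_mono_def df
  proof (intro conjI allI ballI impI)
   fix W g h assume gh: "g : Hom C W X" "h : Hom C W X" "f ** g = f ** h"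
   let ?d = "Add C g (Scale C (- 1) h)"
   have d: "?d : Hom C W X" using gh Scale_Hom by simp
   have fh: "f ** h : Hom C W Y" using gh f Comp_Hom by blast
   have "f ** ?d = Add C (f ** h) (Scale C (- 1) (f ** h))"
    using gh f Scale_Hom by (simp add: Comp_Add_right Comp_Scale_right)
   also have "... = Zero C W Y"
    using Scale_plus[OF fh, of 1 "- 1"] Scale_one[OF fh] Scale_0[OF fh] by simp
   finally obtain u where u: "u : Hom C W (Dom C k)" "k ** u = ?d" using ku[OF d] by blast
   then have "?d = Zero C W X" using 2 Zero_Comp[OF u(1) o(1)] by simp
   then show "g = h" using gh Add_minus_eq by blast
  qed (rule df)
  then show ?thesis using Y df by (auto simp: is_simple_def)
 qed
qed

definition poly_arr where
 "poly_arr X f p = foldr (%c r. Add C (Scale C c (Id C X)) (f ** r)) (coeffs p) (Zero C X X)"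

context
 fixes X f
 assumes f: "f : Hom C X X"
begin

lemma X_Obj: "X : Ob" using Hom_Obj[OF f] by simp

lemma poly_arr_Hom: "poly_arr X f p : Hom C X X"
proof -
 have "foldr (%c r. Add C (Scale C c (Id C X)) (f ** r)) cs (Zero C X X) : Hom C X X" for cs
  using X_Obj f by (induction cs) (auto intro!: Add_Hom Scale_Hom Comp_Hom Id_Hom)
 then show ?thesis by (simp add: poly_arr_def)
qed

lemma poly_arr_pCons: "poly_arr X f (pCons c p) = Add C (Scale C c (Id C X)) (f ** poly_arr X f p)"
proof (cases "p = 0 & c = 0")
 case True
 then show ?thesis
  using X_Obj Comp_Zero[OF f X_Obj] Scale_0[OF Id_Hom[OF X_Obj]] by (simp add: poly_arr_def)
next
 case False
 then show ?thesis by (auto simp: poly_arr_def cCons_def)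
qed

lemma Add_shuffle:
 assumes "a : Hom C X X" "b : Hom C X X" "c : Hom C X X" "d : Hom C X X"
 shows "Add C (Add C a b) (Add C c d) = Add C (Add C a c) (Add C b d)"
proof -
 interpret G: comm_group "hom_group C X X" using hom_comm_group X_Obj by blast
 show ?thesis using G.m_assoc G.m_lcomm G.m_closed assms by simp
qed

lemma poly_arr_0: "poly_arr X f 0 = Zero C X X"
 by (simp add: poly_arr_def)

lemma poly_arr_add: "poly_arr X f (p + q) = Add C (poly_arr X f p) (poly_arr X f q)"
proof (induction p q rule: poly_induct2)
 case 0
 show ?case using X_Obj by (simp add: poly_arr_0)
next
 case (pCons a p b q)
 have h: "f ** poly_arr X f r : Hom C X X" for r using f poly_arr_Hom Comp_Hom by blast
 have s: "Scale C c (Id C X) : Hom C X X" for c using Scale_Hom Id_Hom X_Obj by blast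
 show ?case
  using pCons Scale_plus[OF Id_Hom[OF X_Obj]] Comp_Add_right[OF poly_arr_Hom poly_arr_Hom f]
  by (simp add: poly_arr_pCons Add_shuffle[OF s s h h])
qed

lemma poly_arr_smult: "poly_arr X f (smult c p) = Scale C c (poly_arr X f p)"
proof (induction p)
 case 0
 show ?case using X_Obj by (simp add: poly_arr_0 Scale_Zero)
next
 case (pCons a p)
 have h: "f ** poly_arr X f r : Hom C X X" for r using f poly_arr_Hom Comp_Hom by blast
 have s: "Scale C c (Id C X) : Hom C X X" for c using Scale_Hom Id_Hom X_Obj by blast
 show ?case
  using pCons Scale_Add[OF s h] Scale_times[OF Id_Hom[OF X_Obj]] Comp_Scale_right[OF poly_arr_Hom f]
  by (simp add: poly_arr_pCons)
qed

lemma poly_arr_linear_factor: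
 "poly_arr X f ([:- a, 1:] * q) = Add C f (Scale C (- a) (Id C X)) ** poly_arr X f q"
proof -
 interpret G: comm_group "hom_group C X X" using hom_comm_group X_Obj by blast
 have h: "f ** poly_arr X f q : Hom C X X" using f poly_arr_Hom Comp_Hom by blast
 have s: "Scale C c (Id C X) : Hom C X X" for c using Scale_Hom Id_Hom X_Obj by blast
 have "[:- a, 1:] * q = smult (- a) q + pCons 0 q" by simp
 then have "poly_arr X f ([:- a, 1:] * q) = Add C (Scale C (- a) (poly_arr X f q)) (f ** poly_arr X f q)"
  using h Scale_0[OF Id_Hom[OF X_Obj]] by (simp only: poly_arr_add poly_arr_smult poly_arr_pCons) simp
 also have "... = Add C f (Scale C (- a) (Id C X)) ** poly_arr X f q"
  using f s h poly_arr_Hom[of q] G.m_comm[of "f ** poly_arr X f q" "Scale C (- a) (poly_arr X f q)"] Scale_Hom[OF poly_arr_Hom[of q]]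
  by (simp add: Comp_Add_left[OF poly_arr_Hom f s] Comp_Scale_left[OF poly_arr_Hom Id_Hom[OF X_Obj]] Id_left)
 finally show ?thesis .
qed

end
end

context premodular_category
begin

lemma is_basis_coords:
 assumes b: "is_basis C X Y n b" and XY: "X : Ob" "Y : Ob"
 obtains co where "!!g. g : Hom C X Y ==> g = hom_sum C X Y (%i. Scale C (co g i) (b i)) {..<n}"
  "!!g h i. [|g : Hom C X Y; h : Hom C X Y; i < n|] ==> co (Add C g h) i = co g i + co h i"
  "!!g a i. [|g : Hom C X Y; i < n|] ==> co (Scale C a g) i = a * co g i"
proof -
 let ?s = "%c. hom_sum C X Y (%i. Scale C (c i) (b i)) {..<n}"
 have bh: "b i : Hom C X Y" if "i < n" for i using b that by (simp add: is_basis_def)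
 have ex: "\<exists>!c. c : extensional {..<n} & g = ?s c" if "g : Hom C X Y" for g
  using b that by (simp add: is_basis_def)
 define co where "co g = (THE c. c : extensional {..<n} & g = ?s c)" for g
 have co: "co g : extensional {..<n} & g = ?s (co g)" if "g : Hom C X Y" for g
  unfolding co_def by (rule theI'[OF ex[OF that]])
 have uniq: "co g i = c i" if "g : Hom C X Y" "g = ?s c" "i < n" for g c i
 proof -
  have e: "?s (restrict c {..<n}) = ?s c"
   by (rule hom_sum_cong) (auto intro!: Scale_Hom bh XY)
  have "restrict c {..<n} : extensional {..<n} & g = ?s (restrict c {..<n})"
   unfolding e using that(2) by blast
  then have "co g = restrict c {..<n}" unfolding co_def by (rule the1_equality[OF ex[OF that(1)]])
  then show ?thesis using that(3) by simp
 qed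
 show ?thesis
 proof (rule that[of co])
  show "g = ?s (co g)" if "g : Hom C X Y" for g using co[OF that] by simp
  fix g h i assume gh: "g : Hom C X Y" "h : Hom C X Y" and i: "i < n"
  have "Add C g h = Add C (?s (co g)) (?s (co h))" using co gh by metis
  also have "... = hom_sum C X Y (%i. Add C (Scale C (co g i) (b i)) (Scale C (co h i) (b i))) {..<n}"
   by (rule hom_sum_Add[symmetric]) (auto intro!: Scale_Hom bh XY)
  also have "... = ?s (%i. co g i + co h i)"
   by (rule hom_sum_cong) (auto intro!: Scale_Hom Add_Hom bh XY simp: Scale_plus[OF bh])
  finally show "co (Add C g h) i = co g i + co h i" by (rule uniq[OF Add_Hom[OF gh] _ i])
 next
  fix g a i assume g: "g : Hom C X Y" and i: "i < n"
  have "Scale C a g = Scale C a (?s (co g))" using co g by metis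
  also have "... = hom_sum C X Y (%i. Scale C a (Scale C (co g i) (b i))) {..<n}"
   by (rule additive_hom_sum) (auto intro!: Scale_Hom Scale_Add bh XY)
  also have "... = ?s (%i. a * co g i)"
   by (rule hom_sum_cong) (auto intro!: Scale_Hom bh XY simp: Scale_times[OF bh])
  finally show "co (Scale C a g) i = a * co g i" by (rule uniq[OF Scale_Hom[OF g] _ i])
 qed
qed

text \<open>
 Schur's lemma over an algebraically closed field: an endomorphism of a simple object satisfies a
 polynomial equation, and one of the linear factors of the polynomial is not invertible.
\<close>

lemma simple_End:
 assumes X: "is_simple C X" and f: "f : Hom C X X"
 shows "\<exists>a. f = Scale C a (Id C X)"
proof -
 have o: "X : Ob" and id0: "Id C X ~= Zero C X X" using X by (simp_all add: is_simple_def)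
 obtain n b where b: "is_basis C X X n b" using hom_finite_dim o by blast
 obtain co where co: "!!g. g : Hom C X X ==> g = hom_sum C X X (%i. Scale C (co g i) (b i)) {..<n}"
  "!!g h i. [|g : Hom C X X; h : Hom C X X; i < n|] ==> co (Add C g h) i = co g i + co h i"
  "!!g a i. [|g : Hom C X X; i < n|] ==> co (Scale C a g) i = a * co g i"
  using is_basis_coords[OF b o o] by blast
 have bh: "b i : Hom C X X" if "i < n" for i using b that by (simp add: is_basis_def)
 have "\<exists>p. p ~= 0 & (\<forall>i<n. co (poly_arr X f (id p)) i = 0)"
  by (rule linear_conditions_poly) (simp_all add: poly_arr_add[OF f] poly_arr_smult[OF f] co(2,3) poly_arr_Hom[OF f])
 then obtain p where p: "p ~= 0" "\<forall>i<n. co (poly_arr X f p) i = 0" by auto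
 have "poly_arr X f p = hom_sum C X X (%i. Scale C (co (poly_arr X f p) i) (b i)) {..<n}"
  by (rule co(1)[OF poly_arr_Hom[OF f]])
 also have "... = hom_sum C X X (%i. Scale C 0 (Zero C X X)) {..<n}"
  by (rule hom_sum_cong) (auto intro!: Scale_Hom bh o Zero_Hom simp: p Scale_Zero o Scale_0[OF bh])
 also have "... = Scale C 0 (hom_sum C X X (%i. Zero C X X) {..<n})"
  by (rule additive_hom_sum[symmetric]) (auto intro!: Scale_Hom Scale_Add o Zero_Hom)
 also have "... = Zero C X X" by (rule Scale_0[OF hom_sum_Hom]) (auto intro!: o Zero_Hom)
 finally have "poly_arr X f p = Zero C X X" .
 with p(1) show ?thesis
 proof (induction "degree p" arbitrary: p)
  case 0
  then obtain c where c: "p = [:c:]" "c ~= 0" by (metis degree_eq_zeroE pCons_eq_0_iff)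
  have "Scale C c (Id C X) = Zero C X X"
   using 0(3) c Comp_Zero[OF f o] Scale_Hom[OF Id_Hom[OF o], of c] by (simp add: poly_arr_pCons[OF f] poly_arr_0[OF f])
  then have "Scale C (inverse c * c) (Id C X) = Zero C X X"
   using Scale_times[OF Id_Hom[OF o]] Scale_Zero[OF o o] by simp
  then show ?case using c id0 Scale_one[OF Id_Hom[OF o]] by simp
 next
  case (Suc d)
  then have "degree p > 0" by simp
  then obtain a where "poly p a = 0" using alg_closed_imp_poly_has_root by blast
  then obtain q where q: "p = [:- a, 1:] * q" by (auto simp: poly_eq_0_iff_dvd)
  have "q ~= 0" using Suc.prems(1) q by auto
  moreover from this have "degree p = 1 + degree q"
   unfolding q using degree_mult_eq[of "[:- a, 1:]" q] by (simp del: mult_pCons_left)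
  ultimately have q0: "q ~= 0" "degree q = d" using Suc.hyps(2) by simp_all
  let ?g = "Add C f (Scale C (- a) (Id C X))"
  have g: "?g : Hom C X X" by (intro Add_Hom f Scale_Hom Id_Hom o)
  from schur[OF X X g] show ?case
  proof
   assume g0: "?g = Zero C X X"
   have "Add C f (Scale C (- 1) (Scale C a (Id C X))) = Zero C X X"
    using g0 Scale_times[OF Id_Hom[OF o], of "- 1" a] by simp
   then have "f = Scale C a (Id C X)"
    by (rule Add_minus_eq[OF f Scale_Hom[OF Id_Hom[OF o]]])
   then show ?thesis by blast
  next
   assume i: "is_iso C ?g"
   have "?g ** poly_arr X f q = ?g ** Zero C X X"
    using Suc.prems(2) q poly_arr_linear_factor[OF f, of a q] Comp_Zero[OF g o] by simp
   then have "poly_arr X f q = Zero C X X"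
    using iso_cancel_left[OF i, of "poly_arr X f q" "Zero C X X"] poly_arr_Hom[OF f, of q] g Zero_Hom[OF o o]
    by (auto simp: Hom_def)
   then show ?thesis using Suc.hyps(1)[of q] q0 by simp
  qed
 qed
qed

end

context linear_monoidal_category
begin

lemma wsum_warr' [simp]: "[|word x; word y; !!i. i : I ==> F i : whom x y|] ==> wsum x y F I : whom x y"
 by (simp add: homs)

lemma wscale_id_inject:
 assumes "sc a (idw x) = sc b (idw x)" "idw x ~= wzero x x" "word x"
 shows "a = b"
proof (rule ccontr)
 assume "a ~= b"
 have h: "Id C (wobj x) : Hom C (wobj x) (wobj x)" using assms by (simp add: Id_Hom)
 have "Scale C a (Id C (wobj x)) = Scale C b (Id C (wobj x))"
  using arg_cong[OF assms(1), of underlying] by simp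
 then have "Scale C (a - b) (Id C (wobj x)) = Zero C (wobj x) (wobj x)"
  using Scale_plus[OF h, of a "- b"] Scale_plus[OF h, of b "- b"] Scale_0[OF h] by simp
 then have "sc (a - b) (idw x) = wzero x x" by (intro word_arr_eqI) simp_all
 then have "sc (inverse (a - b)) (sc (a - b) (idw x)) = sc (inverse (a - b)) (wzero x x)" by simp
 then show False using \<open>a ~= b\<close> assms(2,3) by simp
qed

end

context ribbon_category
begin

definition hat_word where
 "hat_word X Y A \<psi> = {;evR Y;A @ [X]}${[Y];\<psi>;[X]}${[Y];coevR X;}"

definition unhat_word where
 "unhat_word X Y A \<chi> = {Du Y # A;evR X;}${[Du Y];\<chi>;[Du X]}${;coevR Y;[Du X]}"

context
 fixes X Y A
 assumes XY [simp]: "X : Ob" "Y : Ob" "word A"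
begin

lemma hat_word_hom [simp]: "\<psi> : whom [Du X] (Du Y # A) ==> hat_word X Y A \<psi> : whom [Y] (A @ [X])"
 and unhat_word_hom [simp]: "\<chi> : whom [Y] (A @ [X]) ==> unhat_word X Y A \<chi> : whom [Du X] (Du Y # A)"
 by (auto simp: homs hat_word_def unhat_word_def)

lemma hat_unhat:
 assumes "\<chi> : whom [Y] (A @ [X])"
 shows "hat_word X Y A (unhat_word X Y A \<chi>) = \<chi>"
proof -
 have [simp]: "warr \<chi>" "dom \<chi> = [Y]" "cod \<chi> = A @ [X]" using assms by (auto simp: homs)
 have "hat_word X Y A (unhat_word X Y A \<chi>)
  = {A;evR X;[X]}${;\<chi>;[Du X, X]}${[Y];coevR X;}"
  by (rule rewrite[OF snake_right_left[of Y, OF _ refl], of _ "{A;evR X;[X]}${;\<chi>;[Du X, X]}" "[]" "[Du X, X]" "{[Y];coevR X;}"])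
   (simp_all add: hat_word_def unhat_word_def diagram)
 also have "... = {;\<chi>;}"
  by (rule rewrite[OF snake_right_left[of X, OF _ refl], of _ "idw (A @ [X])" A "[]" "{;\<chi>;}"])
   (simp_all add: diagram)
 finally show ?thesis by (simp add: layer_nil)
qed

lemma unhat_hat:
 assumes "\<psi> : whom [Du X] (Du Y # A)"
 shows "unhat_word X Y A (hat_word X Y A \<psi>) = \<psi>"
proof -
 have [simp]: "warr \<psi>" "dom \<psi> = [Du X]" "cod \<psi> = Du Y # A" using assms by (auto simp: homs)
 have "unhat_word X Y A (hat_word X Y A \<psi>)
  = {Du Y # A;evR X;}${;\<psi>;[X, Du X]}${;coevR X;[Du X]}"
  by (rule rewrite[OF snake_right_right[of Y, OF _ refl], of _ "{Du Y # A;evR X;}" "[]" "A @ [X, Du X]"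
    "{;\<psi>;[X, Du X]}${;coevR X;[Du X]}"])
   (simp_all add: hat_word_def unhat_word_def diagram)
 also have "... = {;\<psi>;}"
  by (rule rewrite[OF snake_right_right[of X, OF _ refl], of _ "{;\<psi>;}" "[]" "[]" "idw [Du X]"])
   (simp_all add: diagram)
 finally show ?thesis by (simp add: layer_nil)
qed

lemma hat_word_linear:
 "[|!!a. a : I ==> F a : whom [Du X] (Du Y # A)|] ==>
  hat_word X Y A (wsum [Du X] (Du Y # A) (%a. sc (c a) (F a)) I)
  = wsum [Y] (A @ [X]) (%a. sc (c a) (hat_word X Y A (F a))) I"
 by (simp add: hat_word_def homs layer_wsum comp_wsum wsum_comp)
  (intro wsum_cong; simp add: layer_wscale comp_wscale wscale_comp)

lemma unhat_word_linear:
 "[|!!a. a : I ==> F a : whom [Y] (A @ [X])|] ==>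
  unhat_word X Y A (wsum [Y] (A @ [X]) (%a. sc (c a) (F a)) I)
  = wsum [Du X] (Du Y # A) (%a. sc (c a) (unhat_word X Y A (F a))) I"
 by (simp add: unhat_word_def homs layer_wsum comp_wsum wsum_comp)
  (intro wsum_cong; simp add: layer_wscale comp_wscale wscale_comp)

lemma unhat_word_wscale: "\<chi> : whom [Y] (A @ [X]) ==> unhat_word X Y A (sc c \<chi>) = sc c (unhat_word X Y A \<chi>)"
 and hat_word_wscale: "\<psi> : whom [Du X] (Du Y # A) ==> hat_word X Y A (sc c \<psi>) = sc c (hat_word X Y A \<psi>)"
 by (simp_all add: unhat_word_def hat_word_def homs layer_wscale comp_wscale wscale_comp)

lemma hat_eq_zigzag:
 assumes "\<psi> : whom [Du X] (Du Y # A)"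
 shows "{A;evR X;}${;hat_word X Y A \<psi>;[Du X]} = {;evR Y;A}${[Y];\<psi>;}"
proof -
 have [simp]: "warr \<psi>" "dom \<psi> = [Du X]" "cod \<psi> = Du Y # A" using assms by (auto simp: homs)
 show ?thesis
  by (rule rewrite[OF snake_right_right[of X, OF _ refl], of _ "{;evR Y;A}${[Y];\<psi>;}" "[Y]" "[]" "idw [Y, Du X]"])
   (simp_all add: hat_word_def diagram)
qed

end
end

context premodular_category
begin

lemma simple_iso_zero:
 assumes "is_simple C X" "is_simple C Y" "\<not> isomorphic C X Y" "f : Hom C X Y"
 shows "f = Zero C X Y"
 using schur[OF assms(1,2,4)] assms(3,4) by (auto simp: isomorphic_def)

end

context premodular_category_with_choices
begin

abbreviation Sp where "Sp == Simp C"
abbreviation gdim where "gdim == global_dim C"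
abbreviation Ell where "Ell == elliptic_objects C"
abbreviation SOb where "SOb == SumObj C"

abbreviation (input) S where "S i == [Sp i]"
abbreviation (input) S' where "S' i == [Du (Sp i)]"
abbreviation d where "d i == qdim C (Sp i)"

lemma J_finite [simp]: "finite (J C)"
 using Sum_biproduct by (simp add: is_biproduct_def)

lemma Simp_Obj [simp]: "i : J C ==> Sp i : Ob"
 using Simp_simple[of i] by (simp add: is_simple_def)

lemma id_Simp_nonzero: "i : J C ==> idw (S i) ~= wzero (S i) (S i)"
 using Simp_simple[of i] by (auto simp: is_simple_def dest: arg_cong[where f = underlying])

lemma id_Nil_nonzero: "idw [] ~= wzero [] []"
 using Unit_simple by (auto simp: is_simple_def dest: arg_cong[where f = underlying])

lemma schur_zero:
 assumes ik: "i : J C" "k : J C" "i ~= k" and f: "f : whom (S i) (S k)"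
 shows "f = wzero (S i) (S k)"
proof -
 have "\<not> isomorphic C (Sp i) (Sp k)"
 proof
  assume "isomorphic C (Sp i) (Sp k)"
  moreover have "isomorphic C (Sp i) (Sp i)"
   using ik Id_Hom[of "Sp i"] by (auto simp: isomorphic_def intro!: bexI[of _ "Id C (Sp i)"])
  ultimately show False using Simp_complete[OF Simp_simple[OF ik(1)]] ik by blast
 qed
 then have "underlying f = Zero C (Sp i) (Sp k)"
  using simple_iso_zero[OF Simp_simple Simp_simple] ik whom_underlying[OF f] by simp
 then show ?thesis using f by (intro word_arr_eqI) (auto simp: homs)
qed

definition scal where
 "scal f = (SOME a. f = sc a (idw (dom f)))"

lemma scal_eq: "[|i : J C; f : whom (S i) (S i)|] ==> f = sc (scal f) (idw (S i))"
proof -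
 assume i: "i : J C" and f: "f : whom (S i) (S i)"
 obtain a where "underlying f = Scale C a (Id C (Sp i))"
  using simple_End[OF Simp_simple[OF i]] whom_underlying[OF f] by auto
 then have "f = sc a (idw (dom f))" using f by (intro word_arr_eqI) (auto simp: homs)
 then have "f = sc (scal f) (idw (dom f))" unfolding scal_def by (rule someI)
 then show ?thesis using f by (simp add: homs)
qed

lemma scal_Nil: "f : whom [] [] ==> f = sc (scal f) (idw [])"
proof -
 assume f: "f : whom [] []"
 obtain a where "underlying f = Scale C a (Id C (Unit C))"
  using simple_End[OF Unit_simple] whom_underlying[OF f] by auto
 then have "f = sc a (idw (dom f))" using f by (intro word_arr_eqI) (auto simp: homs)
 then have "f = sc (scal f) (idw (dom f))" unfolding scal_def by (rule someI)
 then show ?thesis using f by (simp add: homs)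
qed

lemma scal_unique: "[|i : J C; f = sc a (idw (S i))|] ==> scal f = a"
 using scal_eq[of i f] wscale_id_inject[OF _ id_Simp_nonzero, of "scal f" i a] by (auto simp: homs)

text \<open>By semisimplicity the identity of \<open>x\<close> is a sum of arrows through simple objects.\<close>

lemma simples_separate:
 assumes f: "f : whom x y" and g: "g : whom x y"
  and fg: "!!k h. [|k : J C; h : whom (S k) x|] ==> f$h = g$h"
 shows "f = g"
proof -
 have w [simp]: "word x" "word y" using f warr_word[of f] by (auto simp: homs)
 let ?X = "wobj x" and ?Y = "wobj y"
 obtain n F inc prj where F: "\<forall>i<(n::nat). is_simple C (F i)" and b: "is_biproduct C {..<n} F ?X inc prj"
  using semisimple[of ?X] by auto
 have ip: "inc m : Hom C (F m) ?X" "prj m : Hom C ?X (F m)" if "m < n" for m using b that by (auto simp: is_biproduct_def)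
 have eq: "underlying f ** inc m = underlying g ** inc m" if m: "m < n" for m
 proof -
  obtain k where k: "k : J C" "isomorphic C (F m) (Sp k)" using Simp_complete F m by blast
  then obtain t where t: "t : Hom C (F m) (Sp k)" "is_iso C t" by (auto simp: isomorphic_def)
  let ?h = "(S k, inc m ** inv_arr C t, x)"
  have "?h : whom (S k) x"
   using t ip[OF m] k by (auto simp: homs Hom_def intro!: warr_intro)
  then have "underlying (f$?h) = underlying (g$?h)" using fg k by metis
  then have "(underlying f ** inc m) ** inv_arr C t = (underlying g ** inc m) ** inv_arr C t"
   using t ip[OF m] whom_underlying[OF f] whom_underlying[OF g] by (simp add: Hom_def Comp_Comp)
  then show ?thesis
   by (rule iso_cancel_right[rotated 5])
    (use t ip[OF m] whom_underlying[OF f] whom_underlying[OF g] in "auto simp: Hom_def")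
 qed
 have expand: "underlying h = hom_sum C ?X ?Y (%m. (underlying h ** inc m) ** prj m) {..<n}" if h: "h : whom x y" for h
 proof -
  have hh: "underlying h : Hom C ?X ?Y" by (rule whom_underlying[OF h])
  have "underlying h = underlying h ** hom_sum C ?X ?X (%m. inc m ** prj m) {..<n}"
   using b Id_right[OF hh] by (simp add: is_biproduct_def)
  also have "... = hom_sum C ?X ?Y (%m. underlying h ** inc m ** prj m) {..<n}"
   by (rule additive_hom_sum) (use ip hh in "auto intro!: Comp_Add_right Comp_Hom")
  also have "... = hom_sum C ?X ?Y (%m. (underlying h ** inc m) ** prj m) {..<n}"
   by (rule hom_sum_cong) (use Comp_assoc[OF ip(2) ip(1) hh] in \<open>auto intro!: Comp_Hom ip hh\<close>)
  finally show ?thesis .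
 qed
 have "underlying f = hom_sum C ?X ?Y (%m. (underlying f ** inc m) ** prj m) {..<n}" by (rule expand[OF f])
 also have "... = hom_sum C ?X ?Y (%m. (underlying g ** inc m) ** prj m) {..<n}"
  by (rule hom_sum_cong) (auto simp: eq intro!: Comp_Hom ip whom_underlying[OF g])
 also have "... = underlying g" by (rule expand[OF g, symmetric])
 finally have "underlying f = underlying g" .
 then show ?thesis using f g by (intro word_arr_eqI) (auto simp: homs)
qed

lemma qtrace_eq:
 assumes [simp]: "X : Ob" and f: "f : whom [X] [X]"
  and a: "evR X${;f;[Du X]}$coev X = sc a (idw [])"
 shows "qtrace C (underlying f) = a"
proof -
 have [simp]: "warr f" "dom f = [X]" "cod f = [X]" using f by (auto simp: homs)
 let ?e = "EvR C X ** (underlying f @@ Id C (Du X)) ** Coev C X"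
 have e: "?e = Scale C a (Id C (Unit C))"
  using arg_cong[OF a, of underlying] by (simp add: underlying_layer_single)
 have "(THE b. ?e = Scale C b (Id C (Unit C))) = a"
 proof (rule the_equality)
  show "?e = Scale C a (Id C (Unit C))" by (rule e)
  fix b assume "?e = Scale C b (Id C (Unit C))"
  then have "sc b (idw []) = sc a (idw [])" using e by (intro word_arr_eqI) simp_all
  then show "b = a" using wscale_id_inject[OF _ id_Nil_nonzero] by simp
 qed
 then show ?thesis by (simp add: qtrace_def)
qed

lemma loop_value:
 assumes [simp]: "i : J C"
 shows "evR (Sp i)$coev (Sp i) = sc (d i) (idw [])"
  "wEv (Sp i)$coevR (Sp i) = sc (d i) (idw [])"
proof -
 let ?l = "evR (Sp i)$coev (Sp i)"
 have l: "?l = sc (scal ?l) (idw [])" by (rule scal_Nil) (simp add: homs)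
 have "qtrace C (underlying (idw (S i))) = scal ?l"
 proof (rule qtrace_eq)
  show "evR (Sp i)${;idw (S i);S' i}$coev (Sp i) = sc (scal ?l) (idw [])"
   by (subst l[symmetric]) simp
 qed (simp_all add: homs)
 then have "d i = scal ?l" by (simp add: qdim_def)
 then show *: "?l = sc (d i) (idw [])" using l by metis
 show "wEv (Sp i)$coevR (Sp i) = sc (d i) (idw [])"
  using * trace_left_right[of "Sp i" _ "idw (S i)", OF _ refl] by simp
qed

lemma qtrace_simple:
 assumes [simp]: "i : J C" and f: "f : whom (S i) (S i)"
 shows "qtrace C (underlying f) = scal f * d i"
proof (rule qtrace_eq[OF _ f])
 have e: "{;f;S' i} = sc (scal f) (idw (S i @ S' i))"
  by (subst scal_eq[OF assms]) (simp add: layer_wscale)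
 show "evR (Sp i)${;f;S' i}$coev (Sp i) = sc (scal f * d i) (idw [])"
  unfolding e by (simp add: comp_wscale wscale_comp loop_value)
qed simp

text \<open>Otherwise \<open>wEvR\<close> would vanish on all arrows from simple objects, against the snake identity.\<close>

lemma d_nonzero:
 assumes i [simp]: "i : J C"
 shows "d i ~= 0"
proof
 assume d0: "d i = 0"
 let ?X = "Sp i"
 let ?V = "[?X, Du ?X]"
 obtain k0 where k0: "k0 : J C" "Sp k0 = Unit C" using Simp_Unit by blast
 have z: "evR ?X$h = wzero [] []" if h: "h : whom [] ?V" for h
 proof -
  have [simp]: "warr h" "dom h = []" "cod h = ?V" using h by (auto simp: homs)
  let ?f = "{[?X];wEv ?X;}${;h;[?X]}"
  have f: "?f : whom [?X] [?X]" by (simp add: homs)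
  have "{;h;} = {;?f;[Du ?X]}${;coev ?X;}"
   by (rule rewrite[OF ev_coev(2)[symmetric], of ?X _ "idw ?V" "[?X]" "[]" "{;h;}"]) (simp_all add: diagram)
  then have "h = {;?f;[Du ?X]}$coev ?X" by (simp add: layer_nil)
  also have "... = sc (scal ?f) (coev ?X)"
   by (subst scal_eq[OF i f]) (simp add: layer_wscale wscale_comp)
  finally have "evR ?X$h = evR ?X$sc (scal ?f) (coev ?X)" by (rule arg_cong)
  also have "... = wzero [] []" by (simp add: comp_wscale loop_value d0 wscale_0)
  finally show ?thesis .
 qed
 have "evR ?X = wzero ?V []"
 proof (rule simples_separate)
  fix k h assume k: "k : J C" and h: "h : whom (S k) ?V"
  then have [simp]: "warr h" "dom h = S k" "cod h = ?V" by (auto simp: homs)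
  have "evR ?X$h = wzero (S k) []"
  proof (cases "k = k0")
   case True
   have "h$fuse [] : whom [] ?V" using k0 True by (simp add: homs)
   then have "(evR ?X$h)$fuse [] = wzero [] []"
    using z k0 True by (simp add: cassoc)
   then have "((evR ?X$h)$fuse [])$unfuse [] = wzero (S k) []"
    using k0 True by simp
   then show ?thesis using k0 True by (simp add: cassoc fuse_unfuse)
  next
   case False
   have "fuse []$(evR ?X$h) = wzero (S k) (S k0)"
    by (rule schur_zero) (use k k0 False in "auto simp: homs")
   then have "unfuse []$fuse []$(evR ?X$h) = wzero (S k) []" using k0 k by simp
   then show ?thesis using k by (simp add: cassoc[symmetric] unfuse_fuse)
  qed
  then show "evR ?X$h = wzero ?V []$h" using k by simp
 qed (simp_all add: homs)
 then have "idw [?X] = wzero [?X] [?X]"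
  using snake_right_left[of ?X, OF _ refl] by simp
 then show False using id_Simp_nonzero[OF i] by simp
qed

end

section \<open>Dual bases\<close>

context linear_monoidal_category
begin

lemma hin:
 "word x ==> idw x : whom x x" "[|word x; word y|] ==> wzero x y : whom x y" "f : whom x y ==> sc a f : whom x y"
 "[|g : whom y z; f : whom x y|] ==> g$f : whom x z"
 "[|word x; word y; !!i. i : I ==> F i : whom x y|] ==> wsum x y F I : whom x y"
 by (auto simp: homs)

lemma layer_whom: "[|word p; word q; f : whom x y; x' = p @ x @ q; y' = p @ y @ q|] ==> {p;f;q} : whom x' y'"
 by (auto simp: homs)

lemma wsum_cong_whom: "[|word x; word y; !!i. i : I ==> F i = G i; !!i. i : I ==> G i : whom x y|] ==> wsum x y F I = wsum x y G I"
 by (rule wsum_cong) (simp_all add: homs)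

lemma comp_wsum_whom: "[|g : whom y z; word x; !!i. i : I ==> F i : whom x y|] ==> g$wsum x y F I = wsum x z (%i. g$F i) I"
 using comp_wsum[of g y x I F] by (simp add: homs)

lemma wsum_comp_whom: "[|g : whom x y; word z; !!i. i : I ==> F i : whom y z|] ==> wsum y z F I$g = wsum x z (%i. F i$g) I"
 using wsum_comp[of g y z I F] by (simp add: homs)

lemma layer_wsum_whom: "[|word p; word q; word x; word y; !!i. i : I ==> F i : whom x y; x' = p @ x @ q; y' = p @ y @ q|] ==>
  {p;wsum x y F I;q} = wsum x' y' (%i. {p;F i;q}) I"
 using layer_wsum[of p q x y I F] by (simp add: homs)

lemma comp_wscale_whom: "[|g : whom y z; f : whom x y|] ==> g$sc a f = sc a (g$f)"
 and wscale_comp_whom: "[|g : whom y z; f : whom x y|] ==> sc a g$f = sc a (g$f)"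
 by (simp_all add: homs comp_wscale wscale_comp)

lemma comp_assoc_whom: "[|h : whom y z; g : whom x y; f : whom w x|] ==> (h$g)$f = h$g$f"
 by (simp add: homs cassoc)

lemma wsum_restrict:
 assumes w: "word x" "word y" and K: "finite K" "I \<subseteq> K" and F: "!!i. i : I ==> F i : whom x y"
  "!!i. i : K - I ==> F i = wzero x y"
 shows "wsum x y F K = wsum x y F I"
proof -
 have o: "wobj x : Ob" "wobj y : Ob" using w by simp_all
 interpret G: comm_group "hom_group C (wobj x) (wobj y)" by (rule hom_comm_group[OF o])
 have "finprod (hom_group C (wobj x) (wobj y)) (%i. underlying (F i)) I
   = finprod (hom_group C (wobj x) (wobj y)) (%i. underlying (F i)) K"
 proof (rule G.finprod_mono_neutral_cong_left)
  show "(%i. underlying (F i)) : K \<rightarrow> carrier (hom_group C (wobj x) (wobj y))"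
  proof
   fix i assume "i : K"
   then have "F i : whom x y" using F w by (cases "i : I") (auto intro: hin)
   then show "underlying (F i) : carrier (hom_group C (wobj x) (wobj y))" by (simp add: whom_underlying)
  qed
 qed (use K F(2) in auto)
 then show ?thesis by (simp add: wsum_def hom_sum_def)
qed

lemma wsum_reindex:
 assumes w: "word x" "word y" and e: "inj_on e I" and F: "!!i. i : I ==> F (e i) : whom x y"
 shows "wsum x y F (e ` I) = wsum x y (%i. F (e i)) I"
proof -
 have o: "wobj x : Ob" "wobj y : Ob" using w by simp_all
 interpret G: comm_group "hom_group C (wobj x) (wobj y)" by (rule hom_comm_group[OF o])
 have "finprod (hom_group C (wobj x) (wobj y)) (%i. underlying (F i)) (e ` I)
   = finprod (hom_group C (wobj x) (wobj y)) (%i. underlying (F (e i))) I"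
  by (rule G.finprod_reindex[OF _ e]) (auto simp: whom_underlying F)
 then show ?thesis by (simp add: wsum_def hom_sum_def)
qed

lemma is_basisI:
 assumes w [simp]: "word x" "word y" and b: "!!a. a < n ==> b a : whom x y"
  and span: "!!f. f : whom x y ==> f = wsum x y (%a. sc (\<kappa> f a) (b a)) {..<n}"
  and indep: "!!c a. a < n ==> \<kappa> (wsum x y (%a. sc (c a) (b a)) {..<n}) a = c a"
 shows "is_basis C (wobj x) (wobj y) n (%a. underlying (b a))"
 unfolding is_basis_def
proof (intro conjI allI impI ballI)
 fix f assume f: "f : Hom C (wobj x) (wobj y)"
 let ?f = "(x, f, y)"
 let ?s = "%c. wsum x y (%a. sc (c a) (b a)) {..<n}"
 have fw: "?f : whom x y" using f by (simp add: homs warrI)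
 have sw: "?s c : whom x y" for c by (intro hin w b) simp
 have u: "f = hom_sum C (wobj x) (wobj y) (%i. Scale C (c i) (underlying (b i))) {..<n} \<longleftrightarrow> ?f = ?s c" for c
  by (auto simp: wsum_def)
 have r: "?s (restrict c {..<n}) = ?s c" for c
  by (intro wsum_cong_whom hin w b) simp_all
 show "\<exists>!c. c : extensional {..<n} & f = hom_sum C (wobj x) (wobj y) (%i. Scale C (c i) (underlying (b i))) {..<n}"
 proof (rule ex1I)
  show "restrict (\<kappa> ?f) {..<n} : extensional {..<n} &
   f = hom_sum C (wobj x) (wobj y) (%i. Scale C (restrict (\<kappa> ?f) {..<n} i) (underlying (b i))) {..<n}"
   unfolding u r using span[OF fw] by simp
  fix c assume c: "c : extensional {..<n} & f = hom_sum C (wobj x) (wobj y) (%i. Scale C (c i) (underlying (b i))) {..<n}"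
  then have "?f = ?s c" using u by blast
  then have "\<kappa> ?f a = c a" if "a < n" for a using indep[OF that, of c] by metis
  then show "c = restrict (\<kappa> ?f) {..<n}" using c by (auto simp: extensional_def fun_eq_iff)
 qed
qed (simp add: whom_underlying b)

lemma is_basis_span:
 assumes w: "word x" "word y" and b: "is_basis C (wobj x) (wobj y) n b" and f: "f : whom x y"
 obtains c where "f = wsum x y (%a. sc (c a) (x, b a, y)) {..<n}"
proof -
 obtain c where "underlying f = hom_sum C (wobj x) (wobj y) (%i. Scale C (c i) (b i)) {..<n}"
  using b whom_underlying[OF f] unfolding is_basis_def by metis
 then have "f = wsum x y (%a. sc (c a) (x, b a, y)) {..<n}"
  using f by (intro word_arr_eqI) (auto simp: homs)
 then show ?thesis by (rule that)
qed

end

context premodular_category_with_choices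
begin

definition isotypic_frame :: "'o list => 'j => nat => (nat => ('o, 'a) word_arr) => (nat => ('o, 'a) word_arr) => bool" where
 "isotypic_frame x j n p c \<longleftrightarrow> (\<forall>a<n. p a : whom x (S j)) & (\<forall>a<n. c a : whom (S j) x) &
   (\<forall>a<n. \<forall>b<n. p a$c b = (if a = b then idw (S j) else wzero (S j) (S j))) &
   (\<forall>h\<in>whom (S j) x. h = wsum (S j) x (%a. sc (scal (p a$h)) (c a)) {..<n}) &
   (\<forall>f\<in>whom x (S j). f = wsum x (S j) (%a. sc (scal (f$c a)) (p a)) {..<n})"

lemma isotypic_frame_exists:
 assumes x [simp]: "word x" and j [simp]: "j : J C"
 shows "\<exists>n p c. isotypic_frame x j n p c"
proof -
 let ?X = "wobj x" and ?Y = "Sp j"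
 obtain N F inc prj where F: "\<forall>i<(N::nat). is_simple C (F i)" and b: "is_biproduct C {..<N} F ?X inc prj"
  using semisimple[of ?X] by auto
 have ip: "inc m : Hom C (F m) ?X" "prj m : Hom C ?X (F m)" "F m : Ob" if "m < N" for m using b that by (auto simp: is_biproduct_def)
 have pi: "prj l ** inc m = (if m = l then Id C (F m) else Zero C (F m) (F l))" if "m < N" "l < N" for m l
  using b that by (auto simp: is_biproduct_def)
 define K where "K = {m. m < N & isomorphic C (F m) ?Y}"
 have "\<exists>t. t : Hom C (F m) ?Y & is_iso C t" if "m : K" for m using that by (auto simp: K_def isomorphic_def)
 then obtain t where t: "!!m. m : K ==> t m : Hom C (F m) ?Y & is_iso C (t m)" by metis
 have ti: "inv_arr C (t m) : Hom C ?Y (F m)" if "m : K" for m using t[OF that] by (auto simp: Hom_def)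
 define w where "w m = (x, t m ** prj m, S j)" for m
 define v where "v m = (S j, inc m ** inv_arr C (t m), x)" for m
 define q where "q m = ([F m], inc m, x)$(x, prj m, [F m])" for m
 have wh: "w m : whom x (S j)" if "m : K" for m
  using t[OF that] ip[of m] that by (auto simp: K_def w_def homs intro!: warrI Comp_Hom)
 have vh: "v m : whom (S j) x" if "m : K" for m
  using t[OF that] ti[OF that] ip[of m] that by (auto simp: K_def v_def homs intro!: warrI Comp_Hom)
 have qh: "q m : whom x x" if "m < N" for m
  using ip[OF that] by (auto simp: q_def homs intro!: warr_comp warrI)
 have vw: "q m = v m$w m" if "m : K" for m
  using t[OF that] ip[of m] that by (intro word_arr_eqI) (auto simp: q_def K_def v_def w_def Hom_def Comp_Comp)
 have wv: "w l$v m = (if l = m then idw (S j) else wzero (S j) (S j))" if "l : K" "m : K" for l m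
 proof (rule word_arr_eqI)
  have l: "l < N" "m < N" using that by (auto simp: K_def)
  have "underlying (w l$v m) = t l ** (prj l ** inc m) ** inv_arr C (t m)"
   using t[OF that(1)] ti[OF that(2)] ip[OF l(1)] ip[OF l(2)] by (auto simp: v_def w_def Hom_def Comp_Comp)
  also have "... = (if l = m then Id C ?Y else Zero C ?Y ?Y)"
   unfolding pi[OF l(2,1)] using t[OF that(1)] t[OF that(2)] ti[OF that(2)] ip[OF l(1)]
    Zero_Comp[OF ti[OF that(2)], of "F l"] Comp_Zero[of "t l" "F l" ?Y ?Y] by (auto simp: Hom_def)
  finally show "underlying (w l$v m) = underlying (if l = m then idw (S j) else wzero (S j) (S j))" by simp
 qed (auto simp: w_def v_def)
 have id: "idw x = wsum x x q {..<N}"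
 proof (rule word_arr_eqI)
  have "hom_sum C ?X ?X (%m. underlying (q m)) {..<N} = hom_sum C ?X ?X (%m. inc m ** prj m) {..<N}"
   by (rule hom_sum_cong) (auto simp: q_def intro!: Comp_Hom ip)
  then show "underlying (idw x) = underlying (wsum x x q {..<N})"
   using b by (simp add: is_biproduct_def)
 qed simp_all
 have zero: "q m$h = wzero (S j) x" "f$q m = wzero x (S j)"
  if m: "m < N" "m \<notin> K" and h: "h : whom (S j) x" and f: "f : whom x (S j)" for m h f
 proof -
  have n: "\<not> isomorphic C (F m) ?Y" using m by (simp add: K_def)
  have n': "\<not> isomorphic C ?Y (F m)"
  proof
   assume "isomorphic C ?Y (F m)"
   then obtain s where s: "s : Hom C ?Y (F m)" "is_iso C s" by (auto simp: isomorphic_def)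
   then have "inv_arr C s : Hom C (F m) ?Y" by (auto simp: Hom_def)
   then show False using s n iso_inv by (auto simp: isomorphic_def)
  qed
  have "prj m ** underlying h = Zero C ?Y (F m)"
   by (rule simple_iso_zero[OF Simp_simple _ n']) (use F m ip[OF m(1)] whom_underlying[OF h] j in \<open>auto intro!: Comp_Hom\<close>)
  then have "underlying (q m$h) = Zero C ?Y ?X"
   using ip[OF m(1)] whom_underlying[OF h] Comp_Zero[OF ip(1)[OF m(1)], of ?Y] by (simp add: q_def Hom_def Comp_Comp)
  then show "q m$h = wzero (S j) x" using h by (intro word_arr_eqI) (auto simp: q_def homs)
  have "underlying f ** inc m = Zero C (F m) ?Y"
   by (rule simple_iso_zero[OF _ Simp_simple n]) (use j F m ip[OF m(1)] whom_underlying[OF f] in \<open>auto intro!: Comp_Hom\<close>)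
  then have "(underlying f ** inc m) ** prj m = Zero C ?X ?Y"
   using Zero_Comp[OF ip(2)[OF m(1)], of ?Y] by simp
  then have "underlying (f$q m) = Zero C ?X ?Y"
   using ip[OF m(1)] whom_underlying[OF f] by (simp add: q_def Hom_def Comp_Comp)
  then show "f$q m = wzero x (S j)" using f by (intro word_arr_eqI) (auto simp: q_def homs)
 qed
 define n where "n = card K"
 have Kf: "finite K" by (simp add: K_def)
 obtain e where e: "bij_betw e {..<n} K"
  using ex_bij_betw_nat_finite[OF Kf] by (auto simp: n_def atLeast0LessThan)
 have eK: "e a : K" if "a < n" for a using e that by (auto simp: bij_betw_def)
 have e': "e ` {..<n} = K" "inj_on e {..<n}" using e by (auto simp: bij_betw_def)
 have KN: "K \<subseteq> {..<N}" by (auto simp: K_def)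
 have "isotypic_frame x j n (%a. w (e a)) (%a. v (e a))"
  unfolding isotypic_frame_def
 proof (intro conjI allI impI ballI)
  fix a b assume "a < n" "b < n"
  then show "w (e a)$v (e b) = (if a = b then idw (S j) else wzero (S j) (S j))"
   using wv eK e'(2) by (auto simp: inj_on_def)
 next
  fix h assume h: "h : whom (S j) x"
  then have hs: "warr h" "dom h = S j" "cod h = x" by (auto simp: homs)
  have c: "q m$h = sc (scal (w m$h)) (v m)" if m: "m : K" for m
  proof -
   have "w m$h = sc (scal (w m$h)) (idw (S j))"
    by (rule scal_eq) (use wh[OF m] hs in "auto simp: homs")
   then have "v m$w m$h = v m$sc (scal (w m$h)) (idw (S j))" by simp
   then show ?thesis using vw[OF m] wh[OF m] vh[OF m] hs by (simp add: homs cassoc comp_wscale)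
  qed
  have "h = wsum x x q {..<N}$h" unfolding id[symmetric] using hs by simp
  also have "... = wsum (S j) x (%m. q m$h) {..<N}" by (intro wsum_comp_whom h qh x) simp
  also have "... = wsum (S j) x (%m. q m$h) K"
   by (rule wsum_restrict) (use KN j x zero(1)[OF _ _ h hin(2)[of x "S j"]] in \<open>auto intro!: hin(4)[OF qh h]\<close>)
  also have "... = wsum (S j) x (%a. q (e a)$h) {..<n}"
   unfolding e'(1)[symmetric] by (rule wsum_reindex) (use e' eK KN j x in "auto intro!: hin(4)[OF qh h]")
  also have "... = wsum (S j) x (%a. sc (scal (w (e a)$h)) (v (e a))) {..<n}"
   by (rule wsum_cong_whom) (use eK j x in "auto simp: c intro!: hin(3) vh")
  finally show "h = wsum (S j) x (%a. sc (scal (w (e a)$h)) (v (e a))) {..<n}" .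
 next
  fix f assume f: "f : whom x (S j)"
  then have fs: "warr f" "dom f = x" "cod f = S j" by (auto simp: homs)
  have c: "f$q m = sc (scal (f$v m)) (w m)" if m: "m : K" for m
  proof -
   have "f$v m = sc (scal (f$v m)) (idw (S j))"
    by (rule scal_eq) (use vh[OF m] fs in "auto simp: homs")
   then have "(f$v m)$w m = sc (scal (f$v m)) (idw (S j))$w m" by simp
   then show ?thesis using vw[OF m] wh[OF m] vh[OF m] fs by (simp add: homs cassoc wscale_comp)
  qed
  have "f = f$wsum x x q {..<N}" unfolding id[symmetric] using fs by simp
  also have "... = wsum x (S j) (%m. f$q m) {..<N}" by (intro comp_wsum_whom f qh x) simp
  also have "... = wsum x (S j) (%m. f$q m) K"
   by (rule wsum_restrict) (use KN j x zero(2)[OF _ _ hin(2)[of "S j" x] f] in \<open>auto intro!: hin(4)[OF f qh]\<close>)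
  also have "... = wsum x (S j) (%a. f$q (e a)) {..<n}"
   unfolding e'(1)[symmetric] by (rule wsum_reindex) (use e' eK KN j x in "auto intro!: hin(4)[OF f qh]")
  also have "... = wsum x (S j) (%a. sc (scal (f$v (e a))) (w (e a))) {..<n}"
   by (rule wsum_cong_whom) (use eK j x in "auto simp: c intro!: hin(3) wh")
  finally show "f = wsum x (S j) (%a. sc (scal (f$v (e a))) (w (e a))) {..<n}" .
 qed (use wh vh eK in auto)
 then show ?thesis by blast
qed

lemma scal_wsum:
 fixes n :: nat
 assumes j [simp]: "j : J C" and p: "!!a b. [|a < n; b < n|] ==> p a$c b = (if a = b then sc s (idw (S j)) else wzero (S j) (S j))"
  and x: "word x" and h: "!!a. a < n ==> p a : whom x (S j)" "!!a. a < n ==> c a : whom (S j) x" and a: "a < n"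
 shows "scal (wsum x (S j) (%a. sc (k a) (p a)) {..<n}$c a) = k a * s"
  "scal (p a$wsum (S j) x (%a. sc (k a) (c a)) {..<n}) = k a * s"
proof -
 have "wsum x (S j) (%a. sc (k a) (p a)) {..<n}$c a
   = wsum (S j) (S j) (%b. sc (k b) (p b$c a)) {..<n}"
  by (subst wsum_comp_whom[OF h(2)[OF a]]) (auto simp: wscale_comp_whom[OF h(1) h(2)[OF a]] intro!: wsum_cong_whom hin(3,4) h a)
 also have "... = sc (k a) (p a$c a)"
  by (rule wsum_single) (use p a in "auto intro!: hin(3,1)")
 finally show "scal (wsum x (S j) (%a. sc (k a) (p a)) {..<n}$c a) = k a * s"
  using p[OF a a] by (intro scal_unique[OF j]) simp
 have "p a$wsum (S j) x (%a. sc (k a) (c a)) {..<n}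
   = wsum (S j) (S j) (%b. sc (k b) (p a$c b)) {..<n}"
  by (subst comp_wsum_whom[OF h(1)[OF a]]) (auto simp: comp_wscale_whom[OF h(1)[OF a] h(2)] intro!: x wsum_cong_whom hin(3,4) h a)
 also have "... = sc (k a) (p a$c a)"
  by (rule wsum_single) (use p a in "auto intro!: hin(3,1)")
 finally show "scal (p a$wsum (S j) x (%a. sc (k a) (c a)) {..<n}) = k a * s"
  using p[OF a a] by (intro scal_unique[OF j]) simp
qed

lemma hat_eq:
 assumes [simp]: "A : Ob" "i : J C" "j : J C" and p: "(S' i, p, [Du (Sp j), A]) : whom (S' i) [Du (Sp j), A]"
 shows "hat C A i j p = underlying (hat_word (Sp i) (Sp j) [A] (S' i, p, [Du (Sp j), A]))"
proof -
 have [simp]: "warr (S' i, p, [Du (Sp j), A])" using p by (simp add: homs)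
 show ?thesis by (simp add: hat_def hat_word_def Let_def layer_def)
qed

lemma dual_basis_exists:
 assumes A [simp]: "A : Ob" and ij [simp]: "i : J C" "j : J C"
 shows "\<exists>t. is_dual_basis_pair C A i j t"
proof -
 let ?x = "[A, Sp i]" and ?X = "Sp i" and ?Y = "Sp j"
 let ?y = "[Du ?Y, A]"
 obtain n p c where "isotypic_frame ?x j n p c" using isotypic_frame_exists[of ?x j] by auto
 then have p: "!!a. a < n ==> p a : whom ?x (S j)" and c: "!!a. a < n ==> c a : whom (S j) ?x"
  and pc: "!!a b. [|a < n; b < n|] ==> p a$c b = (if a = b then idw (S j) else wzero (S j) (S j))"
  and hx: "!!h. h : whom (S j) ?x ==> h = wsum (S j) ?x (%a. sc (scal (p a$h)) (c a)) {..<n}"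
  and fx: "!!f. f : whom ?x (S j) ==> f = wsum ?x (S j) (%a. sc (scal (f$c a)) (p a)) {..<n}"
  unfolding isotypic_frame_def by blast+
 have pc': "p a$c b = (if a = b then sc 1 (idw (S j)) else wzero (S j) (S j))" if "a < n" "b < n" for a b
  using pc[OF that] by simp
 define s where "s a = unhat_word ?X ?Y [A] (sc (1 / d j) (c a))" for a
 have sh: "s a : whom (S' i) ?y" if "a < n" for a
  using unhat_word_hom[of ?X ?Y "[A]" "sc (1 / d j) (c a)"] c[OF that] by (simp add: s_def homs)
 have su: "s a = sc (1 / d j) (unhat_word ?X ?Y [A] (c a))" if "a < n" for a
  using unhat_word_wscale[of ?X ?Y "[A]" "c a"] c[OF that] by (simp add: s_def)
 have hs: "hat_word ?X ?Y [A] (s a) = sc (1 / d j) (c a)" if "a < n" for a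
  unfolding s_def using c[OF that] by (intro hat_unhat) (auto simp: homs)
 have b1: "is_basis C (wobj ?x) (wobj (S j)) n (%a. underlying (p a))"
  by (rule is_basisI[where \<kappa> = "%f a. scal (f$c a)"])
   (use p fx scal_wsum(1)[OF ij(2) pc' _ p c] in simp_all)
 have b2: "is_basis C (wobj (S' i)) (wobj ?y) n (%a. underlying (s a))"
 proof (rule is_basisI[where \<kappa> = "%g a. d j * scal (p a$hat_word ?X ?Y [A] g)"])
  fix g assume g: "g : whom (S' i) ?y"
  let ?h = "hat_word ?X ?Y [A] g"
  have h: "?h : whom (S j) ?x" using hat_word_hom[of ?X ?Y "[A]" g] g by simp
  have "g = unhat_word ?X ?Y [A] ?h" using unhat_hat[of ?X ?Y "[A]" g] g by simp
  also have "?h = wsum (S j) ([A] @ [?X]) (%a. sc (scal (p a$?h)) (c a)) {..<n}" using hx[OF h] by simp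
  also have "unhat_word ?X ?Y [A] ... = wsum (S' i) (Du ?Y # [A]) (%a. sc (scal (p a$?h)) (unhat_word ?X ?Y [A] (c a))) {..<n}"
   by (rule unhat_word_linear) (use c in auto)
  also have "... = wsum (S' i) ?y (%a. sc (d j * scal (p a$?h)) (s a)) {..<n}"
   by (rule wsum_cong) (use su d_nonzero[OF ij(2)] unhat_word_hom[of ?X ?Y "[A]"] c sh in \<open>auto simp: homs\<close>)
  finally show "g = wsum (S' i) ?y (%a. sc (d j * scal (p a$?h)) (s a)) {..<n}" .
 next
  fix k a assume a: "a < n"
  have "hat_word ?X ?Y [A] (wsum (S' i) ?y (%a. sc (k a) (s a)) {..<n})
   = wsum (S j) ([A] @ [?X]) (%a. sc (k a) (hat_word ?X ?Y [A] (s a))) {..<n}"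
   by (rule hat_word_linear) (use sh in auto)
  also have "... = wsum (S j) ?x (%a. sc (k a / d j) (c a)) {..<n}"
   unfolding append.simps by (rule wsum_cong) (use hs c in "auto simp: homs")
  finally show "d j * scal (p a$hat_word ?X ?Y [A] (wsum (S' i) ?y (%a. sc (k a) (s a)) {..<n})) = k a"
   using scal_wsum(2)[OF ij(2) pc' _ p c a, of "%a. k a / d j"] d_nonzero[OF ij(2)] by simp
 qed (use sh in auto)
 have "is_dual_basis_pair C A i j (n, %a. underlying (p a), %a. underlying (s a))"
  unfolding is_dual_basis_pair_def
 proof (simp only: prod.case, intro conjI allI impI)
  show "is_basis C (A \<odot> ?X) ?Y n (%a. underlying (p a))" using b1 by simp
  show "is_basis C (Du ?X) (Du ?Y \<odot> A) n (%a. underlying (s a))" using b2 by simp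
  fix a b assume ab: "a < n" "b < n"
  have "(S' i, underlying (s b), ?y) = s b" using sh[OF ab(2)] by (intro word_arr_eqI) (auto simp: homs)
  then have "hat C A i j (underlying (s b)) = underlying (hat_word ?X ?Y [A] (s b))"
   using sh[OF ab(2)] hat_eq[of A i j "underlying (s b)"] by simp
  then have "underlying (p a) ** hat C A i j (underlying (s b)) = underlying (p a$sc (1 / d j) (c b))"
   using hs[OF ab(2)] by simp
  also have "p a$sc (1 / d j) (c b) = sc (if a = b then 1 / d j else 0) (idw (S j))"
   using p[OF ab(1)] c[OF ab(2)] pc[OF ab] by (auto simp: homs comp_wscale wscale_0)
  finally have e: "underlying (p a) ** hat C A i j (underlying (s b)) = underlying (sc (if a = b then 1 / d j else 0) (idw (S j)))" .
  show "qtrace C (underlying (p a) ** hat C A i j (underlying (s b))) = (if a = b then 1 else 0)"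
   unfolding e using d_nonzero[OF ij(2)] by (subst qtrace_simple[OF ij(2)]) (auto simp: homs scal_unique[OF ij(2) refl])
 qed
 then show ?thesis by blast
qed

definition hdim where
 "hdim A i j = fst (dual_bases C A i j)"

definition phi where
 "phi A i j a = ([A, Sp i], fst (snd (dual_bases C A i j)) a, S j)"

definition psi where
 "psi A i j a = (S' i, snd (snd (dual_bases C A i j)) a, [Du (Sp j), A])"

definition chi where
 "chi A i j a = hat_word (Sp i) (Sp j) [A] (psi A i j a)"

context
 fixes A i j
 assumes A [simp]: "A : Ob" and ij [simp]: "i : J C" "j : J C"
begin

lemma dual_pair: "is_dual_basis_pair C A i j (dual_bases C A i j)"
 unfolding dual_bases_def using dual_basis_exists[OF A ij] by (rule someI_ex)

lemma dual_pair_basis: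
 "is_basis C (wobj [A, Sp i]) (wobj (S j)) (hdim A i j) (fst (snd (dual_bases C A i j)))"
 "is_basis C (wobj (S' i)) (wobj [Du (Sp j), A]) (hdim A i j) (snd (snd (dual_bases C A i j)))"
 using dual_pair by (auto simp: is_dual_basis_pair_def hdim_def split: prod.splits)

lemma dual_pair_trace: "[|a < hdim A i j; b < hdim A i j|] ==>
  qtrace C (fst (snd (dual_bases C A i j)) a ** hat C A i j (snd (snd (dual_bases C A i j)) b)) = (if a = b then 1 else 0)"
 using dual_pair by (auto simp: is_dual_basis_pair_def hdim_def split: prod.splits)

lemma phi_hom: "a < hdim A i j ==> phi A i j a : whom [A, Sp i] (S j)"
 using dual_pair_basis(1) by (auto simp: is_basis_def phi_def homs intro!: warrI)

lemma psi_hom: "a < hdim A i j ==> psi A i j a : whom (S' i) [Du (Sp j), A]"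
 using dual_pair_basis(2) by (auto simp: is_basis_def psi_def homs intro!: warrI)

lemma chi_hom: "a < hdim A i j ==> chi A i j a : whom (S j) [A, Sp i]"
 using hat_word_hom[of "Sp i" "Sp j" "[A]" "psi A i j a"] psi_hom[of a] by (simp add: chi_def)

lemma phi_chi:
 assumes ab: "a < hdim A i j" "b < hdim A i j"
 shows "phi A i j a$chi A i j b = (if a = b then sc (1 / d j) (idw (S j)) else wzero (S j) (S j))"
proof -
 have h: "phi A i j a$chi A i j b : whom (S j) (S j)"
  using phi_hom[OF ab(1)] chi_hom[OF ab(2)] by (auto simp: homs)
 have "hat C A i j (snd (snd (dual_bases C A i j)) b) = underlying (chi A i j b)"
  unfolding chi_def psi_def by (rule hat_eq) (use psi_hom[OF ab(2)] in \<open>auto simp: psi_def\<close>)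
 then have "qtrace C (underlying (phi A i j a$chi A i j b)) = (if a = b then 1 else 0)"
  using dual_pair_trace[OF ab] by (simp add: phi_def)
 then have "scal (phi A i j a$chi A i j b) = (if a = b then 1 / d j else 0)"
  using qtrace_simple[OF ij(2) h] d_nonzero[OF ij(2)] by (auto simp: field_simps split: if_splits)
 then have "phi A i j a$chi A i j b = sc (if a = b then 1 / d j else 0) (idw (S j))"
  using scal_eq[OF ij(2) h] by simp
 then show ?thesis by (simp add: wscale_0)
qed

lemma phi_expand:
 assumes f: "f : whom [A, Sp i] (S j)"
 shows "f = wsum [A, Sp i] (S j) (%a. sc (d j * scal (f$chi A i j a)) (phi A i j a)) {..<hdim A i j}"
proof -
 let ?n = "hdim A i j"
 obtain c where "f = wsum [A, Sp i] (S j) (%a. sc (c a) ([A, Sp i], fst (snd (dual_bases C A i j)) a, S j)) {..<?n}"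
  using is_basis_span[OF _ _ dual_pair_basis(1) f] by auto
 then have c: "f = wsum [A, Sp i] (S j) (%a. sc (c a) (phi A i j a)) {..<?n}" by (simp only: phi_def)
 have "scal (f$chi A i j a) = c a * (1 / d j)" if "a < ?n" for a
  unfolding c by (rule scal_wsum(1)[OF ij(2) phi_chi _ phi_hom chi_hom that]) simp_all
 then have "d j * scal (f$chi A i j a) = c a" if "a < ?n" for a using that d_nonzero[OF ij(2)] by simp
 then have "wsum [A, Sp i] (S j) (%a. sc (d j * scal (f$chi A i j a)) (phi A i j a)) {..<?n}
   = wsum [A, Sp i] (S j) (%a. sc (c a) (phi A i j a)) {..<?n}"
  by (intro wsum_cong) (use phi_hom in "auto simp: homs")
 then show ?thesis using c by simp
qed

lemma psi_expand:
 assumes g: "g : whom (S' i) [Du (Sp j), A]"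
 shows "g = wsum (S' i) [Du (Sp j), A] (%a. sc (d j * scal (phi A i j a$hat_word (Sp i) (Sp j) [A] g)) (psi A i j a)) {..<hdim A i j}"
proof -
 let ?n = "hdim A i j" and ?y = "[Du (Sp j), A]" and ?h = "hat_word (Sp i) (Sp j) [A]"
 obtain c where "g = wsum (S' i) ?y (%a. sc (c a) (S' i, snd (snd (dual_bases C A i j)) a, ?y)) {..<?n}"
  using is_basis_span[OF _ _ dual_pair_basis(2) g] by auto
 then have c: "g = wsum (S' i) (Du (Sp j) # [A]) (%a. sc (c a) (psi A i j a)) {..<?n}" by (simp only: psi_def)
 have h: "?h g = wsum (S j) ([A] @ S i) (%a. sc (c a) (chi A i j a)) {..<?n}"
  unfolding chi_def by (subst c, rule hat_word_linear) (use psi_hom in auto)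
 have "scal (phi A i j a$?h g) = c a * (1 / d j)" if "a < ?n" for a
  unfolding h append.simps by (rule scal_wsum(2)[OF ij(2) phi_chi _ phi_hom chi_hom that]) simp_all
 then have "d j * scal (phi A i j a$?h g) = c a" if "a < ?n" for a using that d_nonzero[OF ij(2)] by simp
 then have "wsum (S' i) ?y (%a. sc (d j * scal (phi A i j a$?h g)) (psi A i j a)) {..<?n}
   = wsum (S' i) ?y (%a. sc (c a) (psi A i j a)) {..<?n}"
  by (intro wsum_cong) (use psi_hom in "auto simp: homs")
 then show ?thesis using c by simp
qed

lemma chi_expand:
 assumes h: "h : whom (S j) [A, Sp i]"
 shows "h = wsum (S j) [A, Sp i] (%a. sc (d j * scal (phi A i j a$h)) (chi A i j a)) {..<hdim A i j}"
proof -
 let ?X = "Sp i" and ?Y = "Sp j"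
 let ?g = "unhat_word ?X ?Y [A] h"
 have hg: "hat_word ?X ?Y [A] ?g = h" using hat_unhat[of ?X ?Y "[A]" h] h by simp
 have g: "?g : whom (S' i) [Du ?Y, A]" using unhat_word_hom[of ?X ?Y "[A]" h] h by simp
 have "h = hat_word ?X ?Y [A] ?g" by (rule hg[symmetric])
 also have "?g = wsum (S' i) [Du ?Y, A] (%a. sc (d j * scal (phi A i j a$h)) (psi A i j a)) {..<hdim A i j}"
  by (rule psi_expand[OF g, unfolded hg])
 also have "hat_word ?X ?Y [A] ... = wsum (S j) ([A] @ S i) (%a. sc (d j * scal (phi A i j a$h)) (chi A i j a)) {..<hdim A i j}"
  unfolding chi_def by (rule hat_word_linear) (use psi_hom in auto)
 finally show ?thesis by simp
qed

end
end

section \<open>Completeness relations\<close>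

context premodular_category_with_choices
begin

text \<open>By duality of the bases this is the projection of \<open>A \<otimes> X\<^sub>i\<close> to its \<open>X\<^sub>k\<close>-isotypic part.\<close>

definition isotypic where
 "isotypic A i k = wsum [A, Sp i] [A, Sp i] (%a. sc (d k) (chi A i k a$phi A i k a)) {..<hdim A i k}"

context
 fixes A i
 assumes A [simp]: "A : Ob" and i [simp]: "i : J C"
begin

lemma isotypic_hom: "k : J C ==> isotypic A i k : whom [A, Sp i] [A, Sp i]"
 unfolding isotypic_def by (intro hin(3,5) hin(4)[OF chi_hom phi_hom]) simp_all

lemma isotypic_simple:
 assumes k [simp]: "k : J C" and l [simp]: "l : J C" and h: "h : whom (S l) [A, Sp i]"
 shows "isotypic A i k$h = (if l = k then h else wzero (S l) [A, Sp i])"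
proof -
 let ?V = "[A, Sp i]"
 have e: "isotypic A i k$h = wsum (S l) ?V (%a. sc (d k) (chi A i k a$phi A i k a$h)) {..<hdim A i k}"
  unfolding isotypic_def
  by (subst wsum_comp_whom[OF h]) (auto intro!: hin(3) hin(4)[OF chi_hom phi_hom] hin(4)[OF chi_hom hin(4)[OF phi_hom h]] wsum_cong_whom l
    simp: wscale_comp_whom[OF hin(4)[OF chi_hom phi_hom] h] comp_assoc_whom[OF chi_hom phi_hom h])
 show ?thesis
 proof (cases "l = k")
  case True
  have c: "chi A i k a$phi A i k a$h = sc (scal (phi A i k a$h)) (chi A i k a)" if a: "a < hdim A i k" for a
  proof -
   have "phi A i k a$h = sc (scal (phi A i k a$h)) (idw (S k))"
    by (rule scal_eq[OF k]) (use a in "auto intro!: hin(4)[OF phi_hom h[unfolded True]]")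
   then have "chi A i k a$phi A i k a$h = chi A i k a$sc (scal (phi A i k a$h)) (idw (S k))" by (rule arg_cong)
   then show ?thesis using chi_hom[OF A i k a] by (simp add: comp_wscale homs)
  qed
  have "isotypic A i k$h = wsum (S k) ?V (%a. sc (d k * scal (phi A i k a$h)) (chi A i k a)) {..<hdim A i k}"
   unfolding e unfolding True by (rule wsum_cong_whom) (auto intro!: hin(3) chi_hom simp: c chi_hom[unfolded homs])
  also have "... = h" by (rule chi_expand[symmetric]) (use h True in simp_all)
  finally show ?thesis using True by simp
 next
  case False
  have "phi A i k a$h = wzero (S l) (S k)" if a: "a < hdim A i k" for a
   by (rule schur_zero[OF l k False]) (use h a in "auto intro!: hin(4)[OF phi_hom h]")
  then have "isotypic A i k$h = wzero (S l) ?V"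
   unfolding e using l by (intro wsum_zero) (auto simp: chi_hom[unfolded homs])
  then show ?thesis using False by simp
 qed
qed

lemma isotypic_sum: "wsum [A, Sp i] [A, Sp i] (isotypic A i) (J C) = idw [A, Sp i]"
proof (rule simples_separate)
 fix l h assume l: "l : J C" and h: "h : whom (S l) [A, Sp i]"
 have "wsum [A, Sp i] [A, Sp i] (isotypic A i) (J C)$h = wsum (S l) [A, Sp i] (%k. isotypic A i k$h) (J C)"
  by (rule wsum_comp_whom[OF h]) (auto intro: isotypic_hom)
 also have "... = isotypic A i l$h"
  by (rule wsum_single) (use l h in "auto simp: isotypic_simple")
 also have "... = idw [A, Sp i]$h" using l h by (simp add: isotypic_simple homs)
 finally show "wsum [A, Sp i] [A, Sp i] (isotypic A i) (J C)$h = idw [A, Sp i]$h" .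
qed (auto intro!: hin isotypic_hom)

end

text \<open>Bending both strands back reduces arrows between duals to arrows between the objects themselves.\<close>

lemma dual_transport:
 assumes X [simp]: "X : Ob" "Y : Ob" and f: "f : whom [Du X] [Du Y]"
 shows "f = {;wEv X;[Du Y]}${[Du X];{[X];wEv Y;}${[X];f;[Y]}${;coev X;[Y]};[Du Y]}
 ${[Du X];coev Y;}" (is "f = ?r")
proof -
 have [simp]: "warr f" "dom f = [Du X]" "cod f = [Du Y]" using f by (auto simp: homs)
 have "?r = {;wEv Y;[Du Y]}${[Du Y];coev Y;}${;f;}"
  by (rule rewrite[OF ev_coev(2)[of X], of _ "{;wEv Y;[Du Y]}${[Du Y];coev Y;}${;f;}" "[]" "[]" "idw [Du X]"])
   (simp_all add: diagram)
 also have "... = {;f;}"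
  by (rule rewrite[OF ev_coev(2)[of Y], of _ "idw [Du Y]" "[]" "[]" "{;f;}"]) (simp_all add: diagram)
 finally show ?thesis by (simp add: layer_nil)
qed

lemma dual_schur_zero:
 assumes ij [simp]: "i : J C" "j : J C" "i ~= j" and f: "f : whom (S' i) (S' j)"
 shows "f = wzero (S' i) (S' j)"
proof -
 have [simp]: "warr f" "dom f = S' i" "cod f = S' j" using f by (auto simp: homs)
 have z: "{S i;wEv (Sp j);}${S i;f;S j}${;coev (Sp i);S j} = wzero (S j) (S i)"
  by (rule schur_zero) (use ij(3)[symmetric] in \<open>auto simp: homs\<close>)
 show ?thesis
  by (subst dual_transport[OF _ _ f]) (simp_all add: z del: layer_comp)
qed

lemma dual_schur:
 assumes i [simp]: "i : J C" and f: "f : whom (S' i) (S' i)"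
 shows "\<exists>c. f = sc c (idw (S' i))"
proof -
 have [simp]: "warr f" "dom f = S' i" "cod f = S' i" using f by (auto simp: homs)
 let ?g = "{S i;wEv (Sp i);}${S i;f;S i}${;coev (Sp i);S i}"
 have z: "?g = sc (scal ?g) (idw (S i))" by (rule scal_eq[OF i]) (auto simp: homs)
 have "f = {;wEv (Sp i);S' i}${S' i;?g;S' i}${S' i;coev (Sp i);}"
  by (rule dual_transport[OF _ _ f]) simp_all
 also have "{S' i;?g;S' i} = sc (scal ?g) (idw (S' i @ S i @ S' i))"
  by (subst z) (simp add: layer_wscale del: layer_comp)
 also have "{;wEv (Sp i);S' i}$...${S' i;coev (Sp i);} = sc (scal ?g) (idw (S' i))"
  by (simp add: wscale_comp comp_wscale ev_coev)
 finally show ?thesis by blast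
qed

lemma id_dual_nonzero:
 assumes i [simp]: "i : J C"
 shows "idw (S' i) ~= wzero (S' i) (S' i)"
proof
 let ?X = "Sp i"
 assume z: "idw (S' i) = wzero (S' i) (S' i)"
 have "{S i;idw (S' i);S i} = wzero [?X, Du ?X, ?X] [?X, Du ?X, ?X]" unfolding z by simp
 then have e: "idw [?X, Du ?X, ?X] = wzero [?X, Du ?X, ?X] [?X, Du ?X, ?X]" by simp
 have "idw [?X] = {[?X];wEv ?X;}$idw [?X, Du ?X, ?X]${;coev ?X;[?X]}"
  by (simp add: ev_coev)
 also have "... = wzero [?X] [?X]" unfolding e by simp
 finally show False using id_Simp_nonzero[OF i] by simp
qed

text \<open>Therefore arrows are also determined by what they do to arrows from the duals \<open>X\<^sub>k*\<close>.\<close>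

lemma dual_retract:
 assumes m [simp]: "m : J C"
 shows "\<exists>k\<in>J C. \<exists>u\<in>whom (S m) (S' k). \<exists>v\<in>whom (S' k) (S m). v$u = idw (S m)"
proof -
 let ?M = "Sp m"
 have "\<exists>k\<in>J C. \<exists>p\<in>whom (S' m) (S k). \<exists>q\<in>whom (S k) (S' m). q$p ~= wzero (S' m) (S' m)"
 proof (rule ccontr)
  assume a: "\<not> ?thesis"
  have "idw (S' m) = wzero (S' m) (S' m)"
  proof (rule simples_separate)
   fix k h assume k: "k : J C" and h: "h : whom (S k) (S' m)"
   obtain n p c where F: "isotypic_frame (S' m) k n p c" using isotypic_frame_exists[of "S' m" k] k by auto
   have "h = wsum (S k) (S' m) (%a. sc (scal (p a$h)) (c a)) {..<n}"
    using F h by (simp add: isotypic_frame_def)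
   also have "... = wzero (S k) (S' m)"
   proof (rule wsum_zero)
    fix b assume "b : {..<n}"
    then have b: "p b : whom (S' m) (S k)" "c b : whom (S k) (S' m)" "p b$c b = idw (S k)"
     using F by (auto simp: isotypic_frame_def)
    have "c b = c b$p b$c b" using b by (simp add: homs)
    also have "... = (c b$p b)$c b" by (rule comp_assoc_whom[symmetric, OF b(2,1,2)])
    also have "c b$p b = wzero (S' m) (S' m)" using a k b by blast
    finally have "c b = wzero (S k) (S' m)" using b by (simp add: homs)
    then show "sc (scal (p b$h)) (c b) = wzero (S k) (S' m)" using k by simp
   qed (use k in simp_all)
   finally show "idw (S' m)$h = wzero (S' m) (S' m)$h" using k by simp
  qed (simp_all add: homs)
  then show False using id_dual_nonzero[OF m] by simp
 qed
 then obtain k p q where k [simp]: "k : J C" and p: "p : whom (S' m) (S k)" and q: "q : whom (S k) (S' m)"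
  and n: "q$p ~= wzero (S' m) (S' m)" by blast
 obtain c where c: "q$p = sc c (idw (S' m))" using dual_schur[OF m hin(4)[OF q p]] by blast
 have c0: "c ~= 0" using n c by (auto simp: wscale_0)
 let ?q = "sc (1 / c) q"
 let ?K = "Sp k"
 have [simp]: "warr p" "dom p = S' m" "cod p = S k" "warr q" "dom q = S k" "cod q = S' m"
  using p q by (auto simp: homs)
 have qp: "?q$p = idw (S' m)" using c0 by (simp add: wscale_comp c)
 let ?u = "{S' k;wEv ?M;}${S' k;?q;S m}${;coevR ?K;S m}"
 let ?v = "{S m;evR ?K;}${S m;p;S' k}${;coev ?M;S' k}"
 have "?v$?u = {S m;wEv ?M;}${S m;?q;S m}${S m;p;S m}${;coev ?M;S m}"
  by (rule rewrite[OF snake_right_left[of ?K, OF _ refl], of _ "{S m;wEv ?M;}${S m;?q;S m}" "S m" "S m" "{S m;p;S m}${;coev ?M;S m}"])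
   (simp_all add: diagram)
 also have "... = {S m;wEv ?M;}${;coev ?M;S m}"
  by (rule rewrite[OF qp, of _ "{S m;wEv ?M;}" "S m" "S m" "{;coev ?M;S m}"])
   (simp_all add: cassoc)
 also have "... = idw (S m)" by (simp add: ev_coev)
 finally have "?v$?u = idw (S m)" .
 moreover have "?u : whom (S m) (S' k)" "?v : whom (S' k) (S m)" by (auto simp: homs)
 ultimately show ?thesis using k by blast
qed

lemma duals_separate:
 assumes f: "f : whom x y" and g: "g : whom x y"
  and fg: "!!k h. [|k : J C; h : whom (S' k) x|] ==> f$h = g$h"
 shows "f = g"
proof (rule simples_separate[OF f g])
 fix m h assume m: "m : J C" and h: "h : whom (S m) x"
 obtain k u v where k: "k : J C" and u: "u : whom (S m) (S' k)" and v: "v : whom (S' k) (S m)" and vu: "v$u = idw (S m)"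
  using dual_retract[OF m] by blast
 have e: "h = (h$v)$u" using h u v vu by (simp add: comp_assoc_whom[OF h v u]) (simp add: homs)
 have hv: "h$v : whom (S' k) x" using hin(4)[OF h v] .
 have "f$(h$v)$u = (f$h$v)$u" by (rule comp_assoc_whom[OF f hv u, symmetric])
 also have "... = (g$h$v)$u" using fg[OF k hv] by simp
 also have "... = g$(h$v)$u" by (rule comp_assoc_whom[OF g hv u])
 finally show "f$h = g$h" using e by simp
qed

definition phi' where
 "phi' A j k a = {;wEv (Sp k);S' j}${S' k;phi A j k a;S' j}${[Du (Sp k), A];coev (Sp j);}"

context
 fixes A
 assumes A [simp]: "A : Ob"
begin

lemma phi'_hom: "[|j : J C; k : J C; a < hdim A j k|] ==> phi' A j k a : whom [Du (Sp k), A] (S' j)"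
 using phi_hom[of A j k a] by (auto simp: phi'_def homs)

lemma phi_slide:
 assumes jk [simp]: "j : J C" "k : J C" and a: "a < hdim A j k"
 shows "{;phi A j k a;S' j}${[A];coev (Sp j);} = {S k;phi' A j k a;}${;coev (Sp k);[A]}"
proof -
 have [simp]: "warr (phi A j k a)" "dom (phi A j k a) = [A, Sp j]" "cod (phi A j k a) = S k"
  using phi_hom[OF A jk a] by (auto simp: homs)
 show ?thesis
  by (rule rewrite[OF ev_coev(1)[of "Sp k", symmetric], of _ "idw [Sp k, Du (Sp j)]" "[]" "S' j"
    "{;phi A j k a;S' j}${[A];coev (Sp j);}"])
   (simp_all add: phi'_def diagram)
qed

lemma chi_slide:
 assumes jk [simp]: "j : J C" "k : J C" and a: "a < hdim A j k"
 shows "{[A];evR (Sp j);}${;chi A j k a;S' j} = {;evR (Sp k);[A]}${S k;psi A j k a;}"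
 unfolding chi_def using hat_eq_zigzag[of "Sp j" "Sp k" "[A]" "psi A j k a"] psi_hom[OF A jk a] by simp

lemma phi'_scalar:
 assumes kl [simp]: "k : J C" "l : J C" and a: "a < hdim A l k" and g: "g : whom (S' l) [Du (Sp k), A]"
  and y: "phi' A l k a$g = sc y (idw (S' l))"
 shows "d l * y = d k * scal (phi A l k a$hat_word (Sp l) (Sp k) [A] g)"
proof -
 let ?K = "Sp k" and ?L = "Sp l"
 let ?h = "hat_word ?L ?K [A] g"
 let ?f = "phi A l k a"
 have [simp]: "warr ?f" "dom ?f = [A, ?L]" "cod ?f = S k" "warr g" "dom g = S' l" "cod g = [Du ?K, A]"
  using phi_hom[OF A _ _ a] g by (auto simp: homs)
 have h: "?h : whom (S k) [A, ?L]" using hat_word_hom[of ?L ?K "[A]" g] g by simp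
 have fh: "?f$?h = sc (scal (?f$?h)) (idw (S k))"
  by (rule scal_eq) (rule kl(1), rule hin(4)[OF phi_hom[OF A kl(2,1) a] h])
 let ?m = "wEv ?K${S' k;?f;}${;g;S l}$coevR ?L"
 have "{;wEv ?K;}${S' k;?f$?h;}${;coevR ?K;}
  = {;wEv ?K;}${S' k;?f;}${;g;S l}${;coevR ?L;}"
  by (rule rewrite[OF snake_right_right[of ?K, OF _ refl], of _ "{;wEv ?K;}${S' k;?f;}" "[]" "[A, ?L]" "{;g;S l}${;coevR ?L;}"])
   (simp_all add: hat_word_def diagram)
 moreover have "{;wEv ?K;}${S' k;?f$?h;}${;coevR ?K;} = sc (scal (?f$?h) * d k) (idw [])"
  by (subst fh) (simp add: layer_wscale wscale_comp comp_wscale loop_value layer_nil)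
 moreover have "{;wEv ?L;}${;phi' A l k a$g;S l}${;coevR ?L;}
  = {;wEv ?K;}${S' k;?f;}${;g;S l}${;coevR ?L;}"
  by (rule rewrite[OF ev_coev(1)[of ?L], of _ "{;wEv ?K;}${S' k;?f;}" "[Du ?K, A]" "[]" "{;g;S l}${;coevR ?L;}"])
   (simp_all add: phi'_def diagram)
 moreover have "{;wEv ?L;}${;phi' A l k a$g;S l}${;coevR ?L;} = sc (y * d l) (idw [])"
  unfolding y by (simp add: layer_wscale wscale_comp comp_wscale loop_value layer_nil)
 ultimately have "sc (y * d l) (idw []) = sc (scal (?f$?h) * d k) (idw [])" by simp
 then show ?thesis using wscale_id_inject[OF _ id_Nil_nonzero] by (simp add: mult.commute)
qed

lemma dual_completeness:
 assumes k [simp]: "k : J C"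
 shows "wsum [Du (Sp k), A] [Du (Sp k), A] (%j. wsum [Du (Sp k), A] [Du (Sp k), A]
   (%a. sc (d j) (psi A j k a$phi' A j k a)) {..<hdim A j k}) (J C) = idw [Du (Sp k), A]"
proof (rule duals_separate)
 let ?V = "[Du (Sp k), A]"
 let ?P = "%j. wsum ?V ?V (%a. sc (d j) (psi A j k a$phi' A j k a)) {..<hdim A j k}"
 have P: "?P j : whom ?V ?V" if "j : J C" for j
  using that by (intro hin(3,5) hin(4)[OF psi_hom phi'_hom]) simp_all
 show "wsum ?V ?V ?P (J C) : whom ?V ?V" by (rule hin(5)) (use P in simp_all)
 fix l g assume l [simp]: "l : J C" and g: "g : whom (S' l) ?V"
 have Pg: "?P j$g = wsum (S' l) ?V (%a. sc (d j) (psi A j k a$phi' A j k a$g)) {..<hdim A j k}" if j: "j : J C" for j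
  by (subst wsum_comp_whom[OF g]) (use j in "auto intro!: hin(3) hin(4)[OF psi_hom phi'_hom] hin(4)[OF psi_hom hin(4)[OF phi'_hom g]] wsum_cong_whom
    simp: wscale_comp_whom[OF hin(4)[OF psi_hom phi'_hom] g] comp_assoc_whom[OF psi_hom phi'_hom g]")
 have z: "?P j$g = wzero (S' l) ?V" if j: "j : J C" "j ~= l" for j
 proof -
  have "phi' A j k a$g = wzero (S' l) (S' j)" if a: "a < hdim A j k" for a
   by (rule dual_schur_zero) (use j a in "auto intro!: hin(4)[OF phi'_hom g]")
  then show ?thesis unfolding Pg[OF j(1)] using j by (intro wsum_zero) (auto simp: psi_hom[unfolded homs])
 qed
 have "?P l$g = wsum (S' l) ?V (%a. sc (d k * scal (phi A l k a$hat_word (Sp l) (Sp k) [A] g)) (psi A l k a)) {..<hdim A l k}"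
  unfolding Pg[OF l]
 proof (rule wsum_cong_whom)
  fix a assume "a : {..<hdim A l k}"
  then have a: "a < hdim A l k" by simp
  obtain y where y: "phi' A l k a$g = sc y (idw (S' l))"
   using dual_schur[OF l hin(4)[OF phi'_hom[OF l k a] g]] by blast
  have [simp]: "warr (psi A l k a)" "dom (psi A l k a) = S' l" using psi_hom[OF A l k a] by (auto simp: homs)
  show "sc (d l) (psi A l k a$phi' A l k a$g)
    = sc (d k * scal (phi A l k a$hat_word (Sp l) (Sp k) [A] g)) (psi A l k a)"
   unfolding y phi'_scalar[OF k l a g y, symmetric] by (simp add: comp_wscale)
  show "sc (d k * scal (phi A l k a$hat_word (Sp l) (Sp k) [A] g)) (psi A l k a) : whom (S' l) ?V"
   using a by (intro hin psi_hom) simp_all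
 qed simp_all
 also have "... = g" by (rule psi_expand[symmetric]) (use g in simp_all)
 finally have Pl: "?P l$g = g" .
 have "wsum ?V ?V ?P (J C)$g = wsum (S' l) ?V (%j. ?P j$g) (J C)"
  by (rule wsum_comp_whom[OF g]) (use P in simp_all)
 also have "... = ?P l$g"
  by (rule wsum_single) (use z Pl g in simp_all)
 also have "... = idw ?V$g" using Pl g by (simp add: homs)
 finally show "wsum ?V ?V ?P (J C)$g = idw ?V$g" .
qed (simp add: homs)

end
end

section \<open>The averaging projection\<close>

context monoidal_category
begin

lemma intertwiner_warr: "intw f sg ta ==> warr f"
 by (simp add: intw_def)

lemma intwD: "[|intw f sg ta; a : Ob|] ==> {;f;[a]}$sg [a] = ta [a]${[a];f;}"
 by (simp add: intw_def)

end

context ribbon_category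
begin

definition loop where
 "loop M ro ro' X = {M;evR X;}${;ro' [X];[Du X]}${[X];ro [Du X];}${;coev X;M}"

lemma loop_hom: "[|hbraid M ro; hbraid M ro'; X : Ob|] ==> loop M ro ro' X : whom M M"
 by (auto simp: loop_def homs hb_simps)

text \<open>
 A strand that crosses both halves of the loop by the same crossings slides through the loop, since
 the crossings with the two legs of the loop cancel at the cup and at the cap.
\<close>

lemma loop_commute:
 assumes r: "hbraid M ro" "hbraid M ro'" and s: "hbraid M sg" and e: "crossing e" "crossing e'"
  and c: "crosses e e' M ro sg" "crosses e e' M ro' sg" and X [simp]: "X : Ob" and b [simp]: "b : Ob"
 shows "{;loop M ro ro' X;[b]}$sg [b] = sg [b]${[b];loop M ro ro' X;}"
proof -
 note [simp] = hb_simps(1,3-5)[OF r(1)] hb_simps(3-5)[OF r(2)] hb_simps(3-5)[OF s] e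
 define Y where "Y = Du X"
 have [simp]: "Y : Ob" "dom (evR X) = [X, Y]" "cod (coev X) = [X, Y]" by (simp_all add: Y_def)
 note dual_simps(6,9) [simp del]
 have E: "{M;e [X] [b];}${;ro' [X];[b]}${[X];sg [b];} = {;sg [b];[X]}${[b];ro' [X];}${;e' [X] [b];M}"
  "{M;e [Y] [b];}${;ro [Y];[b]}${[Y];sg [b];} = {;sg [b];[Y]}${[b];ro [Y];}${;e' [Y] [b];M}"
  using c by (simp_all add: crosses_def)
 have top: "{;evR X;[b]} = {[b];evR X;}${;e [X] [b];[Y]}${[X];e [Y] [b];}"
  using crossing_nat1[OF e(1), of "[b]" "evR X" "[X, Y]" "[]"] crossing_append1[OF e(1), of "[X]" "[Y]" "[b]"] by simp
 have bot: "{;e' [X] [b];[Y]}${[X];e' [Y] [b];}${;coev X;[b]} = {[b];coev X;}"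
  using crossing_nat1[OF e(2), of "[b]" "coev X" "[]" "[X, Y]"] crossing_append1[OF e(2), of "[X]" "[Y]" "[b]"] by (simp add: cassoc)
 have "{;loop M ro ro' X;[b]}${;sg [b];}
   = {M @ [b];evR X;}${M;e [X] [b];[Y]}${M @ [X];e [Y] [b];}${;ro' [X];[Y, b]}
   ${[X];ro [Y];[b]}${[X, Y];sg [b];}${;coev X;b # M}"
  by (rule rewrite[OF top, of _ "idw (M @ [b])" M "[]" "{;ro' [X];[Y, b]}${[X];ro [Y];[b]}${[X, Y];sg [b];}${;coev X;b # M}"])
   (simp_all add: loop_def Y_def[symmetric] diagram)
 also have "... = {M @ [b];evR X;}${M;e [X] [b];[Y]}${;ro' [X];[b, Y]}
   ${[X];sg [b];[Y]}${[X, b];ro [Y];}${[X];e' [Y] [b];M}${;coev X;b # M}"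
  by (rule rewrite[OF E(2), of _ "{M @ [b];evR X;}${M;e [X] [b];[Y]}${;ro' [X];[b, Y]}" "[X]" "[]" "{;coev X;b # M}"])
   (simp_all add: diagram)
 also have "... = {M @ [b];evR X;}${;sg [b];[X, Y]}${[b];ro' [X];[Y]}${;e' [X] [b];M @ [Y]}
   ${[X, b];ro [Y];}${[X];e' [Y] [b];M}${;coev X;b # M}"
  by (rule rewrite[OF E(1), of _ "{M @ [b];evR X;}" "[]" "[Y]" "{[X, b];ro [Y];}${[X];e' [Y] [b];M}${;coev X;b # M}"])
   (simp_all add: diagram)
 also have "... = {;sg [b];}${[b];loop M ro ro' X;}"
  by (rule rewrite[OF bot, of _ "{M @ [b];evR X;}${;sg [b];[X, Y]}${[b];ro' [X];[Y]}${[b, X];ro [Y];}" "[]" M "idw (b # M)"])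
   (simp_all add: loop_def Y_def[symmetric] diagram)
 finally show ?thesis by (simp add: layer_nil)
qed

lemma loop_natural:
 assumes f: "intw f ro ta" "intw f ro' ta'" and M: "dom f = M" "cod f = N"
  and h: "hbraid M ro" "hbraid M ro'" "hbraid N ta" "hbraid N ta'" and X [simp]: "X : Ob"
 shows "loop N ta ta' X$f = f$loop M ro ro' X"
proof -
 note [simp] = hb_simps(1,3-5)[OF h(1)] hb_simps(3-5)[OF h(2)] hb_simps(1,3-5)[OF h(3)] hb_simps(3-5)[OF h(4)]
  intertwiner_warr[OF f(1)] M
 let ?Y = "Du X"
 have "{;loop N ta ta' X;}${;f;}
  = {N;evR X;}${;ta' [X];[?Y]}${[X];f;[?Y]}${[X];ro [?Y];}${;coev X;M}"
  by (rule rewrite[OF intwD[OF f(1), of ?Y, symmetric], of _ "{N;evR X;}${;ta' [X];[?Y]}" "[X]" "[]" "{;coev X;M}"])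
   (simp_all add: loop_def diagram)
 also have "... = {;f;}${;loop M ro ro' X;}"
  by (rule rewrite[OF intwD[OF f(2), of X, symmetric], of _ "{N;evR X;}" "[]" "[?Y]" "{[X];ro [?Y];}${;coev X;M}"])
   (simp_all add: loop_def diagram)
 finally show ?thesis using loop_hom[OF h(1,2) X] loop_hom[OF h(3,4) X] by (simp add: layer_nil homs)
qed

text \<open>Once both legs pass \<open>M\<close> by the same half-braiding, its naturality carries the whole cup past \<open>M\<close>.\<close>

lemma loop_contract:
 assumes h: "hbraid M ro" "hbraid M ro'" and f: "f : whom x M" and X [simp]: "X : Ob"
  and eq: "ro [Du X]${[Du X];f;} = ro' [Du X]${[Du X];f;}"
 shows "loop M ro ro' X$f = {M;evR X$coev X;}$f"
proof -
 have [simp]: "warr f" "dom f = x" "cod f = M" using f by (auto simp: homs)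
 have [simp]: "word x" using warr_word(1)[of f] by simp
 note [simp] = hb_simps(1,3-5)[OF h(1)] hb_simps(3-5)[OF h(2)]
 let ?Y = "Du X"
 have n: "{;ro' [X];[?Y]}${[X];ro' [?Y];}${;coev X;M} = {M;coev X;}"
  using half_braid_nat[OF h(2), of "coev X" "[]" "[X, ?Y]"] half_braid_append[OF h(2), of "[X]" "[?Y]"] hb_simps(2)[OF h(2)] by (simp add: cassoc)
 have "{;loop M ro ro' X;}${;f;}
  = {M;evR X;}${;ro' [X];[?Y]}${[X];ro' [?Y];}${[X, ?Y];f;}${;coev X;x}"
  by (rule rewrite[OF eq, of _ "{M;evR X;}${;ro' [X];[?Y]}" "[X]" "[]" "{;coev X;x}"])
   (simp_all add: loop_def diagram)
 also have "... = {M;evR X$coev X;}${;f;}"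
  by (rule rewrite[OF n, of _ "{M;evR X;}" "[]" "[]" "{;f;}"])
   (simp_all add: diagram)
 finally show ?thesis using loop_hom[OF h X] by (simp add: layer_nil homs)
qed

lemma loop_tensor_left:
 assumes c: "hbraid X sg" and h: "hbraid M ro" "hbraid M ro'" and Z [simp]: "Z : Ob"
 shows "loop (X @ M) (hprod sg X ro M) (hprod sg X ro' M) Z = {X;loop M ro ro' Z;}"
proof -
 note [simp] = hb_simps(1,3-5)[OF h(1)] hb_simps(3-5)[OF h(2)] hb_simps(1,3-5)[OF c]
 let ?Y = "Du Z"
 have n: "{;sg [Z];[?Y]}${[Z];sg [?Y];}${;coev Z;X} = {X;coev Z;}"
  using half_braid_nat[OF c, of "coev Z" "[]" "[Z, ?Y]"] half_braid_append[OF c, of "[Z]" "[?Y]"] hb_simps(2)[OF c] by (simp add: cassoc)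
 show ?thesis
  by (rule rewrite[OF n, of _ "{X @ M;evR Z;}${X;ro' [Z];[?Y]}${X @ [Z];ro [?Y];}" "[]" M "idw (X @ M)"])
   (simp_all add: loop_def hprod_def diagram)
qed

lemma loop_tensor_right:
 assumes c: "hbraid X sg" and h: "hbraid M ro" "hbraid M ro'" and Z [simp]: "Z : Ob"
 shows "loop (M @ X) (hprod ro M sg X) (hprod ro' M sg X) Z = {;loop M ro ro' Z;X}"
proof -
 note [simp] = hb_simps(1,3-5)[OF h(1)] hb_simps(3-5)[OF h(2)] hb_simps(1,3-5)[OF c]
 let ?Y = "Du Z"
 have n: "{X;evR Z;}${;sg [Z];[?Y]}${[Z];sg [?Y];} = {;evR Z;X}"
  using half_braid_nat[OF c, of "evR Z" "[Z, ?Y]" "[]"] half_braid_append[OF c, of "[Z]" "[?Y]"] hb_simps(2)[OF c] by (simp add: cassoc)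
 show ?thesis
  by (rule rewrite[OF n, of _ "idw (M @ X)" M "[]" "{;ro' [Z];?Y # X}${[Z];ro [?Y];X}${;coev Z;M @ X}"])
   (simp_all add: loop_def hprod_def diagram)
qed

end

context linear_monoidal_category
begin

lemma sandwich_wsum:
 assumes "u : whom (p @ y @ q) z" "v : whom w (p @ x @ q)" "word p" "word q" "word x" "word y" "!!i. i : I ==> F i : whom x y"
 shows "u${p;wsum x y F I;q}$v = wsum w z (%i. u${p;F i;q}$v) I"
proof -
 have l: "{p;F i;q} : whom (p @ x @ q) (p @ y @ q)" if "i : I" for i
  using assms that by (intro layer_whom[of p q _ x y]) auto
 have w: "word w" "word (p @ y @ q)" "word (p @ x @ q)" using assms warr_word[of v] by (auto simp: homs)
 have "{p;wsum x y F I;q} = wsum (p @ x @ q) (p @ y @ q) (%i. {p;F i;q}) I"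
  using assms by (intro layer_wsum_whom) auto
 then show ?thesis
  using l w by (simp add: wsum_comp_whom[OF assms(2) w(2) l] comp_wsum_whom[OF assms(1) w(1) hin(4)[OF l assms(2)]])
qed

lemma sandwich_wscale:
 assumes "u : whom (p @ y @ q) z" "v : whom w (p @ x @ q)" "word p" "word q" "f : whom x y"
 shows "u${p;sc a f;q}$v = sc a (u${p;f;q}$v)"
 using assms by (simp add: homs layer_wscale comp_wscale wscale_comp)

lemma sandwich_whom:
 assumes "u : whom (p @ y @ q) z" "v : whom w (p @ x @ q)" "word p" "word q" "f : whom x y"
 shows "u${p;f;q}$v : whom w z"
 using assms by (simp add: homs)

lemma wscale_wsum_whom: "[|word x; word y; !!i. i : I ==> F i : whom x y|] ==> sc a (wsum x y F I) = wsum x y (%i. sc a (F i)) I"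
 by (rule wscale_wsum) (auto simp: homs)

lemma wscale_wscale_whom: "f : whom x y ==> sc a (sc b f) = sc (a * b) f"
 by (simp add: homs)

lemma wscale_wsum_swap:
 assumes [simp]: "word x" "word y" and G: "!!k a. [|k : K; a : I k|] ==> G k a : whom x y"
 shows "sc b (wsum x y (%k. wsum x y (%a. sc (c k) (G k a)) (I k)) K)
  = wsum x y (%k. sc (c k) (wsum x y (%a. sc b (G k a)) (I k))) K"
proof -
 have h: "wsum x y (G k) (I k) : whom x y" if "k : K" for k using that G by auto
 have e: "wsum x y (%a. sc t (G k a)) (I k) = sc t (wsum x y (G k) (I k))" if "k : K" for k t
  using that G by (simp add: wscale_wsum_whom[where F = "G k"])
 have "sc b (wsum x y (%k. sc (c k) (wsum x y (G k) (I k))) K) = wsum x y (%k. sc (c k) (sc b (wsum x y (G k) (I k)))) K"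
  by (subst wscale_wsum_whom) (auto intro!: wsum_cong_whom hin(3) h simp: wscale_wscale_whom[OF h] mult.commute)
 moreover have "wsum x y (%k. wsum x y (%a. sc (c k) (G k a)) (I k)) K = wsum x y (%k. sc (c k) (wsum x y (G k) (I k))) K"
  "wsum x y (%k. sc (c k) (wsum x y (%a. sc b (G k a)) (I k))) K = wsum x y (%k. sc (c k) (sc b (wsum x y (G k) (I k)))) K"
  by (rule wsum_cong_whom; auto simp: e intro!: hin(3) h)+
 ultimately show ?thesis by simp
qed

end

context premodular_category_with_choices
begin

text \<open>\<open>avg\<close> is \<open>Qproj\<close> for an arbitrary pair of half-braidings on one word.\<close>

definition avg where
 "avg M ro ro' = sc (1 / gdim) (wsum M M (%j. sc (d j) (loop M ro ro' (Sp j))) (J C))"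

context
 fixes M ro ro'
 assumes h: "hbraid M ro" "hbraid M ro'"
begin

lemma word_M [simp]: "word M" by (rule hb_simps(1)[OF h(1)])

lemma avg_hom: "avg M ro ro' : whom M M"
 unfolding avg_def by (intro hin(3,5) loop_hom h) simp_all

lemma avg_sandwich:
 assumes "u : whom (p @ M @ q) z" "v : whom w (p @ M @ q)" "word p" "word q"
 shows "u${p;avg M ro ro';q}$v
  = sc (1 / gdim) (wsum w z (%j. sc (d j) (u${p;loop M ro ro' (Sp j);q}$v)) (J C))"
proof -
 have w: "word w" "word z" using assms warr_word[of v] warr_word[of u] by (auto simp: homs)
 have l: "loop M ro ro' (Sp j) : whom M M" if "j : J C" for j using loop_hom[OF h] that by simp
 have "u${p;avg M ro ro';q}$v
   = sc (1 / gdim) (u${p;wsum M M (%j. sc (d j) (loop M ro ro' (Sp j))) (J C);q}$v)"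
  unfolding avg_def by (rule sandwich_wscale[OF assms]) (intro hin(3,5) l; simp)
 also have "u${p;wsum M M (%j. sc (d j) (loop M ro ro' (Sp j))) (J C);q}$v
   = wsum w z (%j. u${p;sc (d j) (loop M ro ro' (Sp j));q}$v) (J C)"
  by (rule sandwich_wsum[OF assms]) (auto intro!: hin(3) l)
 also have "... = wsum w z (%j. sc (d j) (u${p;loop M ro ro' (Sp j);q}$v)) (J C)"
  by (rule wsum_cong_whom) (use w in "auto intro!: sandwich_wscale[OF assms] hin(3) sandwich_whom[OF assms] l")
 finally show ?thesis .
qed

lemma avg_cong:
 assumes "word w" "word z" "!!j. j : J C ==> F j = G j" "!!j. j : J C ==> G j : whom w z"
 shows "sc a (wsum w z (%j. sc (d j) (F j)) (J C)) = sc a (wsum w z (%j. sc (d j) (G j)) (J C))"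
 by (rule arg_cong[where f = "sc a"], rule wsum_cong_whom) (use assms in "auto intro: hin(3)")

lemma avg_commute:
 assumes s: "hbraid M sg" and e: "crossing e" "crossing e'" and c: "crosses e e' M ro sg" "crosses e e' M ro' sg"
 shows "intw (avg M ro ro') sg sg"
 unfolding intw_def
proof (intro conjI ballI)
 show "warr (avg M ro ro')" using avg_hom by (simp add: homs)
 fix b assume b [simp]: "b : Ob"
 have s1: "sg [b] : whom (b # M) (M @ [b])" using hb_simps[OF s] by (simp add: homs)
 let ?Q = "avg M ro ro'" and ?l = "%j. loop M ro ro' (Sp j)"
 have Q: "warr ?Q" "dom ?Q = M" "cod ?Q = M" using avg_hom by (auto simp: homs)
 have l: "warr (?l j)" "dom (?l j) = M" "cod (?l j) = M" if "j : J C" for j using loop_hom[OF h, of "Sp j"] that by (auto simp: homs)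
 have "{;?Q;[b]}$sg [b] = idw (M @ [b])${;?Q;[b]}$sg [b]" using Q s1 by (simp add: homs)
 also have "... = sc (1 / gdim) (wsum (b # M) (M @ [b]) (%j. sc (d j) (idw (M @ [b])${;?l j;[b]}$sg [b])) (J C))"
  by (rule avg_sandwich) (use s1 in "simp_all add: homs")
 also have "... = sc (1 / gdim) (wsum (b # M) (M @ [b]) (%j. sc (d j) (sg [b]${[b];?l j;}$idw (b # M))) (J C))"
  by (rule avg_cong) (use s1 l loop_commute[OF h s e c] in "simp_all add: homs")
 also have "... = sg [b]${[b];?Q;}$idw (b # M)"
  by (rule avg_sandwich[symmetric]) (use s1 in "simp_all add: homs")
 also have "... = sg [b]${[b];?Q;}" using Q s1 by (simp add: homs)
 finally show "{;?Q;[b]}$sg [b] = sg [b]${[b];?Q;}" .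
qed

text \<open>Every loop contracts to a circle of dimension \<open>d j\<close>, and the squares of the dimensions add up to \<open>global_dim\<close>.\<close>

lemma avg_fix:
 assumes D: "gdim ~= 0" and f: "f : whom x M"
  and eq: "!!a. a : Ob ==> ro [a]${[a];f;} = ro' [a]${[a];f;}"
 shows "avg M ro ro'$f = f"
proof -
 have [simp]: "warr f" "dom f = x" "cod f = M" using f by (auto simp: homs)
 have [simp]: "word x" using warr_word(1)[of f] by simp
 let ?l = "%j. loop M ro ro' (Sp j)"
 have Q: "warr (avg M ro ro')" "dom (avg M ro ro') = M" "cod (avg M ro ro') = M" using avg_hom by (auto simp: homs)
 have l: "idw M${;?l j;}$f = sc (d j) f" if j [simp]: "j : J C" for j
 proof -
  have [simp]: "warr (?l j)" "dom (?l j) = M" "cod (?l j) = M" using loop_hom[OF h, of "Sp j"] by (auto simp: homs)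
  have "?l j$f = {M;evR (Sp j)$coev (Sp j);}$f"
   by (rule loop_contract[OF h f]) (simp_all add: eq)
  also have "... = sc (d j) f" by (simp only: loop_value j) (simp add: layer_wscale wscale_comp)
  finally show ?thesis by (simp add: layer_nil)
 qed
 have "avg M ro ro'$f = idw M${;avg M ro ro';}$f" using Q by (simp add: layer_nil)
 also have "... = sc (1 / gdim) (wsum x M (%j. sc (d j) (idw M${;?l j;}$f)) (J C))"
  by (rule avg_sandwich) (simp_all add: homs)
 also have "... = sc (1 / gdim) (wsum x M (%j. sc (d j) (sc (d j) f)) (J C))"
  by (rule avg_cong) (simp_all add: l homs)
 also have "wsum x M (%j. sc (d j) (sc (d j) f)) (J C) = sc (\<Sum>j\<in>J C. d j * d j) f"
  using wsum_wscale_const[of f "J C" "%j. d j * d j"] by simp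
 finally show ?thesis using D by (simp add: global_dim_def power2_eq_square)
qed

text \<open>The strand \<open>X\<close> is passed in the same way by both legs of each loop and moves out of it.\<close>

lemma avg_left:
 assumes c: "hbraid X sg"
 shows "avg (X @ M) (hprod sg X ro M) (hprod sg X ro' M) = {X;avg M ro ro';}"
proof -
 note [simp] = hb_simps(1)[OF c]
 have l: "loop M ro ro' (Sp j) : whom M M" if "j : J C" for j using loop_hom[OF h] that by simp
 have Q: "warr (avg M ro ro')" "dom (avg M ro ro') = M" "cod (avg M ro ro') = M" using avg_hom by (auto simp: homs)
 have "{X;avg M ro ro';} = idw (X @ M)${X;avg M ro ro';}$idw (X @ M)" using Q by simp
 also have "... = sc (1 / gdim) (wsum (X @ M) (X @ M) (%j. sc (d j) (idw (X @ M)${X;loop M ro ro' (Sp j);}$idw (X @ M))) (J C))"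
  by (rule avg_sandwich) (simp_all add: homs)
 also have "... = avg (X @ M) (hprod sg X ro M) (hprod sg X ro' M)"
  unfolding avg_def by (rule avg_cong) (use l in "simp_all add: loop_tensor_left[OF c h] homs")
 finally show ?thesis by simp
qed

lemma avg_right:
 assumes c: "hbraid X sg"
 shows "avg (M @ X) (hprod ro M sg X) (hprod ro' M sg X) = {;avg M ro ro';X}"
proof -
 note [simp] = hb_simps(1)[OF c]
 have l: "loop M ro ro' (Sp j) : whom M M" if "j : J C" for j using loop_hom[OF h] that by simp
 have Q: "warr (avg M ro ro')" "dom (avg M ro ro') = M" "cod (avg M ro ro') = M" using avg_hom by (auto simp: homs)
 have "{;avg M ro ro';X} = idw (M @ X)${;avg M ro ro';X}$idw (M @ X)" using Q by simp
 also have "... = sc (1 / gdim) (wsum (M @ X) (M @ X) (%j. sc (d j) (idw (M @ X)${;loop M ro ro' (Sp j);X}$idw (M @ X))) (J C))"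
  by (rule avg_sandwich) (simp_all add: homs)
 also have "... = avg (M @ X) (hprod ro M sg X) (hprod ro' M sg X)"
  unfolding avg_def by (rule avg_cong) (use l in "simp_all add: loop_tensor_right[OF c h] homs")
 finally show ?thesis by simp
qed

text \<open>
 A strand that passes \<open>M\<close> by \<open>ro\<close> before the projection passes it by \<open>ro'\<close> after the projection: fused
 with the strand \<open>X\<^sub>j\<close> of the loop it becomes a sum over the simple constituents \<open>X\<^sub>k\<close> of \<open>A \<otimes> X\<^sub>j\<close>,
 and the strand \<open>X\<^sub>j*\<close>, fused with it on the other side, runs through the constituents of \<open>X\<^sub>k* \<otimes> A\<close>.
\<close>

lemma avg_slide:
 assumes A [simp]: "A : Ob"
 shows "{;avg M ro ro';[A]}$ro [A] = ro' [A]${[A];avg M ro ro';}"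
proof -
 note [simp] = hb_simps(3-5)[OF h(1)] hb_simps(3-5)[OF h(2)]
 let ?X = "%j. Sp j" and ?Y = "%j. Du (Sp j)"
 let ?l = "%j. loop M ro ro' (Sp j)"
 let ?W = "A # M" and ?Z = "M @ [A]"
 let ?Nu = "%j. {M @ [A];evR (?X j);}${;ro' [A, ?X j];[?Y j]}"
 let ?Nv = "%j. {[A, ?X j];ro [?Y j];}${[A];coev (?X j);M}"
 let ?N = "%j f. ?Nu j${;f;M @ [?Y j]}$?Nv j"
 let ?Lu = "%k. {M;evR (?X k);[A]}${;ro' [?X k];[?Y k, A]}${[?X k];ro [?Y k, A];}"
 let ?Lv = "%k. {;coev (?X k);A # M}"
 let ?L = "%k f. ?Lu k${[?X k];f;M}$?Lv k"
 have Nu: "?Nu j : whom ([] @ [A, ?X j] @ M @ [?Y j]) ?Z" and Nv: "?Nv j : whom ?W ([] @ [A, ?X j] @ M @ [?Y j])" if "j : J C" for j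
  using that by (simp_all add: homs)
 have Lu: "?Lu k : whom ([?X k] @ [?Y k, A] @ M) ?Z" and Lv: "?Lv k : whom ?W ([?X k] @ [?Y k, A] @ M)" if "k : J C" for k
  using that by (simp_all add: homs)
 have app: "ro' [A, ?X j] = {;ro' [A];[?X j]}${[A];ro' [?X j];}"
  "ro [?Y j, A] = {;ro [?Y j];[A]}${[?Y j];ro [A];}" if "j : J C" for j
  using half_braid_append[OF h(2), of "[A]" "[?X j]"] half_braid_append[OF h(1), of "[?Y j]" "[A]"] that by simp_all
 have N_id: "?N j (idw [A, ?X j]) = ro' [A]${[A];?l j;}" if j [simp]: "j : J C" for j
 proof -
  have "?N j (idw [A, ?X j]) = {;ro' [A];}${[A];?l j;}"
   by (simp add: app loop_def diagram)
  then show ?thesis by (simp add: layer_nil)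
 qed
 have L_id: "?L k (idw [?Y k, A]) = {;?l k;[A]}$ro [A]" if k [simp]: "k : J C" for k
 proof -
  have "?L k (idw [?Y k, A]) = {;?l k;[A]}${;ro [A];}"
   by (simp add: app loop_def diagram)
  then show ?thesis by (simp add: layer_nil)
 qed
 have NL: "?N j (chi A j k a$phi A j k a) = ?L k (psi A j k a$phi' A j k a)"
  if j [simp]: "j : J C" and k [simp]: "k : J C" and a: "a < hdim A j k" for j k a
 proof -
  have [simp]: "warr (chi A j k a)" "dom (chi A j k a) = [?X k]" "cod (chi A j k a) = [A, ?X j]"
   "warr (phi A j k a)" "dom (phi A j k a) = [A, ?X j]" "cod (phi A j k a) = [?X k]"
   "warr (psi A j k a)" "dom (psi A j k a) = [?Y j]" "cod (psi A j k a) = [?Y k, A]"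
   "warr (phi' A j k a)" "dom (phi' A j k a) = [?Y k, A]" "cod (phi' A j k a) = [?Y j]"
   using chi_hom[OF A j k a] phi_hom[OF A j k a] psi_hom[OF A j k a] phi'_hom[OF A j k a] by (auto simp: homs)
  have n1: "ro' [A, ?X j]${;chi A j k a;M} = {M;chi A j k a;}$ro' [?X k]"
   by (rule half_braid_nat[OF h(2), symmetric]) simp_all
  have n2: "{M;psi A j k a;}$ro [?Y j] = ro [?Y k, A]${;psi A j k a;M}"
   by (rule half_braid_nat[OF h(1)]) simp_all
  have "?N j (chi A j k a$phi A j k a) = {M @ [A];evR (?X j);}${M;chi A j k a;[?Y j]}${;ro' [?X k];[?Y j]}
   ${[?X k];ro [?Y j];}${;phi A j k a;?Y j # M}${[A];coev (?X j);M}"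
   by (rule rewrite[OF n1, of _ "{M @ [A];evR (?X j);}" "[]" "[?Y j]" "{[?X k];ro [?Y j];}${;phi A j k a;?Y j # M}${[A];coev (?X j);M}"])
    (simp_all add: diagram)
  also have "... = {M;evR (?X k);[A]}${M @ [?X k];psi A j k a;}${;ro' [?X k];[?Y j]}
   ${[?X k];ro [?Y j];}${;phi A j k a;?Y j # M}${[A];coev (?X j);M}"
   by (rule rewrite[OF chi_slide[OF A j k a], of _ "idw (M @ [A])" M "[]" "{;ro' [?X k];[?Y j]}${[?X k];ro [?Y j];}${;phi A j k a;?Y j # M}${[A];coev (?X j);M}"])
    (simp_all add: cassoc)
  also have "... = {M;evR (?X k);[A]}${;ro' [?X k];[?Y k, A]}${?X k # M;psi A j k a;}
   ${[?X k];ro [?Y j];}${[?X k];phi' A j k a;M}${;coev (?X k);A # M}"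
   by (rule rewrite[OF phi_slide[OF A j k a], of _ "{M;evR (?X k);[A]}${;ro' [?X k];[?Y k, A]}${?X k # M;psi A j k a;}
   ${[?X k];ro [?Y j];}" "[]" M "idw (A # M)"]) (simp_all add: diagram)
  also have "... = ?L k (psi A j k a$phi' A j k a)"
   by (rule rewrite[OF n2, of _ "{M;evR (?X k);[A]}${;ro' [?X k];[?Y k, A]}" "[?X k]" "[]" "{[?X k];phi' A j k a;M}${;coev (?X k);A # M}"])
    (simp_all add: cassoc)
  finally show ?thesis .
 qed
 have cp: "chi A j k a$phi A j k a : whom [A, ?X j] [A, ?X j]" "psi A j k a$phi' A j k a : whom [?Y k, A] [?Y k, A]"
  if "j : J C" "k : J C" "a < hdim A j k" for j k a
  using that by (auto intro!: hin(4)[OF chi_hom phi_hom] hin(4)[OF psi_hom phi'_hom])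
 have Lcp: "?L k (psi A j k a$phi' A j k a) : whom ?W ?Z" if "j : J C" "k : J C" "a < hdim A j k" for j k a
  by (rule sandwich_whom[OF Lu[OF that(2)] Lv[OF that(2)]]) (use that cp(2)[OF that] in simp_all)
 have W: "word ?W" and Z: "word ?Z" by simp_all
 let ?T = "%j k. wsum ?W ?Z (%a. sc (d j) (?L k (psi A j k a$phi' A j k a))) {..<hdim A j k}"
 have T: "?T j k : whom ?W ?Z" if "j : J C" "k : J C" for j k
  using that by (intro hin(5) hin(3) Lcp) simp_all
 have 1: "sc (d j) (ro' [A]${[A];?l j;}) = wsum ?W ?Z (%k. sc (d k) (?T j k)) (J C)" if j: "j : J C" for j
 proof -
  have "ro' [A]${[A];?l j;} = ?N j (wsum [A, ?X j] [A, ?X j] (isotypic A j) (J C))"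
   unfolding isotypic_sum[OF A j] by (rule N_id[OF j, symmetric])
  also have "... = wsum ?W ?Z (%k. ?N j (isotypic A j k)) (J C)"
   by (rule sandwich_wsum[OF Nu[OF j] Nv[OF j]]) (use j isotypic_hom[OF A j] in simp_all)
  also have "... = wsum ?W ?Z (%k. wsum ?W ?Z (%a. sc (d k) (?L k (psi A j k a$phi' A j k a))) {..<hdim A j k}) (J C)"
  proof (rule wsum_cong_whom)
   fix k assume k: "k : J C"
   have "?N j (isotypic A j k) = wsum ?W ?Z (%a. ?N j (sc (d k) (chi A j k a$phi A j k a))) {..<hdim A j k}"
    unfolding isotypic_def by (rule sandwich_wsum[OF Nu[OF j] Nv[OF j]]) (use j k cp in "auto intro!: hin(3)")
   also have "... = wsum ?W ?Z (%a. sc (d k) (?L k (psi A j k a$phi' A j k a))) {..<hdim A j k}"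
   proof (rule wsum_cong_whom)
    fix a assume "a : {..<hdim A j k}"
    then have a: "a < hdim A j k" by simp
    have "?N j (sc (d k) (chi A j k a$phi A j k a)) = sc (d k) (?N j (chi A j k a$phi A j k a))"
     by (rule sandwich_wscale[OF Nu[OF j] Nv[OF j]]) (use j cp(1)[OF j k a] in simp_all)
    then show "?N j (sc (d k) (chi A j k a$phi A j k a)) = sc (d k) (?L k (psi A j k a$phi' A j k a))"
     unfolding NL[OF j k a] .
    show "sc (d k) (?L k (psi A j k a$phi' A j k a)) : whom ?W ?Z" by (rule hin(3)[OF Lcp[OF j k a]])
   qed simp_all
   finally show "?N j (isotypic A j k) = wsum ?W ?Z (%a. sc (d k) (?L k (psi A j k a$phi' A j k a))) {..<hdim A j k}" .
   show "wsum ?W ?Z (%a. sc (d k) (?L k (psi A j k a$phi' A j k a))) {..<hdim A j k} : whom ?W ?Z"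
    by (intro hin(5) hin(3) Lcp) (use j k in simp_all)
  qed simp_all
  finally have e: "ro' [A]${[A];?l j;} = wsum ?W ?Z (%k. wsum ?W ?Z (%a. sc (d k) (?L k (psi A j k a$phi' A j k a))) {..<hdim A j k}) (J C)" .
  show ?thesis unfolding e
   by (rule wscale_wsum_swap[where G = "%k a. ?L k (psi A j k a$phi' A j k a)" and I = "%k. {..<hdim A j k}" and K = "J C" and x = ?W and y = ?Z and c = d and b = "d j", OF W Z])
    (rule Lcp[OF j], assumption, simp only: lessThan_iff)
 qed
 have 2: "wsum ?W ?Z (%j. ?T j k) (J C) = {;?l k;[A]}$ro [A]" if k: "k : J C" for k
 proof -
  let ?V = "[?Y k, A]"
  let ?P = "%j. wsum ?V ?V (%a. sc (d j) (psi A j k a$phi' A j k a)) {..<hdim A j k}"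
  have P: "?P j : whom ?V ?V" if "j : J C" for j using that k by (intro hin(5) hin(3) cp) simp_all
  have "wsum ?W ?Z (%j. ?T j k) (J C) = wsum ?W ?Z (%j. ?L k (?P j)) (J C)"
  proof (rule wsum_cong_whom)
   fix j assume j: "j : J C"
   have "?L k (?P j) = wsum ?W ?Z (%a. ?L k (sc (d j) (psi A j k a$phi' A j k a))) {..<hdim A j k}"
    by (rule sandwich_wsum[OF Lu[OF k] Lv[OF k]]) (use j k cp in "auto intro!: hin(3)")
   also have "... = ?T j k"
    by (rule wsum_cong_whom) (use k in "auto intro!: sandwich_wscale[OF Lu[OF k] Lv[OF k]] cp hin(3) Lcp j k")
   finally show "?T j k = ?L k (?P j)" by simp
   show "?L k (?P j) : whom ?W ?Z" by (rule sandwich_whom[OF Lu[OF k] Lv[OF k]]) (use k P[OF j] in simp_all)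
  qed simp_all
  also have "... = ?L k (wsum ?V ?V ?P (J C))"
   by (rule sandwich_wsum[OF Lu[OF k] Lv[OF k], symmetric]) (use k P in simp_all)
  also have "... = {;?l k;[A]}$ro [A]"
   unfolding dual_completeness[OF A k] by (rule L_id[OF k])
  finally show ?thesis .
 qed
 have "wsum ?W ?Z (%j. sc (d j) (ro' [A]${[A];?l j;})) (J C) = wsum ?W ?Z (%j. wsum ?W ?Z (%k. sc (d k) (?T j k)) (J C)) (J C)"
  by (rule wsum_cong_whom[OF _ _ 1 hin(5)[OF _ _ hin(3)[OF T]]]) simp_all
 also have "... = wsum ?W ?Z (%k. wsum ?W ?Z (%j. sc (d k) (?T j k)) (J C)) (J C)"
  by (rule wsum_swap) (use T in "auto intro!: hin(3)")
 also have "... = wsum ?W ?Z (%k. sc (d k) ({;?l k;[A]}$ro [A])) (J C)"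
 proof (rule wsum_cong_whom)
  fix k assume k: "k : J C"
  have "wsum ?W ?Z (%j. sc (d k) (?T j k)) (J C) = sc (d k) (wsum ?W ?Z (%j. ?T j k) (J C))"
   by (rule wscale_wsum_whom[symmetric]) (use T k in auto)
  then show "wsum ?W ?Z (%j. sc (d k) (?T j k)) (J C) = sc (d k) ({;?l k;[A]}$ro [A])"
   unfolding 2[OF k] .
  show "sc (d k) ({;?l k;[A]}$ro [A]) : whom ?W ?Z"
   using loop_hom[OF h, of "?X k"] k by (auto simp: homs)
 qed simp_all
 finally have key: "wsum ?W ?Z (%j. sc (d j) (ro' [A]${[A];?l j;})) (J C) = wsum ?W ?Z (%k. sc (d k) ({;?l k;[A]}$ro [A])) (J C)" .
 let ?Q = "avg M ro ro'"
 have Q: "warr ?Q" "dom ?Q = M" "cod ?Q = M" using avg_hom by (auto simp: homs)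
 have l: "warr (?l j)" "dom (?l j) = M" "cod (?l j) = M" if "j : J C" for j using loop_hom[OF h, of "Sp j"] that by (auto simp: homs)
 have "ro' [A]${[A];?Q;}$idw ?W = sc (1 / gdim) (wsum ?W ?Z (%j. sc (d j) (ro' [A]${[A];?l j;}$idw ?W)) (J C))"
  by (rule avg_sandwich) (simp_all add: homs)
 also have "... = sc (1 / gdim) (wsum ?W ?Z (%j. sc (d j) (ro' [A]${[A];?l j;})) (J C))"
  by (rule avg_cong) (use l in "simp_all add: homs")
 also have "... = sc (1 / gdim) (wsum ?W ?Z (%j. sc (d j) (idw ?Z${;?l j;[A]}$ro [A])) (J C))"
  unfolding key by (rule avg_cong) (use l in "simp_all add: homs")
 also have "... = idw ?Z${;?Q;[A]}$ro [A]"
  by (rule avg_sandwich[symmetric]) (simp_all add: homs)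
 finally show ?thesis using Q by simp
qed

end

lemma avg_natural:
 assumes f: "intw f ro ta" "intw f ro' ta'" and M: "dom f = M" "cod f = N"
  and h: "hbraid M ro" "hbraid M ro'" "hbraid N ta" "hbraid N ta'"
 shows "avg N ta ta'$f = f$avg M ro ro'"
proof -
 have fh: "f : whom M N" using intertwiner_warr[OF f(1)] M by (simp add: homs)
 note w [simp] = hb_simps(1)[OF h(1)] hb_simps(1)[OF h(3)]
 have Q: "avg N ta ta' : whom N N" "avg M ro ro' : whom M M" using avg_hom h by blast+
 have l: "loop N ta ta' (Sp j) : whom N N" "loop M ro ro' (Sp j) : whom M M" if "j : J C" for j
  using that loop_hom[OF h(1,2)] loop_hom[OF h(3,4)] by simp_all
 have "idw N${;avg N ta ta';}$f
   = sc (1 / gdim) (wsum M N (%j. sc (d j) (idw N${;loop N ta ta' (Sp j);}$f)) (J C))"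
  by (rule avg_sandwich[OF h(3,4)]) (use fh in "simp_all add: homs")
 also have "... = sc (1 / gdim) (wsum M N (%j. sc (d j) (f${;loop M ro ro' (Sp j);}$idw M)) (J C))"
  by (rule avg_cong[OF h(1,2)]) (use l fh loop_natural[OF f M h] in "simp_all add: homs layer_nil")
 also have "... = f${;avg M ro ro';}$idw M"
  by (rule avg_sandwich[OF h(1,2), symmetric]) (use fh in "simp_all add: homs")
 finally show ?thesis using Q fh by (simp add: homs layer_nil)
qed

context
 fixes M ro ro'
 assumes h: "hbraid M ro" "hbraid M ro'" and c: "crosses braid braid M ro ro'" and D: "gdim ~= 0"
begin

lemma avg_intertwines: "intw (avg M ro ro') ro ro" "intw (avg M ro ro') ro' ro'"
proof -
 have "crosses braid' braid' M ro' ro"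
  by (rule crosses_swap[OF c h]) (simp_all add: braid_inverse)
 then show "intw (avg M ro ro') ro ro"
  by (intro avg_commute[OF h h(1), of braid' braid'] crosses_self h) simp_all
 show "intw (avg M ro ro') ro' ro'"
  by (intro avg_commute[OF h h(2), of braid braid] crosses_self h c) simp_all
qed

lemma avg_equalizes: "a : Ob ==> ro [a]${[a];avg M ro ro';} = ro' [a]${[a];avg M ro ro';}"
 using avg_slide[OF h] intwD[OF avg_intertwines(1)] by simp

lemma avg_idem: "avg M ro ro'$avg M ro ro' = avg M ro ro'"
 by (rule avg_fix[OF h D avg_hom[OF h] avg_equalizes])

end
end

section \<open>Casimir elements\<close>

context linear_monoidal_category
begin

lemma wsum_Sigma:
 assumes w: "word x" "word y" and fin: "finite I" "!!i. i : I ==> finite (K i)"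
  and F: "!!i k. [|i : I; k : K i|] ==> F (i, k) : whom x y"
 shows "wsum x y F (Sigma I K) = wsum x y (%i. wsum x y (%k. F (i, k)) (K i)) I"
proof (rule word_arr_eqI)
 let ?s = "hom_sum C (wobj x) (wobj y)"
 have o: "wobj x : Ob" "wobj y : Ob" using w by simp_all
 interpret G: comm_group "hom_group C (wobj x) (wobj y)" by (rule hom_comm_group[OF o])
 have h: "underlying (F (i, k)) : Hom C (wobj x) (wobj y)" if "i : I" "k : K i" for i k
  using that whom_underlying F by blast
 have "Sigma I K = (\<Union>i\<in>I. Pair i ` K i)" by auto
 then have "?s (%p. underlying (F p)) (Sigma I K) = finprod (hom_group C (wobj x) (wobj y)) (%p. underlying (F p)) (\<Union>i\<in>I. Pair i ` K i)"
  by (simp add: hom_sum_def)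
 also have "... = ?s (%i. ?s (%p. underlying (F p)) (Pair i ` K i)) I"
  unfolding hom_sum_def by (rule G.finprod_UN_disjoint) (use fin h in "auto simp: pairwise_def disjnt_def")
 also have "... = ?s (%i. ?s (%k. underlying (F (i, k))) (K i)) I"
 proof (rule hom_sum_cong)
  fix i assume "i : I"
  then show "?s (%p. underlying (F p)) (Pair i ` K i) = ?s (%k. underlying (F (i, k))) (K i)"
   using h G.finprod_reindex[of "%p. underlying (F p)" "Pair i" "K i"] by (auto simp: hom_sum_def inj_on_def)
 qed (use o h in "auto intro!: hom_sum_Hom")
 finally show "underlying (wsum x y F (Sigma I K)) = underlying (wsum x y (%i. wsum x y (%k. F (i, k)) (K i)) I)" by simp
qed simp_all

lemma wscale_one_whom: "f : whom x y ==> sc 1 f = f"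
 by (simp add: homs)

lemma wsum_triple:
 assumes [simp]: "word x" "word y" "finite K" "!!k. finite (M k)" "!!k. finite (N k)"
  and F: "!!k b a. [|k : K; b : M k; a : N k|] ==> F (k, b, a) : whom x y"
 shows "wsum x y F (SIGMA k : K. M k \<times> N k) = wsum x y (%k. wsum x y (%b. wsum x y (%a. F (k, b, a)) (N k)) (M k)) K"
proof -
 have "wsum x y F (SIGMA k : K. M k \<times> N k) = wsum x y (%k. wsum x y (%p. F (k, p)) (M k \<times> N k)) K"
  by (rule wsum_Sigma) (use F in auto)
 also have "... = wsum x y (%k. wsum x y (%b. wsum x y (%a. F (k, b, a)) (N k)) (M k)) K"
 proof (rule wsum_cong_whom)
  fix k assume k: "k : K"
  show "wsum x y (%p. F (k, p)) (M k \<times> N k) = wsum x y (%b. wsum x y (%a. F (k, b, a)) (N k)) (M k)"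
   by (rule wsum_Sigma) (use F k in auto)
  show "wsum x y (%b. wsum x y (%a. F (k, b, a)) (N k)) (M k) : whom x y"
   by (rule hin(5)[OF _ _ hin(5)[OF _ _ F]]) (use k in auto)
 qed simp_all
 finally show ?thesis .
qed

lemma layer_comb_comp:
 assumes v: "v : whom w (p @ x @ q)" and [simp]: "word p" "word q" "word x" "word y" and F: "!!t. t : T ==> F t : whom x y"
 shows "{p;wsum x y (%t. sc (c t) (F t)) T;q}$v = wsum w (p @ y @ q) (%t. sc (c t) ({p;F t;q}$v)) T"
proof -
 have [simp]: "warr v" "dom v = w" "cod v = p @ x @ q" using v by (auto simp: homs)
 have [simp]: "word w" using warr_word(1)[of v] by simp
 have f: "warr (F t)" "dom (F t) = x" "cod (F t) = y" if "t : T" for t using F[OF that] by (auto simp: homs)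
 have "{p;wsum x y (%t. sc (c t) (F t)) T;q} = wsum (p @ x @ q) (p @ y @ q) (%t. {p;sc (c t) (F t);q}) T"
  by (rule layer_wsum_whom) (simp_all add: homs f)
 moreover have "wsum (p @ x @ q) (p @ y @ q) (%t. {p;sc (c t) (F t);q}) T$v = wsum w (p @ y @ q) (%t. {p;sc (c t) (F t);q}$v) T"
  by (rule wsum_comp_whom) (simp_all add: homs f)
 moreover have "... = wsum w (p @ y @ q) (%t. sc (c t) ({p;F t;q}$v)) T"
  by (rule wsum_cong) (simp_all add: f layer_wscale wscale_comp)
 ultimately show ?thesis by simp
qed

lemma comp_layer_comb:
 assumes u: "u : whom (p @ y @ q) z" and [simp]: "word p" "word q" "word x" "word y" and F: "!!t. t : T ==> F t : whom x y"
 shows "u${p;wsum x y (%t. sc (c t) (F t)) T;q} = wsum (p @ x @ q) z (%t. sc (c t) (u${p;F t;q})) T"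
proof -
 have [simp]: "warr u" "dom u = p @ y @ q" "cod u = z" using u by (auto simp: homs)
 have [simp]: "word z" using warr_word(2)[of u] by simp
 have f: "warr (F t)" "dom (F t) = x" "cod (F t) = y" if "t : T" for t using F[OF that] by (auto simp: homs)
 have "{p;wsum x y (%t. sc (c t) (F t)) T;q} = wsum (p @ x @ q) (p @ y @ q) (%t. {p;sc (c t) (F t);q}) T"
  by (rule layer_wsum_whom) (simp_all add: homs f)
 moreover have "u$wsum (p @ x @ q) (p @ y @ q) (%t. {p;sc (c t) (F t);q}) T = wsum (p @ x @ q) z (%t. u${p;sc (c t) (F t);q}) T"
  by (rule comp_wsum_whom) (simp_all add: homs f)
 moreover have "... = wsum (p @ x @ q) z (%t. sc (c t) (u${p;F t;q})) T"
  by (rule wsum_cong) (simp_all add: f layer_wscale comp_wscale)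
 ultimately show ?thesis by simp
qed

end

context premodular_category_with_choices
begin

text \<open>Dual bases for a word \<open>x\<close>, characterized by the expansion of arrows alone; besides chosen dual bases
 this covers the families obtained for composite words by gluing.\<close>

definition dual_family where
 "dual_family x i j T F G \<longleftrightarrow> finite T & (\<forall>t\<in>T. F t : whom (x @ [Sp i]) (S j) & G t : whom (S' i) (Du (Sp j) # x)) &
  (\<forall>h\<in>whom (x @ [Sp i]) (S j). h = wsum (x @ [Sp i]) (S j) (%t. sc (d j * scal (h$hat_word (Sp i) (Sp j) x (G t))) (F t)) T)"

text \<open>The sum \<open>\<Sum>\<phi>\<^sub>a \<otimes> \<phi>\<^sup>a\<close> that carries \<open>\<Gamma>\<close>; the letters of \<open>x\<close> enter on the left and leave on the right.\<close>

definition casimir where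
 "casimir x i j T F G = wsum (x @ [Sp i, Du (Sp i)]) ([Sp j, Du (Sp j)] @ x)
  (%t. {;F t;Du (Sp j) # x}${x @ [Sp i];G t;}) T"

definition cas where
 "cas A i j = casimir [A] i j {..<hdim A i j} (phi A i j) (psi A i j)"

lemma dual_family_hom: "[|dual_family x i j T F G; t : T|] ==> F t : whom (x @ [Sp i]) (S j)"
 "[|dual_family x i j T F G; t : T|] ==> G t : whom (S' i) (Du (Sp j) # x)"
 by (auto simp: dual_family_def)

context
 fixes i j
 assumes i [simp]: "i : J C" and j [simp]: "j : J C"
begin

lemma casimir_whom:
 assumes "dual_family x i j T F G" "word x"
 shows "casimir x i j T F G : whom (x @ [Sp i, Du (Sp i)]) ([Sp j, Du (Sp j)] @ x)"
 unfolding casimir_def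
 by (rule hin(5)) (use assms(2) dual_family_hom[OF assms(1)] in \<open>auto simp: homs\<close>)

lemma dual_family_single: "A : Ob ==> dual_family [A] i j {..<hdim A i j} (phi A i j) (psi A i j)"
 unfolding dual_family_def
proof (intro conjI ballI)
 fix h assume "A : Ob" "h : whom ([A] @ [Sp i]) (S j)"
 then show "h = wsum ([A] @ [Sp i]) (S j) (%t. sc (d j * scal (h$hat_word (Sp i) (Sp j) [A] (psi A i j t))) (phi A i j t)) {..<hdim A i j}"
  using phi_expand[of A i j h] by (simp add: chi_def)
qed (auto simp: phi_hom psi_hom)

lemma cas_whom: "A : Ob ==> cas A i j : whom [A, Sp i, Du (Sp i)] [Sp j, Du (Sp j), A]"
 unfolding cas_def using casimir_whom[OF dual_family_single, of A] by simp

text \<open>Both sides expand into the same double sum over products of basis vectors: an arrow acts on one basis by a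
 matrix and on the dual basis by its transpose. In particular the sum does not depend on the bases.\<close>

lemma casimir_natural:
 assumes D: "dual_family x i j T F G" and v: "v : whom x [B]"
 shows "cas B i j${;v;[Sp i, Du (Sp i)]} = {[Sp j, Du (Sp j)];v;}$casimir x i j T F G"
proof -
 let ?X = "Sp i" and ?X' = "Du (Sp i)" and ?Y = "Sp j" and ?Y' = "Du (Sp j)"
 have vs [simp]: "warr v" "dom v = x" "cod v = [B]" using v by (auto simp: homs)
 have [simp]: "word x" "B : Ob" using warr_word[of v] by simp_all
 let ?n = "hdim B i j" and ?p = "phi B i j" and ?s = "psi B i j"
 have p: "?p c : whom [B, ?X] [?Y]" "?s c : whom [?X'] [?Y', B]" if "c < ?n" for c
  using that by (simp_all add: phi_hom psi_hom)
 note p' = p[unfolded homs]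
 have fin: "finite T" using D by (simp add: dual_family_def)
 have F: "F t : whom (x @ [?X]) [?Y]" "G t : whom [?X'] (?Y' # x)" if "t : T" for t
  using dual_family_hom[OF D that] by simp_all
 note F' = F[unfolded homs]
 let ?w = "%c t. d j * scal (?p c${;v;[?X]}$hat_word ?X ?Y x (G t))"
 let ?P = "%c t. {;F t;[?Y', B]}${x @ [?X];?s c;}"
 let ?W = "x @ [?X, ?X']" and ?Z = "[?Y, ?Y', B]"
 have P: "?P c t : whom ?W ?Z" if "c < ?n" "t : T" for c t using p'[OF that(1)] F'[OF that(2)] by (simp add: homs)
 have hv: "hat_word ?X ?Y [B] ({[?Y'];v;}$G t) = {;v;[?X]}$hat_word ?X ?Y x (G t)" if "t : T" for t
  using F'[OF that] by (simp add: hat_word_def diagram)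
 have "cas B i j${;v;[?X, ?X']} = wsum ?W ?Z (%c. ({;?p c;[?Y', B]}${[B, ?X];?s c;})${;v;[?X, ?X']}) {..<?n}"
  unfolding cas_def casimir_def append.simps by (rule wsum_comp_whom) (use p' in "auto simp: homs")
 also have "... = wsum ?W ?Z (%c. wsum ?W ?Z (%t. sc (?w c t) (?P c t)) T) {..<?n}"
 proof (rule wsum_cong_whom)
  fix c assume "c : {..<?n}"
  then have c: "c < ?n" by simp
  let ?h = "?p c${;v;[?X]}"
  have h: "?h : whom (x @ [?X]) [?Y]" using p'[OF c] by (simp add: homs)
  have "?h = wsum (x @ [?X]) [?Y] (%t. sc (d j * scal (?h$hat_word ?X ?Y x (G t))) (F t)) T"
   using D h unfolding dual_family_def by blast
  also have "... = wsum (x @ [?X]) [?Y] (%t. sc (?w c t) (F t)) T"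
   by (rule wsum_cong_whom) (use F' p'[OF c] in "auto intro!: hin(3) F simp: cassoc hat_word_def")
  finally have e: "{;?h;[?Y', B]}${x @ [?X];?s c;} = {;...;[?Y', B]}${x @ [?X];?s c;}" by (rule arg_cong)
  have "({;?p c;[?Y', B]}${[B, ?X];?s c;})${;v;[?X, ?X']} = {;?h;[?Y', B]}${x @ [?X];?s c;}"
   using p'[OF c] by (simp add: diagram)
  also have "... = wsum ?W ([] @ [?Y] @ [?Y', B]) (%t. sc (?w c t) (?P c t)) T"
   unfolding e by (rule layer_comb_comp) (use p'[OF c] F in "auto simp: homs")
  finally show "({;?p c;[?Y', B]}${[B, ?X];?s c;})${;v;[?X, ?X']} = wsum ?W ?Z (%t. sc (?w c t) (?P c t)) T" by simp
  show "wsum ?W ?Z (%t. sc (?w c t) (?P c t)) T : whom ?W ?Z"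
   by (rule hin(5)) (auto intro!: hin(3)[OF P[OF c]])
 qed simp_all
 also have "... = wsum ?W ?Z (%t. wsum ?W ?Z (%c. sc (?w c t) (?P c t)) {..<?n}) T"
  by (rule wsum_swap) (use fin in "auto intro!: hin(3)[OF P]")
 also have "... = wsum ?W ?Z (%t. {[?Y, ?Y'];v;}${;F t;?Y' # x}${x @ [?X];G t;}) T"
 proof (rule wsum_cong_whom)
  fix t assume t: "t : T"
  let ?g = "{[?Y'];v;}$G t"
  have g: "?g : whom [?X'] [?Y', B]" using F'[OF t] by (simp add: homs)
  have "?g = wsum [?X'] [?Y', B] (%c. sc (?w c t) (?s c)) {..<?n}"
   using psi_expand[OF _ i j g] hv[OF t] by simp
  then have e: "{;F t;[?Y', B]}${x @ [?X];?g;} = {;F t;[?Y', B]}${x @ [?X];wsum [?X'] [?Y', B] (%c. sc (?w c t) (?s c)) {..<?n};}" by (rule arg_cong)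
  have "... = wsum ((x @ [?X]) @ [?X'] @ []) ?Z (%c. sc (?w c t) (?P c t)) {..<?n}"
   by (rule comp_layer_comb) (use F'[OF t] p in "auto simp: homs")
  with e have e': "{;F t;[?Y', B]}${x @ [?X];?g;} = wsum ?W ?Z (%c. sc (?w c t) (?P c t)) {..<?n}" by simp
  have "{;F t;[?Y', B]}${x @ [?X];?g;} = {[?Y, ?Y'];v;}${;F t;?Y' # x}${x @ [?X];G t;}"
   using F'[OF t] by (simp add: diagram)
  then show "wsum ?W ?Z (%c. sc (?w c t) (?P c t)) {..<?n} = {[?Y, ?Y'];v;}${;F t;?Y' # x}${x @ [?X];G t;}" unfolding e' .
  show "{[?Y, ?Y'];v;}${;F t;?Y' # x}${x @ [?X];G t;} : whom ?W ?Z" using F'[OF t] by (simp add: homs)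
 qed simp_all
 also have "... = {[?Y, ?Y'];v;}$casimir x i j T F G"
  unfolding casimir_def by (rule comp_wsum_whom[symmetric]) (use F' in "auto simp: homs")
 finally show ?thesis .
qed

lemma dual_family_nil: "dual_family [] i j (if i = j then {()} else {}) (%_. idw (S i)) (%_. sc (1 / d i) (idw (S' i)))"
proof -
 let ?X = "Sp i"
 have hat1: "hat_word ?X ?X [] (sc (1 / d i) (idw (S' i))) = sc (1 / d i) (idw (S i))"
  using hat_word_wscale[of ?X ?X "[]" "idw (S' i)" "1 / d i"] snake_right_left[of ?X, OF _ refl] by (simp add: hat_word_def homs)
 have e: "sc (d i * scal (h$sc (1 / d i) (idw (S i)))) (idw (S i)) = h" if h: "h : whom (S i) (S i)" for h
 proof -
  have "h$sc (1 / d i) (idw (S i)) = sc (1 / d i) h" using h by (simp add: homs comp_wscale)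
  also have "... = sc (1 / d i * scal h) (idw (S i))" by (subst scal_eq[OF i h]) simp
  finally have "scal (h$sc (1 / d i) (idw (S i))) = 1 / d i * scal h" by (rule scal_unique[OF i])
  then show ?thesis using scal_eq[OF i h] d_nonzero[OF i] by simp
 qed
 show ?thesis
 proof (cases "i = j")
  case True
  have "h = wsum (S i) (S i) (%_. sc (d i * scal (h$sc (1 / d i) (idw (S i)))) (idw (S i))) {()}" if "h : whom (S i) (S i)" for h
   unfolding e[OF that] using wsum_single[of "S i" "S i" "{()}" "()" "%_. h"] that by simp
  then have "\<forall>h\<in>whom ([] @ [?X]) (S i). h = wsum ([] @ [?X]) (S i) (%_. sc (d i * scal (h$hat_word ?X ?X [] (sc (1 / d i) (idw (S' i))))) (idw (S i))) {()}"
   unfolding hat1 append.simps by blast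
  moreover have "idw (S i) : whom ([] @ [?X]) (S i)" "sc (1 / d i) (idw (S' i)) : whom (S' i) (Du ?X # [])" by (simp_all add: homs)
  ultimately show ?thesis unfolding True[symmetric] dual_family_def by simp
 next
  case False
  then show ?thesis using schur_zero[OF i j False] by (simp add: dual_family_def wsum_empty)
 qed
qed

lemma casimir_nil: "casimir [] i j (if i = j then {()} else {}) (%_. idw (S i)) (%_. sc (1 / d i) (idw (S' i)))
  = (if i = j then sc (1 / d i) (idw [Sp i, Du (Sp i)]) else wzero [Sp i, Du (Sp i)] [Sp j, Du (Sp j)])"
proof (cases "i = j")
 case True
 let ?x = "[Sp i, Du (Sp i)]"
 have "wsum ?x ?x (%_. sc (1 / d i) (idw ?x)) {()} = sc (1 / d i) (idw ?x)"
  using wsum_single[of ?x ?x "{()}" "()" "%_. sc (1 / d i) (idw ?x)"] by (simp add: homs)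
 with True show ?thesis by (simp add: casimir_def layer_wscale)
qed (simp add: casimir_def wsum_empty)

text \<open>Fusing two letters one after the other yields dual bases for the pair; this is what makes \<open>\<Gamma>\<close> multiplicative.\<close>

lemma dual_family_pair:
 assumes A [simp]: "A : Ob" and B [simp]: "B : Ob"
 defines "T == SIGMA k : J C. {..<hdim B i k} \<times> {..<hdim A k j}"
  and "F == %(k, b, a). sc (d k) (phi A k j a${[A];phi B i k b;})"
  and "G == %(k, b, a). {;psi A k j a;[B]}$psi B i k b"
 shows "dual_family [A, B] i j T F G"
  "casimir [A, B] i j T F G = wsum [A, B, Sp i, Du (Sp i)] [Sp j, Du (Sp j), A, B]
   (%k. sc (d k) ({;cas A k j;[B]}${[A];cas B i k;})) (J C)"
proof -
 let ?X = "Sp i" and ?X' = "Du (Sp i)" and ?Y = "Sp j" and ?Y' = "Du (Sp j)"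
 let ?m = "%k. hdim B i k" and ?n = "%k. hdim A k j"
 note pb = phi_hom[OF B i, unfolded homs] psi_hom[OF B i, unfolded homs] chi_hom[OF B i, unfolded homs]
 note pa = phi_hom[OF A _ j, unfolded homs] psi_hom[OF A _ j, unfolded homs] chi_hom[OF A _ j, unfolded homs]
 have F: "F (k, b, a) : whom [A, B, ?X] [?Y]" "G (k, b, a) : whom [?X'] [?Y', A, B]" if "k : J C" "b < ?m k" "a < ?n k" for k a b
  using that pa[OF that(1,3)] pb[OF that(1,2)] by (simp_all add: F_def G_def homs)
 note F' = F[unfolded homs]
 have hat: "hat_word ?X ?Y [A, B] (G (k, b, a)) = {[A];chi B i k b;}$chi A k j a" if k: "k : J C" and b: "b < ?m k" and a: "a < ?n k" for k a b
 proof -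
  note [simp] = k pa[OF k a] pb[OF k b]
  let ?K = "Sp k"
  show ?thesis
   by (rule rewrite[OF snake_right_right[of ?K, OF _ refl, symmetric], of _ "{;evR ?Y;[A, B, ?X]}${[?Y];psi A k j a;[B, ?X]}" "[?Y]" "[B, ?X]" "{[?Y];psi B i k b;[?X]}${[?Y];coevR ?X;}"])
    (simp_all add: G_def hat_word_def chi_def diagram)
 qed
 have "h = wsum [A, B, ?X] [?Y] (%t. sc (d j * scal (h$hat_word ?X ?Y [A, B] (G t))) (F t)) T" if h: "h : whom [A, B, ?X] [?Y]" for h
 proof -
  have [simp]: "warr h" "dom h = [A, B, ?X]" "cod h = [?Y]" using h by (auto simp: homs)
  let ?w = "%k b a. d j * scal (h${[A];chi B i k b;}$chi A k j a)"
  let ?s = "wsum [A, B, ?X] [?Y]"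
  have sF: "?s (%a. sc (?w k b a) (F (k, b, a))) {..<?n k} : whom [A, B, ?X] [?Y]" if "k : J C" "b < ?m k" for k b
   by (rule hin(5)) (use that F in "auto intro!: hin(3)")
  have 1: "h${[A];isotypic B i k;} = ?s (%b. ?s (%a. sc (?w k b a) (F (k, b, a))) {..<?n k}) {..<?m k}" if k: "k : J C" for k
  proof -
   have "h${[A];isotypic B i k;} = wsum ([A] @ [B, ?X] @ []) [?Y] (%b. sc (d k) (h${[A];chi B i k b$phi B i k b;})) {..<?m k}"
    unfolding isotypic_def by (rule comp_layer_comb) (use k pb[OF k] in "auto simp: homs")
   also have "... = ?s (%b. ?s (%a. sc (?w k b a) (F (k, b, a))) {..<?n k}) {..<?m k}"
    unfolding append.simps append_Nil2
   proof (rule wsum_cong_whom)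
    fix b assume "b : {..<?m k}"
    then have b: "b < ?m k" by simp
    let ?h = "h${[A];chi B i k b;}" and ?v = "{[A];phi B i k b;}"
    note [simp] = k pb[OF k b]
    have "?h = wsum [A, Sp k] [?Y] (%a. sc (d j * scal (?h$chi A k j a)) (phi A k j a)) {..<?n k}"
     by (rule phi_expand[OF A k j]) (simp add: homs)
    also have "... = wsum [A, Sp k] [?Y] (%a. sc (?w k b a) (phi A k j a)) {..<?n k}"
     by (rule wsum_cong_whom) (use pa[OF k] in "auto simp: cassoc homs")
    finally have "{;?h;}$?v = {;...;}$?v" by (rule arg_cong)
    also have "... = wsum [A, B, ?X] ([] @ [?Y] @ []) (%a. sc (?w k b a) ({;phi A k j a;}$?v)) {..<?n k}"
     by (rule layer_comb_comp) (use pa[OF k] in "auto simp: homs")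
    finally have e: "?h$?v = ?s (%a. sc (?w k b a) ({;phi A k j a;}$?v)) {..<?n k}" by (simp add: layer_nil)
    have "sc (d k) (h${[A];chi B i k b$phi B i k b;}) = sc (d k) (?h$?v)" by (simp add: cassoc)
    also have "... = ?s (%a. sc (d k) (sc (?w k b a) ({;phi A k j a;}$?v))) {..<?n k}"
     unfolding e by (rule wscale_wsum_whom) (use pa[OF k] in "auto simp: homs")
    also have "... = ?s (%a. sc (?w k b a) (F (k, b, a))) {..<?n k}"
     by (rule wsum_cong) (use pa[OF k] in "auto simp: F_def layer_nil mult.commute")
    finally show "sc (d k) (h${[A];chi B i k b$phi B i k b;}) = ?s (%a. sc (?w k b a) (F (k, b, a))) {..<?n k}" .
   qed (use k sF in simp_all)
   finally show ?thesis .
  qed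
  have 2: "?s (%b. ?s (%a. sc (?w k b a) (F (k, b, a))) {..<?n k}) {..<?m k} : whom [A, B, ?X] [?Y]" if "k : J C" for k
   by (rule hin(5)[OF _ _ sF[OF that]]) simp_all
  have "h = h${[A];wsum [B, ?X] [B, ?X] (isotypic B i) (J C);}"
   unfolding isotypic_sum[OF B i] by simp
  also have "{[A];wsum [B, ?X] [B, ?X] (isotypic B i) (J C);} = wsum [A, B, ?X] [A, B, ?X] (%k. {[A];isotypic B i k;}) (J C)"
   by (rule layer_wsum_whom) (use isotypic_hom[OF B i] in simp_all)
  also have "h$... = ?s (%k. h${[A];isotypic B i k;}) (J C)"
   by (rule comp_wsum_whom[OF h]) (use isotypic_hom[OF B i] in "simp_all add: homs")
  also have "... = ?s (%k. ?s (%b. ?s (%a. sc (?w k b a) (F (k, b, a))) {..<?n k}) {..<?m k}) (J C)"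
   by (rule wsum_cong_whom[OF _ _ 1 2]) simp_all
  also have "... = ?s (%(k, b, a). sc (?w k b a) (F (k, b, a))) T"
   unfolding T_def by (subst wsum_triple) (use F in "auto intro!: hin(3)")
  also have "... = ?s (%t. sc (d j * scal (h$hat_word ?X ?Y [A, B] (G t))) (F t)) T"
   by (rule wsum_cong_whom) (use F in "auto simp: T_def hat intro!: hin(3)")
  finally show ?thesis .
 qed
 then show "dual_family [A, B] i j T F G" using F by (auto simp: dual_family_def T_def)
 let ?W = "[A, B, ?X, ?X']" and ?Z = "[?Y, ?Y', A, B]"
 let ?s = "wsum ?W ?Z"
 let ?P = "%k b a. {;F (k, b, a);[?Y', A, B]}${[A, B, ?X];G (k, b, a);}"
 have P: "?P k b a : whom ?W ?Z" if "k : J C" "b < ?m k" "a < ?n k" for k b a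
  using F'[OF that] by (simp add: homs)
 have "casimir [A, B] i j T F G = ?s (%k. ?s (%b. ?s (?P k b) {..<?n k}) {..<?m k}) (J C)"
  unfolding casimir_def append.simps T_def by (subst wsum_triple) (use P in auto)
 also have "... = ?s (%k. sc (d k) ({;cas A k j;[B]}${[A];cas B i k;})) (J C)"
 proof (rule wsum_cong_whom)
  fix k assume k [simp]: "k : J C"
  let ?K = "Sp k" and ?K' = "Du (Sp k)"
  let ?f = "%b. {;phi B i k b;[?K', B]}${[B, ?X];psi B i k b;}"
  let ?g = "%a. {;phi A k j a;[?Y', A]}${[A, ?K];psi A k j a;}"
  have f: "?f b : whom [B, ?X, ?X'] [?K, ?K', B]" if "b < ?m k" for b using pb[OF k that] by (simp add: homs)
  have g: "?g a : whom [A, ?K, ?K'] [?Y, ?Y', A]" if "a < ?n k" for a using pa[OF k that] by (simp add: homs)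
  have cB: "cas B i k = wsum [B, ?X, ?X'] [?K, ?K', B] (%b. sc 1 (?f b)) {..<?m k}"
   unfolding cas_def casimir_def append.simps by (rule wsum_cong_whom) (use f in "auto simp: homs")
  have cA: "cas A k j = wsum [A, ?K, ?K'] [?Y, ?Y', A] (%a. sc 1 (?g a)) {..<?n k}"
   unfolding cas_def casimir_def append.simps by (rule wsum_cong_whom) (use g in "auto simp: homs")
  have wA: "cas A k j : whom [A, ?K, ?K'] [?Y, ?Y', A]" unfolding cA by (rule hin(5)) (use g in "auto intro!: hin(3)")
  have wB: "cas B i k : whom [B, ?X, ?X'] [?K, ?K', B]" unfolding cB by (rule hin(5)) (use f in "auto intro!: hin(3)")
  let ?R = "%b a. {;?g a;[B]}${[A];?f b;}"
  have "{;cas A k j;[B]}${[A];cas B i k;} = wsum ([A] @ [B, ?X, ?X'] @ []) ?Z (%b. sc 1 ({;cas A k j;[B]}${[A];?f b;})) {..<?m k}"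
   unfolding cB by (rule comp_layer_comb) (use wA f in "auto simp: homs")
  also have "... = ?s (%b. ?s (%a. sc 1 ({;?g a;[B]}${[A];?f b;})) {..<?n k}) {..<?m k}"
   unfolding append.simps append_Nil2
  proof (rule wsum_cong_whom)
   fix b assume "b : {..<?m k}"
   then have b: "b < ?m k" by simp
   have "{;cas A k j;[B]}${[A];?f b;} = wsum ?W ([] @ [?Y, ?Y', A] @ [B]) (%a. sc 1 ({;?g a;[B]}${[A];?f b;})) {..<?n k}"
    unfolding cA by (rule layer_comb_comp) (use f[OF b] g in "auto simp: homs")
   moreover have "{;cas A k j;[B]}${[A];?f b;} : whom ?W ?Z" using wA f[OF b] by (simp add: homs)
   ultimately show "sc 1 ({;cas A k j;[B]}${[A];?f b;}) = ?s (%a. sc 1 ({;?g a;[B]}${[A];?f b;})) {..<?n k}"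
    by (simp only: wscale_one_whom[of _ ?W ?Z] append.simps append_Nil2)
   show "?s (%a. sc 1 ({;?g a;[B]}${[A];?f b;})) {..<?n k} : whom ?W ?Z"
    by (rule hin(5)) (use f[OF b] g in "auto simp: homs")
  qed simp_all
  finally have c: "{;cas A k j;[B]}${[A];cas B i k;} = ?s (%b. ?s (%a. sc 1 (?R b a)) {..<?n k}) {..<?m k}" .
  have e: "sc (d k) (?R b a) = ?P k b a" "?R b a : whom ?W ?Z" if "a < ?n k" "b < ?m k" for a b
   using pa[OF k that(1)] pb[OF k that(2)] by (simp_all add: F_def G_def layer_wscale wscale_comp diagram homs)
  have 2: "?s (%a. sc (d k) (?R b a)) {..<?n k} = ?s (?P k b) {..<?n k}" if b: "b < ?m k" for b
   by (rule wsum_cong_whom[OF _ _ e(1)[OF _ b] P[OF k b]]) simp_all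
  have 3: "?s (?P k b) {..<?n k} : whom ?W ?Z" if "b < ?m k" for b by (rule hin(5)[OF _ _ P[OF k that]]) simp_all
  have "sc (d k) ({;cas A k j;[B]}${[A];cas B i k;}) = ?s (%b. sc 1 (?s (%a. sc (d k) (?R b a)) {..<?n k})) {..<?m k}"
   unfolding c by (rule wscale_wsum_swap[where G = ?R and I = "%_. {..<?n k}" and K = "{..<?m k}"]) (use e(2) in simp_all)
  also have "... = ?s (%b. ?s (?P k b) {..<?n k}) {..<?m k}"
   by (rule wsum_cong_whom) (use 2 3 in "simp_all add: homs")
  finally show "?s (%b. ?s (?P k b) {..<?n k}) {..<?m k} = sc (d k) ({;cas A k j;[B]}${[A];cas B i k;})" by simp
  show "sc (d k) ({;cas A k j;[B]}${[A];cas B i k;}) : whom ?W ?Z" using wA wB by (simp add: homs)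
 qed simp_all
 finally show "casimir [A, B] i j T F G = ?s (%k. sc (d k) ({;cas A k j;[B]}${[A];cas B i k;})) (J C)" .
qed

end
end

section \<open>The unit object\<close>

context linear_monoidal_category
begin

lemma sandwich_comb:
 assumes u: "u : whom (p @ y @ q) z" and v: "v : whom w (p @ x @ q)" and pq: "word p" "word q" "word x" "word y"
  and F: "!!t. t : T ==> F t : whom x y"
 shows "u${p;wsum x y (%t. sc (c t) (F t)) T;q}$v = wsum w z (%t. sc (c t) (u${p;F t;q}$v)) T"
proof -
 have w: "word w" "word z" using u v warr_word[of u] warr_word[of v] by (auto simp: homs)
 have "u${p;wsum x y (%t. sc (c t) (F t)) T;q}$v = wsum w z (%t. u${p;sc (c t) (F t);q}$v) T"
  by (rule sandwich_wsum[OF u v pq]) (rule hin(3)[OF F])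
 also have "... = wsum w z (%t. sc (c t) (u${p;F t;q}$v)) T"
 proof (rule wsum_cong_whom[OF w])
  fix t assume "t : T"
  then have f: "F t : whom x y" by (rule F)
  show "u${p;sc (c t) (F t);q}$v = sc (c t) (u${p;F t;q}$v)" by (rule sandwich_wscale[OF u v pq(1,2) f])
  show "sc (c t) (u${p;F t;q}$v) : whom w z" by (rule hin(3)[OF sandwich_whom[OF u v pq(1,2) f]])
 qed
 finally show ?thesis .
qed

end

context premodular_category_with_choices
begin

abbreviation (input) U where "U == [SOb]"
abbreviation (input) SD where "SD i == [Sp i, Du (Sp i)]"
abbreviation s where "s == SqrtDim C"

lemma s_square: "i : J C ==> s i * s i = d i"
 using SqrtDim by (simp add: power2_eq_square)

lemma SumObj [simp]: "SOb : Ob"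
 using Sum_biproduct by (simp add: is_biproduct_def)

definition inc where "inc i = (SD i, SumInj C i, U)"
definition prj where "prj i = (U, SumProj C i, SD i)"

lemma inc_simps [simp]: "dom (inc i) = SD i" "cod (inc i) = U" "underlying (inc i) = SumInj C i" "i : J C ==> warr (inc i)"
 and prj_simps [simp]: "dom (prj i) = U" "cod (prj i) = SD i" "underlying (prj i) = SumProj C i" "i : J C ==> warr (prj i)"
 using Sum_biproduct by (auto simp: is_biproduct_def inc_def prj_def intro!: warrI)

lemma prj_inj: "[|i : J C; j : J C|] ==> prj j$inc i = (if i = j then idw (SD i) else wzero (SD i) (SD j))"
 using Sum_biproduct by (intro word_arr_eqI) (auto simp: is_biproduct_def)

lemma inj_prj_sum: "wsum U U (%i. inc i$prj i) (J C) = idw U"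
 using Sum_biproduct by (intro word_arr_eqI) (auto simp: is_biproduct_def)

lemma sum_ext:
 assumes f: "f : whom (p @ U @ q) z" and g: "g : whom (p @ U @ q) z" and [simp]: "word p" "word q"
  and eq: "!!i. i : J C ==> f${p;inc i;q} = g${p;inc i;q}"
 shows "f = g"
proof -
 have e: "h = wsum (p @ U @ q) z (%i. (h${p;inc i;q})${p;prj i;q}) (J C)" if h: "h : whom (p @ U @ q) z" for h
 proof -
  have [simp]: "warr h" "dom h = p @ U @ q" "cod h = z" "word z" using h warr_word[of h] by (auto simp: homs)
  have "h = h${p;wsum U U (%i. inc i$prj i) (J C);q}$idw (p @ U @ q)" unfolding inj_prj_sum by simp
  also have "... = wsum (p @ U @ q) z (%i. h${p;inc i$prj i;q}$idw (p @ U @ q)) (J C)"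
   by (rule sandwich_wsum) (simp_all add: homs)
  also have "... = wsum (p @ U @ q) z (%i. (h${p;inc i;q})${p;prj i;q}) (J C)"
   by (rule wsum_cong_whom) (simp_all add: homs cassoc)
  finally show ?thesis .
 qed
 show ?thesis
  apply (subst e[OF f], subst e[OF g])
  using f g warr_word[of f] by (intro wsum_cong_whom) (simp_all add: eq homs)
qed

definition copair where
 "copair A z m = wsum (A @ U) z (%i. m i${A;prj i;}) (J C)"

context
 fixes A z m
 assumes Az [simp]: "word A" "word z" and m: "!!i. i : J C ==> m i : whom (A @ SD i) z"
begin

lemma copair_whom: "copair A z m : whom (A @ U) z"
 unfolding copair_def by (rule hin(5)) (use m in "auto simp: homs")

lemma copair_inj:
 assumes i [simp]: "i : J C"
 shows "copair A z m${A;inc i;} = m i"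
proof -
 have ms: "warr (m j)" "dom (m j) = A @ SD j" "cod (m j) = z" if "j : J C" for j using m[OF that] by (auto simp: homs)
 have c: "(m j${A;prj j;})${A;inc i;} = (if i = j then m i else wzero (A @ SD i) z)" if j [simp]: "j : J C" for j
 proof -
  have "(m j${A;prj j;})${A;inc i;} = m j${A;prj j$inc i;}"
   using ms[OF j] by (simp add: cassoc)
  then show ?thesis using ms[OF j] by (simp add: prj_inj del: layer_comp)
 qed
 have "copair A z m${A;inc i;} = wsum (A @ SD i) z (%j. (m j${A;prj j;})${A;inc i;}) (J C)"
  unfolding copair_def by (rule wsum_comp_whom) (use ms in "auto simp: homs")
 also have "... = (m i${A;prj i;})${A;inc i;}"
  by (rule wsum_single) (use c m in auto)
 finally show ?thesis using c[OF i] by simp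
qed

end

text \<open>The column of \<open>\<Gamma>\<close> on the component \<open>X\<^sub>i \<otimes> X\<^sub>i*\<close>.\<close>

definition gcol where
 "gcol A i = wsum (A # SD i) (U @ [A]) (%j. sc (s i * s j) ({;inc j;[A]}$cas A i j)) (J C)"

definition gam where
 "gam A = copair [A] (U @ [A]) (gcol A)"

lemma cas_simps [simp]:
 "[|A : Ob; i : J C; j : J C|] ==> warr (cas A i j)" "[|A : Ob; i : J C; j : J C|] ==> dom (cas A i j) = A # SD i"
 "[|A : Ob; i : J C; j : J C|] ==> cod (cas A i j) = [Sp j, Du (Sp j), A]"
 using cas_whom[of i j A] by (auto simp: homs)

lemma gcol_whom: "[|A : Ob; i : J C|] ==> gcol A i : whom ([A] @ SD i) (U @ [A])"
 unfolding gcol_def append.simps by (rule hin(5)) (auto simp: homs)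

lemma gcol_simps [simp]:
 "[|A : Ob; i : J C|] ==> warr (gcol A i)" "[|A : Ob; i : J C|] ==> dom (gcol A i) = A # SD i"
 "[|A : Ob; i : J C|] ==> cod (gcol A i) = [SOb, A]"
 using gcol_whom[of A i] by (auto simp: homs)

lemma gam_simps [simp]:
 "A : Ob ==> warr (gam A)" "A : Ob ==> dom (gam A) = [A, SOb]" "A : Ob ==> cod (gam A) = [SOb, A]"
 using copair_whom[of "[A]" "U @ [A]" "gcol A"] gcol_whom[of A] by (auto simp: gam_def homs)

lemma gam_inj: "[|A : Ob; i : J C|] ==> gam A${[A];inc i;} = gcol A i"
 unfolding gam_def by (rule copair_inj) (simp_all add: homs)

lemma gcol_sandwich:
 assumes A: "A : Ob" and i: "i : J C" and u: "u : whom (p @ [SOb, A] @ q) z" and v: "v : whom w (p @ (A # SD i) @ q)" and pq: "word p" "word q"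
 shows "u${p;gcol A i;q}$v = wsum w z (%j. sc (s i * s j) (u${p;inc j;A # q}${p;cas A i j;q}$v)) (J C)"
proof -
 have w: "word w" "word z" using u v warr_word[of u] warr_word[of v] by (auto simp: homs)
 have "u${p;gcol A i;q}$v = wsum w z (%j. sc (s i * s j) (u${p;{;inc j;[A]}$cas A i j;q}$v)) (J C)"
  unfolding gcol_def append.simps by (rule sandwich_comb[OF u v]) (use A i pq in "auto simp: homs")
 also have "... = wsum w z (%j. sc (s i * s j) (u${p;inc j;A # q}${p;cas A i j;q}$v)) (J C)"
  by (rule wsum_cong_whom[OF w]) (use A i pq u v in "auto simp: homs cassoc")
 finally show ?thesis .
qed

lemma gcol_natural:
 assumes D: "!!j. j : J C ==> dual_family x i j (T j) (F j) (G j)" and v: "v : whom x [B]" and i [simp]: "i : J C"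
 shows "gcol B i${;v;SD i} = wsum (x @ SD i) (U @ [B]) (%j. sc (s i * s j) ({U;v;}${;inc j;x}$casimir x i j (T j) (F j) (G j))) (J C)"
proof -
 have vs [simp]: "warr v" "dom v = x" "cod v = [B]" using v by (auto simp: homs)
 have [simp]: "word x" "B : Ob" using warr_word[of v] by simp_all
 have c [simp]: "warr (casimir x i j (T j) (F j) (G j))" "dom (casimir x i j (T j) (F j) (G j)) = x @ SD i" "cod (casimir x i j (T j) (F j) (G j)) = SD j @ x" if "j : J C" for j
  using casimir_whom[OF i that D[OF that]] by (auto simp: homs)
 have "gcol B i${;v;SD i} = idw (U @ [B])${;gcol B i;}${;v;SD i}" by (simp add: layer_nil)
 also have "... = wsum (x @ SD i) (U @ [B]) (%j. sc (s i * s j) (idw (U @ [B])${;inc j;[B]}${;cas B i j;}${;v;SD i})) (J C)"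
  by (rule gcol_sandwich) (simp_all add: homs)
 also have "... = wsum (x @ SD i) (U @ [B]) (%j. sc (s i * s j) ({U;v;}${;inc j;x}$casimir x i j (T j) (F j) (G j))) (J C)"
 proof (rule wsum_cong)
  fix j assume j [simp]: "j : J C"
  have "idw (U @ [B])${;inc j;[B]}${;cas B i j;}${;v;SD i}
   = ({;inc j;[B]}${SD j;v;})$casimir x i j (T j) (F j) (G j)"
   using casimir_natural[OF i j D[OF j] v] by (simp add: layer_nil cassoc)
  also have "{;inc j;[B]}${SD j;v;} = {U;v;}${;inc j;x}" by (simp add: diagram)
  finally show "sc (s i * s j) (idw (U @ [B])${;inc j;[B]}${;cas B i j;}${;v;SD i})
   = sc (s i * s j) ({U;v;}${;inc j;x}$casimir x i j (T j) (F j) (G j))" by (simp add: cassoc)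
 qed simp_all
 finally show ?thesis .
qed

lemma gam_natural:
 assumes f [simp]: "warr f" "dom f = [a]" "cod f = [b]"
 shows "{U;f;}$gam a = gam b${;f;U}"
proof (rule sum_ext[of _ "[a]" "[]" "U @ [b]"])
 have [simp]: "a : Ob" "b : Ob" using warr_word[of f] by simp_all
 fix i assume i [simp]: "i : J C"
 have "({U;f;}$gam a)${[a];inc i;} = {U;f;}${;gcol a i;}$idw (a # SD i)"
  by (simp add: cassoc gam_inj layer_nil)
 also have "... = wsum (a # SD i) (U @ [b]) (%j. sc (s i * s j) ({U;f;}${;inc j;[a]}${;cas a i j;}$idw (a # SD i))) (J C)"
  by (rule gcol_sandwich) (simp_all add: homs)
 also have "... = wsum (a # SD i) (U @ [b]) (%j. sc (s i * s j) ({U;f;}${;inc j;[a]}$cas a i j)) (J C)"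
  by (rule wsum_cong) (simp_all add: layer_nil)
 also have "... = gcol b i${;f;SD i}"
  using gcol_natural[OF dual_family_single[OF i], of a f b] by (simp add: homs cas_def)
 also have "... = (gam b${[b];inc i;})${;f;SD i}" by (simp add: gam_inj)
 also have "... = (gam b${;f;U})${[a];inc i;}" by (simp add: diagram)
 finally show "({U;f;}$gam a)${[a];inc i;} = (gam b${;f;U})${[a];inc i;}" .
qed (use warr_word[of f] in "simp_all add: homs")

lemma gam_Unit: "gam (Unit C)${;fuse [];U} = {U;fuse [];}"
proof (rule sum_ext[of _ "[]" "[]" "U @ [Unit C]"])
 fix i assume i [simp]: "i : J C"
 have "(gam (Unit C)${;fuse [];U})${;inc i;} = (gam (Unit C)${[Unit C];inc i;})${;fuse [];SD i}"
  by (simp add: diagram)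
 also have "... = gcol (Unit C) i${;fuse [];SD i}" by (simp add: gam_inj)
 also have "... = wsum ([] @ SD i) (U @ [Unit C]) (%j. sc (s i * s j) ({U;fuse [];}${;inc j;} $
   casimir [] i j (if i = j then {()} else {}) (%_. idw (S i)) (%_. sc (1 / d i) (idw (S' i))))) (J C)"
  by (rule gcol_natural[OF dual_family_nil]) (simp_all add: homs)
 also have "... = wsum (SD i) (U @ [Unit C]) (%j. sc (s i * s j) ({U;fuse [];}${;inc j;} $
   (if i = j then sc (1 / d i) (idw (SD i)) else wzero (SD i) (SD j)))) (J C)"
  unfolding append.simps by (rule wsum_cong; (simp only: casimir_nil[OF i])?) simp_all
 also have "... = sc (s i * s i) ({U;fuse [];}${;inc i;}$sc (1 / d i) (idw (SD i)))"
  unfolding append.simps by (subst wsum_single[of _ _ _ i]) (auto simp: homs)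
 also have "... = {U;fuse [];}${;inc i;}" using d_nonzero[OF i] by (simp add: s_square comp_wscale)
 finally show "(gam (Unit C)${;fuse [];U})${;inc i;} = {U;fuse [];}${;inc i;}" .
qed (simp_all add: homs)

text \<open>The intermediate components contribute \<open>s j * s j = d j\<close>, the weight with which the dual bases of
 the two factors combine to dual bases of the product.\<close>

lemma gam_mult:
 assumes a [simp]: "a : Ob" and b [simp]: "b : Ob"
 shows "gam (a \<odot> b)${;fuse [a, b];U} = {U;fuse [a, b];}${;gam a;[b]}${[a];gam b;}"
proof (rule sum_ext[of _ "[a, b]" "[]" "U @ [a \<odot> b]"])
 fix i assume i [simp]: "i : J C"
 let ?f = "fuse [a, b]" and ?W = "[a, b] @ SD i" and ?Z = "U @ [a \<odot> b]"
 let ?E = "%k j. {U;?f;}${;inc j;[a, b]}${;cas a k j;[b]}${[a];cas b i k;}"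
 have E: "?E k j : whom ?W ?Z" if "k : J C" "j : J C" for k j using that by (simp add: homs)
 have W: "word ?W" "word ?Z" by simp_all
 have "(gam (a \<odot> b)${;?f;U})${[a, b];inc i;} = (gam (a \<odot> b)${[a \<odot> b];inc i;})${;?f;SD i}"
  by (simp add: diagram)
 also have "... = gcol (a \<odot> b) i${;?f;SD i}" by (simp add: gam_inj)
 also have "... = wsum ?W ?Z (%j. sc (s i * s j) ({U;?f;}${;inc j;[a, b]} $
   casimir [a, b] i j (SIGMA k : J C. {..<hdim b i k} \<times> {..<hdim a k j})
   (%(k, t, r). sc (d k) (phi a k j r${[a];phi b i k t;})) (%(k, t, r). {;psi a k j r;[b]}$psi b i k t))) (J C)"
  by (rule gcol_natural[OF dual_family_pair(1)]) (simp_all add: homs)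
 also have "... = wsum ?W ?Z (%j. wsum ?W ?Z (%k. sc (s i * s j * d k) (?E k j)) (J C)) (J C)"
 proof (rule wsum_cong_whom[OF W])
  fix j assume j [simp]: "j : J C"
  let ?u = "{U;?f;}${;inc j;[a, b]}"
  let ?c = "wsum ?W [Sp j, Du (Sp j), a, b] (%k. sc (d k) ({;cas a k j;[b]}${[a];cas b i k;})) (J C)"
  have c: "?c : whom ?W [Sp j, Du (Sp j), a, b]" by (rule hin(5)) (simp_all add: homs)
  have "?u${;?c;} = wsum ([] @ ?W @ []) ?Z (%k. sc (d k) (?u${;{;cas a k j;[b]}${[a];cas b i k;};})) (J C)"
   by (rule comp_layer_comb) (simp_all add: homs)
  also have "... = wsum ?W ?Z (%k. sc (d k) (?E k j)) (J C)"
   unfolding append_Nil append_Nil2[of ?W] by (rule wsum_cong) (simp_all add: cassoc)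
  finally have e: "{U;?f;}${;inc j;[a, b]}$?c = wsum ?W ?Z (%k. sc (d k) (?E k j)) (J C)"
   using c by (simp add: homs layer_nil cassoc)
  have "sc (s i * s j) (wsum ?W ?Z (%k. sc (d k) (?E k j)) (J C)) = wsum ?W ?Z (%k. sc (s i * s j) (sc (d k) (?E k j))) (J C)"
   by (rule wscale_wsum_whom[OF W hin(3)[OF E]]) simp_all
  also have "... = wsum ?W ?Z (%k. sc (s i * s j * d k) (?E k j)) (J C)"
   by (rule wsum_cong_whom[OF W wscale_wscale_whom[OF E] hin(3)[OF E]]) simp_all
  finally show "sc (s i * s j) ({U;?f;}${;inc j;[a, b]} $
   casimir [a, b] i j (SIGMA k : J C. {..<hdim b i k} \<times> {..<hdim a k j})
   (%(k, t, r). sc (d k) (phi a k j r${[a];phi b i k t;})) (%(k, t, r). {;psi a k j r;[b]}$psi b i k t))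
   = wsum ?W ?Z (%k. sc (s i * s j * d k) (?E k j)) (J C)"
   using dual_family_pair(2)[OF i j a b] e by simp
  show "wsum ?W ?Z (%k. sc (s i * s j * d k) (?E k j)) (J C) : whom ?W ?Z"
   by (rule hin(5)[OF W hin(3)[OF E]]) simp_all
 qed
 also have "... = wsum ?W ?Z (%k. wsum ?W ?Z (%j. sc (s i * s j * d k) (?E k j)) (J C)) (J C)"
  by (rule wsum_swap) (simp_all add: homs)
 also have "... = wsum ?W ?Z (%k. sc (s i * s k) (({U;?f;}${;gam a;[b]})${[a];inc k;[b]}${[a];cas b i k;}$idw ?W)) (J C)"
 proof (rule wsum_cong_whom[OF W])
  fix k assume k [simp]: "k : J C"
  have "({U;?f;}${;gam a;[b]})${[a];inc k;[b]}${[a];cas b i k;}$idw ?W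
   = {U;?f;}${;gcol a k;[b]}${[a];cas b i k;}"
   by (rule rewrite[OF gam_inj[OF a k], of _ "{U;?f;}" "[]" "[b]" "{[a];cas b i k;}"]) (simp_all add: cassoc)
  also have "... = wsum ?W ?Z (%j. sc (s k * s j) (?E k j)) (J C)"
   by (rule gcol_sandwich[OF a k, of "{U;?f;}" "[]" "[b]" ?Z "{[a];cas b i k;}" ?W, simplified append_Nil]) (simp_all add: homs)
  finally have e: "({U;?f;}${;gam a;[b]})${[a];inc k;[b]}${[a];cas b i k;}$idw ?W = wsum ?W ?Z (%j. sc (s k * s j) (?E k j)) (J C)" .
  have "sc (s i * s k) (wsum ?W ?Z (%j. sc (s k * s j) (?E k j)) (J C)) = wsum ?W ?Z (%j. sc (s i * s k) (sc (s k * s j) (?E k j))) (J C)"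
   by (rule wscale_wsum_whom[OF W hin(3)[OF E]]) simp_all
  also have "... = wsum ?W ?Z (%j. sc (s i * s j * d k) (?E k j)) (J C)"
   by (rule wsum_cong_whom[OF W]) (simp_all add: s_square[symmetric] mult_ac homs)
  finally show "wsum ?W ?Z (%j. sc (s i * s j * d k) (?E k j)) (J C) = sc (s i * s k) (({U;?f;}${;gam a;[b]})${[a];inc k;[b]}${[a];cas b i k;}$idw ?W)"
   unfolding e by simp
  show "sc (s i * s k) (({U;?f;}${;gam a;[b]})${[a];inc k;[b]}${[a];cas b i k;}$idw ?W) : whom ?W ?Z"
   by (simp add: homs)
 qed
 also have "... = ({U;?f;}${;gam a;[b]})${[a];gcol b i;}$idw ?W"
  by (rule gcol_sandwich[symmetric]) (simp_all add: homs)
 also have "... = ({U;?f;}${;gam a;[b]}${[a];gam b;})${[a, b];inc i;}"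
  by (rule rewrite[OF gam_inj[OF b i, symmetric], of _ "{U;?f;}${;gam a;[b]}" "[a]" "[]" "idw ?W"]) (simp_all add: cassoc)
 finally show "(gam (a \<odot> b)${;?f;U})${[a, b];inc i;} = ({U;?f;}${;gam a;[b]}${[a];gam b;})${[a, b];inc i;}" .
qed (simp_all add: homs)

definition Gam where
 "Gam = extend U gam"

lemma Gam_single: "A : Ob ==> Gam [A] = gam A"
 unfolding Gam_def by (rule extend_single) simp_all

lemma half_braid_Gam: "hbraid U Gam"
 unfolding Gam_def
proof (rule half_braid_extend[where g = "{;fuse [];U}${U;unfuse [];}"])
 have "gam (Unit C) = (gam (Unit C)${;fuse [];U})${;unfuse [];U}"
  using layer_cancel(1)[OF fuse_unfuse, of "[]" "[]" U] by (simp add: cassoc)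
 then have e: "gam (Unit C) = {U;fuse [];}${;unfuse [];U}" unfolding gam_Unit .
 have "({;fuse [];U}${U;unfuse [];})$gam (Unit C)
  = {;fuse [];U}${U;unfuse [];}${U;fuse [];}${;unfuse [];U}"
  unfolding e by (rule cassoc) simp_all
 also have "... = idw (Unit C # U)"
  using layer_cancel(2)[OF unfuse_fuse, of "[]" U "[]" "{;unfuse [];U}"] layer_cancel(1)[OF fuse_unfuse, of "[]" "[]" U] by simp
 finally show "({;fuse [];U}${U;unfuse [];})$gam (Unit C) = idw (Unit C # U)" .
qed (simp_all add: gam_natural gam_mult)

end

context premodular_category_with_choices
begin

definition om where
 "om i = hprod (%A. braid A (S i)) (S i) (%A. braid' A (S' i)) (S' i)"

definition Om where
 "Om A = copair A (U @ A) (%i. {;inc i;A}$om i A)"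

lemma half_braid_om:
 assumes i [simp]: "i : J C"
 shows "hbraid (SD i) (om i)"
 using half_braid_prod[OF half_braid_braid half_braid_braid_inv, of "S i" "S' i"] by (simp add: om_def)

lemma om_simps [simp]:
 "[|i : J C; word A|] ==> warr (om i A)" "[|i : J C; word A|] ==> dom (om i A) = A @ SD i"
 "[|i : J C; word A|] ==> cod (om i A) = Sp i # Du (Sp i) # A"
 using hb_simps[OF half_braid_om] by auto

lemma Om_simps [simp]: "word A ==> warr (Om A)" "word A ==> dom (Om A) = A @ U" "word A ==> cod (Om A) = SOb # A"
 using copair_whom[of A "U @ A" "%i. {;inc i;A}$om i A"] by (auto simp: Om_def homs)

lemma Om_inj: "[|word A; i : J C|] ==> Om A${A;inc i;} = {;inc i;A}$om i A"
 unfolding Om_def by (rule copair_inj) (auto simp: homs)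

lemma half_braid_Om: "hbraid U Om"
 unfolding hbraid_def
proof (intro conjI allI impI)
 fix f :: "('o, 'a) word_arr" assume f [simp]: "warr f"
 let ?A = "dom f" and ?B = "cod f"
 show "{U;f;}$Om ?A = Om ?B${;f;U}"
 proof (rule sum_ext[of _ ?A "[]" "U @ ?B"])
  fix i assume i [simp]: "i : J C"
  have "({U;f;}$Om ?A)${?A;inc i;} = {U;f;}${;inc i;?A}${;om i ?A;}"
   by (simp add: cassoc Om_inj layer_nil)
  also have "... = {;inc i;?B}${SD i;f;}${;om i ?A;}" by (simp add: diagram)
  also have "... = ({;inc i;?B}$om i ?B)${;f;SD i}"
   using half_braid_nat[OF half_braid_om f, of i] by (simp add: cassoc layer_nil)
  also have "... = (Om ?B${?B;inc i;})${;f;SD i}" by (simp add: Om_inj)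
  also have "... = (Om ?B${;f;U})${?A;inc i;}" by (simp add: diagram)
  finally show "({U;f;}$Om ?A)${?A;inc i;} = (Om ?B${;f;U})${?A;inc i;}" .
 qed (simp_all add: homs)
next
 fix A B assume "word A & word B"
 then have [simp]: "word A" "word B" by auto
 show "Om (A @ B) = {;Om A;B}${A;Om B;}"
 proof (rule sum_ext[of _ "A @ B" "[]" "U @ A @ B"])
  fix i assume i [simp]: "i : J C"
  have "({;Om A;B}${A;Om B;})${A @ B;inc i;} = {;Om A;B}${A;inc i;B}${A;om i B;}"
   by (rule rewrite[OF Om_inj[of B i], of _ "{;Om A;B}" A "[]" "idw (A @ B @ SD i)"]) (simp_all add: cassoc)
  also have "... = {;inc i;A @ B}${;om i A;B}${A;om i B;}"
   by (rule rewrite[OF Om_inj[of A i], of _ "idw (U @ A @ B)" "[]" B "{A;om i B;}"]) (simp_all add: cassoc)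
  also have "... = Om (A @ B)${A @ B;inc i;}"
   using half_braid_append[OF half_braid_om[OF i], of A B] by (simp add: Om_inj)
  finally show "Om (A @ B)${A @ B;inc i;} = ({;Om A;B}${A;Om B;})${A @ B;inc i;}" by simp
 qed (simp_all add: homs)
next
 show "Om [] = idw U"
  by (rule sum_ext[of _ "[]" "[]" U]) (simp_all add: homs Om_inj hb_simps(2)[OF half_braid_om])
qed simp_all

text \<open>Each summand is a box on the left leg next to a box on the right leg. The strand \<open>b\<close> passes the left
 one by the braiding and the right one by the inverse braiding, and is moved across by naturality.\<close>

lemma cas_crosses:
 assumes a [simp]: "a : Ob" and b [simp]: "b : Ob" and i [simp]: "i : J C" and j [simp]: "j : J C"
 shows "{SD j;braid [a] [b];}${;cas a i j;[b]}${[a];om i [b];}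
  = {;om j [b];[a]}${[b];cas a i j;}${;braid' [a] [b];SD i}"
proof -
 let ?X = "Sp i" and ?X' = "Du (Sp i)" and ?Y = "Sp j" and ?Y' = "Du (Sp j)"
 let ?F = "phi a i j" and ?G = "psi a i j"
 let ?P = "%t. {;?F t;[?Y', a]}${[a, ?X];?G t;}"
 let ?w = "[a, b, ?X, ?X']" and ?z = "[?Y, ?Y', b, a]"
 have P: "?P t : whom [a, ?X, ?X'] [?Y, ?Y', a]" if "t < hdim a i j" for t
  using phi_hom[OF a i j that] psi_hom[OF a i j that] by (simp add: homs)
 have c: "cas a i j = wsum [a, ?X, ?X'] [?Y, ?Y', a] ?P {..<hdim a i j}"
  by (simp add: cas_def casimir_def)
 have "{SD j;braid [a] [b];}${;cas a i j;[b]}${[a];om i [b];}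
  = wsum ?w ?z (%t. {SD j;braid [a] [b];}${;?P t;[b]}${[a];om i [b];}) {..<hdim a i j}"
  unfolding c by (rule sandwich_wsum) (use P in "simp_all add: homs")
 also have "... = wsum ?w ?z (%t. {;om j [b];[a]}${[b];?P t;}${;braid' [a] [b];SD i}) {..<hdim a i j}"
 proof (rule wsum_cong_whom)
  fix t assume "t : {..<hdim a i j}"
  then have t: "t < hdim a i j" by simp
  note [simp] = phi_hom[OF a i j t, unfolded homs] psi_hom[OF a i j t, unfolded homs]
  let ?f = "?F t" and ?g = "?G t"
  have E1: "{;?g;[b]}$braid' [b] [?X'] = {[?Y'];braid' [b] [a];}${;braid' [b] [?Y'];[a]}${[b];?g;}"
   using crossing_nat2[of braid' "[b]" ?g "[?X']" "[?Y', a]"] crossing_append2[of braid' "[b]" "[?Y']" "[a]"] by (simp add: cassoc)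
  have E2: "braid [b] [?Y]${[b];?f;} = {;?f;[b]}${[a];braid [b] [?X];}${;braid [b] [a];[?X]}"
   using crossing_nat2[of braid "[b]" ?f "[a, ?X]" "[?Y]"] crossing_append2[of braid "[b]" "[a]" "[?X]"] by simp
  have "{SD j;braid [a] [b];}${;?P t;[b]}${[a];om i [b];}
   = {;?f;[?Y', b, a]}${[a, ?X];braid' [b] [?Y'];[a]}${[a];braid [b] [?X];[?Y', a]}${[a, b, ?X];?g;}"
   by (rule rewrite[OF E1, of _ "{SD j;braid [a] [b];}${;?f;[?Y', a, b]}" "[a, ?X]" "[]" "{[a];braid [b] [?X];[?X']}"])
    (simp_all add: om_def hprod_def diagram)
  also have "... = {;om j [b];[a]}${[b];?P t;}${;braid' [a] [b];SD i}"
   by (rule rewrite[OF E2[symmetric], of _ "{[?Y];braid' [b] [?Y'];[a]}" "[]" "[?Y', a]" "{[b, a, ?X];?g;}${;braid' [a] [b];SD i}"])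
    (simp_all add: om_def hprod_def diagram)
  finally show "{SD j;braid [a] [b];}${;?P t;[b]}${[a];om i [b];}
   = {;om j [b];[a]}${[b];?P t;}${;braid' [a] [b];SD i}" .
  show "{;om j [b];[a]}${[b];?P t;}${;braid' [a] [b];SD i} : whom ?w ?z" by (simp add: homs)
 qed simp_all
 also have "... = {;om j [b];[a]}${[b];cas a i j;}${;braid' [a] [b];SD i}"
  unfolding c by (rule sandwich_wsum[symmetric]) (use P in "simp_all add: homs")
 finally show ?thesis .
qed

lemma crosses_Gam_Om: "crosses braid braid' U Gam Om"
 unfolding crosses_def
proof (intro ballI)
 fix a b assume a [simp]: "a : Ob" and b [simp]: "b : Ob"
 have [simp]: "Gam [a] = gam a" by (simp add: Gam_single)
 show "{U;braid [a] [b];}${;Gam [a];[b]}${[a];Om [b];}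
  = {;Om [b];[a]}${[b];Gam [a];}${;braid' [a] [b];U}"
 proof (rule sum_ext[of _ "[a, b]" "[]" "U @ [b, a]"])
  fix i assume i [simp]: "i : J C"
  let ?w = "[a, b] @ SD i" and ?z = "U @ [b, a]"
  have "({U;braid [a] [b];}${;Gam [a];[b]}${[a];Om [b];})${[a, b];inc i;}
   = {U;braid [a] [b];}${;gam a;[b]}${[a];inc i;[b]}${[a];om i [b];}"
   by (rule rewrite[OF Om_inj[of "[b]" i], of _ "{U;braid [a] [b];}${;gam a;[b]}" "[a]" "[]" "idw ?w"]) (simp_all add: cassoc)
  also have "... = {U;braid [a] [b];}${;gcol a i;[b]}${[a];om i [b];}"
   by (rule rewrite[OF gam_inj[OF a i], of _ "{U;braid [a] [b];}" "[]" "[b]" "{[a];om i [b];}"]) (simp_all add: cassoc)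
  also have "... = wsum ?w ?z (%j. sc (s i * s j) ({U;braid [a] [b];}${;inc j;[a, b]}${;cas a i j;[b]}${[a];om i [b];})) (J C)"
   by (rule gcol_sandwich) (simp_all add: homs)
  also have "... = wsum ?w ?z (%j. sc (s i * s j) ({;Om [b];[a]}${[b];inc j;[a]}${[b];cas a i j;}${;braid' [a] [b];SD i})) (J C)"
  proof (rule wsum_cong)
   fix j assume j [simp]: "j : J C"
   have "{U;braid [a] [b];}${;inc j;[a, b]}${;cas a i j;[b]}${[a];om i [b];}
    = {;inc j;[b, a]}${;om j [b];[a]}${[b];cas a i j;}${;braid' [a] [b];SD i}"
    by (rule rewrite[OF cas_crosses[OF a b i j], of _ "{;inc j;[b, a]}" "[]" "[]" "idw ?w"]) (simp_all add: diagram)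
   also have "... = {;Om [b];[a]}${[b];inc j;[a]}${[b];cas a i j;}${;braid' [a] [b];SD i}"
    by (rule rewrite[OF Om_inj[of "[b]" j, symmetric], of _ "idw ?z" "[]" "[a]" "{[b];cas a i j;}${;braid' [a] [b];SD i}"]) (simp_all add: cassoc)
   finally show "sc (s i * s j) ({U;braid [a] [b];}${;inc j;[a, b]}${;cas a i j;[b]}${[a];om i [b];})
    = sc (s i * s j) ({;Om [b];[a]}${[b];inc j;[a]}${[b];cas a i j;}${;braid' [a] [b];SD i})" by simp
  qed simp_all
  also have "... = {;Om [b];[a]}${[b];gcol a i;}${;braid' [a] [b];SD i}"
   by (rule gcol_sandwich[symmetric]) (simp_all add: homs)
  also have "... = ({;Om [b];[a]}${[b];Gam [a];}${;braid' [a] [b];U})${[a, b];inc i;}"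
   by (rule rewrite[OF gam_inj[OF a i, symmetric], of _ "{;Om [b];[a]}" "[b]" "[]" "{;braid' [a] [b];SD i}"]) (simp_all add: diagram)
  finally show "({U;braid [a] [b];}${;Gam [a];[b]}${[a];Om [b];})${[a, b];inc i;}
   = ({;Om [b];[a]}${[b];Gam [a];}${;braid' [a] [b];U})${[a, b];inc i;}" .
 qed (simp_all add: homs)
qed

lemma gam_expand:
 assumes A [simp]: "A : Ob"
 shows "gam A = wsum [A, SOb] [SOb, A] (%(i, j). wsum [A, SOb] [SOb, A] (%a. sc (s i * s j)
  ({;inc j;[A]}$({;phi A i j a;[Du (Sp j), A]}${[A, Sp i];psi A i j a;})${[A];prj i;})) {..<hdim A i j}) (J C \<times> J C)"
  (is "_ = wsum ?x ?y (%(i, j). wsum ?x ?y (?f i j) _) _")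
proof -
 have h: "{;phi A i j a;[Du (Sp j), A]}${[A, Sp i];psi A i j a;} : whom (A # SD i) [Sp j, Du (Sp j), A]" if "i : J C" "j : J C" "a < hdim A i j" for i j a
  using phi_hom[OF A that] psi_hom[OF A that] that by (simp add: homs)
 have w: "word ?x" "word ?y" by simp_all
 have f: "?f i j a : whom ?x ?y" if "i : J C" "j : J C" "a < hdim A i j" for i j a
  using phi_hom[OF A that] psi_hom[OF A that] that by (simp add: homs)
 have ff: "wsum ?x ?y (?f i j) {..<hdim A i j} : whom ?x ?y" if "i : J C" "j : J C" for i j
  by (rule hin(5)[OF w f[OF that]]) simp
 have 1: "sc (s i * s j) ({;inc j;[A]}$cas A i j${[A];prj i;}) = wsum ?x ?y (?f i j) {..<hdim A i j}"
  if ij [simp]: "i : J C" "j : J C" for i j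
 proof -
  let ?P = "%a. {;phi A i j a;[Du (Sp j), A]}${[A, Sp i];psi A i j a;}"
  have "{;inc j;[A]}$cas A i j${[A];prj i;} = {;inc j;[A]}${;wsum (A # SD i) [Sp j, Du (Sp j), A] ?P {..<hdim A i j};}${[A];prj i;}"
   using cas_simps(1)[OF A ij] by (simp add: cas_def casimir_def layer_nil)
  also have "... = wsum ?x ?y (%a. {;inc j;[A]}${;?P a;}${[A];prj i;}) {..<hdim A i j}"
   by (rule sandwich_wsum) (use h[OF ij] in "auto simp: homs")
  finally have e: "{;inc j;[A]}$cas A i j${[A];prj i;} = wsum ?x ?y (%a. {;inc j;[A]}${;?P a;}${[A];prj i;}) {..<hdim A i j}" .
  have "sc (s i * s j) (wsum ?x ?y (%a. {;inc j;[A]}${;?P a;}${[A];prj i;}) {..<hdim A i j})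
   = wsum ?x ?y (%a. sc (s i * s j) ({;inc j;[A]}${;?P a;}${[A];prj i;})) {..<hdim A i j}"
   by (rule wscale_wsum_whom[OF w]) (use h[OF ij] in "auto simp: homs")
  also have "... = wsum ?x ?y (?f i j) {..<hdim A i j}"
   by (rule wsum_cong_whom[OF w _ f[OF ij]]) (use h[OF ij] in "auto simp: homs layer_nil")
  finally show ?thesis unfolding e .
 qed
 have "gam A = wsum ?x ?y (%i. gcol A i${[A];prj i;}) (J C)"
  by (simp add: gam_def copair_def)
 also have "... = wsum ?x ?y (%i. wsum ?x ?y (%j. wsum ?x ?y (?f i j) {..<hdim A i j}) (J C)) (J C)"
 proof (rule wsum_cong_whom[OF w])
  fix i assume i [simp]: "i : J C"
  have "gcol A i${[A];prj i;} = idw ?y${;gcol A i;}${[A];prj i;}" by (simp add: layer_nil)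
  also have "... = wsum ?x ?y (%j. sc (s i * s j) (idw ?y${;inc j;[A]}${;cas A i j;}${[A];prj i;})) (J C)"
   by (rule gcol_sandwich) (simp_all add: homs)
  also have "... = wsum ?x ?y (%j. wsum ?x ?y (?f i j) {..<hdim A i j}) (J C)"
   by (rule wsum_cong_whom[OF w _ ff]) (simp_all add: layer_nil 1)
  finally show "gcol A i${[A];prj i;} = wsum ?x ?y (%j. wsum ?x ?y (?f i j) {..<hdim A i j}) (J C)" .
  show "wsum ?x ?y (%j. wsum ?x ?y (?f i j) {..<hdim A i j}) (J C) : whom ?x ?y" by (rule hin(5)[OF w ff[OF i]])
 qed
 also have "... = wsum ?x ?y (%(i, j). wsum ?x ?y (?f i j) {..<hdim A i j}) (J C \<times> J C)"
  by (subst wsum_Sigma) (use ff w in auto)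
 finally show ?thesis .
qed

lemma Gamma_gam:
 assumes vs: "word vs" "e : whom vs []" "e' : whom [] vs" "e$e' = idw []"
  and inc': "!!i. i : J C ==> (summand C vs i, inc' i, U) = inc i${S i;e;S' i}"
  and prj': "!!i. i : J C ==> (U, prj' i, summand C vs i) = {S i;e';S' i}$prj i"
 shows "Gamma C vs (SOb, inc', prj') = (\<lambda>A\<in>Ob. underlying (gam A))"
proof
 fix A
 show "Gamma C vs (SOb, inc', prj') A = (\<lambda>A\<in>Ob. underlying (gam A)) A"
 proof (cases "A : Ob")
  case A [simp]: True
  let ?t = "%i j a. underlying (((summand C vs j, inc' j, U) ## idw [A])$(phi A i j a ## idw vs ## psi A i j a)$(idw [A] ## (U, prj' i, summand C vs i)))"
  let ?g = "%i j a. {;inc j;[A]}$({;phi A i j a;[Du (Sp j), A]}${[A, Sp i];psi A i j a;})${[A];prj i;}"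
  let ?S = "hom_sum C (A \<odot> SOb) (SOb \<odot> A)"
  have es [simp]: "warr e" "dom e = vs" "cod e = []" "warr e'" "dom e' = []" "cod e' = vs" "word vs" using vs by (auto simp: homs)
  have t: "?t i j a = underlying (?g i j a)" "?g i j a : whom [A, SOb] [SOb, A]" if [simp]: "i : J C" "j : J C" and a: "a < hdim A i j" for i j a
  proof -
   note [simp] = phi_hom[OF A that, unfolded homs] psi_hom[OF A that, unfolded homs]
   show "?g i j a : whom [A, SOb] [SOb, A]" by (simp add: homs)
   have "((summand C vs j, inc' j, U) ## idw [A])$(phi A i j a ## idw vs ## psi A i j a)$(idw [A] ## (U, prj' i, summand C vs i)) = ?g i j a"
    unfolding inc'[OF that(2)] prj'[OF that(1)]
    by (rule rewrite[OF vs(4), of _ "{;inc j;[A]}${;phi A i j a;[Du (Sp j), A]}${[A, Sp i];psi A i j a;}" "[A, Sp i]" "S' i" "{[A];prj i;}"])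
     (simp_all add: tensor_layers diagram)
   then show "?t i j a = underlying (?g i j a)" by simp
  qed
  have "Gamma C vs (SOb, inc', prj') A = ?S (%p. ?S (%a. Scale C (s (fst p) * s (snd p)) (?t (fst p) (snd p) a)) {..<hdim A (fst p) (snd p)}) (J C \<times> J C)"
   by (simp add: Gamma_def split_def Let_def hdim_def phi_def psi_def)
  also have "... = ?S (%p. ?S (%a. Scale C (s (fst p) * s (snd p)) (underlying (?g (fst p) (snd p) a))) {..<hdim A (fst p) (snd p)}) (J C \<times> J C)"
  proof (rule hom_sum_cong)
   fix p assume p: "p : J C \<times> J C"
   have h: "Scale C (s (fst p) * s (snd p)) (underlying (?g (fst p) (snd p) a)) : Hom C (A \<odot> SOb) (SOb \<odot> A)" if "a < hdim A (fst p) (snd p)" for a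
    using whom_underlying[OF t(2)[OF _ _ that]] p by (intro Scale_Hom) auto
   show "?S (%a. Scale C (s (fst p) * s (snd p)) (?t (fst p) (snd p) a)) {..<hdim A (fst p) (snd p)} = ?S (%a. Scale C (s (fst p) * s (snd p)) (underlying (?g (fst p) (snd p) a))) {..<hdim A (fst p) (snd p)}"
    by (rule hom_sum_cong) (use h t(1) p in auto)
   show "?S (%a. Scale C (s (fst p) * s (snd p)) (underlying (?g (fst p) (snd p) a))) {..<hdim A (fst p) (snd p)} : Hom C (A \<odot> SOb) (SOb \<odot> A)"
    by (rule hom_sum_Hom) (use h in auto)
  qed simp_all
  also have "... = underlying (gam A)" unfolding gam_expand[OF A] by (simp add: split_def)
  finally show ?thesis by simp
 qed (simp add: Gamma_def)
qed

lemma Om_expand: "A : Ob ==> Om [A] = wsum [A, SOb] [SOb, A] (%i. {;inc i;[A]}$om i [A]${[A];prj i;}) (J C)"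
 unfolding Om_def copair_def append.simps by (rule wsum_cong) (simp_all add: cassoc)

lemma underlying_Om:
 assumes A [simp]: "A : Ob" and f: "!!i. i : J C ==> f i = {;inc i;[A]}$om i [A]${[A];prj i;}"
 shows "hom_sum C (A \<odot> SOb) (SOb \<odot> A) (%i. underlying (f i)) (J C) = underlying (Om [A])"
proof -
 have "underlying ({;inc i;[A]}$om i [A]${[A];prj i;}) : Hom C (A \<odot> SOb) (SOb \<odot> A)" if "i : J C" for i
  using whom_underlying[of "{;inc i;[A]}$om i [A]${[A];prj i;}" "[A, SOb]" "[SOb, A]"] that by (simp add: homs)
 then have "hom_sum C (A \<odot> SOb) (SOb \<odot> A) (%i. underlying (f i)) (J C)
  = hom_sum C (A \<odot> SOb) (SOb \<odot> A) (%i. underlying ({;inc i;[A]}$om i [A]${[A];prj i;})) (J C)"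
  by (intro hom_sum_cong) (simp_all add: f)
 then show ?thesis unfolding Om_expand[OF A] by simp
qed

lemma om_single: "[|A : Ob; i : J C|] ==> om i [A] = {S i;wBraidInv C (Du (Sp i)) A;}${;wBraid C A (Sp i);S' i}"
 by (simp add: om_def hprod_def braid_single braid_inv_single)

lemma Omega_Om: "Omega C (unit_sum C) = (\<lambda>A\<in>Ob. underlying (Om [A]))"
proof
 fix A
 show "Omega C (unit_sum C) A = (\<lambda>A\<in>Ob. underlying (Om [A])) A"
 proof (cases "A : Ob")
  case A [simp]: True
  have "hom_sum C (A \<odot> SOb) (SOb \<odot> A) (%i. underlying (((summand C [] i, SumInj C i, U) ## idw [A])
    $(idw [Sp i] ## wBraidInv C (Du (Sp i)) A)$(wBraid C A (Sp i) ## idw [Du (Sp i)])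
    $(idw [A] ## (U, SumProj C i, summand C [] i)))) (J C) = underlying (Om [A])"
  proof (rule underlying_Om[OF A])
   fix i assume i [simp]: "i : J C"
   have "(summand C [] i, SumInj C i, U) = inc i" "(U, SumProj C i, summand C [] i) = prj i" by (simp_all add: inc_def prj_def summand_def)
   then show "((summand C [] i, SumInj C i, U) ## idw [A])
    $(idw [Sp i] ## wBraidInv C (Du (Sp i)) A)$(wBraid C A (Sp i) ## idw [Du (Sp i)])
    $(idw [A] ## (U, SumProj C i, summand C [] i)) = {;inc i;[A]}$om i [A]${[A];prj i;}"
    by (simp add: tensor_layers om_single cassoc)
  qed
  then show ?thesis by (simp add: Omega_def unit_sum_def Let_def)
 qed (simp add: Omega_def unit_sum_def)
qed

lemma unit_sum'_eq:
 assumes i [simp]: "i : J C"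
 shows "(summand C [Unit C] i, SumInj C i ** (Id C (Sp i) @@ LUnit C (Du (Sp i))), U) = inc i${S i;unfuse [];S' i}"
  "(U, (Id C (Sp i) @@ inv_arr C (LUnit C (Du (Sp i)))) ** SumProj C i, summand C [Unit C] i) = {S i;fuse [];S' i}$prj i"
 by (rule word_arr_eqI; simp add: summand_def layer_def underlying_tensor)+

lemma wHalf_unit_center:
 assumes A [simp]: "A : Ob"
 shows "wHalf (snd (unit_center C)) A (Unit C) = {;fuse [];[A]}${[A];unfuse [];}"
 by (rule word_arr_eqI) (simp_all add: unit_center_def layer_def underlying_tensor)

lemma lambda_tilde_Om: "lambda_tilde C (unit_center C) (unit_sum' C) = (\<lambda>A\<in>Ob. underlying (Om [A]))"
proof
 fix A
 let ?l = "snd (unit_center C)"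
 let ?inc = "%i. (summand C [Unit C] i, SumInj C i ** (Id C (Sp i) @@ LUnit C (Du (Sp i))), U)"
 let ?prj = "%i. (U, (Id C (Sp i) @@ inv_arr C (LUnit C (Du (Sp i)))) ** SumProj C i, summand C [Unit C] i)"
 show "lambda_tilde C (unit_center C) (unit_sum' C) A = (\<lambda>A\<in>Ob. underlying (Om [A])) A"
 proof (cases "A : Ob")
  case A [simp]: True
  have "hom_sum C (A \<odot> SOb) (SOb \<odot> A) (%i. underlying ((?inc i ## idw [A])
    $(idw [Sp i, Unit C] ## wBraidInv C (Du (Sp i)) A)$(idw [Sp i] ## wHalf ?l A (Unit C) ## idw [Du (Sp i)])
    $(wBraid C A (Sp i) ## idw [Unit C, Du (Sp i)])$(idw [A] ## ?prj i))) (J C) = underlying (Om [A])"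
  proof (rule underlying_Om[OF A])
   fix i assume i [simp]: "i : J C"
   let ?X = "Sp i" and ?Y = "Du (Sp i)"
   have c: "unfuse []$fuse [] = idw []" by (simp add: unfuse_fuse)
   note lc = layer_cancel[OF c]
   have "(?inc i ## idw [A])$(idw [?X, Unit C] ## wBraidInv C ?Y A)$(idw [?X] ## wHalf ?l A (Unit C) ## idw [?Y])
    $(wBraid C A ?X ## idw [Unit C, ?Y])$(idw [A] ## ?prj i)
    = {;inc i;[A]}${[?X];unfuse [];[?Y, A]}${[?X, Unit C];wBraidInv C ?Y A;}${[?X];fuse [];[A, ?Y]}
    ${[?X, A];unfuse [];[?Y]}${;wBraid C A ?X;[Unit C, ?Y]}${[A, ?X];fuse [];[?Y]}${[A];prj i;}"
    unfolding unit_sum'_eq[OF i] wHalf_unit_center[OF A] by (simp add: tensor_layers cassoc)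
   also have "... = {;inc i;[A]}${[?X];unfuse [];[?Y, A]}${[?X, Unit C];wBraidInv C ?Y A;}${[?X];fuse [];[A, ?Y]}
    ${;wBraid C A ?X;[?Y]}${[A];prj i;}"
    by (rule rewrite[OF c, of _ "{;inc i;[A]}${[?X];unfuse [];[?Y, A]}${[?X, Unit C];wBraidInv C ?Y A;}${[?X];fuse [];[A, ?Y]}${;wBraid C A ?X;[?Y]}" "[A, ?X]" "[?Y]" "{[A];prj i;}"])
     (simp_all add: diagram)
   also have "... = {;inc i;[A]}$om i [A]${[A];prj i;}"
    by (rule rewrite[OF c, of _ "{;inc i;[A]}${[?X];wBraidInv C ?Y A;}" "[?X]" "[A, ?Y]" "{;wBraid C A ?X;[?Y]}${[A];prj i;}"])
     (simp_all add: diagram om_single)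
   finally show "(?inc i ## idw [A])$(idw [?X, Unit C] ## wBraidInv C ?Y A)$(idw [?X] ## wHalf ?l A (Unit C) ## idw [?Y])
    $(wBraid C A ?X ## idw [Unit C, ?Y])$(idw [A] ## ?prj i) = {;inc i;[A]}$om i [A]${[A];prj i;}" .
  qed
  then show ?thesis by (simp add: lambda_tilde_def unit_sum'_def unit_center_def Let_def)
 qed (simp add: lambda_tilde_def unit_sum'_def unit_center_def)
qed

lemma Gamma_unit: "Gamma C [] (unit_sum C) = (\<lambda>A\<in>Ob. underlying (gam A))"
 unfolding unit_sum_def by (rule Gamma_gam[of "[]" "idw []" "idw []"]) (simp_all add: homs inc_def[symmetric] prj_def[symmetric] summand_def)

lemma Gamma_unit': "Gamma C [Unit C] (unit_sum' C) = (\<lambda>A\<in>Ob. underlying (gam A))"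
 unfolding unit_sum'_def by (rule Gamma_gam[of "[Unit C]" "unfuse []" "fuse []"]) (simp_all add: homs unit_sum'_eq unfuse_fuse)

lemma el_unit_I1: "el_unit C = I1_obj C (unit_sum' C) (unit_center C)"
 unfolding el_unit_def I1_obj_def Gamma_unit Omega_Om
 by (simp add: unit_center_def unit_sum'_def lambda_tilde_Om[unfolded unit_center_def unit_sum'_def] Gamma_unit'[unfolded unit_sum'_def])

lemma wHalf_restrict: "[|A : Ob; f A : whom [A, X] [X, A]|] ==> wHalf (\<lambda>A\<in>Ob. underlying (f A)) A X = f A"
 by (rule word_arr_eqI) (simp_all add: homs)

lemma elliptic_objects_iff: "(X, l1, l2) : Ell \<longleftrightarrow> half_braiding C X l1 & half_braiding C X l2 &
  crosses braid braid' [X] (word_half X l1) (word_half X l2)"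
proof -
 have "crosses braid braid' [X] (word_half X l1) (word_half X l2) \<longleftrightarrow> (\<forall>A\<in>Ob. \<forall>B\<in>Ob.
    (idw [X] ## wBraid C A B)$(wHalf l1 A X ## idw [B])$(idw [A] ## wHalf l2 B X)
    = (wHalf l2 B X ## idw [A])$(idw [B] ## wHalf l1 A X)$(wBraidInv C B A ## idw [X]))"
  if h: "half_braiding C X l1" "half_braiding C X l2"
 proof -
  have [simp]: "X : Ob" using h by (simp add: half_braiding_def)
  have [simp]: "warr (wHalf l1 A X)" "warr (wHalf l2 A X)" if "A : Ob" for A using that h by (auto simp: half_braiding_def)
  show ?thesis unfolding crosses_def
   by (intro ball_cong refl) (simp add: half_braid_word_half(2)[OF h(1)] half_braid_word_half(2)[OF h(2)] braid_single braid_inv_single tensor_layers)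
 qed
 then show ?thesis unfolding elliptic_objects_def by auto
qed

lemma el_unit_elliptic: "el_unit C : Ell"
proof -
 have 1: "half_braiding C (SOb) (\<lambda>A\<in>Ob. underlying (Gam [A]))" by (rule half_braiding_of_word[OF half_braid_Gam])
 have 2: "half_braiding C (SOb) (\<lambda>A\<in>Ob. underlying (Om [A]))" by (rule half_braiding_of_word[OF half_braid_Om])
 have G: "(\<lambda>A\<in>Ob. underlying (Gam [A])) = (\<lambda>A\<in>Ob. underlying (gam A))" by (auto simp: Gam_single)
 have "crosses braid braid' U (word_half (SOb) (\<lambda>A\<in>Ob. underlying (Gam [A]))) (word_half (SOb) (\<lambda>A\<in>Ob. underlying (Om [A])))"
  using crosses_Gam_Om unfolding crosses_def
  by (simp add: half_braid_word_half(2)[OF 1] half_braid_word_half(2)[OF 2] wHalf_restrict hb_simps[OF half_braid_Gam] homs)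
 with 1 2 show ?thesis by (simp add: el_unit_def Gamma_unit Omega_Om elliptic_objects_iff G)
qed

end

section \<open>The unit constraints\<close>

context premodular_category_with_choices
begin

definition j0 :: 'j where "j0 = (SOME j. j : J C & Sp j = Unit C)"

lemma j0 [simp]: "j0 : J C" "Sp j0 = Unit C"
 using someI_ex[of "%j. j : J C & Sp j = Unit C"] Simp_Unit by (auto simp: j0_def)

lemma s_j0: "s j0 ~= 0"
 using s_square[of j0] d_nonzero[of j0] by auto

text \<open>By naturality with respect to the isomorphism from the empty word, which everything passes trivially.\<close>

lemma half_braid_Unit:
 assumes r: "hbraid M ro"
 shows "ro [Unit C] = {M;fuse [];}${;unfuse [];M}"
proof -
 note [simp] = hb_simps[OF r]
 have "ro [Unit C] = (ro [Unit C]${;fuse [];M})${;unfuse [];M}"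
  using layer_cancel(1)[OF fuse_unfuse, of "[]" "[]" M] by (simp add: cassoc)
 also have "ro [Unit C]${;fuse [];M} = {M;fuse [];}"
  using half_braid_nat[OF r, of "fuse []" "[]" "[Unit C]"] by simp
 finally show ?thesis .
qed

lemma hom_nil_left:
 assumes i [simp]: "i : J C" and k [simp]: "k : J C" and h: "h : whom [] [Du (Sp i), Sp k]"
 shows "i = k ==> \<exists>c. h = sc c (coevR (Sp i))" "i ~= k ==> h = wzero [] [Du (Sp i), Sp k]"
proof -
 let ?X = "Sp i" and ?X' = "Du (Sp i)" and ?K = "Sp k"
 let ?b = "{;evR ?X;[?K]}${[?X];h;}"
 have [simp]: "warr h" "dom h = []" "cod h = [?X', ?K]" using h by (auto simp: homs)
 have b: "?b : whom (S i) (S k)" by (simp add: homs)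
 have "{[?X'];?b;}${;coevR ?X;} = {;h;}"
  by (rule rewrite[OF snake_right_right[of ?X, OF _ refl], of _ "idw [?X', ?K]" "[]" "[?K]" "{;h;}"]) (simp_all add: diagram)
 then have e: "h = {[?X'];?b;}$coevR ?X" by (simp add: layer_nil)
 { assume "i = k"
  then have "?b = sc (scal ?b) (idw (S i))" using scal_eq[OF i] b by simp
  then obtain c where bc: "?b = sc c (idw (S i))" by blast
  have "h = sc c (coevR ?X)" by (subst e, subst bc) (simp add: layer_wscale wscale_comp)
  then show "\<exists>c. h = sc c (coevR ?X)" by blast }
 { assume "i ~= k"
  then have "?b = wzero (S i) (S k)" using schur_zero[OF i k _ b] by simp
  then show "h = wzero [] [?X', ?K]" by (subst e) (simp del: layer_comp) }
qed

lemma hom_nil_right: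
 assumes j [simp]: "j : J C" and k [simp]: "k : J C" and h: "h : whom [] [Sp j, Du (Sp k)]"
 shows "j = k ==> \<exists>c. h = sc c (coev (Sp k))" "j ~= k ==> h = wzero [] [Sp j, Du (Sp k)]"
proof -
 let ?X = "Sp j" and ?K' = "Du (Sp k)" and ?K = "Sp k"
 let ?b = "{[?X];wEv ?K;}${;h;[?K]}"
 have [simp]: "warr h" "dom h = []" "cod h = [?X, ?K']" using h by (auto simp: homs)
 have b: "?b : whom (S k) (S j)" by (simp add: homs)
 have "{;?b;[?K']}${;coev ?K;} = {;h;}"
  by (rule rewrite[OF ev_coev(2)[of ?K], of _ "idw [?X, ?K']" "[?X]" "[]" "{;h;}"]) (simp_all add: diagram)
 then have e: "h = {;?b;[?K']}$coev ?K" by (simp add: layer_nil)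
 { assume "j = k"
  then have "?b = sc (scal ?b) (idw (S k))" using scal_eq[OF k] b by simp
  then obtain c where bc: "?b = sc c (idw (S k))" by blast
  have "h = sc c (coev ?K)" by (subst e, subst bc) (simp add: layer_wscale wscale_comp)
  then show "\<exists>c. h = sc c (coev ?K)" by blast }
 { assume "j ~= k"
  then have "?b = wzero (S k) (S j)" using schur_zero[OF k j _ b] by simp
  then show "h = wzero [] [?X, ?K']" by (subst e) (simp del: layer_comp) }
qed

text \<open>
 The projection \<open>isotypic A i j0\<close> to the unit component, computed on arrows from a word whose
 invariants are known.
\<close>

lemma unit_hom_fuse: "t : whom (S j0) x ==> t = (t$fuse [])$unfuse []"
 using fuse_unfuse[of "[]"] by (simp add: homs cassoc)

lemma hom_nil_zero:
 assumes l: "l : J C" "l ~= j0" and t: "t : whom (S l) []"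
 shows "t = wzero (S l) []"
proof -
 have [simp]: "warr t" "dom t = S l" "cod t = []" using t by (auto simp: homs)
 have "fuse []$t = wzero (S l) (S j0)" by (rule schur_zero) (use l in "auto simp: homs")
 then have "unfuse []$fuse []$t = wzero (S l) []" using l by simp
 then show ?thesis using unfuse_fuse[of "[]"] by (simp add: cassoc[symmetric])
qed

text \<open>If the invariants of \<open>x\<close> are multiples of \<open>\<eta>\<close>, the unit part of \<open>x\<close> is cut out by \<open>\<eta>\<close> and a functional
 \<open>\<epsilon>\<close> normalized against it.\<close>

lemma isotypic_unit:
 assumes A [simp]: "A : Ob" and i [simp]: "i : J C" and f: "f : whom x [A, Sp i]"
  and eta: "\<eta> : whom [] x" and eps: "\<epsilon> : whom x []" and c: "\<epsilon>$\<eta> = sc c (idw [])" "c ~= 0"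
  and gen: "!!h. h : whom [] x ==> \<exists>b. h = sc b \<eta>"
 shows "isotypic A i j0$f = sc (1 / c) (f$\<eta>$\<epsilon>)"
proof (rule simples_separate)
 have w [simp]: "warr f" "dom f = x" "cod f = [A, Sp i]" "warr \<eta>" "dom \<eta> = []" "cod \<eta> = x" "warr \<epsilon>" "dom \<epsilon> = x" "cod \<epsilon> = []"
  using f eta eps by (auto simp: homs)
 have [simp]: "word x" using warr_word[of f] by simp
 have [simp]: "warr (isotypic A i j0)" "dom (isotypic A i j0) = [A, Sp i]" "cod (isotypic A i j0) = [A, Sp i]"
  using isotypic_hom[OF A i, of j0] by (auto simp: homs)
 show "isotypic A i j0$f : whom x [A, Sp i]" "sc (1 / c) (f$\<eta>$\<epsilon>) : whom x [A, Sp i]" by (simp_all add: homs)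
 fix l t assume l [simp]: "l : J C" and t: "t : whom (S l) x"
 have [simp]: "warr t" "dom t = S l" "cod t = x" using t by (auto simp: homs)
 have L: "(isotypic A i j0$f)$t = (if l = j0 then f$t else wzero (S l) [A, Sp i])"
  using isotypic_simple[OF A i, of j0 l "f$t"] by (simp add: cassoc homs)
 have R: "sc (1 / c) (f$\<eta>$\<epsilon>)$t = sc (1 / c) (f$\<eta>$\<epsilon>$t)" by (simp add: wscale_comp cassoc)
 show "(isotypic A i j0$f)$t = sc (1 / c) (f$\<eta>$\<epsilon>)$t"
 proof (cases "l = j0")
  case True
  have [simp]: "dom t = [Unit C]" using True by simp
  have "t$fuse [] : whom [] x" using True by (simp add: homs)
  then obtain b where b: "t$fuse [] = sc b \<eta>" using gen by blast
  have tb: "t = sc b (\<eta>$unfuse [])" using unit_hom_fuse[of t x] t True unfolding b by (simp add: wscale_comp)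
  have "\<epsilon>$t = sc b ((\<epsilon>$\<eta>)$unfuse [])" by (subst tb) (simp add: comp_wscale cassoc)
  also have "... = sc (b * c) (unfuse [])" unfolding c(1) by (simp add: wscale_comp)
  finally have "sc (1 / c) (f$\<eta>$\<epsilon>$t) = sc b (f$\<eta>$unfuse [])" using c(2) by (simp add: comp_wscale)
  also have "... = f$t" by (subst tb) (simp add: comp_wscale)
  finally show ?thesis using L R True by simp
 next
  case False
  have "\<epsilon>$t = wzero (S l) []" by (rule hom_nil_zero[OF l False]) (simp add: homs)
  then show ?thesis using L R False by simp
 qed
qed

lemma isotypic_unit_zero:
 assumes A [simp]: "A : Ob" and i [simp]: "i : J C" and f: "f : whom x [A, Sp i]"
  and gen: "!!h. h : whom [] x ==> h = wzero [] x"
 shows "isotypic A i j0$f = wzero x [A, Sp i]"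
proof (rule simples_separate)
 have w [simp]: "warr f" "dom f = x" "cod f = [A, Sp i]" using f by (auto simp: homs)
 have [simp]: "word x" using warr_word[of f] by simp
 have [simp]: "warr (isotypic A i j0)" "dom (isotypic A i j0) = [A, Sp i]" "cod (isotypic A i j0) = [A, Sp i]"
  using isotypic_hom[OF A i, of j0] by (auto simp: homs)
 show "isotypic A i j0$f : whom x [A, Sp i]" "wzero x [A, Sp i] : whom x [A, Sp i]" by (simp_all add: homs)
 fix l t assume l [simp]: "l : J C" and t: "t : whom (S l) x"
 have [simp]: "warr t" "dom t = S l" "cod t = x" using t by (auto simp: homs)
 have "t = wzero (S l) x" if "l = j0"
 proof -
  have "t$fuse [] : whom [] x" using that by (simp add: homs)
  then have "t$fuse [] = wzero [] x" by (rule gen)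
  then show ?thesis using unit_hom_fuse[of t x] t that by simp
 qed
 then show "(isotypic A i j0$f)$t = wzero x [A, Sp i]$t"
  using isotypic_simple[OF A i, of j0 l "f$t"] by (cases "l = j0") (simp_all add: cassoc homs)
qed

definition u where "u = evR (Unit C)$prj j0"
definition u' where "u' = inc j0$coev (Unit C)"
definition g where "g A = {;u;[A]}$gam A"

lemma inc_j0 [simp]: "warr (prj j0)" "warr (inc j0)" "cod (prj j0) = [Unit C, Du (Unit C)]" "dom (inc j0) = [Unit C, Du (Unit C)]"
 using inc_simps(1)[of j0] prj_simps(2)[of j0] by (simp_all del: inc_simps prj_simps(1-3)) (simp_all)

lemma u_simps [simp]: "warr u" "dom u = U" "cod u = []" and u'_simps [simp]: "warr u'" "dom u' = []" "cod u' = U"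
 by (simp_all add: u_def u'_def)

lemma g_simps [simp]: "A : Ob ==> warr (g A)" "A : Ob ==> dom (g A) = [A, SOb]" "A : Ob ==> cod (g A) = [A]"
 by (simp_all add: g_def)

lemma u_inc: "i : J C ==> u$inc i = (if i = j0 then evR (Unit C) else wzero (SD i) [])"
 using prj_inj[of i j0] by (simp add: u_def cassoc)

lemma g_inc:
 assumes A [simp]: "A : Ob" and i [simp]: "i : J C"
 shows "g A${[A];inc i;} = sc (s i / s j0) ({[A];evR (Sp i);}${;isotypic A i j0;S' i})"
proof -
 let ?X = "Sp i" and ?X' = "Du (Sp i)" and ?Y = "Sp j0" and ?Y' = "Du (Sp j0)"
 let ?n = "hdim A i j0" and ?w = "A # SD i"
 note ph = phi_hom[OF A i j0(1)] and ps = psi_hom[OF A i j0(1)] and ch = chi_hom[OF A i j0(1)]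
 have "g A${[A];inc i;} = {;u;[A]}${;gcol A i;}$idw ?w"
  by (simp add: g_def cassoc gam_inj layer_nil)
 also have "... = wsum ?w [A] (%j. sc (s i * s j) ({;u;[A]}${;inc j;[A]}${;cas A i j;}$idw ?w)) (J C)"
  by (rule gcol_sandwich) (simp_all add: homs)
 also have "... = wsum ?w [A] (%j. sc (s i * s j) ({;u$inc j;[A]}$cas A i j)) (J C)"
  by (rule wsum_cong) (simp_all add: cassoc layer_nil)
 also have "... = sc (s i * s j0) ({;u$inc j0;[A]}$cas A i j0)"
  by (rule wsum_single) (simp_all add: u_inc homs del: layer_comp)
 also have "{;u$inc j0;[A]}$cas A i j0 = {;evR ?Y;[A]}$cas A i j0" by (simp add: u_inc)
 also have "... = wsum ?w [A] (%a. {;evR ?Y;[A]}${;phi A i j0 a;[?Y', A]}${[A, ?X];psi A i j0 a;}) {..<?n}"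
  unfolding cas_def casimir_def append.simps by (rule comp_wsum_whom) (use ph ps in "auto simp: homs simp del: j0(2)")
 also have "... = wsum ?w [A] (%a. {[A];evR ?X;}${;chi A i j0 a$phi A i j0 a;[?X']}) {..<?n}"
 proof (rule wsum_cong)
  fix a assume "a : {..<?n}"
  then have a: "a < ?n" by simp
  note [simp] = ph[OF a, unfolded homs] ps[OF a, unfolded homs] ch[OF a, unfolded homs]
  show "{;evR ?Y;[A]}${;phi A i j0 a;[?Y', A]}${[A, ?X];psi A i j0 a;} = {[A];evR ?X;}${;chi A i j0 a$phi A i j0 a;[?X']}"
   by (rule rewrite[OF chi_slide[OF A i j0(1) a, symmetric], of _ "idw [A]" "[]" "[]" "{;phi A i j0 a;[?X']}"]) (simp_all add: diagram del: j0(2))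
 qed (use ph ch in "auto simp: homs simp del: j0(2)")
 finally have 1: "g A${[A];inc i;} = sc (s i * s j0) (wsum ?w [A] (%a. {[A];evR ?X;}${;chi A i j0 a$phi A i j0 a;[?X']}) {..<?n})" .
 let ?G = "%a. {[A];evR ?X;}${;chi A i j0 a$phi A i j0 a;[?X']}"
 have G: "?G a : whom ?w [A]" if "a : {..<?n}" for a using that ph[of a] ch[of a] by (simp add: homs)
 have "{[A];evR ?X;}${;isotypic A i j0;[?X']} = wsum ([] @ [A, ?X] @ [?X']) [A] (%a. sc (d j0) (?G a)) {..<?n}"
  unfolding isotypic_def by (rule comp_layer_comb) (use ph ch in "auto simp: homs")
 also have "... = sc (d j0) (wsum ?w [A] ?G {..<?n})"
  unfolding append.simps by (rule wscale_wsum_whom[symmetric, OF _ _ G]) simp_all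
 finally have 2: "{[A];evR ?X;}${;isotypic A i j0;[?X']} = sc (d j0) (wsum ?w [A] ?G {..<?n})" .
 have W: "wsum ?w [A] ?G {..<?n} : whom ?w [A]" by (rule hin(5)[OF _ _ G]) simp_all
 have "s i / s j0 * d j0 = s i * s j0" using s_square[OF j0(1)] s_j0 by (simp add: field_simps)
 then show ?thesis unfolding 1 2 using W by (simp add: homs)
qed

lemma isotypic_simps [simp]: "[|A : Ob; i : J C|] ==> warr (isotypic A i j0)"
 "[|A : Ob; i : J C|] ==> dom (isotypic A i j0) = [A, Sp i]" "[|A : Ob; i : J C|] ==> cod (isotypic A i j0) = [A, Sp i]"
 using isotypic_hom[of A i j0] by (auto simp: homs)

text \<open>The component \<open>X\<^sub>i \<otimes> X\<^sub>i*\<close> of the unit object, recovered from \<open>u\<close> and \<open>\<Gamma>\<close>.\<close>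

lemma g_coev:
 assumes i [simp]: "i : J C"
 shows "{S i;g (Du (Sp i));}${;coev (Sp i);U} = sc (s i / (s j0 * d i)) (prj i)"
proof (rule sum_ext[of _ "[]" "[]" "SD i"])
 let ?X = "Sp i" and ?X' = "Du (Sp i)"
 fix k assume k [simp]: "k : J C"
 let ?K = "Sp k" and ?K' = "Du (Sp k)"
 let ?i = "isotypic ?X' k j0"
 have "({S i;g ?X';}${;coev ?X;U})${;inc k;} = {S i;g ?X'${[?X'];inc k;};}${;coev ?X;SD k}"
  by (simp add: diagram)
 also have "... = sc (s k / s j0) ({[?X, ?X'];evR ?K;}${S i;?i;S' k}${;coev ?X;SD k})"
  unfolding g_inc[OF Dual_Obj[OF Simp_Obj[OF i]] k] by (simp add: layer_wscale wscale_comp cassoc)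
 also have "... = sc (s i / (s j0 * d i)) (prj i)${;inc k;}"
 proof (cases "k = i")
  case True
  have "?i$idw [?X', ?K] = sc (1 / d i) (idw [?X', ?K]$coevR ?X$wEv ?X)"
   by (rule isotypic_unit) (use True hom_nil_left(1)[OF i i] in \<open>simp_all add: homs loop_value d_nonzero\<close>)
  then have e: "?i = sc (1 / d i) (coevR ?X$wEv ?X)" using True by simp
  have "{[?X, ?X'];evR ?X;}${[?X];coevR ?X$wEv ?X;[?X']}${;coev ?X;[?X, ?X']}
   = {[?X];wEv ?X;[?X']}${;coev ?X;[?X, ?X']}"
   by (rule rewrite[OF snake_right_right[of ?X, OF _ refl], of _ "idw [?X, ?X']" "[?X]" "[]" "{[?X];wEv ?X;[?X']}${;coev ?X;[?X, ?X']}"])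
    (simp_all add: diagram)
  also have "... = idw [?X, ?X']"
   by (rule rewrite[OF ev_coev(1)[of ?X], of _ "idw [?X, ?X']" "[]" "[?X']" "idw [?X, ?X']"]) (simp_all add: cassoc)
  finally show ?thesis using True prj_inj[OF i i] by (simp add: e[unfolded True] layer_wscale comp_wscale wscale_comp layer_nil del: layer_comp)
 next
  case False
  have "?i$idw [?X', ?K] = wzero [?X', ?K] [?X', ?K]"
   by (rule isotypic_unit_zero) (use False hom_nil_left(2)[OF i k] in \<open>auto simp: homs\<close>)
  then show ?thesis using False prj_inj[OF k i] by (simp add: wscale_comp layer_nil)
 qed
 finally show "({S i;g ?X';}${;coev ?X;U})${;inc k;} = sc (s i / (s j0 * d i)) (prj i)${;inc k;}" .
qed (simp_all add: homs)

lemma g_natural: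
 assumes f [simp]: "warr f" "dom f = [a]" "cod f = [b]"
 shows "f$g a = g b${;f;U}"
proof -
 have [simp]: "a : Ob" "b : Ob" using warr_word[of f] by simp_all
 have "{;f;}$g a = {;u;[b]}${U;f;}$gam a" by (simp add: g_def diagram)
 then show ?thesis using gam_natural[OF f] by (simp add: g_def cassoc layer_nil)
qed

text \<open>Summed over \<open>j\<close>, the partial traces of the projections to the unit component make up the identity.\<close>

lemma unit_completeness:
 assumes i [simp]: "i : J C"
 shows "wsum (S i) (S i) (%j. sc (d j) ({;wEv (Sp j);S i}${S' j;isotypic (Sp j) i j0;}${;coevR (Sp j);S i})) (J C) = idw (S i)"
  (is "wsum _ _ (%j. sc (d j) (?E j)) _ = _")
proof (rule duals_separate)
 have E [simp]: "warr (?E j)" "dom (?E j) = S i" "cod (?E j) = S i" if "j : J C" for j using that by simp_all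
 show "wsum (S i) (S i) (%j. sc (d j) (?E j)) (J C) : whom (S i) (S i)" "idw (S i) : whom (S i) (S i)" by (simp_all add: homs)
 fix k h assume k [simp]: "k : J C" and h: "h : whom (S' k) (S i)"
 let ?K = "Sp k" and ?K' = "Du (Sp k)" and ?X = "Sp i"
 have [simp]: "warr h" "dom h = S' k" "cod h = S i" using h by (auto simp: homs)
 have n: "?E j$h = {;wEv (Sp j);S i}${S' j;isotypic (Sp j) i j0${S j;h;};}${;coevR (Sp j);S' k}" if [simp]: "j : J C" for j
 proof -
  have "?E j${;h;} = {;wEv (Sp j);S i}${S' j;isotypic (Sp j) i j0${S j;h;};}${;coevR (Sp j);S' k}"
   by (simp add: diagram)
  then show ?thesis by (simp add: layer_nil)
 qed
 have z: "?E j$h = wzero (S' k) (S i)" if j [simp]: "j : J C" and jk: "j ~= k" for j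
 proof -
  have "isotypic (Sp j) i j0${S j;h;} = wzero [Sp j, ?K'] [Sp j, ?X]"
   by (rule isotypic_unit_zero) (use jk hom_nil_right(2)[OF j k] in \<open>auto simp: homs\<close>)
  then show ?thesis unfolding n[OF j] by (simp del: layer_comp)
 qed
 have "isotypic ?K i j0${S k;h;} = sc (1 / d k) ({S k;h;}$coev ?K$evR ?K)"
  by (rule isotypic_unit) (use hom_nil_right(1)[OF k k] in \<open>simp_all add: homs loop_value d_nonzero\<close>)
 then have "sc (d k) (?E k$h) = {;wEv ?K;S i}${S' k;{S k;h;}$coev ?K$evR ?K;}${;coevR ?K;S' k}"
  unfolding n[OF k] by (simp add: layer_wscale comp_wscale wscale_comp d_nonzero del: layer_comp)
 also have "... = {;h;}${[?K'];evR ?K;}${;coevR ?K;[?K']}"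
  by (rule rewrite[OF ev_coev(2)[of ?K], of _ "{;h;}" "[]" "[]" "{[?K'];evR ?K;}${;coevR ?K;[?K']}"]) (simp_all add: diagram)
 also have "... = h" using snake_right_right[of ?K, OF _ refl] by (simp add: layer_nil)
 finally have m: "sc (d k) (?E k$h) = h" .
 have "wsum (S i) (S i) (%j. sc (d j) (?E j)) (J C)$h = wsum (S' k) (S i) (%j. sc (d j) (?E j)$h) (J C)"
  by (rule wsum_comp_whom[OF h]) (simp_all add: homs)
 also have "... = wsum (S' k) (S i) (%j. sc (d j) (?E j$h)) (J C)"
  by (rule wsum_cong) (simp_all add: wscale_comp del: layer_comp)
 also have "... = sc (d k) (?E k$h)" by (rule wsum_single) (use z in "simp_all add: homs del: layer_comp")
 finally show "wsum (S i) (S i) (%j. sc (d j) (?E j)) (J C)$h = idw (S i)$h" using m by simp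
qed

lemma u_intertwines: "intw u Om (%A. idw A)"
 unfolding intw_def
proof (intro conjI ballI)
 fix a assume a [simp]: "a : Ob"
 have "{;u;[a]}$Om [a] = {[a];u;}"
 proof (rule sum_ext[of _ "[a]" "[]" "[a]"])
  fix i assume i [simp]: "i : J C"
  have "({;u;[a]}$Om [a])${[a];inc i;} = {;u$inc i;[a]}$om i [a]"
   using Om_inj[of "[a]" i] by (simp add: cassoc)
  also have "... = {[a];u$inc i;}"
  proof (cases "i = j0")
   case True
   let ?I = "Unit C" and ?I' = "Du (Unit C)"
   have b: "braid [a] [?I] = braid' [a] [?I]"
   proof -
    have "braid [a] [?I] = braid [a] [?I]$braid' [?I] [a]$braid [a] [?I]" using braid_inverse(2)[of "[?I]" "[a]"] by simp
    also have "braid' [?I] [a] = braid [?I] [a]"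
     using half_braid_Unit[OF half_braid_braid, of "[a]"] half_braid_Unit[OF half_braid_braid_inv, of "[a]"] by simp
    finally have "braid [a] [?I] = braid [a] [?I]$braid [?I] [a]$braid [a] [?I]" .
    moreover have "braid [?I] [a]$braid' [a] [?I] = idw [a, ?I]" using braid_inverse(1)[of "[?I]" "[a]"] by simp
    moreover have "braid' [a] [?I]$braid [?I] [a] = idw [?I, a]" using braid_inverse(2)[of "[a]" "[?I]"] by simp
    moreover have "braid [a] [?I]$braid' [?I] [a] = idw [?I, a]" using braid_inverse(1)[of "[a]" "[?I]"] by simp
    ultimately have "braid [a] [?I] = (braid' [a] [?I]$braid [?I] [a])$braid [a] [?I]" by simp
    also have "... = braid' [a] [?I]$braid' [?I] [a]$braid [a] [?I]"
     using half_braid_Unit[OF half_braid_braid, of "[a]"] half_braid_Unit[OF half_braid_braid_inv, of "[a]"] by (simp add: cassoc)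
    also have "... = braid' [a] [?I]" using braid_inverse(2)[of "[?I]" "[a]"] by simp
    finally show ?thesis .
   qed
   have "om j0 [a] = braid' [a] [?I, ?I']"
    using crossing_append2[of braid' "[a]" "[?I]" "[?I']"] by (simp add: om_def hprod_def b)
   then show ?thesis using True crossing_nat2[of braid' "[a]" "evR ?I" "[?I, ?I']" "[]"] by (simp add: u_inc)
  qed (simp add: u_inc)
  finally show "({;u;[a]}$Om [a])${[a];inc i;} = {[a];u;}${[a];inc i;}" by simp
 qed (simp_all add: homs)
 then show "{;u;[a]}$Om [a] = idw [a]${[a];u;}" by simp
qed simp

end

context premodular_category_with_choices
begin

lemma prj_ext:
 assumes f: "f : whom w (p @ U @ q)" and k: "k : whom w (p @ U @ q)" and [simp]: "word p" "word q"
  and eq: "!!i. i : J C ==> {p;prj i;q}$f = {p;prj i;q}$k"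
 shows "f = k"
proof -
 have e: "h = wsum w (p @ U @ q) (%i. {p;inc i;q}${p;prj i;q}$h) (J C)" if h: "h : whom w (p @ U @ q)" for h
 proof -
  have [simp]: "warr h" "dom h = w" "cod h = p @ U @ q" "word w" using h warr_word[of h] by (auto simp: homs)
  have "h = idw (p @ U @ q)${p;wsum U U (%i. inc i$prj i) (J C);q}$h" unfolding inj_prj_sum by simp
  also have "... = wsum w (p @ U @ q) (%i. idw (p @ U @ q)${p;inc i$prj i;q}$h) (J C)"
   by (rule sandwich_wsum) (simp_all add: homs)
  also have "... = wsum w (p @ U @ q) (%i. {p;inc i;q}${p;prj i;q}$h) (J C)"
   by (rule wsum_cong_whom) (simp_all add: homs cassoc)
  finally show ?thesis .
 qed
 show ?thesis
  apply (subst e[OF f], subst e[OF k])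
  using f k warr_word[of f] by (intro wsum_cong_whom) (simp_all add: eq homs)
qed

lemma u_braid: "intw u (%A. braid A U) (%A. idw A)" "intw u (%A. braid' A U) (%A. idw A)"
 unfolding intw_def using crossing_nat2[of braid _ u U "[]"] crossing_nat2[of braid' _ u U "[]"] by simp_all

lemma intertwiner_strand:
 assumes u: "intw u oo (%A. idw A)" and w: "hbraid U oo" and t: "hbraid M ta"
 shows "intw {;u;M} (hprod oo U ta M) ta" "intw {M;u;} (hprod ta M oo U) ta"
proof -
 note [simp] = hb_simps(3-5)[OF w] hb_simps(1,3-5)[OF t]
 { fix a assume a [simp]: "a : Ob"
  have n: "{;u;[a]}$oo [a] = {[a];u;}" using intwD[OF u a] by simp
  have "{;u;M @ [a]}$hprod oo U ta M [a] = {;ta [a];}${[a];u;M}"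
   by (rule rewrite[OF n, of _ "{;ta [a];}" "[]" M "idw (a # U @ M)"]) (simp_all add: hprod_def diagram)
  moreover have "{M;u;[a]}$hprod ta M oo U [a] = {M @ [a];u;}${;ta [a];U}"
   by (rule rewrite[OF n, of _ "idw (M @ [a])" M "[]" "{;ta [a];U}"]) (simp_all add: hprod_def cassoc)
  moreover have "{M @ [a];u;}${;ta [a];U} = {;ta [a];}${a # M;u;}" by (simp add: diagram)
  ultimately have "{;u;M @ [a]}$hprod oo U ta M [a] = ta [a]${[a];u;M}"
   "{M;u;[a]}$hprod ta M oo U [a] = ta [a]${a # M;u;}" by (simp_all add: layer_nil) }
 then show "intw {;u;M} (hprod oo U ta M) ta" "intw {M;u;} (hprod ta M oo U) ta"
  by (simp_all add: intw_def)
qed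

text \<open>An arrow that factors through the unit object does not see which half-braiding is used.\<close>

lemma isotypic_switch:
 assumes h: "hbraid M ta" "hbraid M ta'" and A [simp]: "A : Ob" and i [simp]: "i : J C"
 shows "{M;isotypic A i j0;}$ta [A, Sp i] = ta' [A, Sp i]${;isotypic A i j0;M}"
proof -
 note [simp] = hb_simps(1,3-5)[OF h(1)] hb_simps(3-5)[OF h(2)]
 let ?x = "[A, Sp i]" and ?P = "%a. chi A i j0 a$phi A i j0 a"
 let ?W = "?x @ M" and ?Z = "M @ ?x"
 note ph = phi_hom[OF A i j0(1)] and ch = chi_hom[OF A i j0(1)]
 have P: "?P a : whom ?x ?x" if "a : {..<hdim A i j0}" for a using that ph[of a] ch[of a] by (simp add: homs)
 have "{M;isotypic A i j0;}$ta ?x = wsum ?W (M @ ?x @ []) (%a. sc (d j0) ({M;?P a;}$ta ?x)) {..<hdim A i j0}"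
  unfolding isotypic_def by (rule layer_comb_comp) (use P in "simp_all add: homs")
 also have "... = wsum ?W ?Z (%a. sc (d j0) (ta' ?x${;?P a;M})) {..<hdim A i j0}"
  unfolding append_Nil2
 proof (rule wsum_cong)
  fix a assume "a : {..<hdim A i j0}"
  then have a: "a < hdim A i j0" by simp
  note [simp] = ph[OF a, unfolded homs] ch[OF a, unfolded homs]
  have "{M;?P a;}$ta ?x = {M;chi A i j0 a;}$ta [Unit C]${;phi A i j0 a;M}"
   using half_braid_nat[OF h(1), of "phi A i j0 a" ?x "[Unit C]"] by (simp add: cassoc)
  also have "ta [Unit C] = ta' [Unit C]" using half_braid_Unit[OF h(1)] half_braid_Unit[OF h(2)] by simp
  also have "{M;chi A i j0 a;}$ta' [Unit C]${;phi A i j0 a;M} = ({M;chi A i j0 a;}$ta' [Unit C])${;phi A i j0 a;M}" by (simp add: cassoc)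
  also have "... = ta' ?x${;?P a;M}"
   using half_braid_nat[OF h(2), of "chi A i j0 a" "[Unit C]" ?x] by (simp add: cassoc)
  finally show "sc (d j0) ({M;?P a;}$ta ?x) = sc (d j0) (ta' ?x${;?P a;M})" by simp
 qed (use ph ch in "auto simp: homs")
 also have "... = ta' ?x${;isotypic A i j0;M}"
  unfolding isotypic_def by (rule comp_layer_comb[of "ta' ?x" "[]" ?x M ?Z ?x, symmetric, unfolded append_Nil]) (use P in "simp_all add: homs")
 finally show ?thesis .
qed

abbreviation left_rho where "left_rho M == hprod Gam U (%A. braid A M) M"
abbreviation left_rho' where "left_rho' sg M == hprod (%A. braid' A U) U sg M"
abbreviation right_rho where "right_rho sg M == hprod sg M (%A. braid A U) U"
abbreviation right_rho' where "right_rho' M == hprod (%A. braid' A M) M Gam U"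

definition left_form where
 "left_form sg M = wsum (U @ M) M (%i. sc (s i) ({M;evR (Sp i);}${;sg [Sp i];S' i}${S i;braid [Du (Sp i)] M;}${;prj i;M})) (J C)"

definition right_form where
 "right_form sg M = copair M M (%i. sc (s i) ({M;evR (Sp i);}${;sg [Sp i];S' i}${;braid M [Sp i];S' i}))"

context
 fixes M sg
 assumes h: "hbraid M sg" and D: "gdim ~= 0"
begin

lemma half_braid_unit_sides: "hbraid (U @ M) (left_rho M)" "hbraid (U @ M) (left_rho' sg M)"
  "hbraid (M @ U) (right_rho sg M)" "hbraid (M @ U) (right_rho' M)"
 using hb_simps(1)[OF h] by (intro half_braid_prod half_braid_Gam half_braid_braid half_braid_braid_inv h; simp)+

lemma M_simps: "word M" "!!A. word A ==> warr (sg A)" "!!A. word A ==> dom (sg A) = A @ M" "!!A. word A ==> cod (sg A) = M @ A"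
 "!!a. a : Ob ==> Gam [a] = gam a"
 using hb_simps[OF h] Gam_single by auto

lemma left_loop:
 assumes j [simp]: "j : J C"
 shows "{;u;M}$loop (U @ M) (left_rho M) (left_rho' sg M) (Sp j)
  = sc (s j / (s j0 * d j)) ({M;evR (Sp j);}${;sg [Sp j];S' j}${S j;braid [Du (Sp j)] M;}${;prj j;M})"
proof -
 note [simp] = M_simps
 let ?X = "Sp j" and ?Y = "Du (Sp j)"
 have n: "{;u;[?X]}$braid' [?X] U = {[?X];u;}" using intwD[OF u_braid(2), of ?X] by simp
 have "{;u;M}$loop (U @ M) (left_rho M) (left_rho' sg M) ?X
  = {M;evR ?X;}${;sg [?X];[?Y]}${[?X];braid [?Y] M;}${;{S j;g ?Y;}${;coev ?X;U};M}"
  by (rule rewrite[OF n, of _ "{M;evR ?X;}${;sg [?X];[?Y]}" "[]" "M @ [?Y]" "{?X # U;braid [?Y] M;}${[?X];gam ?Y;M}${;coev ?X;U @ M}"])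
   (simp_all add: loop_def hprod_def g_def diagram)
 then show ?thesis unfolding g_coev[OF j] by (simp add: layer_wscale comp_wscale)
qed

lemma avg_unit_left: "{;u;M}$avg (U @ M) (left_rho M) (left_rho' sg M) = sc (1 / (gdim * s j0)) (left_form sg M)"
proof -
 note [simp] = M_simps
 let ?l = "%j. loop (U @ M) (left_rho M) (left_rho' sg M) (Sp j)"
 let ?F = "%i. {M;evR (Sp i);}${;sg [Sp i];S' i}${S i;braid [Du (Sp i)] M;}${;prj i;M}"
 have F: "?F i : whom (U @ M) M" if "i : J C" for i using that by (simp add: homs)
 have l: "warr (?l j)" "dom (?l j) = U @ M" "cod (?l j) = U @ M" if "j : J C" for j using loop_hom[OF half_braid_unit_sides(1,2), of "Sp j"] that by (auto simp: homs)
 have Q: "warr (avg (U @ M) (left_rho M) (left_rho' sg M))" "dom (avg (U @ M) (left_rho M) (left_rho' sg M)) = U @ M" "cod (avg (U @ M) (left_rho M) (left_rho' sg M)) = U @ M"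
  using avg_hom[OF half_braid_unit_sides(1,2)] by (auto simp: homs)
 have "{;u;M}${;avg (U @ M) (left_rho M) (left_rho' sg M);}$idw (U @ M)
  = sc (1 / gdim) (wsum (U @ M) M (%j. sc (d j) ({;u;M}${;?l j;}$idw (U @ M))) (J C))"
  by (rule avg_sandwich[OF half_braid_unit_sides(1,2)]) (simp_all add: homs)
 also have "wsum (U @ M) M (%j. sc (d j) ({;u;M}${;?l j;}$idw (U @ M))) (J C) = wsum (U @ M) M (%j. sc (1 / s j0) (sc (s j) (?F j))) (J C)"
 proof (rule wsum_cong)
  fix j assume j [simp]: "j : J C"
  have "d j * (s j / (s j0 * d j)) = 1 / s j0 * s j" using d_nonzero[OF j] by simp
  then show "sc (d j) ({;u;M}${;?l j;}$idw (U @ M)) = sc (1 / s j0) (sc (s j) (?F j))"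
   using left_loop[OF j] l[OF j] by (simp add: layer_nil)
 qed simp_all
 also have "... = sc (1 / s j0) (left_form sg M)"
  unfolding left_form_def by (rule wscale_wsum_whom[symmetric]) (simp_all add: homs)
 also have "sc (1 / gdim) ... = sc (1 / (gdim * s j0)) (left_form sg M)"
  using hin(5)[of "U @ M" M "J C" "%i. sc (s i) (?F i)"] by (simp add: left_form_def homs)
 finally show ?thesis using Q by (simp add: layer_nil)
qed

lemma right_loop:
 assumes j [simp]: "j : J C"
 shows "{M;u;}$loop (M @ U) (right_rho sg M) (right_rho' M) (Sp j)
  = {M;wEv (Sp j);}${M @ S' j;g (Sp j);}${;sg [Du (Sp j)];Sp j # U}${S' j;braid' [Sp j] M;U}${;coevR (Sp j);M @ U}"
proof -
 note [simp] = M_simps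
 define X where "X = Sp j"
 define Y where "Y = Du X"
 have [simp]: "X : Ob" "Y : Ob" "Sp j = X" "Du X = Y" by (simp_all add: X_def Y_def)
 let ?t = "wTwist X"
 have E1: "{;g X;[Y]}${[X];braid [Y] U;} = braid [Y] [X]${[Y];g X;}${;braid' [X] [Y];U}"
 proof -
  have "braid [Y] [X]${[Y];g X;} = {;g X;[Y]}${[X];braid [Y] U;}${;braid [Y] [X];U}"
   using crossing_nat2[of braid "[Y]" "g X" "[X, SOb]" "[X]"] crossing_append2[of braid "[Y]" "[X]" U] by simp
  then have "(braid [Y] [X]${[Y];g X;})${;braid' [X] [Y];U} = ({;g X;[Y]}${[X];braid [Y] U;}${;braid [Y] [X];U})${;braid' [X] [Y];U}" by simp
  then show ?thesis by (simp add: cassoc)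
 qed
 have E2: "{M;braid' [X] [Y];}${;braid' [X] M;[Y]}${[X];sg [Y];} = {;sg [Y];[X]}${[Y];braid' [X] M;}${;braid' [X] [Y];M}"
  using crosses_crossing[OF h crossing_braid_inv] by (simp add: crosses_def)
 have E3: "braid' [X] [Y]$coev X = {[Y];?t;}$coevR X" using coevR_twist[of X Y] by simp
 have E4: "braid' [X] M${;?t;M} = {M;?t;}$braid' [X] M" using crossing_nat1[of braid' M ?t "[X]" "[X]"] by simp
 have E5: "g X${;?t;U} = ?t$g X" using g_natural[of ?t X X] by simp
 have E6: "evR X$braid [Y] [X]${[Y];?t;} = wEv X" using evR_twist[of X Y] by simp
 have "{M;u;}$loop (M @ U) (right_rho sg M) (right_rho' M) X
  = {M;evR X;}${M;g X;[Y]}${;braid' [X] M;SOb # [Y]}${X # M;braid [Y] U;}${[X];sg [Y];U}${;coev X;M @ U}"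
  by (simp add: loop_def hprod_def g_def diagram)
 also have "... = {M;evR X;}${M;braid [Y] [X];}${M @ [Y];g X;}${M;braid' [X] [Y];U}${;braid' [X] M;Y # U}${[X];sg [Y];U}${;coev X;M @ U}"
  by (rule rewrite[OF E1, of _ "{M;evR X;}" M "[]" "{;braid' [X] M;Y # U}${[X];sg [Y];U}${;coev X;M @ U}"]) (simp_all add: diagram)
 also have "... = {M;evR X;}${M;braid [Y] [X];}${M @ [Y];g X;}${;sg [Y];X # U}${[Y];braid' [X] M;U}${;braid' [X] [Y];M @ U}${;coev X;M @ U}"
  by (rule rewrite[OF E2, of _ "{M;evR X;}${M;braid [Y] [X];}${M @ [Y];g X;}" "[]" U "{;coev X;M @ U}"]) (simp_all add: cassoc)
 also have "... = {M;evR X;}${M;braid [Y] [X];}${M @ [Y];g X;}${;sg [Y];X # U}${[Y];braid' [X] M;U}${[Y];?t;M @ U}${;coevR X;M @ U}"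
  by (rule rewrite[OF E3, of _ "{M;evR X;}${M;braid [Y] [X];}${M @ [Y];g X;}${;sg [Y];X # U}${[Y];braid' [X] M;U}" "[]" "M @ U" "idw (M @ U)"]) (simp_all add: cassoc)
 also have "... = {M;evR X;}${M;braid [Y] [X];}${M @ [Y];g X;}${M @ [Y];?t;U}${;sg [Y];X # U}${[Y];braid' [X] M;U}${;coevR X;M @ U}"
  by (rule rewrite[OF E4, of _ "{M;evR X;}${M;braid [Y] [X];}${M @ [Y];g X;}${;sg [Y];X # U}" "[Y]" U "{;coevR X;M @ U}"]) (simp_all add: diagram)
 also have "... = {M;evR X;}${M;braid [Y] [X];}${M @ [Y];?t;}${M @ [Y];g X;}${;sg [Y];X # U}${[Y];braid' [X] M;U}${;coevR X;M @ U}"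
  by (rule rewrite[OF E5, of _ "{M;evR X;}${M;braid [Y] [X];}" "M @ [Y]" "[]" "{;sg [Y];X # U}${[Y];braid' [X] M;U}${;coevR X;M @ U}"]) (simp_all add: cassoc)
 also have "... = {M;wEv X;}${M @ [Y];g X;}${;sg [Y];X # U}${[Y];braid' [X] M;U}${;coevR X;M @ U}"
  by (rule rewrite[OF E6, of _ "idw M" M "[]" "{M @ [Y];g X;}${;sg [Y];X # U}${[Y];braid' [X] M;U}${;coevR X;M @ U}"]) (simp_all add: cassoc)
 finally show ?thesis by simp
qed

end
end

context linear_monoidal_category
begin

lemma wscale_cancel:
 assumes "sc c f = sc c f'" "c ~= 0" "warr f" "warr f'"
 shows "f = f'"
proof -
 have "sc (1 / c) (sc c f) = sc (1 / c) (sc c f')" using assms(1) by simp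
 then show ?thesis using assms(2-4) by simp
qed

end

context premodular_category_with_choices
begin

context
 fixes M sg
 assumes h: "hbraid M sg" and D: "gdim ~= 0"
begin

lemma right_loop_inc:
 assumes j [simp]: "j : J C" and i [simp]: "i : J C"
 shows "{M;u;}${;loop (M @ U) (right_rho sg M) (right_rho' M) (Sp j);}${M;inc i;}
  = sc (s i / s j0) (({M;evR (Sp i);}${;sg [Sp i];S' i})
  ${;{;wEv (Sp j);S i}${S' j;isotypic (Sp j) i j0;}${;coevR (Sp j);S i};M @ S' i}${;braid M (S i);S' i})"
proof -
 note [simp] = M_simps[OF h D]
 let ?X = "Sp j" and ?Y = "Du (Sp j)" and ?I = "Sp i" and ?I' = "Du (Sp i)"
 let ?e = "isotypic ?X i j0"
 have l [simp]: "warr (loop (M @ U) (right_rho sg M) (right_rho' M) ?X)" "dom (loop (M @ U) (right_rho sg M) (right_rho' M) ?X) = M @ U" "cod (loop (M @ U) (right_rho sg M) (right_rho' M) ?X) = M @ U"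
  using loop_hom[OF half_braid_unit_sides(3,4)[OF h D], of ?X] by (auto simp: homs)
 let ?a = "{M;wEv ?X;}" and ?b = "{;sg [?Y];?X # SD i}${[?Y];braid' [?X] M;SD i}${;coevR ?X;M @ SD i}"
 have 1: "{M;u;}${;loop (M @ U) (right_rho sg M) (right_rho' M) ?X;}${M;inc i;} = ?a${M @ [?Y];g ?X${[?X];inc i;};}$?b"
 proof -
  have "{M;u;}${;loop (M @ U) (right_rho sg M) (right_rho' M) ?X;}${M;inc i;}
   = ({M;u;}$loop (M @ U) (right_rho sg M) (right_rho' M) ?X)${M;inc i;}" by (simp add: cassoc layer_nil)
  also have "... = ?a${M @ [?Y];g ?X${[?X];inc i;};}$?b"
   unfolding right_loop[OF h D j] by (simp add: diagram)
  finally show ?thesis .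
 qed
 have s1: "{M;?e;}${;braid' [?X] M;[?I]} = {;sg [?X];[?I]}${[?X];sg [?I];}${;?e;M}${[?X];braid M [?I];}"
 proof -
  have "braid' [?X, ?I] M${[?X];braid M [?I];} = {;braid' [?X] M;[?I]}"
   using crossing_append1[of braid' "[?X]" "[?I]" M] by (simp add: cassoc)
  then have "{M;?e;}${;braid' [?X] M;[?I]} = ({M;?e;}$braid' [?X, ?I] M)${[?X];braid M [?I];}" by (simp add: cassoc)
  also have "{M;?e;}$braid' [?X, ?I] M = sg [?X, ?I]${;?e;M}"
   by (rule isotypic_switch[OF half_braid_braid_inv h]) simp_all
  finally show ?thesis using half_braid_append[OF h, of "[?X]" "[?I]"] by (simp add: cassoc)
 qed
 have s2: "{M;wEv ?X;}${;sg [?Y];[?X]}${[?Y];sg [?X];} = {;wEv ?X;M}"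
  using half_braid_nat[OF h, of "wEv ?X" "[?Y, ?X]" "[]"] half_braid_append[OF h, of "[?Y]" "[?X]"] hb_simps(2)[OF h] by simp
 have "?a${M @ [?Y];{[?X];evR ?I;}${;?e;[?I']};}$?b
  = {M;evR ?I;}${M;wEv ?X;SD i}${;sg [?Y];?X # SD i}${[?Y];sg [?X];SD i}${[?Y, ?X];sg [?I];[?I']}${[?Y];?e;M @ [?I']}${[?Y, ?X];braid M [?I];[?I']}${;coevR ?X;M @ SD i}"
  by (rule rewrite[OF s1, of _ "{M;evR ?I;}${M;wEv ?X;SD i}${;sg [?Y];?X # SD i}" "[?Y]" "[?I']" "{;coevR ?X;M @ SD i}"]) (simp_all add: diagram)
 also have "... = {M;evR ?I;}${;wEv ?X;M @ SD i}${[?Y, ?X];sg [?I];[?I']}${[?Y];?e;M @ [?I']}${[?Y, ?X];braid M [?I];[?I']}${;coevR ?X;M @ SD i}"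
  by (rule rewrite[OF s2, of _ "{M;evR ?I;}" "[]" "SD i" "{[?Y, ?X];sg [?I];[?I']}${[?Y];?e;M @ [?I']}${[?Y, ?X];braid M [?I];[?I']}${;coevR ?X;M @ SD i}"]) (simp_all add: cassoc)
 also have "... = ({M;evR ?I;}${;sg [?I];[?I']})
  ${;{;wEv ?X;S i}${S' j;?e;}${;coevR ?X;S i};M @ S' i}${;braid M (S i);S' i}"
  by (simp add: diagram)
 finally have 2: "?a${M @ [?Y];{[?X];evR ?I;}${;?e;[?I']};}$?b = ({M;evR ?I;}${;sg [?I];[?I']})
  ${;{;wEv ?X;S i}${S' j;?e;}${;coevR ?X;S i};M @ S' i}${;braid M (S i);S' i}" .
 have "?a${M @ [?Y];sc (s i / s j0) ({[?X];evR ?I;}${;?e;[?I']});}$?b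
  = sc (s i / s j0) (?a${M @ [?Y];{[?X];evR ?I;}${;?e;[?I']};}$?b)"
  by (rule sandwich_wscale[where y = "[?X]" and z = M and x = "[?X, ?I, ?I']" and w = "M @ SD i"]) (simp_all add: homs)
 then show ?thesis unfolding 1 g_inc[OF Simp_Obj[OF j] i] 2 .
qed

lemma right_form_whom: "right_form sg M : whom (M @ U) M"
 unfolding right_form_def by (rule copair_whom) (simp_all add: homs M_simps[OF h D])

lemma left_form_whom: "left_form sg M : whom (U @ M) M"
 unfolding left_form_def by (rule hin(5)) (simp_all add: homs M_simps[OF h D])

lemma right_form_inc: "i : J C ==> right_form sg M${M;inc i;} = sc (s i) ({M;evR (Sp i);}${;sg [Sp i];S' i}${;braid M [Sp i];S' i})"
 unfolding right_form_def by (rule copair_inj) (simp_all add: homs M_simps[OF h D])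

lemma avg_unit_right: "{M;u;}$avg (M @ U) (right_rho sg M) (right_rho' M) = sc (1 / (gdim * s j0)) (right_form sg M)"
proof (rule sum_ext[of _ M "[]" M])
 note [simp] = M_simps[OF h D]
 let ?Q = "avg (M @ U) (right_rho sg M) (right_rho' M)"
 have Q [simp]: "warr ?Q" "dom ?Q = M @ U" "cod ?Q = M @ U"
  using avg_hom[OF half_braid_unit_sides(3,4)[OF h D]] by (auto simp: homs)
 have R [simp]: "warr (right_form sg M)" "dom (right_form sg M) = M @ U" "cod (right_form sg M) = M" using right_form_whom by (auto simp: homs)
 show "{M;u;}$?Q : whom (M @ U @ []) M" "sc (1 / (gdim * s j0)) (right_form sg M) : whom (M @ U @ []) M" "word M" "word []"
  by (simp_all add: homs)
 fix i assume i [simp]: "i : J C"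
 let ?l = "%j. loop (M @ U) (right_rho sg M) (right_rho' M) (Sp j)"
 let ?w = "M @ SD i"
 let ?u = "{M;evR (Sp i);}${;sg [Sp i];S' i}" and ?v = "{;braid M (S i);S' i}"
 let ?E = "%j. {;wEv (Sp j);S i}${S' j;isotypic (Sp j) i j0;}${;coevR (Sp j);S i}"
 let ?G = "%j. ?u${;?E j;M @ S' i}$?v"
 have G: "?G j : whom ?w M" if "j : J C" for j using that by (simp add: homs)
 have "({M;u;}$?Q)${M;inc i;} = {M;u;}${;?Q;}${M;inc i;}" by (simp add: cassoc layer_nil)
 also have "... = sc (1 / gdim) (wsum ?w M (%j. sc (d j) ({M;u;}${;?l j;}${M;inc i;})) (J C))"
  by (rule avg_sandwich[OF half_braid_unit_sides(3,4)[OF h D]]) (simp_all add: homs)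
 also have "wsum ?w M (%j. sc (d j) ({M;u;}${;?l j;}${M;inc i;})) (J C) = wsum ?w M (%j. sc (s i / s j0) (sc (d j) (?G j))) (J C)"
 proof (rule wsum_cong_whom)
  fix j assume j: "j : J C"
  show "sc (d j) ({M;u;}${;?l j;}${M;inc i;}) = sc (s i / s j0) (sc (d j) (?G j))"
   unfolding right_loop_inc[OF j i] wscale_wscale_whom[OF G[OF j]] by (simp only: mult.commute)
  show "sc (s i / s j0) (sc (d j) (?G j)) : whom ?w M" by (intro hin(3) G[OF j])
 qed simp_all
 also have "... = sc (s i / s j0) (wsum ?w M (%j. sc (d j) (?G j)) (J C))"
  by (rule wscale_wsum_whom[symmetric, OF _ _ hin(3)[OF G]]) simp_all
 also have "wsum ?w M (%j. sc (d j) (?G j)) (J C) = ?u${;wsum (S i) (S i) (%j. sc (d j) (?E j)) (J C);M @ S' i}$?v"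
  by (rule sandwich_comb[symmetric]) (simp_all add: homs)
 also have "... = {M;evR (Sp i);}${;sg [Sp i];S' i}${;braid M (S i);S' i}"
  unfolding unit_completeness[OF i] by (simp add: cassoc)
 finally have 1: "({M;u;}$?Q)${M;inc i;} = sc (1 / gdim) (sc (s i / s j0) ({M;evR (Sp i);}${;sg [Sp i];S' i}${;braid M (S i);S' i}))" .
 have 2: "sc (1 / (gdim * s j0)) (right_form sg M)${M;inc i;} = sc (1 / (gdim * s j0)) (right_form sg M${M;inc i;})"
  by (simp add: wscale_comp)
 show "({M;u;}$?Q)${M;inc i;} = sc (1 / (gdim * s j0)) (right_form sg M)${M;inc i;}"
  unfolding 1 2 right_form_inc[OF i] by simp
qed

lemma prj_u': "i : J C ==> prj i$u' = (if i = j0 then coev (Unit C) else wzero [] (SD i))"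
 using prj_inj[of j0 i] by (simp add: u'_def cassoc[symmetric])

text \<open>Only the loop labelled by the unit object survives between \<open>u'\<close> and \<open>u\<close>.\<close>

lemma unit_section:
 shows "{;u;M}$avg (U @ M) (left_rho M) (left_rho' sg M)${;u';M} = sc (d j0 / gdim) (idw M)"
  "{M;u;}$avg (M @ U) (right_rho sg M) (right_rho' M)${M;u';} = sc (d j0 / gdim) (idw M)"
proof -
 note [simp] = M_simps[OF h D]
 let ?I = "Unit C" and ?I' = "Du (Unit C)"
 have [simp]: "?I' : Ob" by simp
 have L [simp]: "warr (left_form sg M)" "dom (left_form sg M) = U @ M" "cod (left_form sg M) = M" using left_form_whom by (auto simp: homs)
 have R [simp]: "warr (right_form sg M)" "dom (right_form sg M) = M @ U" "cod (right_form sg M) = M" using right_form_whom by (auto simp: homs)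
 have Q [simp]: "warr (avg (SOb # M) (left_rho M) (left_rho' sg M))" "dom (avg (SOb # M) (left_rho M) (left_rho' sg M)) = SOb # M" "cod (avg (SOb # M) (left_rho M) (left_rho' sg M)) = SOb # M"
  "warr (avg (M @ U) (right_rho sg M) (right_rho' M))" "dom (avg (M @ U) (right_rho sg M) (right_rho' M)) = M @ U" "cod (avg (M @ U) (right_rho sg M) (right_rho' M)) = M @ U"
  using avg_hom[OF half_braid_unit_sides(1,2)[OF h D]] avg_hom[OF half_braid_unit_sides(3,4)[OF h D]] by (auto simp: homs)
 let ?F = "%i. {M;evR (Sp i);}${;sg [Sp i];S' i}${S i;braid [Du (Sp i)] M;}"
 have loop0: "{M;evR ?I;}${M;coev ?I;} = sc (d j0) (idw M)"
  using arg_cong[OF loop_value(1)[OF j0(1)], of "%f. {M;f;}"] by (simp add: layer_wscale)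
 have "left_form sg M${;u';M} = wsum M M (%i. sc (s i) (?F i${;prj i;M})${;u';M}) (J C)"
  unfolding left_form_def cassoc[symmetric] by (subst wsum_comp_whom[of "{;u';M}" M "U @ M"]) (simp_all add: homs cassoc cong: wsum_cong)
 also have "... = wsum M M (%i. sc (s i) (?F i${;prj i$u';M})) (J C)"
  by (rule wsum_cong) (simp_all add: wscale_comp cassoc)
 also have "... = sc (s j0) (?F j0${;prj j0$u';M})"
  by (rule wsum_single) (simp_all add: prj_u' homs del: layer_comp)
 also have "?F j0${;prj j0$u';M} = {M;evR ?I;}${;sg [?I];[?I']}${[?I];braid [?I'] M;}${;coev ?I;M}"
  by (simp add: prj_u' cassoc del: layer_comp)
 also have "sg [?I] = braid [?I] M" using half_braid_Unit[OF h] half_braid_Unit[OF half_braid_braid, of M] by simp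
 also have "{M;evR ?I;}${;braid [?I] M;[?I']}${[?I];braid [?I'] M;}${;coev ?I;M} = {M;evR ?I;}${M;coev ?I;}"
  using crossing_nat1[of braid M "coev ?I" "[]" "[?I, ?I']"] crossing_append1[of braid "[?I]" "[?I']" M] by (simp add: cassoc)
 also note loop0
 finally have l: "left_form sg M${;u';M} = sc (s j0) (sc (d j0) (idw M))" .
 have sd: "1 / (gdim * s j0) * s j0 * d j0 = d j0 / gdim" using s_j0 by simp
 have "{;u;M}$avg (U @ M) (left_rho M) (left_rho' sg M)${;u';M} = sc (1 / (gdim * s j0)) (left_form sg M)${;u';M}"
  unfolding avg_unit_left[OF h D, symmetric] by (simp add: cassoc)
 also have "... = sc (1 / (gdim * s j0)) (left_form sg M${;u';M})" by (simp add: wscale_comp)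
 finally show "{;u;M}$avg (U @ M) (left_rho M) (left_rho' sg M)${;u';M} = sc (d j0 / gdim) (idw M)"
  unfolding l using sd s_j0 by simp
 have "right_form sg M${M;u';} = (right_form sg M${M;inc j0;})${M;coev ?I;}" by (simp add: u'_def cassoc)
 also have "... = sc (s j0) ({M;evR ?I;}${;sg [?I];[?I']}${;braid M [?I];[?I']}${M;coev ?I;})"
  unfolding right_form_inc[OF j0(1)] by (simp add: wscale_comp cassoc)
 also have "sg [?I] = braid' [?I] M" using half_braid_Unit[OF h] half_braid_Unit[OF half_braid_braid_inv, of M] by simp
 also have "{M;evR ?I;}${;braid' [?I] M;[?I']}${;braid M [?I];[?I']}${M;coev ?I;} = {M;evR ?I;}${M;coev ?I;}"
  by simp
 also note loop0
 finally have r: "right_form sg M${M;u';} = sc (s j0) (sc (d j0) (idw M))" .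
 have "{M;u;}$avg (M @ U) (right_rho sg M) (right_rho' M)${M;u';} = sc (1 / (gdim * s j0)) (right_form sg M)${M;u';}"
  unfolding avg_unit_right[symmetric] by (simp add: cassoc)
 also have "... = sc (1 / (gdim * s j0)) (right_form sg M${M;u';})" by (simp add: wscale_comp)
 finally show "{M;u;}$avg (M @ U) (right_rho sg M) (right_rho' M)${M;u';} = sc (d j0 / gdim) (idw M)"
  unfolding r using sd s_j0 by simp
qed

text \<open>
 On arrows that do not distinguish the two half-braidings, \<open>u\<close> can be undone: \<open>g_coev\<close> recovers all
 components from it.
\<close>

lemma unit_left_injective:
 assumes F: "F : whom w (U @ M)" "!!a. a : Ob ==> left_rho M [a]${[a];F;} = left_rho' sg M [a]${[a];F;}"
  and G: "G : whom w (U @ M)" "!!a. a : Ob ==> left_rho M [a]${[a];G;} = left_rho' sg M [a]${[a];G;}"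
  and eq: "{;u;M}$F = {;u;M}$G"
 shows "F = G"
proof (rule prj_ext[of _ w "[]" M])
 note [simp] = M_simps[OF h D]
 fix i assume i [simp]: "i : J C"
 let ?X = "Sp i" and ?Y = "Du (Sp i)"
 let ?c = "s i / (s j0 * d i)"
 have K: "{;sc ?c (prj i);M}$f = {[?X];braid' M [?Y];}${[?X];sg [?Y];}${[?X, ?Y];{;u;M}$f;}${;coev ?X;w}"
  if f: "f : whom w (U @ M)" and e: "!!a. a : Ob ==> left_rho M [a]${[a];f;} = left_rho' sg M [a]${[a];f;}" for f
 proof -
  have [simp]: "warr f" "dom f = w" "cod f = U @ M" "word w" using f warr_word[of f] by (auto simp: homs)
  have n: "{;u;[?Y]}$braid' [?Y] U = {[?Y];u;}" using intwD[OF u_braid(2), of ?Y] by simp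
  have "{;braid [?Y] M;}${;g ?Y;M}${[?Y];f;} = {;u;M @ [?Y]}$left_rho M [?Y]${[?Y];f;}"
   by (simp add: hprod_def g_def diagram)
  also have "... = {;u;M @ [?Y]}$left_rho' sg M [?Y]${[?Y];f;}" using e[of ?Y] by simp
  also have "... = {;sg [?Y];}${[?Y];u;M}${[?Y];f;}"
   by (rule rewrite[OF n, of _ "{;sg [?Y];}" "[]" M "{[?Y];f;}"]) (simp_all add: hprod_def diagram)
  finally have x: "braid [?Y] M${;g ?Y;M}${[?Y];f;} = sg [?Y]${[?Y];u;M}${[?Y];f;}" by (simp add: layer_nil)
  have "{;sc ?c (prj i);M}$f = {[?X];g ?Y;M}${[?X, ?Y];f;}${;coev ?X;w}"
  proof -
   have "{;{S i;g ?Y;}${;coev ?X;U};M}${;f;} = {[?X];g ?Y;M}${[?X, ?Y];f;}${;coev ?X;w}"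
    by (simp add: diagram)
   then show ?thesis unfolding g_coev[OF i] by (simp add: layer_nil)
  qed
  also have "... = {[?X];braid' M [?Y];}${[?X];braid [?Y] M;}${[?X];g ?Y;M}${[?X, ?Y];f;}${;coev ?X;w}" by simp
  also have "... = {[?X];braid' M [?Y];}${[?X];sg [?Y];}${[?X, ?Y];{;u;M}$f;}${;coev ?X;w}"
   by (rule rewrite[OF x, of _ "{[?X];braid' M [?Y];}" "[?X]" "[]" "{;coev ?X;w}"]) (simp_all add: cassoc)
  finally show ?thesis .
 qed
 have nz: "?c ~= 0" using s_square[OF i] d_nonzero[OF i] s_j0 by auto
 have w: "warr F" "warr G" "cod F = U @ M" "cod G = U @ M" using F(1) G(1) by (auto simp: homs)
 have "sc ?c ({;prj i;M}$F) = sc ?c ({;prj i;M}$G)"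
  using K[OF F] K[OF G] eq w by (simp add: layer_wscale wscale_comp del: layer_comp)
 then show "{;prj i;M}$F = {;prj i;M}$G" by (rule wscale_cancel) (use nz w in simp_all)
qed (use F G M_simps[OF h D] in simp_all)

lemma unit_right_injective:
 assumes F: "F : whom w (M @ U)" "!!a. a : Ob ==> right_rho sg M [a]${[a];F;} = right_rho' M [a]${[a];F;}"
  and G: "G : whom w (M @ U)" "!!a. a : Ob ==> right_rho sg M [a]${[a];G;} = right_rho' M [a]${[a];G;}"
  and eq: "{M;u;}$F = {M;u;}$G"
 shows "F = G"
proof (rule prj_ext[of _ w M "[]"])
 note [simp] = M_simps[OF h D]
 fix i assume i [simp]: "i : J C"
 let ?X = "Sp i" and ?Y = "Du (Sp i)"
 let ?c = "s i / (s j0 * d i)"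
 have K: "{M;sc ?c (prj i);}$f = {;braid' [?X] M;[?Y]}${[?X];sg [?Y];}${[?X, ?Y];{M;u;}$f;}${;coev ?X;w}"
  if f: "f : whom w (M @ U)" and e: "!!a. a : Ob ==> right_rho sg M [a]${[a];f;} = right_rho' M [a]${[a];f;}" for f
 proof -
  have [simp]: "warr f" "dom f = w" "cod f = M @ U" "word w" using f warr_word[of f] by (auto simp: homs)
  have n: "{;u;[?Y]}$braid [?Y] U = {[?Y];u;}" using intwD[OF u_braid(1), of ?Y] by simp
  have c: "{M;coev ?X;} = {;braid' [?X] M;[?Y]}${[?X];braid' [?Y] M;}${;coev ?X;M}"
   using crossing_nat1[of braid' M "coev ?X" "[]" "[?X, ?Y]"] crossing_append1[of braid' "[?X]" "[?Y]" M] by (simp add: cassoc)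
  have "{M;g ?Y;}${;braid' [?Y] M;U}${[?Y];f;} = {M;u;[?Y]}$right_rho' M [?Y]${[?Y];f;}"
   by (simp add: hprod_def g_def cassoc)
  also have "... = {M;u;[?Y]}$right_rho sg M [?Y]${[?Y];f;}" using e[of ?Y] by simp
  also have "... = {;sg [?Y];}${?Y # M;u;}${[?Y];f;}"
   by (rule rewrite[OF n, of _ "idw (M @ [?Y])" M "[]" "{;sg [?Y];U}${[?Y];f;}"]) (simp_all add: hprod_def diagram)
  finally have x: "{M;g ?Y;}${;braid' [?Y] M;U}${[?Y];f;} = sg [?Y]${?Y # M;u;}${[?Y];f;}" by (simp add: layer_nil)
  have "{M;sc ?c (prj i);}$f = {M @ [?X];g ?Y;}${M;coev ?X;U}$f"
   unfolding g_coev[OF i, symmetric] by (simp add: cassoc)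
  also have "... = {M @ [?X];g ?Y;}${;braid' [?X] M;?Y # U}${[?X];braid' [?Y] M;U}${;coev ?X;M @ U}${;f;}"
   by (rule rewrite[OF c, of _ "{M @ [?X];g ?Y;}" "[]" U f]) (simp_all add: cassoc layer_nil)
  also have "... = {;braid' [?X] M;[?Y]}${?X # M;g ?Y;}${[?X];braid' [?Y] M;U}${[?X, ?Y];f;}${;coev ?X;w}"
   by (simp add: diagram)
  also have "... = {;braid' [?X] M;[?Y]}${[?X];sg [?Y];}${[?X, ?Y];{M;u;}$f;}${;coev ?X;w}"
   by (rule rewrite[OF x, of _ "{;braid' [?X] M;[?Y]}" "[?X]" "[]" "{;coev ?X;w}"]) (simp_all add: cassoc)
  finally show ?thesis .
 qed
 have nz: "?c ~= 0" using s_square[OF i] d_nonzero[OF i] s_j0 by auto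
 have w: "warr F" "warr G" "cod F = M @ U" "cod G = M @ U" using F(1) G(1) by (auto simp: homs)
 have "sc ?c ({M;prj i;}$F) = sc ?c ({M;prj i;}$G)"
  using K[OF F] K[OF G] eq w by (simp add: layer_wscale wscale_comp del: layer_comp)
 then show "{M;prj i;}$F = {M;prj i;}$G" by (rule wscale_cancel) (use nz w in simp_all)
qed (use F G M_simps[OF h D] in simp_all)

end
end

section \<open>The tensor product of elliptic objects\<close>

context monoidal_category
begin

lemma intertwiner_cong:
 assumes "!!a. a : Ob ==> sg [a] = sg' [a]" "!!a. a : Ob ==> ta [a] = ta' [a]"
 shows "intw f sg ta \<longleftrightarrow> intw f sg' ta'"
 using assms by (simp add: intw_def)

text \<open>Move \<open>f\<close> and \<open>i\<close> through together, \<open>i\<close> back alone, and cancel \<open>i\<close> by means of \<open>p\<close>.\<close>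

lemma intertwiner_cancel:
 assumes fi: "intw (i$f) sg oo" and i: "intw i ta oo" and p: "warr p" "p$i = idw N" "dom p = cod i"
  and f [simp]: "warr f" "cod f = N" "dom i = N" and h: "hbraid (dom f) sg" "hbraid N ta" "hbraid (cod i) oo"
 shows "intw f sg ta"
 unfolding intw_def
proof (intro conjI ballI)
 fix a assume a [simp]: "a : Ob"
 note [simp] = intertwiner_warr[OF i] p(1,3) hb_simps(1,3-5)[OF h(1)] hb_simps(1,3-5)[OF h(2)] hb_simps(1,3-5)[OF h(3)]
 have "{;i;[a]}${;f;[a]}$sg [a] = oo [a]${[a];i;}${[a];f;}"
  using intwD[OF fi a] by (simp add: cassoc)
 also have "... = {;i;[a]}$ta [a]${[a];f;}"
  by (rule rewrite[OF intwD[OF i a, symmetric], of _ "idw (cod i @ [a])" "[]" "[]" "{[a];f;}"]) (simp_all add: cassoc layer_nil)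
 finally have "{;p;[a]}${;i;[a]}${;f;[a]}$sg [a] = {;p;[a]}${;i;[a]}$ta [a]${[a];f;}" by simp
 then show "{;f;[a]}$sg [a] = ta [a]${[a];f;}" using layer_cancel(2)[OF p(2), of "[]" "[a]"] by simp
qed simp

text \<open>Preceded by the inclusion, both sides become the same diagram on \<open>M\<close>, and the inclusion is split.\<close>

lemma crosses_retract:
 assumes i: "intw i sg sg'" "intw i ta ta'" and p [simp]: "warr p" "p$i = idw N" "dom p = M" "cod i = M" "dom i = N"
  and h: "hbraid N sg" "hbraid N ta" "hbraid M sg'" "hbraid M ta'" and e [simp]: "crossing e" "crossing e'" and c: "crosses e e' M sg' ta'"
 shows "crosses e e' N sg ta"
 unfolding crosses_def
proof (intro ballI)
 fix a b assume a [simp]: "a : Ob" and b [simp]: "b : Ob"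
 note [simp] = intertwiner_warr[OF i(1)] hb_simps(1,3-5)[OF h(1)] hb_simps(3-5)[OF h(2)] hb_simps(1,3-5)[OF h(3)] hb_simps(3-5)[OF h(4)]
 let ?L = "{N;e [a] [b];}${;sg [a];[b]}${[a];ta [b];}" and ?R = "{;ta [b];[a]}${[b];sg [a];}${;e' [a] [b];N}"
 have "{;i;[b, a]}$?L = {M;e [a] [b];}${;sg' [a];[b]}${[a];i;[b]}${[a];ta [b];}"
  by (rule rewrite[OF intwD[OF i(1) a], of _ "{M;e [a] [b];}" "[]" "[b]" "{[a];ta [b];}"]) (simp_all add: diagram)
 also have "... = {M;e [a] [b];}${;sg' [a];[b]}${[a];ta' [b];}${[a, b];i;}"
  by (rule rewrite[OF intwD[OF i(2) b], of _ "{M;e [a] [b];}${;sg' [a];[b]}" "[a]" "[]" "idw (a # b # N)"]) (simp_all add: cassoc)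
 also have "... = {;ta' [b];[a]}${[b];sg' [a];}${;e' [a] [b];M}${[a, b];i;}"
  by (rule rewrite[OF c[unfolded crosses_def, rule_format, OF a b], of _ "idw (M @ [b, a])" "[]" "[]" "{[a, b];i;}"]) (simp_all add: cassoc)
 also have "... = {;ta' [b];[a]}${[b];i;[a]}${[b];sg [a];}${;e' [a] [b];N}"
  by (rule rewrite[OF intwD[OF i(1) a, symmetric], of _ "{;ta' [b];[a]}" "[b]" "[]" "{;e' [a] [b];N}"]) (simp_all add: diagram)
 also have "... = {;i;[b, a]}$?R"
  by (rule rewrite[OF intwD[OF i(2) b, symmetric], of _ "idw (M @ [b, a])" "[]" "[a]" "{[b];sg [a];}${;e' [a] [b];N}"]) (simp_all add: cassoc)
 finally have "{;p;[b, a]}${;i;[b, a]}$?L = {;p;[b, a]}${;i;[b, a]}$?R" by simp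
 then show "?L = ?R" using layer_cancel(2)[OF p(2), of "[]" "[b, a]"] by simp
qed

end

context premodular_category_with_choices
begin

abbreviation hw where "hw P == word_half (fst P) (snd P)"

definition rh where
 "rh P R = hprod (hw P) [fst P] (%A. braid A [fst R]) [fst R]"

definition rh' where
 "rh' P R = hprod (%A. braid' A [fst P]) [fst P] (hw R) [fst R]"

definition iw where
 "iw P R = ([ImObj C P R], ImInc C P R, [fst P, fst R])"

definition pw where
 "pw P R = ([fst P, fst R], ImProj C P R, [ImObj C P R])"

definition redw where
 "redw P R A = {;pw P R;A}$rh P R A${A;iw P R;}"

context
 fixes P R
 assumes P: "P : drinfeld_center_objects C" and R: "R : drinfeld_center_objects C" and D: "gdim ~= 0"
begin

lemma hw: "hbraid [fst P] (hw P)" "hbraid [fst R] (hw R)" "half_braiding C (fst P) (snd P)" "half_braiding C (fst R) (snd R)"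
 using P R half_braid_word_half(1) by (auto simp: drinfeld_center_objects_def)

lemma Obj_simps: "fst P : Ob" "fst R : Ob"
 using hb_simps(1)[OF hw(1)] hb_simps(1)[OF hw(2)] by simp_all

lemma half_braid_rh: "hbraid [fst P, fst R] (rh P R)" "hbraid [fst P, fst R] (rh' P R)"
 using half_braid_prod[OF hw(1) half_braid_braid, of "[fst R]"] half_braid_prod[OF half_braid_braid_inv hw(2), of "[fst P]"] Obj_simps
 by (simp_all add: rh_def rh'_def)

lemma crosses_rh: "crosses braid braid [fst P, fst R] (rh P R) (rh' P R)"
proof -
 note [simp] = Obj_simps
 have A: "crosses braid braid [fst P] (hw P) (%A. braid' A [fst P])"
  by (rule crosses_swap[OF crosses_crossing[OF hw(1) crossing_braid_inv] half_braid_braid_inv hw(1)]) (simp_all add: braid_inverse)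
 have B: "crosses braid braid [fst R] (%A. braid A [fst R]) (hw R)" by (rule crosses_crossing[OF hw(2) crossing_braid])
 have "crosses braid braid ([fst P] @ [fst R]) (rh P R) (rh' P R)"
  unfolding rh_def rh'_def by (rule crosses_prod[OF A hw(1) half_braid_braid_inv B half_braid_braid hw(2)]) simp_all
 then show ?thesis by simp
qed

lemma Qproj_avg: "Qproj C P R = underlying (avg [fst P, fst R] (rh P R) (rh' P R))"
proof -
 note [simp] = Obj_simps
 obtain X l Y m where PR: "P = (X, l)" "R = (Y, m)" by (cases P, cases R) auto
 have [simp]: "X : Ob" "Y : Ob" using Obj_simps PR by simp_all
 have w [simp]: "warr (wHalf l A X)" "warr (wHalf m A Y)" if "A : Ob" for A using that hw(3,4) PR by (auto simp: half_braiding_def)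
 have e: "(idw [X, Y] ## evR S)$(rho' C P R S ## idw [Du S])$(idw [S] ## rho C P R (Du S))$(coev S ## idw [X, Y])
  = loop [X, Y] (rh P R) (rh' P R) S" if [simp]: "S : Ob" for S
  using half_braid_word_half(2)[OF hw(3)[unfolded PR fst_conv snd_conv]] half_braid_word_half(2)[OF hw(4)[unfolded PR fst_conv snd_conv]]
  by (simp add: PR loop_def rho_def rho'_def rh_def rh'_def hprod_def braid_single braid_inv_single tensor_layers cassoc)
 have l: "loop [X, Y] (rh P R) (rh' P R) S : whom [X, Y] [X, Y]" if "S : Ob" for S
  using loop_hom[OF half_braid_rh that] PR by simp
 have "hom_sum C (X \<odot> Y) (X \<odot> Y) (%j. Scale C (d j) (underlying
     ((idw [X, Y] ## evR (Sp j))$(rho' C P R (Sp j) ## idw [Du (Sp j)])$(idw [Sp j] ## rho C P R (Du (Sp j)))$(coev (Sp j) ## idw [X, Y])))) (J C)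
  = hom_sum C (X \<odot> Y) (X \<odot> Y) (%j. Scale C (d j) (underlying (loop [X, Y] (rh P R) (rh' P R) (Sp j)))) (J C)"
  by (rule hom_sum_cong) (use whom_underlying[OF l] in "auto simp: e intro!: Scale_Hom")
 then show ?thesis by (simp add: Qproj_def avg_def PR Let_def)
qed

text \<open>The image of an idempotent splits it: cancel the mono on the left and the epi on the right.\<close>

lemma image_facts: "ImObj C P R : Ob" "iw P R : whom [ImObj C P R] [fst P, fst R]" "pw P R : whom [fst P, fst R] [ImObj C P R]"
  "iw P R$pw P R = avg [fst P, fst R] (rh P R) (rh' P R)" "pw P R$iw P R = idw [ImObj C P R]"
proof -
 note [simp] = Obj_simps
 let ?X = "fst P" and ?Y = "fst R" and ?I = "ImObj C P R" and ?p = "ImProj C P R" and ?i = "ImInc C P R"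
 have im: "?p : Hom C (?X \<odot> ?Y) ?I" "?i : Hom C ?I (?X \<odot> ?Y)" "is_epi C ?p" "is_mono C ?i" "?i ** ?p = Qproj C P R"
  using image[of "fst P" "snd P" "fst R" "snd R"] P R by simp_all
 show I [simp]: "?I : Ob" using im(2) Hom_Obj by blast
 show i: "iw P R : whom [?I] [?X, ?Y]" and p: "pw P R : whom [?X, ?Y] [?I]" using im(1,2) by (simp_all add: iw_def pw_def homs warrI)
 have Q: "avg [?X, ?Y] (rh P R) (rh' P R) : whom [?X, ?Y] [?X, ?Y]" by (rule avg_hom[OF half_braid_rh])
 show ip: "iw P R$pw P R = avg [?X, ?Y] (rh P R) (rh' P R)"
  using i p Q im(5) by (intro word_arr_eqI) (auto simp: homs Qproj_avg, simp_all add: iw_def pw_def)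
 have "(iw P R$pw P R)$(iw P R$pw P R) = iw P R$pw P R"
  unfolding ip by (rule avg_idem[OF half_braid_rh crosses_rh D])
 then have "underlying ((iw P R$pw P R)$(iw P R$pw P R)) = underlying (iw P R$pw P R)" by (rule arg_cong)
 then have "?i ** (?p ** ?i ** ?p) = ?i ** ?p"
  using im(1,2) by (simp add: iw_def pw_def Hom_def Comp_Comp)
 then have "?p ** ?i ** ?p = ?p" using im(1,2,4) unfolding is_mono_def by (auto simp: Hom_def)
 then have "(?p ** ?i) ** ?p = Id C ?I ** ?p" using im(1,2) by (simp add: Hom_def Comp_Comp)
 then have "?p ** ?i = Id C ?I" using im(1,2,3) unfolding is_epi_def by (auto simp: Hom_def)
 then show "pw P R$iw P R = idw [?I]" using i p by (intro word_arr_eqI) (auto simp: homs, simp_all add: iw_def pw_def)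
qed

lemma iw_simps: "warr (iw P R)" "dom (iw P R) = [ImObj C P R]" "cod (iw P R) = [fst P, fst R]"
 "warr (pw P R)" "dom (pw P R) = [fst P, fst R]" "cod (pw P R) = [ImObj C P R]"
 using image_facts(2,3) by (auto simp: homs)

lemma avg_iw: "avg [fst P, fst R] (rh P R) (rh' P R)$iw P R = iw P R"
 using image_facts(4,5) iw_simps by (simp add: cassoc flip: image_facts(4))

lemma iw_equalizes: "a : Ob ==> rh P R [a]${[a];iw P R;} = rh' P R [a]${[a];iw P R;}"
proof -
 assume a [simp]: "a : Ob"
 let ?Q = "avg [fst P, fst R] (rh P R) (rh' P R)"
 note [simp] = iw_simps Obj_simps hb_simps(3-5)[OF half_braid_rh(1)] hb_simps(3-5)[OF half_braid_rh(2)]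
 have [simp]: "warr ?Q" "dom ?Q = [fst P, fst R]" "cod ?Q = [fst P, fst R]" using avg_hom[OF half_braid_rh] by (auto simp: homs)
 have "{[a];iw P R;} = {[a];?Q;}${[a];iw P R;}" by (simp add: avg_iw flip: layer_comp)
 moreover have "rh P R [a]${[a];?Q;}${[a];iw P R;} = rh' P R [a]${[a];?Q;}${[a];iw P R;}"
  by (rule rewrite[OF avg_equalizes[OF half_braid_rh crosses_rh D a], of _ "idw ([fst P, fst R] @ [a])" "[]" "[]" "{[a];iw P R;}"]) (simp_all add: cassoc layer_nil)
 ultimately show ?thesis by simp
qed

lemma redw: "hbraid [ImObj C P R] (redw P R)" "intw (iw P R) (redw P R) (rh P R)" "intw (iw P R) (redw P R) (rh' P R)"
proof -
 have I: "intw (iw P R$pw P R) (rh P R) (rh P R)"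
  unfolding image_facts(4) by (rule avg_intertwines(1)[OF half_braid_rh crosses_rh D])
 note r = half_braid_retract[OF half_braid_rh(1) iw_simps(1,4,3,5,2,6) image_facts(5) I]
 show "hbraid [ImObj C P R] (redw P R)" "intw (iw P R) (redw P R) (rh P R)" using r(1,2) unfolding redw_def[abs_def] by simp_all
 then show "intw (iw P R) (redw P R) (rh' P R)" using iw_equalizes by (simp add: intw_def)
qed

lemma red_half_redw: "red_half C P R = (\<lambda>A\<in>Ob. underlying (redw P R [A]))"
proof
 fix A
 obtain X l Y m where PR: "P = (X, l)" "R = (Y, m)" by (cases P, cases R) auto
 have [simp]: "X : Ob" "Y : Ob" using Obj_simps PR by simp_all
 have w [simp]: "warr (wHalf l A X)" "warr (wHalf m A Y)" if "A : Ob" for A using that hw(3,4) PR by (auto simp: half_braiding_def)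
 note [simp] = image_facts(1)[unfolded PR] iw_simps[unfolded PR fst_conv]
 have e: "([X, Y], ImProj C (X, l) (Y, m), [ImObj C (X, l) (Y, m)]) = pw P R" "([ImObj C (X, l) (Y, m)], ImInc C (X, l) (Y, m), [X, Y]) = iw P R" by (simp_all add: pw_def iw_def PR)
 show "red_half C P R A = (\<lambda>A\<in>Ob. underlying (redw P R [A])) A"
 proof (cases "A : Ob")
  case [simp]: True
  then show ?thesis using half_braid_word_half(2)[OF hw(3)[unfolded PR fst_conv snd_conv]]
   by (simp add: red_half_def Let_def redw_def rho_def rh_def hprod_def braid_single tensor_layers cassoc PR e[unfolded PR])
 qed (simp add: red_half_def)
qed

end
end

context premodular_category_with_choices
begin

abbreviation h1 where "h1 P == word_half (fst P) (fst (snd P))"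
abbreviation h2 where "h2 P == word_half (fst P) (snd (snd P))"
abbreviation ob where "ob P == [fst P]"
abbreviation inc2 where "inc2 P R == iw (hb1 P) (hb1 R)"
abbreviation prj2 where "prj2 P R == pw (hb1 P) (hb1 R)"
abbreviation ot where "ot == el_tensor C"
abbreviation r1 where "r1 P R == hprod (h1 P) (ob P) (%A. braid A (ob R)) (ob R)"
abbreviation r1' where "r1' P R == hprod (%A. braid' A (ob P)) (ob P) (h1 R) (ob R)"
abbreviation r2 where "r2 P R == hprod (h2 P) (ob P) (h2 R) (ob R)"

lemma hb1_simps [simp]: "fst (hb1 P) = fst P" "snd (hb1 P) = fst (snd P)"
 by (simp_all add: hb1_def split: prod.splits)

lemma fst_ot [simp]: "fst (ot P R) = ImObj C (hb1 P) (hb1 R)"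
 by (simp add: el_tensor_def)

lemma rh_r1: "rh (hb1 P) (hb1 R) = r1 P R" "rh' (hb1 P) (hb1 R) = r1' P R"
 by (simp_all add: rh_def[abs_def] rh'_def[abs_def])

lemma ell:
 assumes "P : Ell"
 shows "hb1 P : drinfeld_center_objects C" "fst P : Ob" "hbraid (ob P) (h1 P)" "hbraid (ob P) (h2 P)" "crosses braid braid' (ob P) (h1 P) (h2 P)"
  "half_braiding C (fst P) (fst (snd P))" "half_braiding C (fst P) (snd (snd P))"
proof -
 obtain X l m where P: "P = (X, l, m)" by (cases P) auto
 then have h: "half_braiding C X l" "half_braiding C X m" "crosses braid braid' [X] (word_half X l) (word_half X m)"
  using assms elliptic_objects_iff by auto
 then show "hb1 P : drinfeld_center_objects C" "fst P : Ob" "hbraid (ob P) (h1 P)" "hbraid (ob P) (h2 P)" "crosses braid braid' (ob P) (h1 P) (h2 P)"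
  "half_braiding C (fst P) (fst (snd P))" "half_braiding C (fst P) (snd (snd P))"
  by (auto simp: P hb1_def drinfeld_center_objects_def half_braid_word_half(1), auto simp: half_braiding_def)
qed

lemma word_half_restrict:
 assumes "hbraid [X] ro" "a : Ob"
 shows "word_half X (\<lambda>A\<in>Ob. underlying (ro [A])) [a] = ro [a]"
 using half_braid_word_half(2)[OF half_braiding_of_word[OF assms(1)] assms(2)] hb_simps[OF assms(1)] assms(2)
 by (simp add: wHalf_restrict homs)

definition tensw where
 "tensw P R A = {;prj2 P R;A}$r2 P R A${A;inc2 P R;}"

context
 fixes P R
 assumes P: "P : Ell" and R: "R : Ell" and D: "gdim ~= 0"
begin

lemmas eP = ell[OF P] and eR = ell[OF R]

lemma half_braid_r: "hbraid [fst P, fst R] (r1 P R)" "hbraid [fst P, fst R] (r1' P R)" "hbraid [fst P, fst R] (r2 P R)"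
 using half_braid_rh[OF eP(1) eR(1) D] half_braid_prod[OF eP(4) eR(4)] by (simp_all add: rh_r1)

lemmas inc2_simps = iw_simps[OF eP(1) eR(1) D, unfolded hb1_simps]
lemmas inc2_facts = image_facts[OF eP(1) eR(1) D, unfolded rh_r1 hb1_simps]
lemmas inc2_avg = avg_iw[OF eP(1) eR(1) D, unfolded rh_r1 hb1_simps]

text \<open>The compatibility of a product is checked factor by factor: one factor satisfies it by assumption, for the other
 it is naturality of the braiding. For \<open>r1\<close> the first factor is the one used, for \<open>r1'\<close> the second.\<close>

lemma crosses_r2: "crosses braid braid' [fst P, fst R] (r1 P R) (r2 P R)" "crosses braid braid' [fst P, fst R] (r1' P R) (r2 P R)"
proof -
 note [simp] = eP(2) eR(2)
 have "crosses braid braid' (ob P @ ob R) (r1 P R) (r2 P R)"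
  by (rule crosses_prod[OF eP(5,3,4) crosses_crossing[OF eR(4) crossing_braid] half_braid_braid eR(4)]) simp_all
 moreover have "crosses braid braid' (ob P @ ob R) (r1' P R) (r2 P R)"
  by (rule crosses_prod[OF crosses_crossing[OF eP(4) crossing_braid_inv] half_braid_braid_inv eP(4) eR(5,3,4)]) simp_all
 ultimately show "crosses braid braid' [fst P, fst R] (r1 P R) (r2 P R)" "crosses braid braid' [fst P, fst R] (r1' P R) (r2 P R)" by simp_all
qed

lemma tensw: "hbraid [ImObj C (hb1 P) (hb1 R)] (tensw P R)" "intw (inc2 P R) (tensw P R) (r2 P R)"
proof -
 have I: "intw (inc2 P R$prj2 P R) (r2 P R) (r2 P R)"
  unfolding inc2_facts(4) by (rule avg_commute[OF half_braid_r crossing_braid crossing_braid_inv crosses_r2])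
 note r = half_braid_retract[OF half_braid_r(3) inc2_simps(1,4,3,5,2,6) inc2_facts(5) I]
 show "hbraid [ImObj C (hb1 P) (hb1 R)] (tensw P R)" "intw (inc2 P R) (tensw P R) (r2 P R)" using r(1,2) unfolding tensw_def[abs_def] by simp_all
qed

lemma tens_half_tensw: "tens_half C P R = (\<lambda>A\<in>Ob. underlying ((tensw P R) [A]))"
proof
 fix A
 obtain X l l' Y m m' where PR: "P = (X, l, l')" "R = (Y, m, m')" by (cases P, cases R) auto
 have [simp]: "X : Ob" "Y : Ob" using eP(2) eR(2) PR by simp_all
 have w [simp]: "warr (wHalf l' A X)" "warr (wHalf m' A Y)" if "A : Ob" for A using that eP(7) eR(7) PR by (auto simp: half_braiding_def)
 note [simp] = inc2_facts(1)[unfolded PR hb1_def prod.case] inc2_simps[unfolded PR fst_conv hb1_def prod.case]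
 have e: "([X, Y], ImProj C (X, l) (Y, m), [ImObj C (X, l) (Y, m)]) = pw (X, l) (Y, m)" "([ImObj C (X, l) (Y, m)], ImInc C (X, l) (Y, m), [X, Y]) = iw (X, l) (Y, m)" by (simp_all add: pw_def iw_def)
 show "tens_half C P R A = (\<lambda>A\<in>Ob. underlying ((tensw P R) [A])) A"
 proof (cases "A : Ob")
  case [simp]: True
  then show ?thesis using half_braid_word_half(2)[OF eP(7)[unfolded PR fst_conv snd_conv]] half_braid_word_half(2)[OF eR(7)[unfolded PR fst_conv snd_conv]]
   by (simp add: tens_half_def Let_def tensw_def hprod_def tensor_layers cassoc Comp_Comp PR e hb1_def)
 qed (simp add: tens_half_def PR)
qed

lemma ot_singles: "a : Ob ==> h1 (ot P R) [a] = redw (hb1 P) (hb1 R) [a]" "a : Ob ==> h2 (ot P R) [a] = (tensw P R) [a]"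
 using word_half_restrict[OF redw(1)[OF eP(1) eR(1) D]] word_half_restrict[OF tensw(1)]
 by (simp_all add: el_tensor_def red_half_redw[OF eP(1) eR(1) D] tens_half_tensw)

lemma inc2_intw: "intw (inc2 P R) (h1 (ot P R)) (r1 P R)" "intw (inc2 P R) (h1 (ot P R)) (r1' P R)" "intw (inc2 P R) (h2 (ot P R)) (r2 P R)"
 using redw(2,3)[OF eP(1) eR(1) D] tensw(2) ot_singles unfolding rh_r1 by (simp_all cong: intertwiner_cong)

lemma ot_elliptic: "ot P R : Ell"
proof -
 let ?I = "ImObj C (hb1 P) (hb1 R)"
 note i = inc2_simps inc2_facts(5)
 have "crosses braid braid' [?I] (redw (hb1 P) (hb1 R)) (tensw P R)"
  by (rule crosses_retract[OF redw(2)[OF eP(1) eR(1) D, unfolded rh_r1] tensw(2) i(4,7,5,3,2) redw(1)[OF eP(1) eR(1) D] tensw(1) half_braid_r(1,3) crossing_braid crossing_braid_inv crosses_r2(1)])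
 then have "crosses braid braid' [?I] (h1 (ot P R)) (h2 (ot P R))" using ot_singles unfolding crosses_def by simp
 then show ?thesis
  using half_braiding_of_word[OF redw(1)[OF eP(1) eR(1) D]] half_braiding_of_word[OF tensw(1)]
  by (simp add: el_tensor_def elliptic_objects_iff red_half_redw[OF eP(1) eR(1) D] tens_half_tensw)
qed

end

text \<open>Half-braidings on words make the conditions accessible to diagrams; \<open>arrow_Hom\<close> gives the comparison with the arrows of the category.\<close>

definition earr where
 "earr P f R \<longleftrightarrow> P : Ell & R : Ell & f : whom (ob P) (ob R) & intw f (h1 P) (h1 R) & intw f (h2 P) (h2 R)"

lemma earr_simps: "earr P f R ==> warr f" "earr P f R ==> dom f = ob P" "earr P f R ==> cod f = ob R"
 by (auto simp: earr_def homs)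

lemma earr_id: "P : Ell ==> earr P (idw (ob P)) P"
 using ell[of P] by (auto simp: earr_def homs intertwiner_id)

lemma earr_comp: "[|earr P f R; earr R k V|] ==> earr P (k$f) V"
 using ell[of P] ell[of R] ell[of V] by (auto simp: earr_def homs intro!: intertwiner_comp)

lemma earr_inverse:
 assumes f: "earr P f R" and k: "k : whom (ob R) (ob P)" and e: "k$f = idw (ob P)" "f$k = idw (ob R)"
 shows "earr R k P"
proof -
 have P: "P : Ell" and R: "R : Ell" using f by (auto simp: earr_def)
 note p = ell[OF P] and r = ell[OF R]
 note [simp] = earr_simps[OF f] p(2-4) r(2-4) k[unfolded homs]
 have "intw (f$k) (h1 R) (h1 R)" "intw (f$k) (h2 R) (h2 R)" unfolding e(2) by (rule intertwiner_id; simp)+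
 moreover have "intw f (h1 P) (h1 R)" "intw f (h2 P) (h2 R)" using f by (auto simp: earr_def)
 ultimately have "intw k (h1 R) (h1 P)" "intw k (h2 R) (h2 P)"
  using intertwiner_cancel[OF _ _ _ e(1), where sg = "h1 R" and oo = "h1 R" and ta = "h1 P"] intertwiner_cancel[OF _ _ _ e(1), where sg = "h2 R" and oo = "h2 R" and ta = "h2 P"] by simp_all
 then show ?thesis using P R k by (simp add: earr_def)
qed

lemma intertwiner_braid: "[|warr f; dom f = X; cod f = Y|] ==> intw f (%A. braid A X) (%A. braid A Y)"
 "[|warr f; dom f = X; cod f = Y|] ==> intw f (%A. braid' A X) (%A. braid' A Y)"
 using crossing_nat2[of braid _ f X Y] crossing_nat2[of braid' _ f X Y] by (auto simp: intw_def)

text \<open>Source and target objects are arguments, since a word arrow does not determine its half-braidings.\<close>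

definition tarr where
 "tarr P P' f f' R R' = prj2 R R'$(f ## f')$inc2 P P'"

lemma inc2_cancel:
 assumes "P : Ell" "R : Ell" "gdim ~= 0" and f: "f : whom x (ob (ot P R))" "k : whom x (ob (ot P R))"
  and eq: "inc2 P R$f = inc2 P R$k"
 shows "f = k"
proof -
 note i = inc2_simps[OF assms(1-3)] inc2_facts(5)[OF assms(1-3)]
 have "(prj2 P R$inc2 P R)$f = (prj2 P R$inc2 P R)$k" using eq f i(1-6) by (simp add: homs cassoc)
 then show ?thesis using f unfolding i(7) by (simp add: homs)
qed

context
 fixes P P' f f' R R'
 assumes f: "earr P f R" and f': "earr P' f' R'" and D: "gdim ~= 0"
begin

lemma EO: "P : Ell" "P' : Ell" "R : Ell" "R' : Ell"
 using f f' by (auto simp: earr_def)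

lemma tensor_intertwines: "intw (f ## f') (r1 P P') (r1 R R')" "intw (f ## f') (r1' P P') (r1' R R')" "intw (f ## f') (r2 P P') (r2 R R')"
proof -
 note [simp] = earr_simps[OF f] earr_simps[OF f'] ell(2-4)[OF EO(1)] ell(2-4)[OF EO(2)] ell(2-4)[OF EO(3)] ell(2-4)[OF EO(4)]
 have b: "intw f (%A. braid' A (ob P)) (%A. braid' A (ob R))" "intw f' (%A. braid A (ob P')) (%A. braid A (ob R'))"
  by (rule intertwiner_braid; simp)+
 show "intw (f ## f') (r1 P P') (r1 R R')" "intw (f ## f') (r1' P P') (r1' R R')" "intw (f ## f') (r2 P P') (r2 R R')"
  using intertwiner_tensor[of f "h1 P" "h1 R" f', OF _ b(2)] intertwiner_tensor[OF b(1), of f' "h1 P'" "h1 R'"] intertwiner_tensor[of f "h2 P" "h2 R" f' "h2 P'" "h2 R'"] f f'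
  by (simp_all add: earr_def half_braid_braid half_braid_braid_inv)
qed

text \<open>The average is natural, so a tensor product of arrows commutes with the projections and needs only one of them.\<close>

lemma inc2_tarr: "inc2 R R'$tarr P P' f f' R R' = (f ## f')$inc2 P P'"
proof -
 let ?t = "f ## f'" and ?Q = "avg [fst R, fst R'] (r1 R R') (r1' R R')" and ?Q' = "avg [fst P, fst P'] (r1 P P') (r1' P P')"
 note [simp] = earr_simps[OF f] earr_simps[OF f'] inc2_simps[OF EO(1,2) D] inc2_simps[OF EO(3,4) D]
 have [simp]: "warr ?Q'" "dom ?Q' = [fst P, fst P']" "cod ?Q' = [fst P, fst P']"
  using avg_hom[OF half_braid_r(1,2)[OF EO(1,2) D]] by (auto simp: homs)
 have n: "?Q$?t = ?t$?Q'"
  by (rule avg_natural[OF tensor_intertwines(1,2) _ _ half_braid_r(1,2)[OF EO(1,2) D] half_braid_r(1,2)[OF EO(3,4) D]]) simp_all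
 have "inc2 R R'$tarr P P' f f' R R' = ((inc2 R R'$prj2 R R')$?t)$inc2 P P'" by (simp add: tarr_def cassoc)
 also have "... = ?t$?Q'$inc2 P P'" unfolding inc2_facts(4)[OF EO(3,4) D] n by (rule cassoc) simp_all
 finally show ?thesis unfolding inc2_avg[OF EO(1,2) D] .
qed

lemma tarr_whom: "tarr P P' f f' R R' : whom (ob (ot P P')) (ob (ot R R'))"
 using earr_simps[OF f] earr_simps[OF f'] inc2_simps[OF EO(1,2) D] inc2_simps[OF EO(3,4) D] by (simp add: tarr_def homs)

lemma earr_tarr: "earr (ot P P') (tarr P P' f f' R R') (ot R R')"
proof -
 note [simp] = earr_simps[OF f] earr_simps[OF f'] inc2_simps[OF EO(1,2) D] inc2_simps[OF EO(3,4) D] half_braid_r[OF EO(1,2) D] half_braid_r[OF EO(3,4) D]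
 have o: "ot P P' : Ell" "ot R R' : Ell" using ot_elliptic[OF EO(1,2) D] ot_elliptic[OF EO(3,4) D] .
 note o' [simp] = ell(2-4)[OF o(1), unfolded fst_ot] ell(2-4)[OF o(2), unfolded fst_ot]
 note t [simp] = tarr_whom[unfolded homs fst_ot]
 have "intw (inc2 R R'$tarr P P' f f' R R') (h1 (ot P P')) (r1 R R')" "intw (inc2 R R'$tarr P P' f f' R R') (h2 (ot P P')) (r2 R R')"
  unfolding inc2_tarr by (rule intertwiner_comp[OF inc2_intw(1)[OF EO(1,2) D] tensor_intertwines(1)] intertwiner_comp[OF inc2_intw(3)[OF EO(1,2) D] tensor_intertwines(3)]; simp)+
 then have "intw (tarr P P' f f' R R') (h1 (ot P P')) (h1 (ot R R'))" "intw (tarr P P' f f' R R') (h2 (ot P P')) (h2 (ot R R'))"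
  using intertwiner_cancel[OF _ inc2_intw(1)[OF EO(3,4) D] inc2_simps(4)[OF EO(3,4) D] inc2_facts(5)[OF EO(3,4) D]]
   intertwiner_cancel[OF _ inc2_intw(3)[OF EO(3,4) D] inc2_simps(4)[OF EO(3,4) D] inc2_facts(5)[OF EO(3,4) D]] by simp_all
 then show ?thesis using o t by (simp add: earr_def homs)
qed

end

section \<open>The associativity constraint\<close>

definition incL where "incL P R V = (inc2 P R ## idw (ob V))$inc2 (ot P R) V"
definition incR where "incR P R V = (idw (ob P) ## inc2 R V)$inc2 P (ot R V)"
definition assL where "assL P R V = prj2 P (ot R V)$(idw (ob P) ## prj2 R V)$incL P R V"
definition assR where "assR P R V = prj2 (ot P R) V$(prj2 P R ## idw (ob V))$incR P R V"

context
 fixes P R V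
 assumes P: "P : Ell" and R: "R : Ell" and V: "V : Ell" and D: "gdim ~= 0"
begin

lemmas PR = ot_elliptic[OF P R D] and RS = ot_elliptic[OF R V D]
lemmas PR_S = ot_elliptic[OF PR V D] and P_RS = ot_elliptic[OF P RS D]
lemmas incs = inc2_simps[OF P R D] inc2_simps[OF R V D] inc2_simps[OF PR V D] inc2_simps[OF P RS D]
lemmas hs = ell(2-4)[OF P] ell(2-4)[OF R] ell(2-4)[OF V] ell(2-4)[OF PR] ell(2-4)[OF RS] ell(2-4)[OF PR_S] ell(2-4)[OF P_RS]

abbreviation (input) XYZ where "XYZ == [fst P, fst R, fst V]"
abbreviation (input) "a1 == hprod (h1 P) (ob P) (%A. braid A [fst R, fst V]) [fst R, fst V]"
abbreviation (input) "b1 == hprod (r1 P R) [fst P, fst R] (%A. braid A (ob V)) (ob V)"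
abbreviation (input) "a2 == hprod (%A. braid' A (ob P)) (ob P) (r1 R V) [fst R, fst V]"
abbreviation (input) "b2 == hprod (r1' P R) [fst P, fst R] (%A. braid A (ob V)) (ob V)"
abbreviation (input) "a3 == hprod (%A. braid' A (ob P)) (ob P) (r1' R V) [fst R, fst V]"
abbreviation (input) "b3 == hprod (%A. braid' A [fst P, fst R]) [fst P, fst R] (h1 V) (ob V)"
abbreviation (input) "c2 == hprod (h2 P) (ob P) (r2 R V) [fst R, fst V]"
abbreviation (input) "d2 == hprod (r2 P R) [fst P, fst R] (h2 V) (ob V)"

lemma hb3: "hbraid XYZ a1" "hbraid XYZ b1" "hbraid XYZ a2" "hbraid XYZ b2" "hbraid XYZ a3" "hbraid XYZ b3" "hbraid XYZ c2" "hbraid XYZ d2"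
proof -
 note [simp] = hs(1-9)
 note r = half_braid_r[OF P R D] half_braid_r[OF R V D]
 show "hbraid XYZ a1" "hbraid XYZ b1" "hbraid XYZ a2" "hbraid XYZ b2" "hbraid XYZ a3" "hbraid XYZ b3" "hbraid XYZ c2" "hbraid XYZ d2"
  using half_braid_prod[OF hs(2) half_braid_braid, of "[fst R, fst V]"] half_braid_prod[OF r(1) half_braid_braid, of "ob V"] half_braid_prod[OF half_braid_braid_inv r(4), of "ob P"]
   half_braid_prod[OF r(2) half_braid_braid, of "ob V"] half_braid_prod[OF half_braid_braid_inv r(5), of "ob P"] half_braid_prod[OF half_braid_braid_inv hs(8), of "[fst P, fst R]"]
   half_braid_prod[OF hs(3) r(6)] half_braid_prod[OF r(3) hs(9)] by simp_all
qed

text \<open>The two bracketings induce the same half-braidings on the word of three letters.\<close>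

lemma triple_eq: "a : Ob ==> b1 [a] = a1 [a]" "a : Ob ==> b2 [a] = a2 [a]" "a : Ob ==> b3 [a] = a3 [a]" "a : Ob ==> d2 [a] = c2 [a]"
 using crossing_append2[of braid "[a]" "ob R" "ob V"] crossing_append2[of braid' "[a]" "ob P" "ob R"] hs(1-9)
  hb_simps[OF hs(2)] hb_simps[OF hs(3)] hb_simps[OF hs(5)] hb_simps[OF hs(6)] hb_simps[OF hs(8)] hb_simps[OF hs(9)]
 by (simp_all add: hprod_def cassoc)

lemma inc_tensor_intertwines:
 "intw (inc2 P R ## idw (ob V)) (r1 (ot P R) V) b1" "intw (inc2 P R ## idw (ob V)) (r1 (ot P R) V) b2"
 "intw (inc2 P R ## idw (ob V)) (r1' (ot P R) V) b3" "intw (inc2 P R ## idw (ob V)) (r2 (ot P R) V) d2"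
 "intw (idw (ob P) ## inc2 R V) (r1 P (ot R V)) a1" "intw (idw (ob P) ## inc2 R V) (r1' P (ot R V)) a2"
 "intw (idw (ob P) ## inc2 R V) (r1' P (ot R V)) a3" "intw (idw (ob P) ## inc2 R V) (r2 P (ot R V)) c2"
proof -
 note [simp] = incs hs[unfolded fst_ot] half_braid_r[OF P R D] half_braid_r[OF R V D]
 note i = inc2_intw[OF P R D] inc2_intw[OF R V D]
 have b: "intw (inc2 P R) (%A. braid' A (ob (ot P R))) (%A. braid' A [fst P, fst R])" "intw (inc2 R V) (%A. braid A (ob (ot R V))) (%A. braid A [fst R, fst V])"
  by (rule intertwiner_braid; simp)+
 have d: "intw (idw (ob V)) (%A. braid A (ob V)) (%A. braid A (ob V))" "intw (idw (ob V)) (h1 V) (h1 V)" "intw (idw (ob V)) (h2 V) (h2 V)"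
  "intw (idw (ob P)) (%A. braid' A (ob P)) (%A. braid' A (ob P))" "intw (idw (ob P)) (h1 P) (h1 P)" "intw (idw (ob P)) (h2 P) (h2 P)"
  by (rule intertwiner_id; simp add: half_braid_braid half_braid_braid_inv)+
 show "intw (inc2 P R ## idw (ob V)) (r1 (ot P R) V) b1" "intw (inc2 P R ## idw (ob V)) (r1 (ot P R) V) b2"
  "intw (inc2 P R ## idw (ob V)) (r1' (ot P R) V) b3" "intw (inc2 P R ## idw (ob V)) (r2 (ot P R) V) d2"
  "intw (idw (ob P) ## inc2 R V) (r1 P (ot R V)) a1" "intw (idw (ob P) ## inc2 R V) (r1' P (ot R V)) a2"
  "intw (idw (ob P) ## inc2 R V) (r1' P (ot R V)) a3" "intw (idw (ob P) ## inc2 R V) (r2 P (ot R V)) c2"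
  using intertwiner_tensor[OF i(1) d(1)] intertwiner_tensor[OF i(2) d(1)] intertwiner_tensor[OF b(1) d(2)] intertwiner_tensor[OF i(3) d(3)]
   intertwiner_tensor[OF d(5) b(2)] intertwiner_tensor[OF d(4) i(4)] intertwiner_tensor[OF d(4) i(5)] intertwiner_tensor[OF d(6) i(6)]
  by (simp_all add: half_braid_braid half_braid_braid_inv)
qed

lemma incLR_whom: "incL P R V : whom (ob (ot (ot P R) V)) XYZ" "incR P R V : whom (ob (ot P (ot R V))) XYZ"
  "assL P R V : whom (ob (ot (ot P R) V)) (ob (ot P (ot R V)))" "assR P R V : whom (ob (ot P (ot R V))) (ob (ot (ot P R) V))"
 using incs hs(1,4,7) by (simp_all add: incL_def incR_def assL_def assR_def homs)

lemma incLR_intertwines: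
 "intw (incL P R V) (h1 (ot (ot P R) V)) a1" "intw (incL P R V) (h1 (ot (ot P R) V)) a2" "intw (incL P R V) (h1 (ot (ot P R) V)) a3" "intw (incL P R V) (h2 (ot (ot P R) V)) c2"
 "intw (incR P R V) (h1 (ot P (ot R V))) b1" "intw (incR P R V) (h1 (ot P (ot R V))) b2" "intw (incR P R V) (h1 (ot P (ot R V))) b3" "intw (incR P R V) (h2 (ot P (ot R V))) c2"
proof -
 note [simp] = incs hs[unfolded fst_ot] hb3 half_braid_r[OF PR V D, unfolded fst_ot] half_braid_r[OF P RS D, unfolded fst_ot]
 note c = triple_eq[THEN sym]
 note i = inc2_intw[OF PR V D] inc2_intw[OF P RS D]
 note t = inc_tensor_intertwines
 have "intw (incL P R V) (h1 (ot (ot P R) V)) b1" "intw (incL P R V) (h1 (ot (ot P R) V)) b2" "intw (incL P R V) (h1 (ot (ot P R) V)) b3" "intw (incL P R V) (h2 (ot (ot P R) V)) d2"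
  "intw (incR P R V) (h1 (ot P (ot R V))) a1" "intw (incR P R V) (h1 (ot P (ot R V))) a2" "intw (incR P R V) (h1 (ot P (ot R V))) a3" "intw (incR P R V) (h2 (ot P (ot R V))) c2"
  unfolding incL_def incR_def
  using intertwiner_comp[OF i(1) t(1)] intertwiner_comp[OF i(1) t(2)] intertwiner_comp[OF i(2) t(3)] intertwiner_comp[OF i(3) t(4)]
   intertwiner_comp[OF i(4) t(5)] intertwiner_comp[OF i(5) t(6)] intertwiner_comp[OF i(5) t(7)] intertwiner_comp[OF i(6) t(8)] by simp_all
 then show "intw (incL P R V) (h1 (ot (ot P R) V)) a1" "intw (incL P R V) (h1 (ot (ot P R) V)) a2" "intw (incL P R V) (h1 (ot (ot P R) V)) a3" "intw (incL P R V) (h2 (ot (ot P R) V)) c2"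
  "intw (incR P R V) (h1 (ot P (ot R V))) b1" "intw (incR P R V) (h1 (ot P (ot R V))) b2" "intw (incR P R V) (h1 (ot P (ot R V))) b3" "intw (incR P R V) (h2 (ot P (ot R V))) c2"
  unfolding intw_def by (simp_all add: triple_eq del: incs)
qed

lemma equalize: "[|intw i sg ta; intw i sg ta'; a : Ob|] ==> ta [a]${[a];i;} = ta' [a]${[a];i;}"
 using intwD[of i sg ta a] intwD[of i sg ta' a] by simp

text \<open>\<open>incL\<close> equalizes all three half-braidings of the triple product, so both averages occurring in the
 composite fix it.\<close>

lemma incR_assL: "incR P R V$assL P R V = incL P R V"
proof -
 note [simp] = incs hs(1,4,7)
 note L [simp] = incLR_whom(1)[unfolded homs fst_ot]
 let ?f = "idw (ob P) ## inc2 R V" and ?Q = "avg XYZ a1 a2" and ?Q' = "avg [fst P, fst (ot R V)] (r1 P (ot R V)) (r1' P (ot R V))"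
 have [simp]: "warr ?Q" "dom ?Q = XYZ" "cod ?Q = XYZ" "warr ?Q'" "dom ?Q' = [fst P, fst (ot R V)]" "cod ?Q' = [fst P, fst (ot R V)]"
  using avg_hom[OF hb3(1,3)] avg_hom[OF half_braid_r(1,2)[OF P RS D]] by (auto simp: homs)
 have [simp]: "warr (avg [fst R, fst V] (r1 R V) (r1' R V))" using avg_hom[OF half_braid_r(1,2)[OF R V D]] by (auto simp: homs)
 have n: "?Q$?f = ?f$?Q'"
  by (rule avg_natural[OF inc_tensor_intertwines(5,6) _ _ half_braid_r(1,2)[OF P RS D] hb3(1,3)]) simp_all
 have l: "?f$(idw (ob P) ## prj2 R V) = avg XYZ a2 a3"
 proof -
  have "?f$(idw (ob P) ## prj2 R V) = idw (ob P) ## avg [fst R, fst V] (r1 R V) (r1' R V)"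
   using tensor_comp[of "idw (ob P)" "idw (ob P)" "prj2 R V" "inc2 R V"] inc2_facts(4)[OF R V D] by simp
  also have "... = {ob P;avg [fst R, fst V] (r1 R V) (r1' R V);}" by (simp add: layer_def)
  also have "... = avg XYZ a2 a3" using avg_left[OF half_braid_r(1,2)[OF R V D] half_braid_braid_inv, of "ob P"] by simp
  finally show ?thesis .
 qed
 have "incR P R V$assL P R V = (?f$(inc2 P (ot R V)$prj2 P (ot R V)))$(idw (ob P) ## prj2 R V)$incL P R V"
  by (simp add: incR_def assL_def cassoc)
 also have "... = ?Q$(?f$(idw (ob P) ## prj2 R V))$incL P R V"
  unfolding inc2_facts(4)[OF P RS D] n[symmetric] by (simp add: cassoc)
 also have "... = ?Q$incL P R V"
  unfolding l using avg_fix[OF hb3(3,5) D incLR_whom(1) equalize[OF incLR_intertwines(2,3)]] by simp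
 also have "... = incL P R V" by (rule avg_fix[OF hb3(1,3) D incLR_whom(1) equalize[OF incLR_intertwines(1,2)]])
 finally show ?thesis .
qed

lemma incL_assR: "incL P R V$assR P R V = incR P R V"
proof -
 note [simp] = incs hs(1,4,7)
 note L [simp] = incLR_whom(2)[unfolded homs fst_ot]
 let ?f = "inc2 P R ## idw (ob V)" and ?Q = "avg XYZ b2 b3" and ?Q' = "avg [fst (ot P R), fst V] (r1 (ot P R) V) (r1' (ot P R) V)"
 have [simp]: "warr ?Q" "dom ?Q = XYZ" "cod ?Q = XYZ" "warr ?Q'" "dom ?Q' = [fst (ot P R), fst V]" "cod ?Q' = [fst (ot P R), fst V]"
  using avg_hom[OF hb3(4,6)] avg_hom[OF half_braid_r(1,2)[OF PR V D]] by (auto simp: homs)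
 have [simp]: "warr (avg [fst P, fst R] (r1 P R) (r1' P R))" using avg_hom[OF half_braid_r(1,2)[OF P R D]] by (auto simp: homs)
 have n: "?Q$?f = ?f$?Q'"
  by (rule avg_natural[OF inc_tensor_intertwines(2,3) _ _ half_braid_r(1,2)[OF PR V D] hb3(4,6)]) simp_all
 have l: "?f$(prj2 P R ## idw (ob V)) = avg XYZ b1 b2"
 proof -
  have "?f$(prj2 P R ## idw (ob V)) = avg [fst P, fst R] (r1 P R) (r1' P R) ## idw (ob V)"
   using tensor_comp[of "prj2 P R" "inc2 P R" "idw (ob V)" "idw (ob V)"] inc2_facts(4)[OF P R D] by simp
  also have "... = {;avg [fst P, fst R] (r1 P R) (r1' P R);ob V}" by (simp add: layer_def)
  also have "... = avg XYZ b1 b2" using avg_right[OF half_braid_r(1,2)[OF P R D] half_braid_braid, of "ob V"] by simp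
  finally show ?thesis .
 qed
 have "incL P R V$assR P R V = (?f$(inc2 (ot P R) V$prj2 (ot P R) V))$(prj2 P R ## idw (ob V))$incR P R V"
  by (simp add: incL_def assR_def cassoc)
 also have "... = ?Q$(?f$(prj2 P R ## idw (ob V)))$incR P R V"
  unfolding inc2_facts(4)[OF PR V D] n[symmetric] by (simp add: cassoc)
 also have "... = ?Q$incR P R V"
  unfolding l using avg_fix[OF hb3(2,4) D incLR_whom(2) equalize[OF incLR_intertwines(5,6)]] by simp
 also have "... = incR P R V" by (rule avg_fix[OF hb3(4,6) D incLR_whom(2) equalize[OF incLR_intertwines(6,7)]])
 finally show ?thesis .
qed

end
end

section \<open>The unit constraints are isomorphisms\<close>

context premodular_category_with_choices
begin

abbreviation e1 where "e1 == el_unit C"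

lemma fst_e1 [simp]: "fst e1 = SOb"
 by (simp add: el_unit_def)

lemma e1_singles: "a : Ob ==> word_half (SOb) (fst (snd e1)) [a] = Gam [a]" "a : Ob ==> word_half (SOb) (snd (snd e1)) [a] = Om [a]"
proof -
 have G: "(\<lambda>A\<in>Ob. underlying (gam A)) = (\<lambda>A\<in>Ob. underlying (Gam [A]))" by (auto simp: Gam_single)
 show "a : Ob ==> word_half (SOb) (fst (snd e1)) [a] = Gam [a]" "a : Ob ==> word_half (SOb) (snd (snd e1)) [a] = Om [a]"
  using word_half_restrict[OF half_braid_Gam] word_half_restrict[OF half_braid_Om] by (simp_all add: el_unit_def Gamma_unit Omega_Om G)
qed

text \<open>The loops only use the half-braidings at objects, where those of the unit object are \<open>Gam\<close> and \<open>Om\<close>.\<close>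

lemma avg_singles:
 assumes "!!a. a : Ob ==> ro [a] = ta [a]" "!!a. a : Ob ==> ro' [a] = ta' [a]" "hbraid M ta" "hbraid M ta'"
 shows "avg M ro ro' = avg M ta ta'"
 unfolding avg_def using hb_simps(1)[OF assms(3)] assms(1,2) loop_hom[OF assms(3,4)] by (intro avg_cong[OF assms(3,4)]) (simp_all add: loop_def)

definition lw where
 "lw c P = sc c ({;u;ob P}$inc2 e1 P)"

definition rw where
 "rw c P = sc c ({ob P;u;}$inc2 P e1)"

lemma intertwiner_wscale:
 assumes f: "intw f sg ta" and h: "hbraid (dom f) sg" "hbraid (cod f) ta"
 shows "intw (sc c f) sg ta"
 unfolding intw_def
proof (intro conjI ballI)
 fix a assume a [simp]: "a : Ob"
 note [simp] = intertwiner_warr[OF f] hb_simps(1,3-5)[OF h(1)] hb_simps(1,3-5)[OF h(2)]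
 show "{;sc c f;[a]}$sg [a] = ta [a]${[a];sc c f;}"
  using intwD[OF f a] by (simp add: layer_wscale wscale_comp comp_wscale)
qed (use intertwiner_warr[OF f] in simp)

lemma scaled_retract:
 assumes k: "sc c L$k = idw (cod L)" and c: "c ~= 0" and [simp]: "warr L" "warr k" "cod k = dom L" "dom k = cod L"
 shows "L$k$sc c L = L"
proof (rule wscale_cancel[OF _ c])
 have "sc c (L$k$sc c L) = (sc c L$k)$sc c L" by (simp add: wscale_comp cassoc comp_wscale)
 then show "sc c (L$k$sc c L) = sc c L" unfolding k by simp
qed simp_all

context
 fixes P
 assumes P: "P : Ell" and D: "gdim ~= 0"
begin

lemmas eE = el_unit_elliptic
lemmas hP = ell[OF P]
lemmas iL = inc2_simps[OF eE P D, unfolded fst_e1] and iR = inc2_simps[OF P eE D, unfolded fst_e1]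
lemmas rL = half_braid_r[OF eE P D, unfolded fst_e1] and rR = half_braid_r[OF P eE D, unfolded fst_e1]

lemma unit_sides:
 "a : Ob ==> r1 e1 P [a] = left_rho (ob P) [a]" "r1' e1 P = left_rho' (h1 P) (ob P)"
 "r1 P e1 = right_rho (h1 P) (ob P)" "a : Ob ==> r1' P e1 [a] = right_rho' (ob P) [a]"
 "a : Ob ==> r2 e1 P [a] = hprod Om U (h2 P) (ob P) [a]" "a : Ob ==> r2 P e1 [a] = hprod (h2 P) (ob P) Om U [a]"
 by (simp_all add: hprod_def e1_singles)

lemma inc2_avg_unit: "avg (U @ ob P) (left_rho (ob P)) (left_rho' (h1 P) (ob P)) = inc2 e1 P$prj2 e1 P"
 "avg (ob P @ U) (right_rho (h1 P) (ob P)) (right_rho' (ob P)) = inc2 P e1$prj2 P e1"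
proof -
 show "avg (U @ ob P) (left_rho (ob P)) (left_rho' (h1 P) (ob P)) = inc2 e1 P$prj2 e1 P"
  using avg_singles[OF unit_sides(1) refl half_braid_unit_sides(1,2)[OF hP(3) D]] inc2_facts(4)[OF eE P D] by (simp add: unit_sides(2))
 show "avg (ob P @ U) (right_rho (h1 P) (ob P)) (right_rho' (ob P)) = inc2 P e1$prj2 P e1"
  using avg_singles[OF refl unit_sides(4) half_braid_unit_sides(3,4)[OF hP(3) D]] inc2_facts(4)[OF P eE D] by (simp add: unit_sides(3))
qed

lemma lw_whom: "lw c P : whom (ob (ot e1 P)) (ob P)" "rw c P : whom (ob (ot P e1)) (ob P)"
 using iL iR hP(2) by (simp_all add: lw_def rw_def homs)

lemma lw_earr: "earr (ot e1 P) (lw c P) P" "earr (ot P e1) (rw c P) P"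
proof -
 note [simp] = iL iR hP(2-4) half_braid_Om rL rR
 have o: "ot e1 P : Ell" "ot P e1 : Ell" using ot_elliptic[OF eE P D] ot_elliptic[OF P eE D] .
 note [simp] = ell(2-4)[OF o(1), unfolded fst_ot] ell(2-4)[OF o(2), unfolded fst_ot]
 have s: "intw {;u;ob P} (r1' e1 P) (h1 P)" "intw {;u;ob P} (r2 e1 P) (h2 P)"
  "intw {ob P;u;} (r1 P e1) (h1 P)" "intw {ob P;u;} (r2 P e1) (h2 P)"
  using intertwiner_strand[OF u_braid(2) half_braid_braid_inv hP(3)] intertwiner_strand[OF u_braid(1) half_braid_braid hP(3)] intertwiner_strand[OF u_intertwines half_braid_Om hP(4)]
  by (simp_all add: intw_def unit_sides(1,4-6)[unfolded fst_e1])
 have "intw ({;u;ob P}$inc2 e1 P) (h1 (ot e1 P)) (h1 P)" "intw ({;u;ob P}$inc2 e1 P) (h2 (ot e1 P)) (h2 P)"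
  "intw ({ob P;u;}$inc2 P e1) (h1 (ot P e1)) (h1 P)" "intw ({ob P;u;}$inc2 P e1) (h2 (ot P e1)) (h2 P)"
  using intertwiner_comp[OF inc2_intw(2)[OF eE P D] s(1)] intertwiner_comp[OF inc2_intw(3)[OF eE P D] s(2)]
   intertwiner_comp[OF inc2_intw(1)[OF P eE D] s(3)] intertwiner_comp[OF inc2_intw(3)[OF P eE D] s(4)] by simp_all
 then show "earr (ot e1 P) (lw c P) P" "earr (ot P e1) (rw c P) P"
  using lw_whom[of c] o P intertwiner_wscale by (simp_all add: earr_def lw_def rw_def)
qed

text \<open>One composite is \<open>unit_section\<close>. For the other, an arrow into the reduced product is determined
 by its composite with \<open>u\<close>.\<close>

lemma lw_inverse:
 assumes c: "c ~= 0"
 shows "\<exists>k. k : whom (ob P) (ob (ot e1 P)) & k$lw c P = idw (ob (ot e1 P)) & lw c P$k = idw (ob P)" (is "\<exists>k. ?L k")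
  "\<exists>k. k : whom (ob P) (ob (ot P e1)) & k$rw c P = idw (ob (ot P e1)) & rw c P$k = idw (ob P)" (is "\<exists>k. ?R k")
proof -
 note [simp] = iL iR hP(2) image_facts(1)[OF ell(1)[OF eE] hP(1) D] image_facts(1)[OF hP(1) ell(1)[OF eE] D]
 have b: "d j0 ~= 0" using d_nonzero[of j0] by simp
 let ?b = "gdim / (c * d j0)"
 let ?l = "sc ?b (prj2 e1 P${;u';ob P})" and ?r = "sc ?b (prj2 P e1${ob P;u';})"
 have k: "?l : whom (ob P) (ob (ot e1 P))" "?r : whom (ob P) (ob (ot P e1))" by (simp_all add: homs)
 have s: "{;u;ob P}$inc2 e1 P$prj2 e1 P${;u';ob P} = sc (d j0 / gdim) (idw (ob P))"
  "{ob P;u;}$inc2 P e1$prj2 P e1${ob P;u';} = sc (d j0 / gdim) (idw (ob P))"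
  using unit_section[OF hP(3) D] unfolding inc2_avg_unit by (simp_all add: cassoc)
 have 1: "lw c P$?l = idw (ob P)" "rw c P$?r = idw (ob P)"
  using c b D by (simp_all add: lw_def rw_def wscale_comp comp_wscale cassoc s)
 note kk = k[unfolded homs] and lws = lw_whom[of c, unfolded homs]
 have eq: "{;u;ob P}$inc2 e1 P$?l$lw c P = {;u;ob P}$inc2 e1 P"
  "{ob P;u;}$inc2 P e1$?r$rw c P = {ob P;u;}$inc2 P e1"
  using trans[OF cassoc[of "?l$lw c P" "inc2 e1 P" "{;u;ob P}", symmetric] scaled_retract[of c "{;u;ob P}$inc2 e1 P" ?l, folded lw_def]]
   trans[OF cassoc[of "?r$rw c P" "inc2 P e1" "{ob P;u;}", symmetric] scaled_retract[of c "{ob P;u;}$inc2 P e1" ?r, folded rw_def]]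
   1 c kk lws by simp_all
 have E: "left_rho (ob P) [a]${[a];inc2 e1 P;} = left_rho' (h1 P) (ob P) [a]${[a];inc2 e1 P;}"
  "right_rho (h1 P) (ob P) [a]${[a];inc2 P e1;} = right_rho' (ob P) [a]${[a];inc2 P e1;}" if "a : Ob" for a
  using trans[OF intwD[OF inc2_intw(1)[OF eE P D] that, symmetric] intwD[OF inc2_intw(2)[OF eE P D] that]]
   trans[OF intwD[OF inc2_intw(1)[OF P eE D] that, symmetric] intwD[OF inc2_intw(2)[OF P eE D] that]] that by (simp_all only: unit_sides)
 have w [simp]: "warr (left_rho (ob P) [a])" "dom (left_rho (ob P) [a]) = a # SOb # ob P" "warr (left_rho' (h1 P) (ob P) [a])" "dom (left_rho' (h1 P) (ob P) [a]) = a # SOb # ob P"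
  "warr (right_rho (h1 P) (ob P) [a])" "dom (right_rho (h1 P) (ob P) [a]) = a # ob P @ U" "warr (right_rho' (ob P) [a])" "dom (right_rho' (ob P) [a]) = a # ob P @ U" if "a : Ob" for a
  using hb_simps(3,4)[OF half_braid_unit_sides(1)[OF hP(3) D], of "[a]"] hb_simps(3,4)[OF half_braid_unit_sides(2)[OF hP(3) D], of "[a]"]
   hb_simps(3,4)[OF half_braid_unit_sides(3)[OF hP(3) D], of "[a]"] hb_simps(3,4)[OF half_braid_unit_sides(4)[OF hP(3) D], of "[a]"] that by simp_all
 have F: "left_rho (ob P) [a]${[a];inc2 e1 P$z;} = left_rho' (h1 P) (ob P) [a]${[a];inc2 e1 P$z;}"
  if "a : Ob" "warr z" "cod z = ob (ot e1 P)" for a z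
  using that arg_cong[OF E(1)[OF that(1)], of "%x. x${[a];z;}"] by (simp add: cassoc)
 have G: "right_rho (h1 P) (ob P) [a]${[a];inc2 P e1$z;} = right_rho' (ob P) [a]${[a];inc2 P e1$z;}"
  if "a : Ob" "warr z" "cod z = ob (ot P e1)" for a z
  using that arg_cong[OF E(2)[OF that(1)], of "%x. x${[a];z;}"] by (simp add: cassoc)
 have z: "warr (?l$lw c P)" "cod (?l$lw c P) = ob (ot e1 P)" "dom (?l$lw c P) = ob (ot e1 P)"
  "warr (?r$rw c P)" "cod (?r$rw c P) = ob (ot P e1)" "dom (?r$rw c P) = ob (ot P e1)" using lws kk by simp_all
 have 2: "inc2 e1 P$?l$lw c P = inc2 e1 P"
  by (rule unit_left_injective[OF hP(3) D _ F[OF _ z(1,2)] _ E(1) eq(1), of "ob (ot e1 P)"]) (use z(1-3) in \<open>simp_all add: homs\<close>)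
 have "?l$lw c P = idw (ob (ot e1 P))"
  by (rule inc2_cancel[OF eE P D, of _ "ob (ot e1 P)"]) (use 2 z(1-3) in \<open>simp_all add: homs\<close>)
 then show "\<exists>k. ?L k" using k(1) 1(1) by blast
 have 3: "inc2 P e1$?r$rw c P = inc2 P e1"
  by (rule unit_right_injective[OF hP(3) D _ G[OF _ z(4,5)] _ E(2) eq(2), of "ob (ot P e1)"]) (use z(4-6) in \<open>simp_all add: homs\<close>)
 have "?r$rw c P = idw (ob (ot P e1))"
  by (rule inc2_cancel[OF P eE D, of _ "ob (ot P e1)"]) (use 3 z(4-6) in \<open>simp_all add: homs\<close>)
 then show "\<exists>k. ?R k" using k(2) 1(2) by blast
qed

text \<open>The constant compensates the factor in \<open>avg_unit_left\<close> and \<open>avg_unit_right\<close>; that it is the same on both sides is what the triangle needs.\<close>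

lemma lw_form: "lw (\<kappa> * gdim * s j0) P = sc \<kappa> (left_form (h1 P) (ob P))$inc2 e1 P"
 "rw (\<kappa> * gdim * s j0) P = sc \<kappa> (right_form (h1 P) (ob P))$inc2 P e1"
proof -
 note [simp] = iL iR hP(2) s_j0
 note [simp] = left_form_whom[OF hP(3) D, unfolded homs] right_form_whom[OF hP(3) D, unfolded homs]
 have i: "inc2 e1 P = (inc2 e1 P$prj2 e1 P)$inc2 e1 P" "inc2 P e1 = (inc2 P e1$prj2 P e1)$inc2 P e1"
  using inc2_facts(5)[OF eE P D] inc2_facts(5)[OF P eE D] by (simp_all add: cassoc)
 have "{;u;ob P}$inc2 e1 P = ({;u;ob P}$inc2 e1 P$prj2 e1 P)$inc2 e1 P" by (subst i(1)) (simp add: cassoc)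
 also have "... = sc (1 / (gdim * s j0)) (left_form (h1 P) (ob P))$inc2 e1 P" using avg_unit_left[OF hP(3) D] unfolding inc2_avg_unit by simp
 finally have e: "{;u;ob P}$inc2 e1 P = sc (1 / (gdim * s j0)) (left_form (h1 P) (ob P))$inc2 e1 P" .
 show "lw (\<kappa> * gdim * s j0) P = sc \<kappa> (left_form (h1 P) (ob P))$inc2 e1 P"
  unfolding lw_def e using D by (simp add: wscale_comp)
 have "{ob P;u;}$inc2 P e1 = ({ob P;u;}$inc2 P e1$prj2 P e1)$inc2 P e1" by (subst i(2)) (simp add: cassoc)
 also have "... = sc (1 / (gdim * s j0)) (right_form (h1 P) (ob P))$inc2 P e1" using avg_unit_right[OF hP(3) D] unfolding inc2_avg_unit by simp
 finally have e: "{ob P;u;}$inc2 P e1 = sc (1 / (gdim * s j0)) (right_form (h1 P) (ob P))$inc2 P e1" .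
 show "rw (\<kappa> * gdim * s j0) P = sc \<kappa> (right_form (h1 P) (ob P))$inc2 P e1"
  unfolding rw_def e using D by (simp add: wscale_comp)
qed

lemma el_unit_constraints:
 "el_lunit C \<kappa> P = (ot e1 P, underlying (lw (\<kappa> * gdim * s j0) P), P)"
 "el_runit C \<kappa> P = (ot P e1, underlying (rw (\<kappa> * gdim * s j0) P), P)"
proof -
 obtain X l l' where PX: "P = (X, l, l')" by (cases P) auto
 have [simp]: "X : Ob" using hP(2) PX by simp
 have w [simp]: "warr (wHalf l A X)" if "A : Ob" for A using that hP(6) PX by (auto simp: half_braiding_def)
 have wh [simp]: "word_half X l [A] = wHalf l A X" if "A : Ob" for A using half_braid_word_half(2)[of X l A] that hP(6) PX by simp
 have p: "([SOb], SumProj C i, summand C [] i) = prj i" for i by (simp add: prj_def summand_def)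
 let ?l = "%i. (idw [X] ## evR (Sp i))$(wHalf l (Sp i) X ## idw [Du (Sp i)])$(idw [Sp i] ## wBraid C (Du (Sp i)) X)$(prj i ## idw [X])"
 let ?r = "%i. (idw [X] ## evR (Sp i))$(wHalf l (Sp i) X ## idw [Du (Sp i)])$(wBraid C X (Sp i) ## idw [Du (Sp i)])$(idw [X] ## prj i)"
 have F: "left_form (h1 P) (ob P) = wsum [SOb, X] [X] (%i. sc (s i) (?l i)) (J C)"
  unfolding left_form_def PX fst_conv snd_conv append_Cons append_Nil by (rule wsum_cong_whom) (auto simp: homs tensor_layers braid_single cassoc)
 have G: "right_form (h1 P) (ob P) = wsum [X, SOb] [X] (%i. sc (s i) (?r i)) (J C)"
  unfolding right_form_def copair_def PX fst_conv snd_conv append_Cons append_Nil by (rule wsum_cong_whom) (auto simp: homs tensor_layers braid_single cassoc wscale_comp)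
 have i: "underlying (iw R V) = ImInc C R V" for R V by (simp add: iw_def)
 have b: "hb1 P = (X, l)" by (simp add: PX hb1_def)
 show "el_lunit C \<kappa> P = (ot e1 P, underlying (lw (\<kappa> * gdim * s j0) P), P)"
  unfolding lw_form F by (simp add: i b) (simp add: el_lunit_def PX Let_def p)
 show "el_runit C \<kappa> P = (ot P e1, underlying (rw (\<kappa> * gdim * s j0) P), P)"
  unfolding lw_form G by (simp add: i b) (simp add: el_runit_def PX Let_def p)
qed

end

lemma lw_natural:
 assumes f: "earr P f R" and D: "gdim ~= 0"
 shows "lw c R$tarr e1 P (idw (ob e1)) f e1 R = f$lw c P"
  "rw c R$tarr P e1 f (idw (ob e1)) R e1 = f$rw c P"
proof -
 have P: "P : Ell" and R: "R : Ell" using f by (auto simp: earr_def)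
 have i: "earr e1 (idw (ob e1)) e1" by (rule earr_id[OF el_unit_elliptic])
 note [simp] = iL[OF P D] iR[OF P D] iL[OF R D] iR[OF R D] ell(2)[OF P] ell(2)[OF R] earr_simps[OF f]
 note [simp] = tarr_whom[OF i f D, unfolded homs fst_e1 fst_ot] tarr_whom[OF f i D, unfolded homs fst_e1 fst_ot]
 have x: "f${;u;ob P} = {;u;ob R}${U;f;}" using exchange[of "[]" f u "[]" "[]"] by (simp add: layer_nil)
 have "{;u;ob R}$inc2 e1 R$tarr e1 P (idw (ob e1)) f e1 R = f${;u;ob P}$inc2 e1 P"
  unfolding inc2_tarr[OF i f D] using x by (simp add: tensor_layers cassoc[symmetric])
 then show "lw c R$tarr e1 P (idw (ob e1)) f e1 R = f$lw c P" by (simp add: lw_def wscale_comp comp_wscale cassoc)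
 have "{ob R;u;}$inc2 R e1$tarr P e1 f (idw (ob e1)) R e1 = f${ob P;u;}$inc2 P e1"
  unfolding inc2_tarr[OF f i D] by (simp add: tensor_layers diagram layer_nil)
 then show "rw c R$tarr P e1 f (idw (ob e1)) R e1 = f$rw c P" by (simp add: rw_def wscale_comp comp_wscale cassoc)
qed

end

section \<open>Coherence\<close>

context premodular_category_with_choices
begin

lemma inc2_tarr_left:
 assumes f: "earr P f R" and V: "V : Ell" and D: "gdim ~= 0"
 shows "inc2 R V$tarr P V f (idw (ob V)) R V = {;f;ob V}$inc2 P V"
  "inc2 V R$tarr V P (idw (ob V)) f V R = {ob V;f;}$inc2 V P"
proof -
 have P: "P : Ell" and R: "R : Ell" using f by (auto simp: earr_def)
 note [simp] = earr_simps[OF f] ell(2)[OF P] ell(2)[OF R] ell(2)[OF V] inc2_simps[OF P V D] inc2_simps[OF V P D]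
 show "inc2 R V$tarr P V f (idw (ob V)) R V = {;f;ob V}$inc2 P V"
  using inc2_tarr[OF f earr_id[OF V] D] by (simp add: tensor_layers)
 show "inc2 V R$tarr V P (idw (ob V)) f V R = {ob V;f;}$inc2 V P"
  using inc2_tarr[OF earr_id[OF V] f D] by (simp add: tensor_layers)
qed

context
 fixes P R V
 assumes P: "P : Ell" and R: "R : Ell" and V: "V : Ell" and D: "gdim ~= 0"
begin

lemma incLR_layers: "incL P R V = {;inc2 P R;ob V}$inc2 (ot P R) V" "incR P R V = {ob P;inc2 R V;}$inc2 P (ot R V)"
 using incs[OF P R V D] hs(1,4,7)[OF P R V D] hs(10,13)[OF P R V D, unfolded fst_ot] by (simp_all add: incL_def incR_def tensor_layers)

lemma inc_split: "\<exists>p. warr p & dom p = cod (incL P R V) & p$incL P R V = idw (dom (incL P R V))"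
 "\<exists>p. warr p & dom p = cod (incR P R V) & p$incR P R V = idw (dom (incR P R V))"
proof -
 note [simp] = incs[OF P R V D] hs(1,4,7)[OF P R V D] hs(10,13)[OF P R V D, unfolded fst_ot]
 have o: "ot P R : Ell" "ot R V : Ell" using ot_elliptic[OF P R D] ot_elliptic[OF R V D] .
 note i = inc2_facts(5)[OF P R D] inc2_facts(5)[OF R V D] inc2_facts(5)[OF o(1) V D] inc2_facts(5)[OF P o(2) D]
 have a: "{;prj2 P R;ob V}${;inc2 P R;ob V}$inc2 (ot P R) V = inc2 (ot P R) V"
  by (rule rewrite[OF i(1), of _ "idw [fst (ot P R), fst V]" "[]" "ob V" "inc2 (ot P R) V"]) (simp_all add: cassoc)
 have b: "{ob P;prj2 R V;}${ob P;inc2 R V;}$inc2 P (ot R V) = inc2 P (ot R V)"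
  by (rule rewrite[OF i(2), of _ "idw [fst P, fst (ot R V)]" "ob P" "[]" "inc2 P (ot R V)"]) (simp_all add: cassoc)
 show "\<exists>p. warr p & dom p = cod (incL P R V) & p$incL P R V = idw (dom (incL P R V))"
  by (rule exI[of _ "prj2 (ot P R) V${;prj2 P R;ob V}"]) (use a i(3) in \<open>simp add: incLR_layers cassoc\<close>)
 show "\<exists>p. warr p & dom p = cod (incR P R V) & p$incR P R V = idw (dom (incR P R V))"
  by (rule exI[of _ "prj2 P (ot R V)${ob P;prj2 R V;}"]) (use b i(4) in \<open>simp add: incLR_layers cassoc\<close>)
qed

lemma inc_cancel: "[|incR P R V$f = incR P R V$k; f : whom x (ob (ot P (ot R V))); k : whom x (ob (ot P (ot R V)))|] ==> f = k"
 "[|incL P R V$f = incL P R V$k; f : whom x (ob (ot (ot P R) V)); k : whom x (ob (ot (ot P R) V))|] ==> f = k"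
proof -
 note w = incLR_whom(1,2)[OF P R V D, unfolded homs]
 { assume e: "incR P R V$f = incR P R V$k" and h: "f : whom x (ob (ot P (ot R V)))" "k : whom x (ob (ot P (ot R V)))"
  obtain p where p: "warr p" "dom p = cod (incR P R V)" "p$incR P R V = idw (dom (incR P R V))" using inc_split(2) by blast
  have "(p$incR P R V)$f = (p$incR P R V)$k" using e p(1,2) w h by (simp add: homs cassoc)
  then show "f = k" unfolding p(3) using h w by (simp add: homs) }
 { assume e: "incL P R V$f = incL P R V$k" and h: "f : whom x (ob (ot (ot P R) V))" "k : whom x (ob (ot (ot P R) V))"
  obtain p where p: "warr p" "dom p = cod (incL P R V)" "p$incL P R V = idw (dom (incL P R V))" using inc_split(1) by blast
  have "(p$incL P R V)$f = (p$incL P R V)$k" using e p(1,2) w h by (simp add: homs cassoc)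
  then show "f = k" unfolding p(3) using h w by (simp add: homs) }
qed

lemma ass_inverse: "assR P R V$assL P R V = idw (ob (ot (ot P R) V))" "assL P R V$assR P R V = idw (ob (ot P (ot R V)))"
proof -
 note w = incLR_whom[OF P R V D, unfolded homs] and [simp] = hs(16,19)[OF P R V D, unfolded fst_ot]
 have "incL P R V$assR P R V$assL P R V = (incL P R V$assR P R V)$assL P R V" using w by (simp add: cassoc)
 then have e: "incL P R V$assR P R V$assL P R V = incL P R V" unfolding incL_assR[OF P R V D] incR_assL[OF P R V D] .
 show "assR P R V$assL P R V = idw (ob (ot (ot P R) V))"
  by (rule inc_cancel(2)[of _ _ "ob (ot (ot P R) V)"]) (use e w in "simp_all add: homs")
 have "incR P R V$assL P R V$assR P R V = (incR P R V$assL P R V)$assR P R V" using w by (simp add: cassoc)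
 then have e: "incR P R V$assL P R V$assR P R V = incR P R V" unfolding incL_assR[OF P R V D] incR_assL[OF P R V D] .
 show "assL P R V$assR P R V = idw (ob (ot P (ot R V)))"
  by (rule inc_cancel(1)[of _ _ "ob (ot P (ot R V))"]) (use e w in "simp_all add: homs")
qed

lemma assL_earr: "earr (ot (ot P R) V) (assL P R V) (ot P (ot R V))"
proof -
 note w = incLR_whom[OF P R V D, unfolded homs] and h = hs[OF P R V D]
 obtain p where p: "warr p" "p$incR P R V = idw (dom (incR P R V))" "dom p = cod (incR P R V)" using inc_split(2) by blast
 note t = hb3[OF P R V D]
 note [simp] = w h(14-21)[unfolded fst_ot] t
 have b: "intw (incR P R V) (h1 (ot P (ot R V))) (hprod (r1 P R) [fst P, fst R] (%A. braid A (ob V)) (ob V))"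
  "intw (incL P R V) (h1 (ot (ot P R) V)) (hprod (r1 P R) [fst P, fst R] (%A. braid A (ob V)) (ob V))"
  using incLR_intertwines(1,5)[OF P R V D] by (simp_all add: intw_def triple_eq[OF P R V D])
 note i = b incLR_intertwines(4,8)[OF P R V D]
 have "intw (assL P R V) (h1 (ot (ot P R) V)) (h1 (ot P (ot R V)))"
  by (rule intertwiner_cancel[OF _ i(1) p(1,2,3)]) (use i(2) t(2) in \<open>simp_all add: incR_assL[OF P R V D]\<close>)
 moreover have "intw (assL P R V) (h2 (ot (ot P R) V)) (h2 (ot P (ot R V)))"
  by (rule intertwiner_cancel[OF _ i(4) p(1,2,3)]) (use i(3) t(7) in \<open>simp_all add: incR_assL[OF P R V D]\<close>)
 ultimately show ?thesis using w PR_S[OF P R V D] P_RS[OF P R V D] by (simp add: earr_def homs)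
qed

end

lemma ass_natural:
 assumes f: "earr P f P'" and g: "earr R k R'" and h: "earr V h V'" and D: "gdim ~= 0"
 shows "assL P' R' V'$tarr (ot P R) V (tarr P R f k P' R') h (ot P' R') V' =
  tarr P (ot R V) f (tarr R V k h R' V') P' (ot R' V')$assL P R V"
proof -
 note O = EO(1,3)[OF f g D] EO(2,4)[OF f g D] EO(2,4)[OF g h D]
 note fk = earr_tarr[OF f g D] and kh = earr_tarr[OF g h D]
 note w [simp] = incLR_whom[OF O(1,3,5) D, unfolded homs fst_ot] incLR_whom[OF O(2,4,6) D, unfolded homs fst_ot]
 note [simp] = incs[OF O(1,3,5) D, unfolded fst_ot] incs[OF O(2,4,6) D, unfolded fst_ot] earr_simps[OF f] earr_simps[OF g] earr_simps[OF h] earr_simps[OF fk, unfolded fst_ot] earr_simps[OF kh, unfolded fst_ot]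
 note [simp] = earr_simps[OF earr_tarr[OF fk h D], unfolded fst_ot] earr_simps[OF earr_tarr[OF f kh D], unfolded fst_ot] hs(1,4,7)[OF O(1,3,5) D] hs(1,4,7)[OF O(2,4,6) D]
 let ?T = "tarr (ot P R) V (tarr P R f k P' R') h (ot P' R') V'" and ?T' = "tarr P (ot R V) f (tarr R V k h R' V') P' (ot R' V')"
 have "incR P' R' V'$assL P' R' V'$?T = (incR P' R' V'$assL P' R' V')$?T" by (simp add: cassoc)
 also have "... = (inc2 P' R' ## idw (ob V'))$inc2 (ot P' R') V'$?T" unfolding incR_assL[OF O(2,4,6) D] incL_def by (simp add: cassoc)
 also have "... = ((inc2 P' R'$tarr P R f k P' R') ## h)$inc2 (ot P R) V"
  unfolding inc2_tarr[OF fk h D] using tensor_comp[of "tarr P R f k P' R'" "inc2 P' R'" h "idw (ob V')"] by (simp add: cassoc[symmetric])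
 also have "... = ((f ## k) ## h)$incL P R V"
  unfolding inc2_tarr[OF f g D] incL_def using tensor_comp[of "inc2 P R" "f ## k" "idw (ob V)" h] by (simp add: cassoc)
 finally have 1: "incR P' R' V'$assL P' R' V'$?T = ((f ## k) ## h)$incL P R V" .
 have "incR P' R' V'$?T'$assL P R V = (idw (ob P') ## inc2 R' V')$(inc2 P' (ot R' V')$?T')$assL P R V" by (simp add: incR_def cassoc)
 also have "... = (f ## (inc2 R' V'$tarr R V k h R' V'))$inc2 P (ot R V)$assL P R V"
  unfolding inc2_tarr[OF f kh D] using tensor_comp[of f "idw (ob P')" "tarr R V k h R' V'" "inc2 R' V'"] by (simp add: cassoc[symmetric])
 also have "... = (f ## k ## h)$incR P R V$assL P R V"
  unfolding inc2_tarr[OF g h D] incR_def using tensor_comp[of "idw (ob P)" f "inc2 R V" "k ## h"] by (simp add: cassoc)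
 finally have 2: "incR P' R' V'$?T'$assL P R V = (f ## k ## h)$incL P R V" unfolding incR_assL[OF O(1,3,5) D] .
 show ?thesis
  by (rule inc_cancel(1)[OF O(2,4,6) D, of _ _ "ob (ot (ot P R) V)"]) (use 1 2 in "simp_all add: tensor_assoc homs")
qed

context
 fixes P R V Z
 assumes P: "P : Ell" and R: "R : Ell" and V: "V : Ell" and Z: "Z : Ell" and D: "gdim ~= 0"
begin

text \<open>After the inclusion into \<open>P \<otimes> R \<otimes> V \<otimes> Z\<close>, every constraint replaces one bracketing of inclusions by another,
 and both sides end in the inclusion of the leftmost bracketing.\<close>

lemma word_pentagon:
 "tarr P (ot (ot R V) Z) (idw (ob P)) (assL R V Z) P (ot R (ot V Z))$assL P (ot R V) Z$tarr (ot (ot P R) V) Z (assL P R V) (idw (ob Z)) (ot P (ot R V)) Z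
  = assL P R (ot V Z)$assL (ot P R) V Z" (is "?A$?B$?C = ?E$?F")
proof -
 note PR = ot_elliptic[OF P R D] and RV = ot_elliptic[OF R V D] and VZ = ot_elliptic[OF V Z D]
 note R_VZ = ot_elliptic[OF R VZ D] and RV_Z = ot_elliptic[OF RV Z D] and PR_V = ot_elliptic[OF PR V D] and P_RV = ot_elliptic[OF P RV D]
 note a = assL_earr[OF R V Z D] assL_earr[OF P R V D] assL_earr[OF P RV Z D] assL_earr[OF P R VZ D] assL_earr[OF PR V Z D]
 note t = earr_tarr[OF earr_id[OF P] a(1) D] earr_tarr[OF a(2) earr_id[OF Z] D]
 note [simp] = earr_simps[OF a(1), unfolded fst_ot] earr_simps[OF a(2), unfolded fst_ot] earr_simps[OF a(3), unfolded fst_ot] earr_simps[OF a(4), unfolded fst_ot] earr_simps[OF a(5), unfolded fst_ot]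
  earr_simps[OF t(1), unfolded fst_ot] earr_simps[OF t(2), unfolded fst_ot]
  inc2_simps[OF P R D, unfolded fst_ot] inc2_simps[OF R V D, unfolded fst_ot] inc2_simps[OF V Z D, unfolded fst_ot] inc2_simps[OF PR V D, unfolded fst_ot] inc2_simps[OF P RV D, unfolded fst_ot]
  inc2_simps[OF RV Z D, unfolded fst_ot] inc2_simps[OF R VZ D, unfolded fst_ot] inc2_simps[OF PR VZ D, unfolded fst_ot] inc2_simps[OF P RV_Z D, unfolded fst_ot] inc2_simps[OF P R_VZ D, unfolded fst_ot]
  inc2_simps[OF PR_V Z D, unfolded fst_ot] inc2_simps[OF P_RV Z D, unfolded fst_ot]
  ell(2)[OF P] ell(2)[OF R] ell(2)[OF V] ell(2)[OF Z]
  ell(2)[OF PR, unfolded fst_ot] ell(2)[OF RV, unfolded fst_ot] ell(2)[OF VZ, unfolded fst_ot] ell(2)[OF R_VZ, unfolded fst_ot]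
  incLR_whom(1,2)[OF R V Z D, unfolded homs fst_ot] incLR_whom(1,2)[OF P R V D, unfolded homs fst_ot] incLR_whom(1,2)[OF P RV Z D, unfolded homs fst_ot] incLR_whom(1,2)[OF P R VZ D, unfolded homs fst_ot] incLR_whom(1,2)[OF PR V Z D, unfolded homs fst_ot]
 note l = incLR_layers[OF R V Z D] incLR_layers[OF P R V D] incLR_layers[OF P RV Z D] incLR_layers[OF P R VZ D] incLR_layers[OF PR V Z D]
 note r = incR_assL[OF R V Z D] incR_assL[OF P R V D] incR_assL[OF P RV Z D] incR_assL[OF P R VZ D] incR_assL[OF PR V Z D]
 let ?i = "inc2 P (ot R (ot V Z))" and ?XY = "{ob P;inc2 R V;ob Z}" and ?YZ = "{ob P @ ob R;inc2 V Z;}" and ?WX = "{;inc2 P R;[fst V, fst Z]}"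
 let ?N = "{;incL P R V;ob Z}$inc2 (ot (ot P R) V) Z" and ?I = "{ob P;incR R V Z;}"
 have "?I$?i$?A = {ob P;incR R V Z$assL R V Z;}$inc2 P (ot (ot R V) Z)"
  unfolding inc2_tarr_left(2)[OF a(1) P D] by (simp add: cassoc)
 also have "... = ?XY$incR P (ot R V) Z" unfolding r unfolding l by (simp add: cassoc)
 finally have A: "?I$?i$?A = ?XY$incR P (ot R V) Z" .
 have C: "?XY$incL P (ot R V) Z$?C = ?N"
 proof -
  have "?XY$incL P (ot R V) Z = {;incR P R V;ob Z}$inc2 (ot P (ot R V)) Z" unfolding l by (simp add: cassoc)
  then have "?XY$incL P (ot R V) Z$?C = {;incR P R V;ob Z}$inc2 (ot P (ot R V)) Z$?C" by (simp add: cassoc[symmetric])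
  also have "... = {;incR P R V$assL P R V;ob Z}$inc2 (ot (ot P R) V) Z" unfolding inc2_tarr_left(1)[OF a(2) Z D] by (simp add: cassoc)
  finally show ?thesis unfolding r .
 qed
 have "?I$?i$?A$?B$?C = (?I$?i$?A)$?B$?C" by (simp add: cassoc)
 also have "... = ?XY$(incR P (ot R V) Z$?B)$?C" unfolding A by (simp add: cassoc)
 finally have 1: "?I$?i$?A$?B$?C = ?N" unfolding r C .
 have "?I$?i$?E$?F = ?YZ$(incR P R (ot V Z)$?E)$?F" unfolding l by (simp add: cassoc)
 also have "... = ?WX$(incR (ot P R) V Z$?F)" unfolding r(4) unfolding l by (simp add: diagram)
 also have "... = ?N" unfolding r unfolding l by (simp add: cassoc)
 finally have 2: "?I$?i$?E$?F = ?N" .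
 have w: "?A$?B$?C : whom (ob (ot (ot (ot P R) V) Z)) (ob (ot P (ot R (ot V Z))))" "?E$?F : whom (ob (ot (ot (ot P R) V) Z)) (ob (ot P (ot R (ot V Z))))"
  by (simp_all add: homs)
 obtain p where p: "warr p" "dom p = cod (incR R V Z)" "p$incR R V Z = idw (dom (incR R V Z))" using inc_split(2)[OF R V Z D] by blast
 have pc: "cod p = [fst (ot R (ot V Z))]" using arg_cong[OF p(3), of cod] by simp
 have c: "x = y" if e: "?I$?i$x = ?I$?i$y" and h: "x : whom v (ob (ot P (ot R (ot V Z))))" "y : whom v (ob (ot P (ot R (ot V Z))))" for x y v
 proof -
  have q: "{ob P;p;}$?I$?i$z = ?i$z" if "z : whom v (ob (ot P (ot R (ot V Z))))" for z
   by (rule rewrite[OF p(3), of _ "idw [fst P, fst (ot R (ot V Z))]" "ob P" "[]" "?i$z"]) (use p(1,2) pc that in \<open>simp_all add: homs cassoc\<close>)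
  have "?i$x = ?i$y" using q[OF h(1)] q[OF h(2)] unfolding e by simp
  then show ?thesis by (rule inc2_cancel[OF P R_VZ D h])
 qed
 show ?thesis by (rule c[OF _ w]) (simp only: 1 2)
qed

end

lemma word_triangle:
 assumes P: "P : Ell" and R: "R : Ell" and D: "gdim ~= 0"
 shows "tarr P (ot e1 R) (idw (ob P)) (lw c R) P R$assL P e1 R = tarr (ot P e1) R (rw c P) (idw (ob R)) P R" (is "?A$?B = ?C")
proof -
 note E = el_unit_elliptic
 note PE = ot_elliptic[OF P E D] and ER = ot_elliptic[OF E R D]
 note a = assL_earr[OF P E R D] lw_earr(1)[OF R D, of c] lw_earr(2)[OF P D, of c]
 note t = earr_tarr[OF earr_id[OF P] a(2) D] earr_tarr[OF a(3) earr_id[OF R] D]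
 note [simp] = earr_simps[OF a(1), unfolded fst_ot fst_e1] earr_simps[OF a(2), unfolded fst_ot fst_e1] earr_simps[OF a(3), unfolded fst_ot fst_e1] earr_simps[OF t(1), unfolded fst_ot fst_e1] earr_simps[OF t(2), unfolded fst_ot fst_e1]
  inc2_simps[OF P R D] inc2_simps[OF P E D, unfolded fst_ot fst_e1] inc2_simps[OF E R D, unfolded fst_ot fst_e1] inc2_simps[OF PE R D, unfolded fst_ot] inc2_simps[OF P ER D, unfolded fst_ot]
  ell(2)[OF P] ell(2)[OF R] ell(2)[OF PE, unfolded fst_ot] ell(2)[OF ER, unfolded fst_ot]
  incLR_whom(1,2)[OF P E R D, unfolded homs fst_ot fst_e1]
 let ?u = "{ob P;u;ob R}"
 have "inc2 P R$?A$?B = (inc2 P R$?A)$?B" by (simp add: cassoc)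
 also have "... = sc c (?u$incR P e1 R$?B)"
  unfolding inc2_tarr_left(2)[OF a(2) P D] unfolding lw_def incLR_layers[OF P E R D] by (simp add: layer_wscale wscale_comp comp_wscale cassoc)
 also have "... = inc2 P R$?C"
  unfolding inc2_tarr_left(1)[OF a(3) R D] incR_assL[OF P E R D] unfolding rw_def incLR_layers[OF P E R D] by (simp add: layer_wscale wscale_comp comp_wscale cassoc)
 finally have e: "inc2 P R$?A$?B = inc2 P R$?C" .
 show ?thesis by (rule inc2_cancel[OF P R D _ _ e, of "ob (ot (ot P e1) R)"]) (simp_all add: homs)
qed

end

section \<open>The monoidal category of elliptic objects\<close>

context premodular_category_with_choices
begin

definition arrow where
 "arrow P f R = (P, underlying f, R)"

lemma intertwines_word:
 assumes l: "half_braiding C X l" and m: "half_braiding C Y m" and f: "f : whom [X] [Y]"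
 shows "intertwines C (underlying f) l m \<longleftrightarrow> intw f (word_half X l) (word_half Y m)"
proof -
 have [simp]: "X : Ob" "Y : Ob" and w: "warr (wHalf l A X)" "warr (wHalf m A Y)" if "A : Ob" for A
  using l m that by (auto simp: half_braiding_def)
 have o [simp]: "X : Ob" "Y : Ob" using l m by (auto simp: half_braiding_def)
 have [simp]: "warr f" "dom f = [X]" "cod f = [Y]" using f by (auto simp: homs)
 have "m A ** (Id C A @@ underlying f) = (underlying f @@ Id C A) ** l A \<longleftrightarrow> {;f;[A]}$word_half X l [A] = word_half Y m [A]${[A];f;}" if [simp]: "A : Ob" for A
 proof -
  have "underlying (word_half Y m [A]${[A];f;}) = m A ** (Id C A @@ underlying f)" "underlying ({;f;[A]}$word_half X l [A]) = (underlying f @@ Id C A) ** l A"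
   "dom (word_half Y m [A]${[A];f;}) = dom ({;f;[A]}$word_half X l [A])" "cod (word_half Y m [A]${[A];f;}) = cod ({;f;[A]}$word_half X l [A])"
   by (simp_all add: half_braid_word_half(2)[OF l] half_braid_word_half(2)[OF m] underlying_layer_left underlying_layer_single w)
  then show ?thesis by (metis word_arr_eqI)
 qed
 then show ?thesis by (simp add: intertwines_def intw_def)
qed

lemma elliptic_simps [simp]: "Obj (elliptic_monoidal C \<kappa>) = Ell" "Id (elliptic_monoidal C \<kappa>) P = (P, Id C (fst P), P)"
 "Dom (elliptic_monoidal C \<kappa>) = fst" "Cod (elliptic_monoidal C \<kappa>) = (%F. snd (snd F))"
 "TensO (elliptic_monoidal C \<kappa>) = el_tensor C" "TensA (elliptic_monoidal C \<kappa>) = el_tensor_arr C" "Unit (elliptic_monoidal C \<kappa>) = el_unit C"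
 "Assoc (elliptic_monoidal C \<kappa>) = el_assoc C" "LUnit (elliptic_monoidal C \<kappa>) = el_lunit C \<kappa>" "RUnit (elliptic_monoidal C \<kappa>) = el_runit C \<kappa>"
 by (auto simp: elliptic_monoidal_def elliptic_center_def category_data.defs monoidal_data.defs fun_eq_iff)

lemma arrow_comp [simp]: "arrow R k V \<cdot>\<^bsub>elliptic_monoidal C \<kappa>\<^esub> arrow P f R' = arrow P (k$f) V"
 by (simp add: arrow_def elliptic_monoidal_def elliptic_center_def category_data.defs monoidal_data.defs)

lemma arrow_Hom: "F : Hom (elliptic_monoidal C \<kappa>) P R \<longleftrightarrow> (\<exists>f. earr P f R & F = arrow P f R)"
proof -
 obtain X l l' where P: "P = (X, l, l')" by (cases P) auto
 obtain Y m m' where R: "R = (Y, m, m')" by (cases R) auto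
 have H: "F : Hom (elliptic_monoidal C \<kappa>) P R \<longleftrightarrow> P : Ell & R : Ell &
   (\<exists>f. f : Hom C X Y & intertwines C f l m & intertwines C f l' m' & F = (P, f, R))"
  unfolding Hom_def by (auto simp: P R elliptic_monoidal_def elliptic_center_def category_data.defs monoidal_data.defs Hom_def)
 have w: "f : Hom C X Y \<longleftrightarrow> ([X], f, [Y]) : whom [X] [Y]" if "X : Ob" "Y : Ob" for f
  using whom_underlying[of "([X], f, [Y])" "[X]" "[Y]"] that by (auto simp: homs warrI dom_def cod_def underlying_def)
 show ?thesis
 proof (cases "P : Ell & R : Ell")
  case True
  note p = ell(2,6,7)[of P, unfolded P fst_conv snd_conv] and r = ell(2,6,7)[of R, unfolded R fst_conv snd_conv]
  have pr: "X : Ob" "Y : Ob" "half_braiding C X l" "half_braiding C X l'" "half_braiding C Y m" "half_braiding C Y m'" using True p r P R by auto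
  have i: "intertwines C (underlying f) l m \<longleftrightarrow> intw f (h1 P) (h1 R)" "intertwines C (underlying f) l' m' \<longleftrightarrow> intw f (h2 P) (h2 R)" if "f : whom [X] [Y]" for f
   using intertwines_word[OF pr(3,5) that] intertwines_word[OF pr(4,6) that] by (simp_all add: P R)
  have "(\<exists>f. f : Hom C X Y & intertwines C f l m & intertwines C f l' m' & F = (P, f, R)) \<longleftrightarrow> (\<exists>f. earr P f R & F = arrow P f R)"
  proof
   assume "\<exists>f. f : Hom C X Y & intertwines C f l m & intertwines C f l' m' & F = (P, f, R)"
   then obtain f where f: "f : Hom C X Y" "intertwines C f l m" "intertwines C f l' m'" "F = (P, f, R)" by blast
   have "([X], f, [Y]) : whom [X] [Y]" using f(1) w pr by simp
   then have "earr P ([X], f, [Y]) R & F = arrow P ([X], f, [Y]) R"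
    using i[of "([X], f, [Y])"] f True by (simp add: earr_def arrow_def underlying_def P R)
   then show "\<exists>f. earr P f R & F = arrow P f R" by blast
  next
   assume "\<exists>f. earr P f R & F = arrow P f R"
   then obtain f where f: "earr P f R" "F = arrow P f R" by blast
   then have h: "f : whom [X] [Y]" by (simp add: earr_def P R)
   show "\<exists>f. f : Hom C X Y & intertwines C f l m & intertwines C f l' m' & F = (P, f, R)"
    by (rule exI[of _ "underlying f"]) (use f i[OF h] whom_underlying[OF h] in "simp add: earr_def arrow_def")
  qed
  then show ?thesis using H True by simp
 next
  case False
  then show ?thesis using H by (auto simp: earr_def)
 qed
qed

lemma arrow_HomI: "earr P f R ==> arrow P f R : Hom (elliptic_monoidal C \<kappa>) P R"
 unfolding arrow_Hom by blast

lemma arrow_id: "P : Ell ==> (P, Id C (fst P), P) = arrow P (idw (ob P)) P"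
 using ell(2)[of P] by (simp add: arrow_def)

lemma arrow_iso:
 assumes f: "earr P f R" and k: "k : whom (ob R) (ob P)" and e: "k$f = idw (ob P)" "f$k = idw (ob R)"
 shows "is_iso (elliptic_monoidal C \<kappa>) (arrow P f R)"
proof -
 have o: "P : Ell" "R : Ell" using f by (auto simp: earr_def)
 have h: "arrow P f R : Hom (elliptic_monoidal C \<kappa>) P R" "arrow R k P : Hom (elliptic_monoidal C \<kappa>) R P"
  unfolding arrow_Hom using f earr_inverse[OF f k e] by blast+
 have "arrow P f R : Arr (elliptic_monoidal C \<kappa>)" using h(1) by (simp add: Hom_def)
 moreover have "Dom (elliptic_monoidal C \<kappa>) (arrow P f R) = P" "Cod (elliptic_monoidal C \<kappa>) (arrow P f R) = R" by (simp_all add: arrow_def)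
 ultimately have "inverse_arrows (elliptic_monoidal C \<kappa>) (arrow P f R) (arrow R k P)"
  using h(2) o unfolding inverse_arrows_def by (simp add: arrow_id e)
 then show ?thesis unfolding is_iso_def by blast
qed

lemma arrow_assoc:
 assumes P: "P : Ell" and R: "R : Ell" and V: "V : Ell" and D: "gdim ~= 0"
 shows "el_assoc C P R V = arrow (ot (ot P R) V) (assL P R V) (ot P (ot R V))"
proof -
 have u: "underlying (iw A B) = ImInc C A B" "underlying (pw A B) = ImProj C A B" for A B by (simp_all add: iw_def pw_def)
 note [simp] = incs[OF P R V D] hs(1,4,7)[OF P R V D] hs(10,13,16,19)[OF P R V D, unfolded fst_ot]
 show ?thesis by (simp add: el_assoc_def arrow_def assL_def incL_def underlying_tensor u, simp add: Comp_Comp u[symmetric])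
qed

lemma arrow_tensor:
 assumes f: "earr P f R" and f': "earr P' f' R'" and D: "gdim ~= 0"
 shows "el_tensor_arr C (arrow P f R) (arrow P' f' R') = arrow (ot P P') (tarr P P' f f' R R') (ot R R')"
proof -
 have u: "underlying (iw A B) = ImInc C A B" "underlying (pw A B) = ImProj C A B" for A B by (simp_all add: iw_def pw_def)
 note [simp] = earr_simps[OF f] earr_simps[OF f'] inc2_simps[OF EO(1,2)[OF f f' D] D] inc2_simps[OF EO(3,4)[OF f f' D] D] EO[OF f f' D, THEN ell(2)]
 show ?thesis by (simp add: el_tensor_arr_def arrow_def tarr_def underlying_tensor u)
qed

theorem elliptic_monoidal_category:
 assumes D: "gdim ~= 0" and k: "\<kappa> ~= 0"
 shows "monoidal_category (elliptic_monoidal C \<kappa>)"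
proof -
 let ?E = "elliptic_monoidal C \<kappa>" and ?c = "\<kappa> * gdim * s j0"
 have c: "?c ~= 0" using D k s_j0 by simp
 note E = el_unit_elliptic
 have T: "el_tensor_arr C F F' = arrow (ot P P') (tarr P P' f f' R R') (ot R R')" if "earr P f R" "earr P' f' R'" "F = arrow P f R" "F' = arrow P' f' R'" for P f R P' f' R' F F'
  using arrow_tensor[OF that(1,2) D] that(3,4) by simp
 have L: "el_lunit C \<kappa> P = arrow (ot e1 P) (lw ?c P) P" "el_runit C \<kappa> P = arrow (ot P e1) (rw ?c P) P" if "P : Ell" for P
  using el_unit_constraints[OF that D] by (simp_all add: arrow_def)
 show ?thesis
 proof unfold_locales
  fix F assume "F : Arr ?E"
  then have "F : Hom ?E (fst F) (snd (snd F))" by (simp add: Hom_def)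
  then have "fst F : Ell & snd (snd F) : Ell" unfolding arrow_Hom by (auto simp: earr_def)
  then show "Dom ?E F : Obj ?E" "Cod ?E F : Obj ?E" by simp_all
 next
  fix P assume P: "P : Obj ?E"
  then show "Id ?E P : Hom ?E P P" using arrow_HomI[OF earr_id[of P]] arrow_id[of P] by simp
  show "LUnit ?E P : Hom ?E (Unit ?E \<odot>\<^bsub>?E\<^esub> P) P" "RUnit ?E P : Hom ?E (P \<odot>\<^bsub>?E\<^esub> Unit ?E) P"
   using P L[of P] arrow_HomI[OF lw_earr(1)[of P ?c]] arrow_HomI[OF lw_earr(2)[of P ?c]] D by simp_all
  show "is_iso ?E (LUnit ?E P)" "is_iso ?E (RUnit ?E P)"
   using P L[of P] lw_inverse[OF _ D c, of P] arrow_iso[OF lw_earr(1)[of P ?c]] arrow_iso[OF lw_earr(2)[of P ?c]] D by auto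
 next
  fix F G P R V assume "F : Hom ?E P R" "G : Hom ?E R V"
  then show "G \<cdot>\<^bsub>?E\<^esub> F : Hom ?E P V" unfolding arrow_Hom using earr_comp by fastforce
 next
  fix F P R assume "F : Hom ?E P R"
  then obtain f where f: "earr P f R" and F: "F = arrow P f R" unfolding arrow_Hom by blast
  have PR: "P : Ell" "R : Ell" using f by (auto simp: earr_def)
  show "F \<cdot>\<^bsub>?E\<^esub> Id ?E P = F" "Id ?E R \<cdot>\<^bsub>?E\<^esub> F = F"
   using earr_simps[OF f] by (simp_all add: F arrow_id PR)
  note t = T[OF earr_id[OF E] f arrow_id[OF E] F] T[OF f earr_id[OF E] F arrow_id[OF E]]
  show "LUnit ?E R \<cdot>\<^bsub>?E\<^esub> (Id ?E (Unit ?E) \<boxtimes>\<^bsub>?E\<^esub> F) = F \<cdot>\<^bsub>?E\<^esub> LUnit ?E P" "RUnit ?E R \<cdot>\<^bsub>?E\<^esub> (F \<boxtimes>\<^bsub>?E\<^esub> Id ?E (Unit ?E)) = F \<cdot>\<^bsub>?E\<^esub> RUnit ?E P"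
   using lw_natural[OF f D, of ?c] by (simp_all add: t[simplified] L PR) (simp_all add: F)
 next
  fix F G H P R V Z assume "F : Hom ?E P R" "G : Hom ?E R V" "H : Hom ?E V Z"
  then obtain f g' h where f: "earr P f R" "F = arrow P f R" and g: "earr R g' V" "G = arrow R g' V" and h: "earr V h Z" "H = arrow V h Z" unfolding arrow_Hom by blast
  show "(H \<cdot>\<^bsub>?E\<^esub> G) \<cdot>\<^bsub>?E\<^esub> F = H \<cdot>\<^bsub>?E\<^esub> (G \<cdot>\<^bsub>?E\<^esub> F)"
   using earr_simps[OF f(1)] earr_simps[OF g(1)] earr_simps[OF h(1)] by (simp add: f(2) g(2) h(2) cassoc)
 next
  fix P R assume "P : Obj ?E" "R : Obj ?E"
  then have P: "P : Ell" and R: "R : Ell" by simp_all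
  show "P \<odot>\<^bsub>?E\<^esub> R : Obj ?E" using ot_elliptic[OF P R D] by simp
  have i: "tarr P R (idw (ob P)) (idw (ob R)) P R = idw (ob (ot P R))"
   using inc2_facts(5)[OF P R D] inc2_simps[OF P R D] ell(2)[OF P] ell(2)[OF R] by (simp add: tarr_def tensor_id)
  show "Id ?E P \<boxtimes>\<^bsub>?E\<^esub> Id ?E R = Id ?E (P \<odot>\<^bsub>?E\<^esub> R)"
   using T[OF earr_id[OF P] earr_id[OF R] arrow_id[OF P] arrow_id[OF R]] arrow_id[OF ot_elliptic[OF P R D]] i by simp
  have t: "el_tensor_arr C (P, Id C (fst P), P) (el_lunit C \<kappa> R) = arrow (ot P (ot e1 R)) (tarr P (ot e1 R) (idw (ob P)) (lw ?c R) P R) (ot P R)"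
   "el_tensor_arr C (el_runit C \<kappa> P) (R, Id C (fst R), R) = arrow (ot (ot P e1) R) (tarr (ot P e1) R (rw ?c P) (idw (ob R)) P R) (ot P R)"
   by (rule T[OF earr_id[OF P] lw_earr(1)[OF R D] arrow_id[OF P] L(1)[OF R]], rule T[OF lw_earr(2)[OF P D] earr_id[OF R] L(2)[OF P] arrow_id[OF R]])
  show "(Id ?E P \<boxtimes>\<^bsub>?E\<^esub> LUnit ?E R) \<cdot>\<^bsub>?E\<^esub> Assoc ?E P (Unit ?E) R = RUnit ?E P \<boxtimes>\<^bsub>?E\<^esub> Id ?E R"
   unfolding elliptic_simps t arrow_assoc[OF P E R D] arrow_comp word_triangle[OF P R D] ..
 next
  show "Unit ?E : Obj ?E" using E by simp
 next
  fix F F' P R P' R' assume "F : Hom ?E P R" "F' : Hom ?E P' R'"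
  then obtain f f' where f: "earr P f R" "F = arrow P f R" and f': "earr P' f' R'" "F' = arrow P' f' R'" unfolding arrow_Hom by blast
  show "F \<boxtimes>\<^bsub>?E\<^esub> F' : Hom ?E (P \<odot>\<^bsub>?E\<^esub> P') (R \<odot>\<^bsub>?E\<^esub> R')"
   using arrow_HomI[OF earr_tarr[OF f(1) f'(1) D]] T[OF f(1) f'(1) f(2) f'(2)] by simp
 next
  fix F P R G V F' P' R' G' V' assume "F : Hom ?E P R" "G : Hom ?E R V" "F' : Hom ?E P' R'" "G' : Hom ?E R' V'"
  then obtain f h f' h' where f: "earr P f R" "F = arrow P f R" and h: "earr R h V" "G = arrow R h V" and f': "earr P' f' R'" "F' = arrow P' f' R'" and h': "earr R' h' V'" "G' = arrow R' h' V'"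
   unfolding arrow_Hom by blast
  note hf = earr_comp[OF f(1) h(1)] earr_comp[OF f'(1) h'(1)]
  note O = EO[OF f(1) f'(1) D] EO(3,4)[OF h(1) h'(1) D]
  note [simp] = earr_simps[OF f(1)] earr_simps[OF h(1)] earr_simps[OF f'(1)] earr_simps[OF h'(1)] inc2_simps[OF O(1,2) D] inc2_simps[OF O(3,4) D] inc2_simps[OF O(5,6) D]
  note t = tarr_whom[OF hf D] tarr_whom[OF f(1) f'(1) D] tarr_whom[OF h(1) h'(1) D]
  have "inc2 V V'$tarr R R' h h' V V'$tarr P P' f f' R R' = (inc2 V V'$tarr R R' h h' V V')$tarr P P' f f' R R'"
   using t by (simp add: homs cassoc)
  also have "... = (h ## h')$(inc2 R R'$tarr P P' f f' R R')" unfolding inc2_tarr[OF h(1) h'(1) D] using t by (simp add: homs cassoc)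
  also have "... = ((h$f) ## (h'$f'))$inc2 P P'" unfolding inc2_tarr[OF f(1) f'(1) D] using tensor_comp[of f h f' h'] by (simp add: cassoc)
  also have "... = inc2 V V'$tarr P P' (h$f) (h'$f') V V'" by (rule inc2_tarr[OF hf D, symmetric])
  finally have e: "inc2 V V'$tarr R R' h h' V V'$tarr P P' f f' R R' = inc2 V V'$tarr P P' (h$f) (h'$f') V V'" .
  have "tarr R R' h h' V V'$tarr P P' f f' R R' = tarr P P' (h$f) (h'$f') V V'"
   by (rule inc2_cancel[OF O(5,6) D _ t(1) e]) (use t in "simp add: homs")
  then show "(G \<cdot>\<^bsub>?E\<^esub> F) \<boxtimes>\<^bsub>?E\<^esub> (G' \<cdot>\<^bsub>?E\<^esub> F') = (G \<boxtimes>\<^bsub>?E\<^esub> G') \<cdot>\<^bsub>?E\<^esub> (F \<boxtimes>\<^bsub>?E\<^esub> F')"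
   using T[OF f(1) f'(1) f(2) f'(2)] T[OF h(1) h'(1) h(2) h'(2)] T[OF hf refl refl] by (simp add: f(2) f'(2) h(2) h'(2))
 next
  fix P R V assume "P : Obj ?E" "R : Obj ?E" "V : Obj ?E"
  then have o: "P : Ell" "R : Ell" "V : Ell" by simp_all
  note a = arrow_assoc[OF o D]
  show "Assoc ?E P R V : Hom ?E ((P \<odot>\<^bsub>?E\<^esub> R) \<odot>\<^bsub>?E\<^esub> V) (P \<odot>\<^bsub>?E\<^esub> (R \<odot>\<^bsub>?E\<^esub> V))"
   using arrow_HomI[OF assL_earr[OF o D]] a by simp
  show "is_iso ?E (Assoc ?E P R V)"
   using arrow_iso[OF assL_earr[OF o D] incLR_whom(4)[OF o D] ass_inverse[OF o D]] a by simp
 next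
  fix F P P' G R R' H V V' assume "F : Hom ?E P P'" "G : Hom ?E R R'" "H : Hom ?E V V'"
  then obtain f g' h where f: "earr P f P'" "F = arrow P f P'" and g: "earr R g' R'" "G = arrow R g' R'" and h: "earr V h V'" "H = arrow V h V'" unfolding arrow_Hom by blast
  note o = EO[OF f(1) g(1) D] EO(2,4)[OF g(1) h(1) D]
  note t = T[OF f(1) g(1) f(2) g(2)] T[OF g(1) h(1) g(2) h(2)]
  note t' = T[OF earr_tarr[OF f(1) g(1) D] h(1) t(1) h(2)] T[OF f(1) earr_tarr[OF g(1) h(1) D] f(2) t(2)]
  show "Assoc ?E P' R' V' \<cdot>\<^bsub>?E\<^esub> ((F \<boxtimes>\<^bsub>?E\<^esub> G) \<boxtimes>\<^bsub>?E\<^esub> H) = (F \<boxtimes>\<^bsub>?E\<^esub> (G \<boxtimes>\<^bsub>?E\<^esub> H)) \<cdot>\<^bsub>?E\<^esub> Assoc ?E P R V"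
   unfolding elliptic_simps t' arrow_assoc[OF o(1,2,5) D] arrow_assoc[OF o(3,4,6) D] arrow_comp ass_natural[OF f(1) g(1) h(1) D] ..
 next
  fix P R V Z assume "P : Obj ?E" "R : Obj ?E" "V : Obj ?E" "Z : Obj ?E"
  then have o: "P : Ell" "R : Ell" "V : Ell" "Z : Ell" by simp_all
  note p = ot_elliptic[OF o(1,2) D] ot_elliptic[OF o(2,3) D] ot_elliptic[OF o(3,4) D]
  note t = T[OF earr_id[OF o(1)] assL_earr[OF o(2-4) D] arrow_id[OF o(1)] arrow_assoc[OF o(2-4) D]] T[OF assL_earr[OF o(1-3) D] earr_id[OF o(4)] arrow_assoc[OF o(1-3) D] arrow_id[OF o(4)]]
  show "(Id ?E P \<boxtimes>\<^bsub>?E\<^esub> Assoc ?E R V Z) \<cdot>\<^bsub>?E\<^esub> Assoc ?E P (R \<odot>\<^bsub>?E\<^esub> V) Z \<cdot>\<^bsub>?E\<^esub> (Assoc ?E P R V \<boxtimes>\<^bsub>?E\<^esub> Id ?E Z) = Assoc ?E P R (V \<odot>\<^bsub>?E\<^esub> Z) \<cdot>\<^bsub>?E\<^esub> Assoc ?E (P \<odot>\<^bsub>?E\<^esub> R) V Z"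
   unfolding elliptic_simps t arrow_assoc[OF o(1) p(2) o(4) D] arrow_assoc[OF o(1,2) p(3) D] arrow_assoc[OF p(1) o(3,4) D] arrow_comp word_pentagon[OF o D] ..
 qed
qed

end

theorem mainTheorem3:
  fixes C :: "('o, 'a, 'k::{alg_closed_field, field_char_0}, 'j) chosen_data" and \<kappa> :: 'k
  assumes "premodular_category_with_choices C"
    and "global_dim C \<noteq> 0"
    and "\<kappa> \<noteq> 0"
  shows "el_unit C = I1_obj C (unit_sum' C) (unit_center C) \<and>
    monoidal_category (elliptic_monoidal C \<kappa>)"
  using premodular_category_with_choices.el_unit_I1[OF assms(1)]
    premodular_category_with_choices.elliptic_monoidal_category[OF assms] by simp

end
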